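(* Let $(\rho_h,\mathbf M_h,\mathbf E_h,\mathbf B_h,(\mathbf X_p,\mathbf U_p)_{p=1}^N)$ be a solution on a time interval of the flux-free semi-discrete scheme (S) described in the context, with $\rho_h(t)\in Q_{k+1}$, $\mathbf M_h(t)\in Q_{k+1}^d$, $\mathbf E_h(t)\in\mathring N_k$, $\mathbf B_h(t)\in\mathring{RT}_k$, $\mathbf X_p(t)\in\Omega_h$. Then the following quantities are constant in time: 1. the total fluid mass $\int_{\Omega_h}\rho_h\,dx$; 2. the total particle mass $\sum_{p=1}^N w_p$; 3. the total energy $$\int_{\Omega_h}\rho_h\big(\gamma(m\mathbf M_h/\rho_h)-1\big)c^2\,dx+\sum_{p=1}^N w_p\big(\gamma(\mathbf U_p)-1\big)mc^2+\frac1{8\pi}\int_{\Omega_h}\big(|\mathbf E_h|^2+|\mathbf B_h|^2\big)\,dx;$$ 4. the weak Gauss law residual $$\int_{\Omega_h}\Big[\nabla_w\cdot\mathbf E_h-4\pi e\Big(\frac{\rho_h}{m}+\sum_{p=1}^N w_p\,\delta(\mathbf x-\mathbf X_p)\Big)\Big]\phi_h\,dx$$ for every $\phi_h\in\mathring Q_{k+1}$ (where $\int_{\Omega_h}\delta(\mathbf x-\mathbf X_p)\phi_h\,dx=\phi_h(\mathbf X_p)$); 5. the divergence $\nabla\cdot\mathbf B_h$.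
   Context: Let $d=3$, let $\Omega\subset\mathbb R^3$ be a bounded domain with a (finite, conforming, polyhedral) partition $\mathcal T_h$ into cells $K$, $\Omega_h=\bigcup_{K\in\mathcal T_h}K$ (identified with $\Omega$), and let $k\ge0$ be an integer. The constants $c>0$ (speed of light), $m>0$ (mass), $e$ (charge, a nonzero real number) and the particle weights $w_p$, $p=1,\dots,N$, are fixed. For $\mathbf u\in\mathbb R^3$, $\gamma(\mathbf u)=\sqrt{1+\frac{\mathbf u\cdot\mathbf u}{m^2c^2}}$; also $\mathbf M^2:=\mathbf M\cdot\mathbf M$. Finite element spaces ($P_k(K)$: polynomials of degree at most $k$ on $K$): $Q_k=\{f\in H^1(\Omega): f|_K\in P_k(K)\ \forall K\}$; $N_k=\{f\in H(\mathrm{curl},\Omega): f|_K\in P_k(K)^d+\mathbf x\times P_k(K)^d\ \forall K\}$; $RT_k=\{f\in H(\mathrm{div},\Omega): f|_K\in P_k(K)^d+\mathbf x P_k(K)\ \forall K\}$. $\mathring Q_k$, $\mathring N_k$, $\mathring{RT}_k$ are the subspaces of functions with, respectively, $f=0$, $\mathbf n\times f=0$, $\mathbf n\cdot f=0$ on $\partial\Omega$. The weak divergence $\nabla_w\cdot:\mathring N_k\to\mathring Q_{k+1}$ is defined by $\int_\Omega(\nabla_w\cdot\mathbf E_h)\phi_h\,dx=-\int_\Omega\mathbf E_h\cdot\nabla\phi_h\,dx$ for all $\phi_h\in\mathring Q_{k+1}$. Vector-gradient notation: $(\mathbf a\cdot\nabla\mathbf b)\cdot\mathbf c=\sum_{i,j}a_i(\partial_i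 b_j)c_j$. Scheme (S). Let $\mathbf w_h$ be the $L^2(\Omega)$-projection onto $Q_{k+1}^d$ of $\frac{\mathbf M_h}{\rho_h\gamma(m\mathbf M_h/\rho_h)}$, and $G_h$ the $L^2(\Omega)$-projection onto $Q_{k+1}$ of $\gamma(m\mathbf M_h/\rho_h)-1-\frac{\mathbf M_h^2}{\rho_h^2c^2\gamma(m\mathbf M_h/\rho_h)}$. Then: $$\int_\Omega\partial_t\rho_h\,\phi_h\,dx=\int_\Omega\rho_h\mathbf w_h\cdot\nabla\phi_h\,dx\quad\forall\phi_h\in Q_{k+1},$$ $$\int_\Omega\partial_t\mathbf M_h\cdot\boldsymbol\mu_h\,dx=\int_\Omega(\mathbf w_h\cdot\nabla\boldsymbol\mu_h-\boldsymbol\mu_h\cdot\nabla\mathbf w_h)\cdot\mathbf M_h\,dx-\int_\Omega\rho_h\,\boldsymbol\mu_h\cdot\nabla G_h\,c^2\,dx+\frac em\int_\Omega\rho_h\Big(\mathbf E_h+\mathbf w_h\times\frac{\mathbf B_h}c\Big)\cdot\boldsymbol\mu_h\,dx\quad\forall\boldsymbol\mu_h\in Q_{k+1}^d,$$ $$\int_\Omega\partial_t\mathbf E_h\cdot\boldsymbol\nu_h\,dx=c\int_\Omega\mathbf B_h\cdot(\nabla\times\boldsymbol\nu_h)\,dx-\frac{4\pi e}m\int_\Omega\rho_h\mathbf w_h\cdot\boldsymbol\nu_h\,dx-\frac{4\pi e}m\sum_{p=1}^N\frac{w_p\mathbf U_p}{\gamma(\mathbf U_p)}\cdot\boldsymbol\nu_h(\mathbf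 X_p)\quad\forall\boldsymbol\nu_h\in\mathring N_k,$$ $$\int_\Omega\partial_t\mathbf B_h\cdot\boldsymbol\tau_h\,dx=-c\int_\Omega\boldsymbol\tau_h\cdot(\nabla\times\mathbf E_h)\,dx\quad\forall\boldsymbol\tau_h\in\mathring{RT}_k,$$ $$\partial_t\mathbf X_p=\frac{\mathbf U_p}{m\gamma(\mathbf U_p)},\qquad\partial_t\mathbf U_p=e\Big(\mathbf E_h(\mathbf X_p,t)+\frac{\mathbf U_p\times\mathbf B_h(\mathbf X_p,t)}{cm\gamma(\mathbf U_p)}\Big).$$ A solution is understood to have $\rho_h$ nowhere vanishing (so that all expressions are defined) and all particles in $\Omega_h$. The unknowns are absolutely continuous in time and the equations hold for almost every $t$. At a point lying on a mesh face, the value of a discontinuous piecewise polynomial field is its trace from one fixed adjacent cell (the same cell for all fields). *)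

theory Defs
  imports "HOL-Analysis.Analysis"
begin

section \<open>Polyhedral meshes\<close>

text \<open>Cells are closed polyhedra, not necessarily convex (the library's polytopes are convex).\<close>

definition polyhedral_cell :: "(real^3) set \<Rightarrow> bool" where
  "polyhedral_cell K \<longleftrightarrow>
     K \<noteq> {} \<and> (\<exists>P. finite P \<and> (\<forall>Q\<in>P. polytope Q) \<and> K = \<Union>P) \<and>
     closure (interior K) = K \<and> connected (interior K)"

text \<open>The directions in which \<open>K\<close> is translation invariant near \<open>x\<close>. For a polyhedron they form
  a subspace, whose dimension is the dimension of the open face of \<open>K\<close> containing \<open>x\<close>: 3 at interior
  points, 2 inside facets, 1 inside edges, 0 at vertices. On a convex polytope the sets
  \<open>cell_faces j K\<close> are its \<open>j\<close>-dimensional faces in the usual sense.\<close>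

definition local_directions :: "(real^3) set \<Rightarrow> real^3 \<Rightarrow> (real^3) set" where
  "local_directions K x =
     {v. \<exists>r>0. \<forall>y\<in>ball x r. \<forall>s::real. y + s *\<^sub>R v \<in> ball x r \<longrightarrow> (y \<in> K \<longleftrightarrow> y + s *\<^sub>R v \<in> K)}"

definition cell_faces :: "nat \<Rightarrow> (real^3) set \<Rightarrow> (real^3) set set" where
  "cell_faces j K = closure ` components {x \<in> K. dim (local_directions K x) = j}"

text \<open>A finite conforming polyhedral partition \<open>T\<close> of the bounded domain \<open>\<Omega>\<close>: distinct cells meet
  in a (possibly empty) union of common faces, and the boundary of \<open>\<Omega>\<close> consists of facets of cells.
  The union of the closed cells is the closure of \<open>\<Omega>\<close>.\<close>

definition conforming_polyhedral_mesh :: "(real^3) set \<Rightarrow> (real^3) set set \<Rightarrow> bool" where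
  "conforming_polyhedral_mesh \<Omega> T \<longleftrightarrow>
     open \<Omega> \<and> connected \<Omega> \<and> bounded \<Omega> \<and> \<Omega> \<noteq> {} \<and>
     finite T \<and> (\<forall>K\<in>T. polyhedral_cell K) \<and> \<Union>T = closure \<Omega> \<and>
     (\<forall>K\<in>T. \<forall>K'\<in>T. K \<noteq> K' \<longrightarrow>
        interior K \<inter> interior K' = {} \<and>
        (\<exists>\<F> \<subseteq> (\<Union>j. cell_faces j K) \<inter> (\<Union>j. cell_faces j K'). K \<inter> K' = \<Union>\<F>)) \<and>
     (\<exists>\<F> \<subseteq> (\<Union>K\<in>T. cell_faces 2 K). frontier \<Omega> = \<Union>\<F>)"

text \<open>Fields are represented by functions that are polynomial on the interior of each cell; their
  values on the mesh skeleton carry no information. The trace of a field from \<open>K\<close> is the limit from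
  the interior of \<open>K\<close>. Point values of fields are traces from a cell \<open>\<kappa> x\<close> containing \<open>x\<close>, chosen
  once for all fields.\<close>

definition cell_trace :: "(real^3) set \<Rightarrow> (real^3 \<Rightarrow> 'a::t2_space) \<Rightarrow> real^3 \<Rightarrow> 'a" where
  "cell_trace K f x = Lim (at x within interior K) f"

definition cell_selection :: "(real^3) set set \<Rightarrow> (real^3 \<Rightarrow> (real^3) set) \<Rightarrow> bool" where
  "cell_selection T \<kappa> \<longleftrightarrow> (\<forall>x\<in>\<Union>T. \<kappa> x \<in> T \<and> x \<in> \<kappa> x)"

definition point_value :: "(real^3 \<Rightarrow> (real^3) set) \<Rightarrow> (real^3 \<Rightarrow> 'a::t2_space) \<Rightarrow> real^3 \<Rightarrow> 'a" where
  "point_value \<kappa> f x = cell_trace (\<kappa> x) f x"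

text \<open>\<open>x\<close> lies in the relative interior of a facet of \<open>K\<close>, on the boundary of \<open>\<Omega>\<close> near \<open>x\<close>, and \<open>n\<close>
  is the outward unit normal of \<open>K\<close> there. Almost every boundary point is of this form, and using
  \<open>K\<close> rather than \<open>\<Omega>\<close> to define the normal also handles domains lying on both sides of a facet.\<close>

definition boundary_normal :: "(real^3) set \<Rightarrow> (real^3) set \<Rightarrow> real^3 \<Rightarrow> real^3 \<Rightarrow> bool" where
  "boundary_normal \<Omega> K x n \<longleftrightarrow>
     norm n = 1 \<and>
     (\<exists>r>0. K \<inter> ball x r = {y. n \<bullet> (y - x) \<le> 0} \<inter> ball x r \<and>
            {y. n \<bullet> (y - x) = 0} \<inter> ball x r \<subseteq> frontier \<Omega>)"


section \<open>Weak derivatives and the spaces H1, H(curl), H(div)\<close>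

definition partial_deriv :: "3 \<Rightarrow> (real^3 \<Rightarrow> real) \<Rightarrow> real^3 \<Rightarrow> real" where
  "partial_deriv i f x = frechet_derivative f (at x) (axis i 1)"

definition grad :: "(real^3 \<Rightarrow> real) \<Rightarrow> real^3 \<Rightarrow> real^3" where
  "grad f x = (\<chi> i. partial_deriv i f x)"

definition curl :: "(real^3 \<Rightarrow> real^3) \<Rightarrow> real^3 \<Rightarrow> real^3" where
  "curl f x = vector
     [partial_deriv 2 (\<lambda>y. f y $ 3) x - partial_deriv 3 (\<lambda>y. f y $ 2) x,
      partial_deriv 3 (\<lambda>y. f y $ 1) x - partial_deriv 1 (\<lambda>y. f y $ 3) x,
      partial_deriv 1 (\<lambda>y. f y $ 2) x - partial_deriv 2 (\<lambda>y. f y $ 1) x]"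

primrec times_cont_diff :: "nat \<Rightarrow> (real^3 \<Rightarrow> real) \<Rightarrow> bool" where
  "times_cont_diff 0 f \<longleftrightarrow> continuous_on UNIV f"
| "times_cont_diff (Suc n) f \<longleftrightarrow>
     (\<forall>x. f differentiable (at x)) \<and> (\<forall>i. times_cont_diff n (partial_deriv i f))"

definition test_function :: "(real^3) set \<Rightarrow> (real^3 \<Rightarrow> real) \<Rightarrow> bool" where
  "test_function \<Omega> \<psi> \<longleftrightarrow>
     (\<forall>n. times_cont_diff n \<psi>) \<and>
     compact (closure {x. \<psi> x \<noteq> 0}) \<and> closure {x. \<psi> x \<noteq> 0} \<subseteq> \<Omega>"

definition L2 :: "(real^3) set \<Rightarrow> (real^3 \<Rightarrow> 'a::euclidean_space) set" where
  "L2 \<Omega> = {f \<in> borel_measurable (lebesgue_on \<Omega>). integrable (lebesgue_on \<Omega>) (\<lambda>x. (norm (f x))\<^sup>2)}"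

definition has_weak_grad :: "(real^3) set \<Rightarrow> (real^3 \<Rightarrow> real) \<Rightarrow> (real^3 \<Rightarrow> real^3) \<Rightarrow> bool" where
  "has_weak_grad \<Omega> f g \<longleftrightarrow> g \<in> L2 \<Omega> \<and>
     (\<forall>\<psi>. test_function \<Omega> \<psi> \<longrightarrow>
        (\<forall>i. (LINT x|lebesgue_on \<Omega>. f x * partial_deriv i \<psi> x) = - (LINT x|lebesgue_on \<Omega>. g x $ i * \<psi> x)))"

definition has_weak_curl :: "(real^3) set \<Rightarrow> (real^3 \<Rightarrow> real^3) \<Rightarrow> (real^3 \<Rightarrow> real^3) \<Rightarrow> bool" where
  "has_weak_curl \<Omega> f g \<longleftrightarrow> g \<in> L2 \<Omega> \<and>
     (\<forall>\<psi>. (\<forall>i. test_function \<Omega> (\<lambda>x. \<psi> x $ i)) \<longrightarrow>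
        (LINT x|lebesgue_on \<Omega>. f x \<bullet> curl \<psi> x) = (LINT x|lebesgue_on \<Omega>. g x \<bullet> \<psi> x))"

definition has_weak_div :: "(real^3) set \<Rightarrow> (real^3 \<Rightarrow> real^3) \<Rightarrow> (real^3 \<Rightarrow> real) \<Rightarrow> bool" where
  "has_weak_div \<Omega> f g \<longleftrightarrow> g \<in> L2 \<Omega> \<and>
     (\<forall>\<psi>. test_function \<Omega> \<psi> \<longrightarrow>
        (LINT x|lebesgue_on \<Omega>. f x \<bullet> grad \<psi> x) = - (LINT x|lebesgue_on \<Omega>. g x * \<psi> x))"

definition H1 :: "(real^3) set \<Rightarrow> (real^3 \<Rightarrow> real) set" where
  "H1 \<Omega> = {f \<in> L2 \<Omega>. \<exists>g. has_weak_grad \<Omega> f g}"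

definition Hcurl :: "(real^3) set \<Rightarrow> (real^3 \<Rightarrow> real^3) set" where
  "Hcurl \<Omega> = {f \<in> L2 \<Omega>. \<exists>g. has_weak_curl \<Omega> f g}"

definition Hdiv :: "(real^3) set \<Rightarrow> (real^3 \<Rightarrow> real^3) set" where
  "Hdiv \<Omega> = {f \<in> L2 \<Omega>. \<exists>g. has_weak_div \<Omega> f g}"

text \<open>Weak derivatives are determined up to null sets; the operators pick a representative.\<close>

definition wgrad :: "(real^3) set \<Rightarrow> (real^3 \<Rightarrow> real) \<Rightarrow> real^3 \<Rightarrow> real^3" where
  "wgrad \<Omega> f = (SOME g. has_weak_grad \<Omega> f g)"

definition wcurl :: "(real^3) set \<Rightarrow> (real^3 \<Rightarrow> real^3) \<Rightarrow> real^3 \<Rightarrow> real^3" where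
  "wcurl \<Omega> f = (SOME g. has_weak_curl \<Omega> f g)"

definition wdiv :: "(real^3) set \<Rightarrow> (real^3 \<Rightarrow> real^3) \<Rightarrow> real^3 \<Rightarrow> real" where
  "wdiv \<Omega> f = (SOME g. has_weak_div \<Omega> f g)"


section \<open>Finite element spaces\<close>

definition Pk :: "nat \<Rightarrow> (real^3 \<Rightarrow> real) set" where
  "Pk k = {p. \<exists>a. \<forall>x. p x = (\<Sum>\<alpha> | (\<Sum>i\<in>UNIV. \<alpha> i) \<le> k. a \<alpha> * (\<Prod>i\<in>UNIV. (x $ i) ^ \<alpha> i))}"

definition Pkvec :: "nat \<Rightarrow> (real^3 \<Rightarrow> real^3) set" where
  "Pkvec k = {p. \<forall>i. (\<lambda>x. p x $ i) \<in> Pk k}"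

definition Qk :: "(real^3) set \<Rightarrow> (real^3) set set \<Rightarrow> nat \<Rightarrow> (real^3 \<Rightarrow> real) set" where
  "Qk \<Omega> T k = {f \<in> H1 \<Omega>. \<forall>K\<in>T. \<exists>p\<in>Pk k. \<forall>x\<in>interior K. f x = p x}"

definition Qkvec :: "(real^3) set \<Rightarrow> (real^3) set set \<Rightarrow> nat \<Rightarrow> (real^3 \<Rightarrow> real^3) set" where
  "Qkvec \<Omega> T k = {f. \<forall>i. (\<lambda>x. f x $ i) \<in> Qk \<Omega> T k}"

definition Nk :: "(real^3) set \<Rightarrow> (real^3) set set \<Rightarrow> nat \<Rightarrow> (real^3 \<Rightarrow> real^3) set" where
  "Nk \<Omega> T k = {f \<in> Hcurl \<Omega>. \<forall>K\<in>T. \<exists>p\<in>Pkvec k. \<exists>q\<in>Pkvec k. \<forall>x\<in>interior K. f x = p x + cross3 x (q x)}"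

definition RTk :: "(real^3) set \<Rightarrow> (real^3) set set \<Rightarrow> nat \<Rightarrow> (real^3 \<Rightarrow> real^3) set" where
  "RTk \<Omega> T k = {f \<in> Hdiv \<Omega>. \<forall>K\<in>T. \<exists>p\<in>Pkvec k. \<exists>q\<in>Pk k. \<forall>x\<in>interior K. f x = p x + q x *\<^sub>R x}"

definition Qk0 :: "(real^3) set \<Rightarrow> (real^3) set set \<Rightarrow> nat \<Rightarrow> (real^3 \<Rightarrow> real) set" where
  "Qk0 \<Omega> T k = {f \<in> Qk \<Omega> T k. \<forall>K\<in>T. \<forall>x \<in> K \<inter> frontier \<Omega>. cell_trace K f x = 0}"

definition Nk0 :: "(real^3) set \<Rightarrow> (real^3) set set \<Rightarrow> nat \<Rightarrow> (real^3 \<Rightarrow> real^3) set" where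
  "Nk0 \<Omega> T k = {f \<in> Nk \<Omega> T k. \<forall>K\<in>T. \<forall>x n. boundary_normal \<Omega> K x n \<longrightarrow> cross3 n (cell_trace K f x) = 0}"

definition RTk0 :: "(real^3) set \<Rightarrow> (real^3) set set \<Rightarrow> nat \<Rightarrow> (real^3 \<Rightarrow> real^3) set" where
  "RTk0 \<Omega> T k = {f \<in> RTk \<Omega> T k. \<forall>K\<in>T. \<forall>x n. boundary_normal \<Omega> K x n \<longrightarrow> n \<bullet> cell_trace K f x = 0}"

definition L2_projection ::
  "(real^3) set \<Rightarrow> (real^3 \<Rightarrow> 'a::euclidean_space) set \<Rightarrow> (real^3 \<Rightarrow> 'a) \<Rightarrow> (real^3 \<Rightarrow> 'a) \<Rightarrow> bool" where
  "L2_projection \<Omega> V f g \<longleftrightarrow>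
     g \<in> V \<and> (\<forall>v\<in>V. (LINT x|lebesgue_on \<Omega>. g x \<bullet> v x) = (LINT x|lebesgue_on \<Omega>. f x \<bullet> v x))"

text \<open>The discrete weak divergence from \<open>Nk0 \<Omega> T k\<close> to \<open>Qk0 \<Omega> T (k + 1)\<close>, unique up to null sets.\<close>

definition weak_divergence ::
  "(real^3) set \<Rightarrow> (real^3) set set \<Rightarrow> nat \<Rightarrow> (real^3 \<Rightarrow> real^3) \<Rightarrow> real^3 \<Rightarrow> real" where
  "weak_divergence \<Omega> T k E =
     (SOME D. D \<in> Qk0 \<Omega> T (k + 1) \<and>
        (\<forall>\<phi>\<in>Qk0 \<Omega> T (k + 1).
           (LINT x|lebesgue_on \<Omega>. D x * \<phi> x) = - (LINT x|lebesgue_on \<Omega>. E x \<bullet> wgrad \<Omega> \<phi> x)))"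


section \<open>Absolute continuity and time derivatives\<close>

text \<open>Absolute continuity on every compact subinterval of \<open>I\<close>.\<close>

definition abs_cont :: "real set \<Rightarrow> (real \<Rightarrow> 'a::metric_space) \<Rightarrow> bool" where
  "abs_cont I f \<longleftrightarrow>
     (\<forall>a b. {a..b} \<subseteq> I \<longrightarrow>
       (\<forall>\<epsilon>>0. \<exists>\<delta>>0. \<forall>\<D>. \<D> division_of \<Union>\<D> \<and> \<Union>\<D> \<subseteq> {a..b} \<and> (\<Sum>k\<in>\<D>. measure lborel k) < \<delta> \<longrightarrow>
          (\<Sum>k\<in>\<D>. dist (f (Inf k)) (f (Sup k))) < \<epsilon>))"

text \<open>The finite element unknowns take values in finite-dimensional spaces, in which absolute
  continuity and differentiability in time amount to the same property at each point of the open
  cells. Absolute continuity makes the time derivatives exist for almost every \<open>t\<close>.\<close>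

definition field_abs_cont ::
  "(real^3) set set \<Rightarrow> real set \<Rightarrow> (real \<Rightarrow> real^3 \<Rightarrow> 'a::real_normed_vector) \<Rightarrow> bool" where
  "field_abs_cont T I f \<longleftrightarrow> (\<forall>K\<in>T. \<forall>x\<in>interior K. abs_cont I (\<lambda>t. f t x))"

definition field_differentiable_at ::
  "(real^3) set set \<Rightarrow> (real \<Rightarrow> real^3 \<Rightarrow> 'a::real_normed_vector) \<Rightarrow> real \<Rightarrow> bool" where
  "field_differentiable_at T f t \<longleftrightarrow> (\<forall>K\<in>T. \<forall>x\<in>interior K. (\<lambda>s. f s x) differentiable (at t))"

definition time_deriv :: "(real \<Rightarrow> real^3 \<Rightarrow> 'a::real_normed_vector) \<Rightarrow> real \<Rightarrow> real^3 \<Rightarrow> 'a" where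
  "time_deriv f t x = vector_derivative (\<lambda>s. f s x) (at t)"


section \<open>The scheme\<close>

definition lorentz :: "real \<Rightarrow> real \<Rightarrow> real^3 \<Rightarrow> real" where
  "lorentz m c u = sqrt (1 + (u \<bullet> u) / (m\<^sup>2 * c\<^sup>2))"

text \<open>\<open>(a \<cdot> \<nabla>b) \<cdot> d = \<Sum>i j. a\<^sub>i (\<partial>\<^sub>i b\<^sub>j) d\<^sub>j\<close>\<close>

definition adv :: "(real^3) set \<Rightarrow> (real^3 \<Rightarrow> real^3) \<Rightarrow> (real^3 \<Rightarrow> real^3) \<Rightarrow> (real^3 \<Rightarrow> real^3) \<Rightarrow> real^3 \<Rightarrow> real" where
  "adv \<Omega> a b d x = (\<Sum>i\<in>UNIV. \<Sum>j\<in>UNIV. a x $ i * (wgrad \<Omega> (\<lambda>y. b y $ j) x $ i) * d x $ j)"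

definition velocity_projection ::
  "(real^3) set \<Rightarrow> (real^3) set set \<Rightarrow> nat \<Rightarrow> real \<Rightarrow> real \<Rightarrow>
   (real^3 \<Rightarrow> real) \<Rightarrow> (real^3 \<Rightarrow> real^3) \<Rightarrow> (real^3 \<Rightarrow> real^3) \<Rightarrow> bool" where
  "velocity_projection \<Omega> T k c m \<rho> M w \<longleftrightarrow>
     L2_projection \<Omega> (Qkvec \<Omega> T (k + 1))
       (\<lambda>x. (1 / (\<rho> x * lorentz m c ((m / \<rho> x) *\<^sub>R M x))) *\<^sub>R M x) w"

definition G_projection ::
  "(real^3) set \<Rightarrow> (real^3) set set \<Rightarrow> nat \<Rightarrow> real \<Rightarrow> real \<Rightarrow>
   (real^3 \<Rightarrow> real) \<Rightarrow> (real^3 \<Rightarrow> real^3) \<Rightarrow> (real^3 \<Rightarrow> real) \<Rightarrow> bool" where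
  "G_projection \<Omega> T k c m \<rho> M G \<longleftrightarrow>
     L2_projection \<Omega> (Qk \<Omega> T (k + 1))
       (\<lambda>x. lorentz m c ((m / \<rho> x) *\<^sub>R M x) - 1
            - (M x \<bullet> M x) / ((\<rho> x)\<^sup>2 * c\<^sup>2 * lorentz m c ((m / \<rho> x) *\<^sub>R M x))) G"

definition scheme_equations ::
  "(real^3) set \<Rightarrow> (real^3) set set \<Rightarrow> (real^3 \<Rightarrow> (real^3) set) \<Rightarrow> nat \<Rightarrow>
   real \<Rightarrow> real \<Rightarrow> real \<Rightarrow> nat \<Rightarrow> (nat \<Rightarrow> real) \<Rightarrow>
   (real \<Rightarrow> real^3 \<Rightarrow> real) \<Rightarrow> (real \<Rightarrow> real^3 \<Rightarrow> real^3) \<Rightarrow>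
   (real \<Rightarrow> real^3 \<Rightarrow> real^3) \<Rightarrow> (real \<Rightarrow> real^3 \<Rightarrow> real^3) \<Rightarrow>
   (nat \<Rightarrow> real \<Rightarrow> real^3) \<Rightarrow> (nat \<Rightarrow> real \<Rightarrow> real^3) \<Rightarrow>
   (real \<Rightarrow> real^3 \<Rightarrow> real^3) \<Rightarrow> (real \<Rightarrow> real^3 \<Rightarrow> real) \<Rightarrow> real \<Rightarrow> bool" where
  "scheme_equations \<Omega> T \<kappa> k c m e N wt \<rho> M E B X U w G t \<longleftrightarrow>
     field_differentiable_at T \<rho> t \<and> field_differentiable_at T M t \<and>
     field_differentiable_at T E t \<and> field_differentiable_at T B t \<and>
     (\<forall>\<phi>\<in>Qk \<Omega> T (k + 1).
        (LINT x|lebesgue_on \<Omega>. time_deriv \<rho> t x * \<phi> x)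
        = (LINT x|lebesgue_on \<Omega>. \<rho> t x * (w t x \<bullet> wgrad \<Omega> \<phi> x))) \<and>
     (\<forall>\<mu>\<in>Qkvec \<Omega> T (k + 1).
        (LINT x|lebesgue_on \<Omega>. time_deriv M t x \<bullet> \<mu> x)
        = (LINT x|lebesgue_on \<Omega>. adv \<Omega> (w t) \<mu> (M t) x - adv \<Omega> \<mu> (w t) (M t) x)
          - (LINT x|lebesgue_on \<Omega>. \<rho> t x * (\<mu> x \<bullet> wgrad \<Omega> (G t) x) * c\<^sup>2)
          + e / m * (LINT x|lebesgue_on \<Omega>.
              \<rho> t x * ((E t x + cross3 (w t x) ((1 / c) *\<^sub>R B t x)) \<bullet> \<mu> x))) \<and>
     (\<forall>\<nu>\<in>Nk0 \<Omega> T k.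
        (LINT x|lebesgue_on \<Omega>. time_deriv E t x \<bullet> \<nu> x)
        = c * (LINT x|lebesgue_on \<Omega>. B t x \<bullet> wcurl \<Omega> \<nu> x)
          - 4 * pi * e / m * (LINT x|lebesgue_on \<Omega>. \<rho> t x * (w t x \<bullet> \<nu> x))
          - 4 * pi * e / m * (\<Sum>p\<in>{1..N}.
              ((wt p / lorentz m c (U p t)) *\<^sub>R U p t) \<bullet> point_value \<kappa> \<nu> (X p t))) \<and>
     (\<forall>\<tau>\<in>RTk0 \<Omega> T k.
        (LINT x|lebesgue_on \<Omega>. time_deriv B t x \<bullet> \<tau> x)
        = - c * (LINT x|lebesgue_on \<Omega>. \<tau> x \<bullet> wcurl \<Omega> (E t) x)) \<and>
     (\<forall>p\<in>{1..N}.
        (X p has_vector_derivative (1 / (m * lorentz m c (U p t))) *\<^sub>R U p t) (at t) \<and>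
        (U p has_vector_derivative
           e *\<^sub>R (point_value \<kappa> (E t) (X p t)
             + (1 / (c * m * lorentz m c (U p t))) *\<^sub>R cross3 (U p t) (point_value \<kappa> (B t) (X p t)))) (at t))"

definition scheme_solution ::
  "(real^3) set \<Rightarrow> (real^3) set set \<Rightarrow> (real^3 \<Rightarrow> (real^3) set) \<Rightarrow> nat \<Rightarrow>
   real \<Rightarrow> real \<Rightarrow> real \<Rightarrow> nat \<Rightarrow> (nat \<Rightarrow> real) \<Rightarrow> real set \<Rightarrow>
   (real \<Rightarrow> real^3 \<Rightarrow> real) \<Rightarrow> (real \<Rightarrow> real^3 \<Rightarrow> real^3) \<Rightarrow>
   (real \<Rightarrow> real^3 \<Rightarrow> real^3) \<Rightarrow> (real \<Rightarrow> real^3 \<Rightarrow> real^3) \<Rightarrow>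
   (nat \<Rightarrow> real \<Rightarrow> real^3) \<Rightarrow> (nat \<Rightarrow> real \<Rightarrow> real^3) \<Rightarrow> bool" where
  "scheme_solution \<Omega> T \<kappa> k c m e N wt I \<rho> M E B X U \<longleftrightarrow>
     (\<forall>t\<in>I. \<rho> t \<in> Qk \<Omega> T (k + 1) \<and> M t \<in> Qkvec \<Omega> T (k + 1) \<and>
            E t \<in> Nk0 \<Omega> T k \<and> B t \<in> RTk0 \<Omega> T k \<and>
            (\<forall>x\<in>\<Omega>. point_value \<kappa> (\<rho> t) x \<noteq> 0) \<and>
            (\<forall>p\<in>{1..N}. X p t \<in> \<Union>T)) \<and>
     field_abs_cont T I \<rho> \<and> field_abs_cont T I M \<and> field_abs_cont T I E \<and> field_abs_cont T I B \<and>
     (\<forall>p\<in>{1..N}. abs_cont I (X p) \<and> abs_cont I (U p)) \<and>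
     (\<exists>w G. (\<forall>t\<in>I. velocity_projection \<Omega> T k c m (\<rho> t) (M t) (w t) \<and>
                    G_projection \<Omega> T k c m (\<rho> t) (M t) (G t)) \<and>
            (AE t in lebesgue_on I. scheme_equations \<Omega> T \<kappa> k c m e N wt \<rho> M E B X U w G t))"

end

theory Submission
  imports Defs
begin

text \<open>The invariants come from testing the scheme with suitable members of the discrete spaces. What needs
care is that the unknowns are only absolutely continuous in time and only piecewise polynomial in
space, with no information on the mesh skeleton.

An absolutely continuous function of time whose derivative vanishes almost everywhere is constant
(\<open>abs_cont_zero_derivative_imp_const\<close>), so every invariant is shown to be such a function. The spaces of
fields are finite-dimensional, and a field is a combination of fixed basis fields whose coefficients
are its values at finitely many points of the open cells (\<open>field_basis\<close>). Absolute continuity at each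
point therefore yields one modulus of continuity for all points (\<open>field_control\<close>), which allows
integrals of fields to be differentiated under the integral sign (\<open>functional_control\<close>).

For the energy, consider the fluid energy density as a function of the values \<open>r\<close> of \<open>\<rho>\<close> and \<open>u\<close> of \<open>M\<close> at
a point. Since \<open>\<rho>\<close> does not vanish, its sign \<open>\<sigma>\<close> there is constant in time, and the density is
\<open>c\<^sup>2(\<sigma> |(r, u / c)| - r)\<close>, with the partial derivatives \<open>c\<^sup>2(1 / \<gamma> - 1)\<close> and \<open>u / (r \<gamma>)\<close>. The former is \<open>c\<^sup>2\<close> times
the source of \<open>G\<close>, the latter is the source of \<open>w\<close> (\<open>fluid_energy_density_deriv\<close>). As the time derivatives
of \<open>\<rho>\<close> and \<open>M\<close> lie in the target spaces of the two projections, the sources may be replaced by \<open>G\<close> and \<open>w\<close>, and the first two equations apply with the test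
functions \<open>G\<close> and \<open>w\<close>: the transport terms cancel, the magnetic force drops out, and the work
\<open>e / m \<integral> \<rho> w \<bullet> E\<close> of the electric field remains (\<open>fluid_energy\<close>). It is balanced, together with the work
on the particles, by the field equations tested with \<open>E\<close> and \<open>B\<close>.

For the Gauss law, the weak divergence exists by finite-dimensional Riesz representation, so that its
pairing with \<open>\<phi>\<close> is \<open>- \<integral> E \<bullet> \<nabla>\<phi>\<close>. The gradient of \<open>\<phi>\<close> is an admissible test function of the third equation
and has no curl (\<open>grad_in_Nk0\<close>); the fluid current then cancels against the first equation. The particle
current cancels against the derivative of \<open>\<phi>(X)\<close>. Here \<open>\<phi>\<close> is continuous across cells, since its weak
gradient is bounded (\<open>Qk_traces_agree\<close>), but its gradient jumps. Nevertheless, at all but countably many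
times, the derivative along the path is given by the gradient from any cell containing the point,
because two cell polynomials that agree at times accumulating at \<open>t\<close> have the same derivative along
the path at \<open>t\<close> (\<open>Qk0_path_derivative\<close>).

Finally, the curl of \<open>E\<close> lies in the space of test functions of the fourth equation (\<open>curl_in_RTk0\<close>).
Hence the time derivative of \<open>B\<close> is \<open>- c\<close> times the curl of \<open>E\<close> almost everywhere, and this is weakly
divergence free.\<close>

section \<open>Absolute continuity in time\<close>

definition thin_division :: "real \<Rightarrow> real \<Rightarrow> real \<Rightarrow> real set set \<Rightarrow> bool" where
  "thin_division a b \<delta> \<D> \<longleftrightarrow>
     \<D> division_of \<Union>\<D> \<and> \<Union>\<D> \<subseteq> {a..b} \<and> (\<Sum>k\<in>\<D>. measure lborel k) < \<delta>"

text \<open>Here \<open>d s t\<close> stands for a bound on the increment of a function between the times \<open>s\<close> and \<open>t\<close>. Working with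
such bounds, rather than with one function, makes it possible to bound the values of a field at all
points by the same \<open>d\<close>, as is necessary for integrals over the domain.\<close>

definition ac_control :: "real \<Rightarrow> real \<Rightarrow> (real \<Rightarrow> real \<Rightarrow> real) \<Rightarrow> bool" where
  "ac_control a b d \<longleftrightarrow>
     (\<forall>\<epsilon>>0. \<exists>\<delta>>0. \<forall>\<D>. thin_division a b \<delta> \<D> \<longrightarrow> (\<Sum>k\<in>\<D>. d (Inf k) (Sup k)) < \<epsilon>)"

lemma ac_controlD:
  assumes "ac_control a b d" "\<epsilon> > 0"
  obtains \<delta> where "\<delta> > 0"
    "\<And>\<D>. thin_division a b \<delta> \<D> \<Longrightarrow> (\<Sum>k\<in>\<D>. d (Inf k) (Sup k)) < \<epsilon>"
  using assms unfolding ac_control_def by blast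

lemma abs_cont_iff_ac_control:
  "abs_cont I f \<longleftrightarrow> (\<forall>a b. {a..b} \<subseteq> I \<longrightarrow> ac_control a b (\<lambda>s t. dist (f s) (f t)))"
  unfolding abs_cont_def ac_control_def thin_division_def ..

lemma abs_cont_imp_ac_control:
  assumes "abs_cont I f" "{a..b} \<subseteq> I"
  shows "ac_control a b (\<lambda>s t. dist (f s) (f t))"
  using assms abs_cont_iff_ac_control by blast

lemma thin_division_member:
  assumes "thin_division a b \<delta> \<D>" "k \<in> \<D>"
  shows "Inf k \<in> {a..b}" "Sup k \<in> {a..b}"
proof -
  have D: "\<D> division_of \<Union>\<D>" "\<Union>\<D> \<subseteq> {a..b}"
    using assms(1) by (auto simp: thin_division_def)
  obtain c d where k: "k = {c..d}"
    using division_ofD(4)[OF D(1) assms(2)] by auto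
  have "c \<le> d" using division_ofD(3)[OF D(1) assms(2)] k by simp
  moreover have "{c..d} \<subseteq> {a..b}" using D(2) assms(2) k by blast
  ultimately show "Inf k \<in> {a..b}" "Sup k \<in> {a..b}" using k by auto
qed

lemma ac_control_mono:
  assumes d: "ac_control a b d" and C: "0 \<le> C"
    and le: "\<And>s t. s \<in> {a..b} \<Longrightarrow> t \<in> {a..b} \<Longrightarrow> d' s t \<le> C * d s t"
  shows "ac_control a b d'"
  unfolding ac_control_def
proof (intro allI impI)
  fix \<epsilon> :: real assume \<epsilon>: "\<epsilon> > 0"
  then have "\<epsilon> / (C + 1) > 0" using C by simp
  then obtain \<delta> where \<delta>: "\<delta> > 0" and *:
    "\<And>\<D>. thin_division a b \<delta> \<D> \<Longrightarrow> (\<Sum>k\<in>\<D>. d (Inf k) (Sup k)) < \<epsilon> / (C + 1)"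
    by (rule ac_controlD[OF d]) blast
  have "(\<Sum>k\<in>\<D>. d' (Inf k) (Sup k)) < \<epsilon>" if D: "thin_division a b \<delta> \<D>" for \<D>
  proof -
    let ?s = "\<Sum>k\<in>\<D>. d (Inf k) (Sup k)"
    have "(\<Sum>k\<in>\<D>. d' (Inf k) (Sup k)) \<le> (\<Sum>k\<in>\<D>. C * d (Inf k) (Sup k))"
      by (intro sum_mono le thin_division_member[OF D])
    also have "\<dots> = C * ?s" by (simp add: sum_distrib_left)
    also have "\<dots> \<le> C * (\<epsilon> / (C + 1))"
      using *[OF D] C by (intro mult_left_mono) auto
    also have "\<dots> < \<epsilon>" using C \<epsilon> by (simp add: field_simps)
    finally show ?thesis .
  qed
  with \<delta> show "\<exists>\<delta>>0. \<forall>\<D>. thin_division a b \<delta> \<D> \<longrightarrow> (\<Sum>k\<in>\<D>. d' (Inf k) (Sup k)) < \<epsilon>" by blast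
qed

lemma ac_control_add:
  assumes d: "ac_control a b d" and e: "ac_control a b e"
  shows "ac_control a b (\<lambda>s t. d s t + e s t)"
  unfolding ac_control_def
proof (intro allI impI)
  fix \<epsilon> :: real assume "\<epsilon> > 0"
  then have \<epsilon>: "\<epsilon> / 2 > 0" by simp
  obtain \<delta>1 where 1: "\<delta>1 > 0"
    "\<And>\<D>. thin_division a b \<delta>1 \<D> \<Longrightarrow> (\<Sum>k\<in>\<D>. d (Inf k) (Sup k)) < \<epsilon> / 2"
    by (rule ac_controlD[OF d \<epsilon>]) blast
  obtain \<delta>2 where 2: "\<delta>2 > 0"
    "\<And>\<D>. thin_division a b \<delta>2 \<D> \<Longrightarrow> (\<Sum>k\<in>\<D>. e (Inf k) (Sup k)) < \<epsilon> / 2"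
    by (rule ac_controlD[OF e \<epsilon>]) blast
  have "(\<Sum>k\<in>\<D>. d (Inf k) (Sup k) + e (Inf k) (Sup k)) < \<epsilon>"
    if D: "thin_division a b (min \<delta>1 \<delta>2) \<D>" for \<D>
  proof -
    have "thin_division a b \<delta>1 \<D>" "thin_division a b \<delta>2 \<D>"
      using D by (auto simp: thin_division_def)
    from 1(2)[OF this(1)] 2(2)[OF this(2)] show ?thesis by (simp add: sum.distrib)
  qed
  moreover have "min \<delta>1 \<delta>2 > 0" using 1(1) 2(1) by simp
  ultimately show "\<exists>\<delta>>0. \<forall>\<D>. thin_division a b \<delta> \<D> \<longrightarrow>
      (\<Sum>k\<in>\<D>. d (Inf k) (Sup k) + e (Inf k) (Sup k)) < \<epsilon>" by blast
qed

lemma ac_control_zero: "ac_control a b (\<lambda>s t. 0)"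
  by (auto simp: ac_control_def intro: exI[of _ 1])

lemma ac_control_sum:
  assumes "finite J" "\<And>j. j \<in> J \<Longrightarrow> ac_control a b (d j)"
  shows "ac_control a b (\<lambda>s t. \<Sum>j\<in>J. d j s t)"
  using assms
proof (induction J rule: finite_induct)
  case empty
  show ?case by (simp add: ac_control_zero)
next
  case (insert j J)
  then show ?case by (simp add: ac_control_add)
qed

lemma ac_control_subset:
  assumes d: "ac_control a b d" and uv: "{u..v} \<subseteq> {a..b}"
  shows "ac_control u v d"
proof -
  have "thin_division u v \<delta> \<D> \<Longrightarrow> thin_division a b \<delta> \<D>" for \<delta> \<D>
    using uv unfolding thin_division_def by blast
  with d show ?thesis unfolding ac_control_def by meson
qed

lemma abs_cont_if_ac_control:
  assumes "ac_control a b d" "\<And>s t. s \<in> {a..b} \<Longrightarrow> t \<in> {a..b} \<Longrightarrow> dist (f s) (f t) \<le> C * d s t"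
    and "0 \<le> C"
  shows "abs_cont {a..b} f"
  unfolding abs_cont_iff_ac_control
  using ac_control_subset[OF ac_control_mono[OF assms(1,3,2)]] by blast

lemma abs_cont_subset: "abs_cont I f \<Longrightarrow> J \<subseteq> I \<Longrightarrow> abs_cont J f"
  unfolding abs_cont_iff_ac_control by blast

lemma abs_cont_bound_by:
  assumes "abs_cont I g" "{a..b} \<subseteq> I"
    and "\<And>s t. s \<in> {a..b} \<Longrightarrow> t \<in> {a..b} \<Longrightarrow> dist (f s) (f t) \<le> C * dist (g s) (g t)" "0 \<le> C"
  shows "abs_cont {a..b} f"
  using abs_cont_if_ac_control[OF abs_cont_imp_ac_control[OF assms(1,2)] assms(3,4)] .

lemma abs_cont_add:
  fixes f g :: "real \<Rightarrow> 'a::real_normed_vector"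
  assumes "abs_cont {a..b} f" "abs_cont {a..b} g"
  shows "abs_cont {a..b} (\<lambda>t. f t + g t)"
  by (rule abs_cont_if_ac_control[OF ac_control_add[OF
        abs_cont_imp_ac_control[OF assms(1) order_refl] abs_cont_imp_ac_control[OF assms(2) order_refl]], of _ 1])
    (auto simp: dist_triangle_add)

lemma abs_cont_scaled:
  fixes f :: "real \<Rightarrow> real"
  assumes "abs_cont {a..b} f"
  shows "abs_cont {a..b} (\<lambda>t. r * f t)"
  by (rule abs_cont_bound_by[OF assms order_refl, of _ "\<bar>r\<bar>"])
    (auto simp: dist_real_def abs_mult right_diff_distrib[symmetric])

lemma abs_cont_sum:
  fixes f :: "'j \<Rightarrow> real \<Rightarrow> 'a::real_normed_vector"
  assumes "finite J" "\<And>j. j \<in> J \<Longrightarrow> abs_cont {a..b} (f j)"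
  shows "abs_cont {a..b} (\<lambda>t. \<Sum>j\<in>J. f j t)"
  using assms
proof (induction J rule: finite_induct)
  case empty
  show ?case by (simp add: abs_cont_iff_ac_control ac_control_zero)
next
  case (insert j J)
  then show ?case by (simp add: abs_cont_add)
qed

lemma abs_cont_imp_continuous_on:
  assumes "abs_cont {a..b} f"
  shows "continuous_on {a..b} f"
  unfolding continuous_on_iff
proof (intro ballI allI impI)
  fix x \<epsilon> :: real assume x: "x \<in> {a..b}" and "\<epsilon> > 0"
  have ac: "ac_control a b (\<lambda>s t. dist (f s) (f t))"
    by (rule abs_cont_imp_ac_control[OF assms order_refl])
  obtain \<delta> where "\<delta> > 0" and *:
    "\<And>\<D>. thin_division a b \<delta> \<D> \<Longrightarrow> (\<Sum>k\<in>\<D>. dist (f (Inf k)) (f (Sup k))) < \<epsilon>"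
    by (rule ac_controlD[OF ac \<open>\<epsilon> > 0\<close>]) blast
  have close: "dist (f u) (f v) < \<epsilon>" if "a \<le> u" "u \<le> v" "v \<le> b" "v - u < \<delta>" for u v
  proof -
    have "{{u..v}} division_of \<Union>{{u..v}}"
      using that(2) by (simp add: division_of_self[where a=u and b=v, unfolded box_real])
    then have "(\<Sum>k\<in>{{u..v}}. dist (f (Inf k)) (f (Sup k))) < \<epsilon>"
      using that by (intro *) (auto simp: thin_division_def)
    then show ?thesis using that(2) by simp
  qed
  have "dist (f y) (f x) < \<epsilon>" if y: "y \<in> {a..b}" "dist y x < \<delta>" for y
  proof (cases "y \<le> x")
    case True
    then show ?thesis using close[of y x] x y by (auto simp: dist_real_def)
  next
    case False
    then show ?thesis using close[of x y] x y by (auto simp: dist_real_def dist_commute)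
  qed
  then show "\<exists>d>0. \<forall>x'\<in>{a..b}. dist x' x < d \<longrightarrow> dist (f x') (f x) < \<epsilon>"
    using \<open>\<delta> > 0\<close> by blast
qed

text \<open>Cover the exceptional times by an open set of small measure and choose a gauge that keeps intervals
tagged there inside this set, and that makes \<open>f\<close> nearly constant on all other intervals. On a fine
tagged division the former contribute little by absolute continuity, the latter by the derivative.\<close>

lemma abs_cont_zero_derivative_imp_const:
  fixes f :: "real \<Rightarrow> real"
  assumes ac: "abs_cont {a..b} f" and "a \<le> b" and N: "negligible N"
    and deriv: "\<And>t. t \<in> {a<..<b} - N \<Longrightarrow> (f has_real_derivative 0) (at t)"
  shows "f a = f b"
proof -
  have "\<bar>f b - f a\<bar> \<le> \<epsilon>" if "\<epsilon> > 0" for \<epsilon> :: real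
  proof -
    define \<eta> where "\<eta> = \<epsilon> / 2 / (b - a + 1)"
    have \<eta>: "\<eta> > 0" using that \<open>a \<le> b\<close> by (simp add: \<eta>_def)
    have \<epsilon>2: "\<epsilon> / 2 > 0" using that by simp
    have acf: "ac_control a b (\<lambda>s t. dist (f s) (f t))"
      by (rule abs_cont_imp_ac_control[OF ac order_refl])
    obtain \<delta> where "\<delta> > 0" and AC:
      "\<And>\<D>. thin_division a b \<delta> \<D> \<Longrightarrow> (\<Sum>k\<in>\<D>. dist (f (Inf k)) (f (Sup k))) < \<epsilon> / 2"
      by (rule ac_controlD[OF acf \<epsilon>2]) blast
    \<comment> \<open>The endpoints join the exceptional set, as the derivative is only known in between.\<close>
    define N' where "N' = N \<union> {a, b}"
    have "negligible N'" using N by (simp add: N'_def negligible_Un)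
    then have N': "N' \<in> sets lebesgue" "emeasure lebesgue N' = 0" "N' \<in> null_sets lebesgue"
      using negligible_imp_sets negligible_iff_null_sets by blast+
    from sets_lebesgue_outer_open[OF N'(1) \<open>\<delta> > 0\<close>] obtain V where
      V0: "open V" "N' \<subseteq> V" "V - N' \<in> lmeasurable" "emeasure lebesgue (V - N') < ennreal \<delta>" by blast
    have Vm: "V \<in> sets lebesgue" using V0(1) by simp
    have Ve: "emeasure lebesgue (V - N') = emeasure lebesgue V"
      by (rule emeasure_Diff_null_set[OF N'(3) Vm])
    have Vf: "V \<in> lmeasurable" using V0(4) Ve Vm by (intro fmeasurableI) (auto intro: order_less_trans)
    have "measure lebesgue V < \<delta>"
      using V0(4) Ve \<open>\<delta> > 0\<close> emeasure_eq_measure2[OF Vf] by (simp add: ennreal_less_iff)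
    note V = V0(1,2) Vm Vf this
    have "\<exists>r>0. (t \<in> N' \<longrightarrow> ball t r \<subseteq> V) \<and>
        (t \<in> {a..b} - N' \<longrightarrow> (\<forall>y\<in>ball t r. \<bar>f y - f t\<bar> \<le> \<eta> * \<bar>y - t\<bar>))" for t
    proof (cases "t \<in> N'")
      case True
      then show ?thesis using V by (meson DiffE open_contains_ball subsetD)
    next
      case False
      show ?thesis
      proof (cases "t \<in> {a..b}")
        case True
        with False have "t \<in> {a<..<b} - N" by (auto simp: N'_def)
        then have "(f has_derivative (\<lambda>h. 0 * h)) (at t)"
          using deriv unfolding has_field_derivative_def by blast
        then obtain r where "r > 0" "\<And>y. norm (y - t) < r \<Longrightarrow> norm (f y - f t - 0 * (y - t)) \<le> \<eta> * norm (y - t)"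
          unfolding has_derivative_at_alt using \<eta> by meson
        then show ?thesis using False
          by (intro exI[of _ r]) (auto simp: dist_norm norm_minus_commute)
      qed (use False in \<open>auto intro: exI[of _ 1]\<close>)
    qed
    then obtain r where r: "\<And>t. r t > 0" "\<And>t. t \<in> N' \<Longrightarrow> ball t (r t) \<subseteq> V"
      "\<And>t y. t \<in> {a..b} - N' \<Longrightarrow> y \<in> ball t (r t) \<Longrightarrow> \<bar>f y - f t\<bar> \<le> \<eta> * \<bar>y - t\<bar>"
      by metis
    have "gauge (\<lambda>t. ball t (r t))" using r(1) by (simp add: gauge_def)
    then obtain p where p: "p tagged_division_of {a..b}" "(\<lambda>t. ball t (r t)) fine p"
      by (rule fine_division_exists_real)
    have fin: "finite p" using p(1) by blast
    have mem: "\<exists>u v. K = {u..v} \<and> u \<le> v \<and> x \<in> {u..v} \<and> {u..v} \<subseteq> {a..b} \<and> {u..v} \<subseteq> ball x (r x)"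
      if "(x, K) \<in> p" for x K
    proof -
      from tagged_division_ofD(2-4)[OF p(1) that] obtain u v where "x \<in> K" "K \<subseteq> {a..b}" "K = {u..v}"
        by auto
      with p(2) that show ?thesis unfolding fine_def by fastforce
    qed
    define p1 where "p1 = {(x, K) \<in> p. x \<in> N'}"
    define p2 where "p2 = {(x, K) \<in> p. x \<notin> N'}"
    have pU: "p = p1 \<union> p2" "p1 \<inter> p2 = {}" "finite p1" "finite p2"
      using fin by (auto simp: p1_def p2_def intro: finite_subset[OF _ fin])
    define F where "F = (\<lambda>K::real set. f (Sup K) - f (Inf K))"
    have "(\<Sum>(x, K)\<in>p. F K) = f b - f a"
      unfolding F_def using additive_tagged_division_1[OF \<open>a \<le> b\<close> p(1)] .
    moreover have "(\<Sum>(x, K)\<in>p. F K) = (\<Sum>(x, K)\<in>p1. F K) + (\<Sum>(x, K)\<in>p2. F K)"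
      using pU by (simp add: sum.union_disjoint)
    moreover have "\<bar>\<Sum>(x, K)\<in>p2. F K\<bar> \<le> \<eta> * (b - a)"
    proof -
      have "\<bar>\<Sum>(x, K)\<in>p2. F K\<bar> \<le> (\<Sum>(x, K)\<in>p2. \<eta> * measure lborel K)"
        unfolding split_def
      proof (rule order_trans[OF sum_abs sum_mono])
        fix z assume "z \<in> p2"
        then obtain x K where z: "z = (x, K)" "(x, K) \<in> p" "x \<notin> N'" by (auto simp: p2_def)
        obtain u v where K: "K = {u..v}" "u \<le> v" "x \<in> {u..v}" "{u..v} \<subseteq> {a..b}" "{u..v} \<subseteq> ball x (r x)"
          using mem[OF z(2)] by blast
        have "x \<in> {a..b} - N'" "u \<in> ball x (r x)" "v \<in> ball x (r x)"
          using K z(3) by (auto simp del: mem_ball intro!: subsetD[OF K(5)])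
        then have "\<bar>f u - f x\<bar> \<le> \<eta> * \<bar>u - x\<bar>" "\<bar>f v - f x\<bar> \<le> \<eta> * \<bar>v - x\<bar>" using r(3) by blast+
        moreover have "\<eta> * \<bar>u - x\<bar> + \<eta> * \<bar>v - x\<bar> = \<eta> * (v - u)"
          using K(3) by (simp add: algebra_simps)
        ultimately have "\<bar>f v - f u\<bar> \<le> \<eta> * (v - u)" by linarith
        then show "\<bar>F (snd z)\<bar> \<le> \<eta> * measure lborel (snd z)" using K(1,2) z(1) by (simp add: F_def)
      qed
      also have "\<dots> \<le> (\<Sum>(x, K)\<in>p. \<eta> * measure lborel K)"
        using \<eta> fin by (intro sum_mono2) (auto simp: p2_def)
      also have "\<dots> = \<eta> * (\<Sum>(x, K)\<in>p. measure lborel K)" by (simp add: sum_distrib_left split_def)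
      also have "(\<Sum>(x, K)\<in>p. measure lborel K) = b - a"
        using additive_content_tagged_division[of p a b] p(1) \<open>a \<le> b\<close> by (simp add: box_real)
      finally show ?thesis .
    qed
    moreover have "\<bar>\<Sum>(x, K)\<in>p1. F K\<bar> < \<epsilon> / 2"
    proof -
      have p1: "p1 tagged_partial_division_of {a..b}"
        using p(1) by (auto simp: p1_def tagged_division_of_def intro: tagged_partial_division_subset)
      define q where "q = snd ` p1"
      have divq: "q division_of \<Union>q"
        unfolding q_def using p1 by (rule partial_division_of_tagged_division)
      have "\<bar>\<Sum>(x, K)\<in>p1. F K\<bar> \<le> (\<Sum>z\<in>p1. \<bar>F (snd z)\<bar>)"
        unfolding split_def by (rule sum_abs)
      also have "\<dots> = (\<Sum>K\<in>q. \<bar>F K\<bar>)"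
        unfolding q_def
      \<comment> \<open>An interval carrying two tags is degenerate, so \<open>F\<close> vanishes on it.\<close>
      proof (rule sum.reindex_nontrivial[symmetric, unfolded o_def, OF pU(3)])
        fix z z' assume z: "z \<in> p1" "z' \<in> p1" "z \<noteq> z'" "snd z = snd z'"
        obtain x K y where zz: "z = (x, K)" "z' = (y, K)" using z(4) by (metis prod.collapse)
        then have "interior K = {}"
          using tagged_partial_division_ofD(5)[OF p1, of x K y K] z by auto
        moreover obtain u v where "K = {u..v}" "u \<le> v" using mem[of x K] z(1) zz by (auto simp: p1_def)
        ultimately have "K = {u}" by (auto simp: interior_atLeastAtMost_real)
        then show "\<bar>F (snd z)\<bar> = 0" by (simp add: zz F_def)
      qed
      also have "\<dots> = (\<Sum>K\<in>q. dist (f (Inf K)) (f (Sup K)))"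
        by (simp add: F_def dist_real_def abs_minus_commute)
      also have "\<dots> < \<epsilon> / 2"
      proof (rule AC, unfold thin_division_def, intro conjI)
        show "\<Union>q \<subseteq> {a..b}" using mem by (fastforce simp: q_def p1_def)
        have "(\<Sum>K\<in>q. measure lborel K) = (\<Sum>K\<in>q. measure lebesgue K)"
        proof (intro sum.cong refl measure_completion[symmetric])
          fix K assume "K \<in> q"
          then obtain u v where "K = cbox u v" using division_ofD(4)[OF divq] by blast
          then show "K \<in> sets lborel" by simp
        qed
        also have "\<dots> = measure lebesgue (\<Union>q)" by (rule content_division[OF divq])
        also have "\<dots> \<le> measure lebesgue V"
        proof (rule measure_mono_fmeasurable)
          show "\<Union>q \<subseteq> V"
          proof
            fix y assume "y \<in> \<Union>q"
            then obtain x K where xK: "(x, K) \<in> p" "x \<in> N'" "y \<in> K" by (auto simp: q_def p1_def)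
            with mem[OF xK(1)] r(2)[OF xK(2)] show "y \<in> V" by blast
          qed
          show "\<Union>q \<in> sets lebesgue"
            using lmeasurable_division[OF divq] by blast
        qed (rule V(4))
        also have "\<dots> < \<delta>" using V by simp
        finally show "(\<Sum>K\<in>q. measure lborel K) < \<delta>" .
      qed (rule divq)
      finally show ?thesis .
    qed
    moreover have "\<eta> * (b - a) \<le> \<epsilon> / 2"
      using that \<open>a \<le> b\<close> unfolding \<eta>_def by (simp add: field_simps)
    ultimately show "\<bar>f b - f a\<bar> \<le> \<epsilon>" by linarith
  qed
  then have "\<bar>f b - f a\<bar> \<le> 0 + \<epsilon>" if "\<epsilon> > 0" for \<epsilon> using that by simp
  then have "\<bar>f b - f a\<bar> \<le> 0" by (rule field_le_epsilon)
  then show ?thesis by simp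
qed

section \<open>Integrals depending on a parameter\<close>

lemma param_integral_abs_cont:
  fixes F :: "real \<Rightarrow> 'x \<Rightarrow> real"
  assumes d: "ac_control a b d" and F: "\<And>t. t \<in> {a..b} \<Longrightarrow> integrable \<mu> (F t)"
    and G: "integrable \<mu> G" "\<And>x. 0 \<le> G x"
    and le: "\<And>s t. s \<in> {a..b} \<Longrightarrow> t \<in> {a..b} \<Longrightarrow> AE x in \<mu>. \<bar>F s x - F t x\<bar> \<le> G x * d s t"
  shows "abs_cont {a..b} (\<lambda>t. LINT x|\<mu>. F t x)"
proof (rule abs_cont_if_ac_control[OF d])
  fix s t assume st: "s \<in> {a..b}" "t \<in> {a..b}"
  have "dist (LINT x|\<mu>. F s x) (LINT x|\<mu>. F t x) = \<bar>LINT x|\<mu>. F s x - F t x\<bar>"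
    using F st by (simp add: dist_real_def)
  also have "\<dots> \<le> (LINT x|\<mu>. \<bar>F s x - F t x\<bar>)" by (rule integral_abs_bound)
  also have "\<dots> \<le> (LINT x|\<mu>. G x * d s t)"
    using F G st le[OF st] by (intro integral_mono_AE) auto
  finally show "dist (LINT x|\<mu>. F s x) (LINT x|\<mu>. F t x) \<le> (LINT x|\<mu>. G x) * d s t" by simp
qed (use G in simp)

text \<open>Dominated convergence of the difference quotients; the Lipschitz bound is only required in comparison
with the time \<open>t\<close> itself.\<close>

lemma param_integral_has_derivative:
  fixes F :: "real \<Rightarrow> 'x \<Rightarrow> real"
  assumes r: "r > 0" and F: "\<And>s. s \<in> ball t r \<Longrightarrow> integrable \<mu> (F s)"
    and G: "integrable \<mu> G"
    and le: "\<And>s. s \<in> ball t r \<Longrightarrow> AE x in \<mu>. \<bar>F s x - F t x\<bar> \<le> G x * \<bar>s - t\<bar>"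
    and F': "AE x in \<mu>. ((\<lambda>s. F s x) has_real_derivative F' x) (at t)"
      "F' \<in> borel_measurable \<mu>"
  shows "((\<lambda>s. LINT x|\<mu>. F s x) has_real_derivative (LINT x|\<mu>. F' x)) (at t)"
  unfolding has_field_derivative_iff tendsto_at_iff_sequentially
proof (intro allI impI, unfold o_def)
  fix \<sigma> :: "nat \<Rightarrow> real" assume \<sigma>: "\<forall>i. \<sigma> i \<in> UNIV - {t}" "\<sigma> \<longlonglongrightarrow> t"
  obtain n0 where n0: "\<And>n. n \<ge> n0 \<Longrightarrow> \<sigma> n \<in> ball t r"
    using metric_LIMSEQ_D[OF \<sigma>(2) r] by (auto simp: dist_commute)
  define \<tau> where "\<tau> n = \<sigma> (n + n0)" for n
  have \<tau>: "\<tau> n \<in> ball t r" "\<tau> n \<noteq> t" for n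
    using n0 \<sigma>(1) by (auto simp: \<tau>_def)
  have \<tau>lim: "\<tau> \<longlonglongrightarrow> t" unfolding \<tau>_def using \<sigma>(2) by (rule LIMSEQ_ignore_initial_segment)
  have t: "t \<in> ball t r" using r by simp
  have "(\<lambda>n. LINT x|\<mu>. (F (\<tau> n) x - F t x) / (\<tau> n - t)) \<longlonglongrightarrow> (LINT x|\<mu>. F' x)"
  proof (rule integral_dominated_convergence[OF F'(2) _ G])
    show "(\<lambda>x. (F (\<tau> n) x - F t x) / (\<tau> n - t)) \<in> borel_measurable \<mu>" for n
      using F[OF \<tau>(1)] F[OF t] by (intro borel_measurable_divide borel_measurable_diff) auto
    show "AE x in \<mu>. norm ((F (\<tau> n) x - F t x) / (\<tau> n - t)) \<le> G x" for n
      using le[OF \<tau>(1)[of n]] by eventually_elim (use \<tau>(2)[of n] in \<open>simp add: abs_divide field_simps\<close>)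
    show "AE x in \<mu>. (\<lambda>n. (F (\<tau> n) x - F t x) / (\<tau> n - t)) \<longlonglongrightarrow> F' x"
      using F'(1)
    proof eventually_elim
      case (elim x)
      then show ?case
        using \<tau>lim \<tau>(2) unfolding has_field_derivative_iff tendsto_at_iff_sequentially o_def by blast
    qed
  qed
  moreover have "(LINT x|\<mu>. (F (\<tau> n) x - F t x) / (\<tau> n - t))
      = ((LINT x|\<mu>. F (\<tau> n) x) - (LINT x|\<mu>. F t x)) / (\<tau> n - t)" for n
    using F[OF \<tau>(1)] F[OF t] by simp
  ultimately have "(\<lambda>n. ((LINT x|\<mu>. F (\<tau> n) x) - (LINT x|\<mu>. F t x)) / (\<tau> n - t)) \<longlonglongrightarrow> (LINT x|\<mu>. F' x)"
    by (simp only:)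
  then show "(\<lambda>n. ((LINT x|\<mu>. F (\<sigma> n) x) - (LINT x|\<mu>. F t x)) / (\<sigma> n - t)) \<longlonglongrightarrow> (LINT x|\<mu>. F' x)"
    unfolding \<tau>_def by (rule LIMSEQ_offset)
qed

section \<open>Partial derivatives\<close>

lemma has_derivative_partial_deriv:
  assumes "f differentiable (at x)"
  shows "(f has_derivative (\<lambda>v. \<Sum>i\<in>UNIV. v $ i * partial_deriv i f x)) (at x)"
proof -
  let ?D = "frechet_derivative f (at x)"
  have D: "(f has_derivative ?D) (at x)" using assms frechet_derivative_works by blast
  then have lin: "linear ?D" by (rule has_derivative_linear)
  have "?D v = (\<Sum>i\<in>UNIV. v $ i * partial_deriv i f x)" for v
  proof -
    have "?D v = ?D (\<Sum>i\<in>UNIV. v $ i *s axis i 1)" by (simp add: basis_expansion)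
    also have "\<dots> = (\<Sum>i\<in>UNIV. v $ i * ?D (axis i 1))"
      by (simp add: linear_sum[OF lin] linear_cmul[OF lin] scalar_mult_eq_scaleR)
    finally show ?thesis by (simp add: partial_deriv_def)
  qed
  then have "?D = (\<lambda>v. \<Sum>i\<in>UNIV. v $ i * partial_deriv i f x)" by blast
  with D show ?thesis by simp
qed

lemma partial_deriv_eqI:
  "(f has_derivative D) (at x) \<Longrightarrow> partial_deriv i f x = D (axis i 1)"
  unfolding partial_deriv_def using frechet_derivative_at by metis

lemma partial_deriv_cong_open:
  assumes "open A" "x \<in> A" "\<And>y. y \<in> A \<Longrightarrow> f y = g y"
  shows "partial_deriv i f x = partial_deriv i g x"
proof -
  have "(f has_derivative D) (at x) \<longleftrightarrow> (g has_derivative D) (at x)" for D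
    using has_derivative_transform_within_open[of f D x UNIV A g]
      has_derivative_transform_within_open[of g D x UNIV A f] assms by auto
  then show ?thesis unfolding partial_deriv_def frechet_derivative_def by simp
qed

lemma partial_deriv_eq_0_open:
  assumes "open A" "x \<in> A" "\<And>y. y \<in> A \<Longrightarrow> f y = 0"
  shows "partial_deriv i f x = 0"
  using partial_deriv_cong_open[of A x f "\<lambda>_. 0" i] assms partial_deriv_eqI[where f="\<lambda>_. 0" and D="\<lambda>_. 0" and x=x and i=i] by simp

lemma partial_deriv_mult:
  assumes "f differentiable (at x)" "g differentiable (at x)"
  shows "partial_deriv i (\<lambda>x. f x * g x) x = partial_deriv i f x * g x + f x * partial_deriv i g x"
proof -
  have "(f has_derivative frechet_derivative f (at x)) (at x)" "(g has_derivative frechet_derivative g (at x)) (at x)"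
    using assms frechet_derivative_works by blast+
  from partial_deriv_eqI[OF has_derivative_mult[OF this]] show ?thesis by (simp add: partial_deriv_def)
qed

lemma partial_deriv_add:
  assumes "f differentiable (at x)" "g differentiable (at x)"
  shows "partial_deriv i (\<lambda>x. f x + g x) x = partial_deriv i f x + partial_deriv i g x"
proof -
  have "(f has_derivative frechet_derivative f (at x)) (at x)" "(g has_derivative frechet_derivative g (at x)) (at x)"
    using assms frechet_derivative_works by blast+
  from partial_deriv_eqI[OF has_derivative_add[OF this]] show ?thesis by (simp add: partial_deriv_def)
qed

lemma partial_deriv_cmult:
  assumes "f differentiable (at x)"
  shows "partial_deriv i (\<lambda>x. c * f x) x = c * partial_deriv i f x"
proof -
  have "(f has_derivative frechet_derivative f (at x)) (at x)"
    using assms frechet_derivative_works by blast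
  from partial_deriv_eqI[OF has_derivative_mult_right[OF this]] show ?thesis by (simp add: partial_deriv_def)
qed

definition C1 :: "(real^3 \<Rightarrow> real) \<Rightarrow> bool" where
  "C1 f \<longleftrightarrow> (\<forall>x. f differentiable (at x)) \<and> (\<forall>i. continuous_on UNIV (partial_deriv i f))"

lemma C1_continuous_on: "C1 f \<Longrightarrow> continuous_on A f"
  unfolding C1_def by (meson continuous_at_imp_continuous_on differentiable_imp_continuous_within)

lemma C1_mult:
  assumes "C1 f" "C1 g"
  shows "C1 (\<lambda>x. f x * g x)"
proof -
  have "partial_deriv i (\<lambda>x. f x * g x) = (\<lambda>x. partial_deriv i f x * g x + f x * partial_deriv i g x)" for i
    using assms partial_deriv_mult unfolding C1_def by blast
  then show ?thesis
    using assms C1_continuous_on[of f UNIV] C1_continuous_on[of g UNIV] unfolding C1_def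
    by (auto intro!: continuous_intros differentiable_mult)
qed

lemma times_cont_diff_imp_C1: "times_cont_diff (Suc (Suc n)) f \<Longrightarrow> C1 f"
  unfolding C1_def by (auto intro!: continuous_at_imp_continuous_on differentiable_imp_continuous_within)

lemma partial_deriv_along_line:
  assumes "f differentiable (at (x + s *\<^sub>R v))"
  shows "((\<lambda>s. f (x + s *\<^sub>R v)) has_real_derivative (\<Sum>i\<in>UNIV. v $ i * partial_deriv i f (x + s *\<^sub>R v))) (at s)"
proof -
  have "((\<lambda>s. x + s *\<^sub>R v) has_derivative (\<lambda>h. h *\<^sub>R v)) (at s)"
    by (auto intro!: derivative_eq_intros)
  from has_derivative_compose[OF this has_derivative_partial_deriv[OF assms]]
  show ?thesis unfolding has_field_derivative_def
    by (rule has_derivative_eq_rhs) (auto simp: sum_distrib_right sum_distrib_left mult_ac)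
qed

lemma partial_deriv_along_axis:
  assumes "f differentiable (at (x + s *\<^sub>R axis i 1))"
  shows "((\<lambda>s. f (x + s *\<^sub>R axis i 1)) has_real_derivative partial_deriv i f (x + s *\<^sub>R axis i 1)) (at s)"
  using partial_deriv_along_line[OF assms]
  by (simp add: axis_def if_distrib[of "\<lambda>a. a * _"] cong: if_cong)

text \<open>Both mixed derivatives are limits of the same second difference quotient, by two applications of
  the mean value theorem in either order.\<close>

lemma second_difference:
  assumes f: "\<And>x. f differentiable (at x)" "\<And>x. partial_deriv i f differentiable (at x)" and "h > 0"
  obtains \<xi> \<eta> where "0 < \<xi>" "\<xi> < h" "0 < \<eta>" "\<eta> < h"
    "f (x + h *\<^sub>R axis i 1 + h *\<^sub>R axis j 1) - f (x + h *\<^sub>R axis i 1) - f (x + h *\<^sub>R axis j 1) + f x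
     = h * h * partial_deriv j (partial_deriv i f) (x + \<xi> *\<^sub>R axis i 1 + \<eta> *\<^sub>R axis j 1)"
proof -
  define u where "u = (\<lambda>s. f (x + h *\<^sub>R axis j 1 + s *\<^sub>R axis i 1) - f (x + s *\<^sub>R axis i 1))"
  have "(u has_real_derivative partial_deriv i f (x + h *\<^sub>R axis j 1 + s *\<^sub>R axis i 1)
           - partial_deriv i f (x + s *\<^sub>R axis i 1)) (at s)" for s
    unfolding u_def by (intro DERIV_diff partial_deriv_along_axis f)
  from MVT2[OF \<open>h > 0\<close> this] obtain \<xi> where \<xi>: "0 < \<xi>" "\<xi> < h"
    "u h - u 0 = h * (partial_deriv i f (x + h *\<^sub>R axis j 1 + \<xi> *\<^sub>R axis i 1) - partial_deriv i f (x + \<xi> *\<^sub>R axis i 1))"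
    by auto
  have "((\<lambda>s. partial_deriv i f (x + \<xi> *\<^sub>R axis i 1 + s *\<^sub>R axis j 1)) has_real_derivative
          partial_deriv j (partial_deriv i f) (x + \<xi> *\<^sub>R axis i 1 + s *\<^sub>R axis j 1)) (at s)" for s
    by (intro partial_deriv_along_axis f)
  from MVT2[OF \<open>h > 0\<close> this] obtain \<eta> where \<eta>: "0 < \<eta>" "\<eta> < h"
    "partial_deriv i f (x + \<xi> *\<^sub>R axis i 1 + h *\<^sub>R axis j 1) - partial_deriv i f (x + \<xi> *\<^sub>R axis i 1)
     = h * partial_deriv j (partial_deriv i f) (x + \<xi> *\<^sub>R axis i 1 + \<eta> *\<^sub>R axis j 1)"
    by auto
  show thesis
    using \<xi> \<eta> by (intro that[of \<xi> \<eta>]) (auto simp: u_def add_ac)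
qed

lemma second_difference_tendsto:
  assumes f: "\<And>x. f differentiable (at x)" "\<And>x. partial_deriv i f differentiable (at x)"
    and cont: "continuous_on UNIV (partial_deriv j (partial_deriv i f))"
  shows "((\<lambda>h. (f (x + h *\<^sub>R axis i 1 + h *\<^sub>R axis j 1) - f (x + h *\<^sub>R axis i 1) - f (x + h *\<^sub>R axis j 1) + f x) / (h * h))
     \<longlongrightarrow> partial_deriv j (partial_deriv i f) x) (at_right 0)"
proof -
  let ?g = "partial_deriv j (partial_deriv i f)"
  let ?q = "\<lambda>h. (f (x + h *\<^sub>R axis i 1 + h *\<^sub>R axis j 1) - f (x + h *\<^sub>R axis i 1) - f (x + h *\<^sub>R axis j 1) + f x) / (h * h)"
  have "\<exists>\<xi> \<eta>. 0 < \<xi> \<and> \<xi> < h \<and> 0 < \<eta> \<and> \<eta> < h \<and> ?q h = ?g (x + \<xi> *\<^sub>R axis i 1 + \<eta> *\<^sub>R axis j 1)" if "h > 0" for h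
    by (rule second_difference[OF f that, of x j]) (use that in auto)
  then obtain \<xi> \<eta> where *: "\<And>h. h > 0 \<Longrightarrow> 0 < \<xi> h \<and> \<xi> h < h \<and> 0 < \<eta> h \<and> \<eta> h < h \<and> ?q h = ?g (x + \<xi> h *\<^sub>R axis i 1 + \<eta> h *\<^sub>R axis j 1)"
    by metis
  have ev: "eventually (\<lambda>h. h > 0) (at_right (0::real))" by (simp add: eventually_at_right_less)
  have 1: "(\<xi> \<longlongrightarrow> 0) (at_right 0)"
    by (rule tendsto_sandwich[of "\<lambda>_. 0" _ _ "\<lambda>h. h"]) (use * in \<open>auto intro!: eventually_mono[OF ev] intro: less_imp_le\<close>)
  have 2: "(\<eta> \<longlongrightarrow> 0) (at_right 0)"
    by (rule tendsto_sandwich[of "\<lambda>_. 0" _ _ "\<lambda>h. h"]) (use * in \<open>auto intro!: eventually_mono[OF ev] intro: less_imp_le\<close>)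
  have "((\<lambda>h. x + \<xi> h *\<^sub>R axis i 1 + \<eta> h *\<^sub>R axis j 1) \<longlongrightarrow> x + 0 *\<^sub>R axis i 1 + 0 *\<^sub>R axis j 1) (at_right 0)"
    by (intro tendsto_intros 1 2)
  then have "((\<lambda>h. ?g (x + \<xi> h *\<^sub>R axis i 1 + \<eta> h *\<^sub>R axis j 1)) \<longlongrightarrow> ?g x) (at_right 0)"
    using cont by (intro isCont_tendsto_compose[of _ ?g]) (auto simp: continuous_on_eq_continuous_at)
  moreover have "eventually (\<lambda>h. ?g (x + \<xi> h *\<^sub>R axis i 1 + \<eta> h *\<^sub>R axis j 1) = ?q h) (at_right 0)"
    by (rule eventually_mono[OF ev]) (use * in metis)
  ultimately show ?thesis by (rule Lim_transform_eventually)
qed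

lemma mixed_partial_derivs_commute:
  assumes "times_cont_diff 3 f"
  shows "partial_deriv j (partial_deriv i f) x = partial_deriv i (partial_deriv j f) x"
proof -
  have f: "f differentiable (at x)" "partial_deriv i f differentiable (at x)"
    "continuous_on UNIV (partial_deriv j (partial_deriv i f))" for x i j
    using assms by (auto simp: numeral_3_eq_3 intro!: continuous_at_imp_continuous_on differentiable_imp_continuous_within)
  let ?q = "\<lambda>h. (f (x + h *\<^sub>R axis j 1 + h *\<^sub>R axis i 1) - f (x + h *\<^sub>R axis j 1) - f (x + h *\<^sub>R axis i 1) + f x) / (h * h)"
  have 1: "(?q \<longlongrightarrow> partial_deriv i (partial_deriv j f) x) (at_right 0)"
    by (intro second_difference_tendsto f)
  have 2: "(?q \<longlongrightarrow> partial_deriv j (partial_deriv i f) x) (at_right 0)"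
    using second_difference_tendsto[of f i j x, OF f] by (simp add: algebra_simps)
  show ?thesis by (rule tendsto_unique[OF _ 2 1]) simp
qed

lemma partial_deriv_support:
  "closure {x. partial_deriv i f x \<noteq> 0} \<subseteq> closure {x. f x \<noteq> 0}"
proof (rule closure_minimal)
  have "partial_deriv i f x = 0" if "x \<in> - closure {x. f x \<noteq> 0}" for x
  proof (rule partial_deriv_eq_0_open[OF _ that])
    show "f y = 0" if "y \<in> - closure {x. f x \<noteq> 0}" for y
      using that closure_subset[of "{x. f x \<noteq> 0}"] by auto
  qed auto
  then show "{x. partial_deriv i f x \<noteq> 0} \<subseteq> closure {x. f x \<noteq> 0}" by auto
qed simp

lemma C1_compact_support_lipschitz:
  assumes "C1 f" "compact (closure {x. f x \<noteq> 0})"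
  obtains L where "L \<ge> 0" "\<And>x y. \<bar>f x - f y\<bar> \<le> L * norm (x - y)" "\<And>i x. \<bar>partial_deriv i f x\<bar> \<le> L"
proof -
  let ?S = "closure {x. f x \<noteq> 0}"
  have "\<forall>i. \<exists>B. \<forall>x. \<bar>partial_deriv i f x\<bar> \<le> B"
  proof
    fix i
    have cpt: "compact (partial_deriv i f ` ?S)"
      using assms by (intro compact_continuous_image) (auto simp: C1_def intro: continuous_on_subset)
    obtain B where B: "B > 0" "\<forall>y\<in>partial_deriv i f ` ?S. norm y \<le> B"
      using compact_imp_bounded[OF cpt] unfolding bounded_pos by blast
    have "partial_deriv i f x = 0" if "x \<notin> ?S" for x
      using that partial_deriv_support[of i f] closure_subset[of "{x. partial_deriv i f x \<noteq> 0}"] by blast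
    with B have "\<bar>partial_deriv i f x\<bar> \<le> B" for x by (cases "x \<in> ?S") auto
    then show "\<exists>B. \<forall>x. \<bar>partial_deriv i f x\<bar> \<le> B" by blast
  qed
  from choice[OF this] obtain B where B: "\<And>i x. \<bar>partial_deriv i f x\<bar> \<le> B i" by blast
  have B0: "B i \<ge> 0" for i using B[of i 0] by linarith
  let ?L = "\<Sum>i\<in>UNIV. B i"
  show thesis
  proof
    show L0: "?L \<ge> 0" by (simp add: sum_nonneg B0)
    show "\<bar>partial_deriv i f x\<bar> \<le> ?L" for i x
      using B[of i x] member_le_sum[of i UNIV B] B0 by (simp add: order_trans)
    show "\<bar>f x - f y\<bar> \<le> ?L * norm (x - y)" for x y
    proof -
      have "norm (f x - f y) \<le> ?L * norm (x - y)"
      proof (rule differentiable_bound[OF convex_UNIV])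
        fix z :: "real^3"
        show "(f has_derivative (\<lambda>v. \<Sum>i\<in>UNIV. v $ i * partial_deriv i f z)) (at z within UNIV)"
          using assms by (intro has_derivative_partial_deriv) (auto simp: C1_def)
        show "onorm (\<lambda>v. \<Sum>i\<in>UNIV. v $ i * partial_deriv i f z) \<le> ?L"
        proof (rule onorm_bound[OF L0])
          fix v :: "real^3"
          have "norm (\<Sum>i\<in>UNIV. v $ i * partial_deriv i f z) \<le> (\<Sum>i\<in>UNIV. B i * norm v)"
          proof (rule sum_norm_le)
            fix i :: 3
            have "\<bar>partial_deriv i f z\<bar> * \<bar>v $ i\<bar> \<le> B i * norm v"
              by (intro mult_mono B B0 component_le_norm_cart) auto
            then show "norm (v $ i * partial_deriv i f z) \<le> B i * norm v" by (simp add: abs_mult mult.commute)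
          qed
          then show "norm (\<Sum>i\<in>UNIV. v $ i * partial_deriv i f z) \<le> ?L * norm v"
            by (simp add: sum_distrib_right)
        qed
      qed auto
      then show ?thesis by simp
    qed
  qed
qed

text \<open>Translating a compactly supported function does not change its integral, and the derivative of
  the integral of the translates is the integral of the directional derivative.\<close>

lemma integral_partial_deriv_lborel:
  assumes f: "C1 f" "compact (closure {x. f x \<noteq> 0})"
  shows "(LINT x|lborel. partial_deriv i f x) = 0"
proof -
  obtain L where L: "L \<ge> 0" "\<And>x y. \<bar>f x - f y\<bar> \<le> L * norm (x - y)" "\<And>i x. \<bar>partial_deriv i f x\<bar> \<le> L"
    by (rule C1_compact_support_lipschitz[OF f]) blast
  obtain R where R: "\<And>x. f x \<noteq> 0 \<Longrightarrow> norm x \<le> R"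
  proof -
    obtain R where "\<forall>x\<in>closure {x. f x \<noteq> 0}. norm x \<le> R"
      using compact_imp_bounded[OF f(2)] unfolding bounded_iff by blast
    then show thesis using closure_subset[of "{x. f x \<noteq> 0}"] by (intro that[of R]) blast
  qed
  let ?G = "\<lambda>x::real^3. L * indicator (cball 0 (R + 1)) x"
  let ?e = "axis i 1 :: real^3"
  have fm: "f \<in> borel_measurable borel" using C1_continuous_on[OF f(1)] by (rule borel_measurable_continuous_onI)
  have shift: "(LINT x|lborel. f (x + s *\<^sub>R ?e)) = (LINT x|lborel. f x)" for s
  proof -
    have "(LINT x|lborel. f x) = (LINT x|distr lborel borel ((+) (s *\<^sub>R ?e)). f x)" by (simp add: lborel_distr_plus)
    also have "\<dots> = (LINT x|lborel. f (s *\<^sub>R ?e + x))"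
      using fm by (subst integral_distr) auto
    finally show ?thesis by (simp add: add.commute)
  qed
  have fint: "integrable lborel (\<lambda>x. f (x + s *\<^sub>R ?e))" for s
  proof -
    have cpt: "compact (f ` cball 0 R)"
      by (intro compact_continuous_image C1_continuous_on[OF f(1)]) auto
    obtain B where "\<forall>y\<in>f ` cball 0 R. norm y \<le> B"
      using compact_imp_bounded[OF cpt] unfolding bounded_iff by blast
    then have B: "\<And>x. x \<in> cball 0 R \<Longrightarrow> \<bar>f x\<bar> \<le> B" by auto
    have "integrable lborel f"
    proof (rule Bochner_Integration.integrable_bound)
      show "integrable lborel (\<lambda>x. B * indicator (cball 0 R) x :: real)"
        using emeasure_lborel_cball_finite by (intro integrable_mult_right integrable_real_indicator) auto
      show "AE x in lborel. norm (f x) \<le> norm (B * indicator (cball 0 R) x :: real)"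
      proof (intro AE_I2)
        fix x :: "real^3"
        show "norm (f x) \<le> norm (B * indicator (cball 0 R) x :: real)"
          using B[of x] R[of x] by (cases "x \<in> cball 0 R") auto
      qed
    qed (use fm in auto)
    then have "integrable (distr lborel borel ((+) (s *\<^sub>R ?e))) f" by (simp add: lborel_distr_plus)
    then have "integrable lborel (\<lambda>x. f (s *\<^sub>R ?e + x))"
      using fm by (subst (asm) integrable_distr_eq) auto
    then show ?thesis by (simp add: add.commute)
  qed
  have "((\<lambda>s. LINT x|lborel. f (x + s *\<^sub>R ?e)) has_real_derivative (LINT x|lborel. partial_deriv i f x)) (at 0)"
  proof (rule param_integral_has_derivative[of 1 0 _ _ ?G])
    show "integrable lborel ?G"
      using emeasure_lborel_cball_finite by (intro integrable_mult_right integrable_real_indicator) auto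
    show "AE x in lborel. \<bar>f (x + s *\<^sub>R ?e) - f (x + 0 *\<^sub>R ?e)\<bar> \<le> ?G x * \<bar>s - 0\<bar>" if s: "s \<in> ball 0 1" for s
    proof (intro AE_I2)
      fix x :: "real^3"
      have "\<bar>f (x + s *\<^sub>R ?e) - f (x + 0 *\<^sub>R ?e)\<bar> \<le> L * \<bar>s\<bar>"
        using L(2)[of "x + s *\<^sub>R ?e" x] by (simp add: norm_axis_1)
      moreover have "f (x + s *\<^sub>R ?e) - f (x + 0 *\<^sub>R ?e) = 0" if "x \<notin> cball 0 (R + 1)"
      proof -
        have "norm x > R + 1" using that by simp
        moreover have "norm x \<le> norm (x + s *\<^sub>R ?e) + 1"
          using norm_triangle_ineq4[of "x + s *\<^sub>R ?e" "s *\<^sub>R ?e"] s by (simp add: norm_axis_1)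
        ultimately show ?thesis using R[of x] R[of "x + s *\<^sub>R ?e"] by force
      qed
      ultimately show "\<bar>f (x + s *\<^sub>R ?e) - f (x + 0 *\<^sub>R ?e)\<bar> \<le> ?G x * \<bar>s - 0\<bar>"
        by (cases "x \<in> cball 0 (R + 1)") auto
    qed
    show "AE x in lborel. ((\<lambda>s. f (x + s *\<^sub>R ?e)) has_real_derivative partial_deriv i f x) (at 0)"
      using partial_deriv_along_axis[of f _ 0 i] f(1) by (intro AE_I2) (simp add: C1_def)
    show "partial_deriv i f \<in> borel_measurable lborel"
      using f(1) by (simp add: C1_def borel_measurable_continuous_onI)
  qed (use fint in auto)
  moreover have "((\<lambda>s. LINT x|lborel. f (x + s *\<^sub>R ?e)) has_real_derivative 0) (at 0)"
    by (simp add: shift)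
  ultimately show ?thesis using DERIV_unique by blast
qed

section \<open>Smooth bumps and the fundamental lemma of the calculus of variations\<close>

text \<open>The span of this family contains the bump profile \<open>exp (- 1 / s)\<close>, extended by zero, and is closed under
differentiation.\<close>

definition flat_exp :: "nat \<Rightarrow> real \<Rightarrow> real" where
  "flat_exp k s = (if s \<le> 0 then 0 else exp (- 1 / s) / s ^ k)"

lemma flat_exp_tendsto_0: "(flat_exp k \<longlongrightarrow> 0) (at 0)"
proof (rule filterlim_split_at)
  have "((\<lambda>s. inverse s ^ k / exp (inverse s)) \<longlongrightarrow> 0) (at_right (0::real))"
    by (rule filterlim_compose[OF tendsto_power_div_exp_0 filterlim_inverse_at_top_right])
  moreover have "eventually (\<lambda>s. inverse s ^ k / exp (inverse s) = flat_exp k s) (at_right 0)"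
    using eventually_at_right_less[of 0]
    by eventually_elim (simp add: flat_exp_def exp_minus field_simps)
  ultimately show "(flat_exp k \<longlongrightarrow> 0) (at_right 0)" by (rule Lim_transform_eventually)
  have "((\<lambda>s::real. 0::real) \<longlongrightarrow> 0) (at_left 0)" by simp
  moreover have "eventually (\<lambda>s. 0 = flat_exp k s) (at_left 0)"
    unfolding eventually_at_left_field by (intro exI[of _ "-1"]) (auto simp: flat_exp_def)
  ultimately show "(flat_exp k \<longlongrightarrow> 0) (at_left 0)" by (rule Lim_transform_eventually)
qed

lemma flat_exp_deriv:
  "(flat_exp k has_real_derivative (flat_exp (k + 2) s - real k * flat_exp (k + 1) s)) (at s)"
proof (cases s "0::real" rule: linorder_cases)
  case less
  have "((\<lambda>s. 0) has_real_derivative 0) (at s)" by simp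
  then have "(flat_exp k has_real_derivative 0) (at s)"
    by (rule has_field_derivative_transform_within_open[of _ _ _ "{..<0}"]) (use less in \<open>auto simp: flat_exp_def\<close>)
  then show ?thesis using less by (simp add: flat_exp_def)
next
  case equal
  have "((\<lambda>h. (flat_exp k (0 + h) - flat_exp k 0) / h) \<longlongrightarrow> 0) (at 0)"
    by (rule Lim_transform_eventually[OF flat_exp_tendsto_0[of "k + 1"]])
      (auto simp: eventually_at_filter flat_exp_def)
  then show ?thesis using equal by (simp add: DERIV_def flat_exp_def)
next
  case greater
  have "((\<lambda>s. exp (- 1 / s) / s ^ k) has_real_derivative
      (exp (- 1 / s) * (1 / s\<^sup>2) * s ^ k - exp (- 1 / s) * (real k * s ^ (k - 1))) / (s ^ k * s ^ k)) (at s)"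
    using greater by (auto intro!: derivative_eq_intros simp: power2_eq_square)
  moreover have "(exp (- 1 / s) * (1 / s\<^sup>2) * s ^ k - exp (- 1 / s) * (real k * s ^ (k - 1))) / (s ^ k * s ^ k)
      = flat_exp (k + 2) s - real k * flat_exp (k + 1) s"
    using greater by (cases k) (auto simp: flat_exp_def field_simps power2_eq_square)
  ultimately have "((\<lambda>s. exp (- 1 / s) / s ^ k) has_real_derivative
      flat_exp (k + 2) s - real k * flat_exp (k + 1) s) (at s)" by simp
  then show ?thesis
    by (rule has_field_derivative_transform_within_open[of _ _ _ "{0<..}"]) (use greater in \<open>auto simp: flat_exp_def\<close>)
qed

text \<open>An algebra that contains the bumps and is closed under partial derivatives. All its members are then
arbitrarily often differentiable, without any formula for higher derivatives.\<close>

inductive smooth_alg :: "(real^3 \<Rightarrow> real) \<Rightarrow> bool" where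
  flat: "smooth_alg (\<lambda>x. flat_exp k (r * x $ i + b))"
| const: "smooth_alg (\<lambda>x. c)"
| add: "smooth_alg f \<Longrightarrow> smooth_alg g \<Longrightarrow> smooth_alg (\<lambda>x. f x + g x)"
| mult: "smooth_alg f \<Longrightarrow> smooth_alg g \<Longrightarrow> smooth_alg (\<lambda>x. f x * g x)"

lemma smooth_alg_derivs:
  "smooth_alg f \<Longrightarrow> (\<forall>x. f differentiable (at x)) \<and> (\<forall>i. smooth_alg (partial_deriv i f))"
proof (induction rule: smooth_alg.induct)
  case (flat k r i b)
  define d where "d = (\<lambda>s. flat_exp (k + 2) s - real k * flat_exp (k + 1) s)"
  have D: "((\<lambda>x. flat_exp k (r * x $ i + b)) has_derivative (\<lambda>v. d (r * x $ i + b) * (r * v $ i))) (at x)" for x :: "real^3"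
  proof -
    have "((\<lambda>x. r * x $ i + b) has_derivative (\<lambda>v. r * v $ i)) (at x)"
      by (auto intro!: derivative_eq_intros bounded_linear.has_derivative[OF bounded_linear_vec_nth])
    from has_derivative_compose[OF this flat_exp_deriv[of k "r * x $ i + b", unfolded has_field_derivative_def]]
    show ?thesis by (simp add: d_def)
  qed
  have eq: "partial_deriv j (\<lambda>x. flat_exp k (r * x $ i + b))
      = (\<lambda>x. (r * axis j 1 $ i) * (flat_exp (k + 2) (r * x $ i + b) + (- real k) * flat_exp (k + 1) (r * x $ i + b)))" for j
    using partial_deriv_eqI[OF D] by (auto simp: d_def algebra_simps)
  have "smooth_alg (partial_deriv j (\<lambda>x. flat_exp k (r * x $ i + b)))" for j
    unfolding eq by (intro smooth_alg.intros)
  then show ?case using D by (auto simp: differentiable_def)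
next
  case (const c)
  have "partial_deriv j (\<lambda>x. c) = (\<lambda>x. 0)" for j
    using partial_deriv_eqI[OF has_derivative_const] by blast
  then show ?case by (auto intro: smooth_alg.const)
next
  case (add f g)
  then have "partial_deriv j (\<lambda>x. f x + g x) = (\<lambda>x. partial_deriv j f x + partial_deriv j g x)" for j
    by (intro ext partial_deriv_add) auto
  then show ?case using add by (auto intro: smooth_alg.add)
next
  case (mult f g)
  then have "partial_deriv j (\<lambda>x. f x * g x) = (\<lambda>x. partial_deriv j f x * g x + f x * partial_deriv j g x)" for j
    by (intro ext partial_deriv_mult) auto
  moreover have "smooth_alg (\<lambda>x. partial_deriv j f x * g x + f x * partial_deriv j g x)" for j
    using mult by (intro smooth_alg.add smooth_alg.mult) auto
  ultimately show ?case using mult by auto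
qed

lemma smooth_alg_times_cont_diff: "smooth_alg f \<Longrightarrow> times_cont_diff n f"
proof (induction n arbitrary: f)
  case 0
  then show ?case
    using smooth_alg_derivs by (auto intro!: continuous_at_imp_continuous_on differentiable_imp_continuous_within)
next
  case (Suc n)
  then show ?case using smooth_alg_derivs by auto
qed

lemma smooth_alg_prod:
  assumes "finite A" "\<And>i. i \<in> A \<Longrightarrow> smooth_alg (f i)"
  shows "smooth_alg (\<lambda>x. \<Prod>i\<in>A. f i x)"
  using assms by (induction A rule: finite_induct) (auto intro: smooth_alg.const smooth_alg.mult)

text \<open>A product of flat exponentials of the scaled distances to the faces of the box. The growing factors
\<open>Suc n\<close> make the bumps converge to the indicator of the open box.\<close>

definition box_bump :: "real^3 \<Rightarrow> real^3 \<Rightarrow> nat \<Rightarrow> real^3 \<Rightarrow> real" where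
  "box_bump a b n x = (\<Prod>i\<in>UNIV. flat_exp 0 (real (Suc n) * x $ i + (- real (Suc n) * a $ i))
                                * flat_exp 0 (- real (Suc n) * x $ i + real (Suc n) * b $ i))"

lemma box_bump_smooth: "times_cont_diff k (box_bump a b n)"
  unfolding box_bump_def by (intro smooth_alg_times_cont_diff smooth_alg_prod smooth_alg.intros) auto

lemma flat_exp_0_bounds: "0 \<le> flat_exp 0 s" "flat_exp 0 s \<le> 1" "flat_exp 0 s > 0 \<longleftrightarrow> s > 0" "flat_exp 0 s = 0 \<longleftrightarrow> s \<le> 0"
  by (auto simp: flat_exp_def)

lemma box_bump_bounds: "0 \<le> box_bump a b n x" "box_bump a b n x \<le> 1"
  unfolding box_bump_def by (auto intro!: prod_nonneg prod_le_1 mult_nonneg_nonneg mult_le_one simp: flat_exp_0_bounds)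

lemma box_bump_eq_0_iff: "box_bump a b n x = 0 \<longleftrightarrow> x \<notin> box a b"
proof -
  have "flat_exp 0 (real (Suc n) * x $ i + (- real (Suc n) * a $ i)) = 0 \<longleftrightarrow> x $ i \<le> a $ i" for i
  proof -
    have "real (Suc n) * x $ i + (- real (Suc n) * a $ i) = real (Suc n) * (x $ i - a $ i)" by (simp add: algebra_simps)
    then show ?thesis by (simp only: flat_exp_0_bounds mult_le_0_iff) auto
  qed
  moreover have "flat_exp 0 (- real (Suc n) * x $ i + real (Suc n) * b $ i) = 0 \<longleftrightarrow> b $ i \<le> x $ i" for i
  proof -
    have "- real (Suc n) * x $ i + real (Suc n) * b $ i = real (Suc n) * (b $ i - x $ i)" by (simp add: algebra_simps)
    then show ?thesis by (simp only: flat_exp_0_bounds mult_le_0_iff) auto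
  qed
  ultimately show ?thesis by (auto simp: box_bump_def mem_box_cart not_less)
qed

lemma box_bump_tendsto: "(\<lambda>n. box_bump a b n x) \<longlonglongrightarrow> indicator (box a b) x"
proof (cases "x \<in> box a b")
  case True
  have lim: "(\<lambda>n. flat_exp 0 (real (Suc n) * s)) \<longlonglongrightarrow> 1" if "s > 0" for s
  proof -
    have "(\<lambda>n. exp (- 1 / s * inverse (real (Suc n)))) \<longlonglongrightarrow> exp (- 1 / s * 0)"
      by (intro tendsto_intros LIMSEQ_inverse_real_of_nat)
    moreover have "exp (- 1 / s * inverse (real (Suc n))) = flat_exp 0 (real (Suc n) * s)" for n
    proof -
      have "real (Suc n) * s > 0" using that by simp
      then show ?thesis unfolding flat_exp_def by (simp add: field_simps del: of_nat_Suc)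
    qed
    ultimately show ?thesis by simp
  qed
  have "box_bump a b n x = (\<Prod>i\<in>UNIV. flat_exp 0 (real (Suc n) * (x $ i - a $ i)) * flat_exp 0 (real (Suc n) * (b $ i - x $ i)))" for n
    unfolding box_bump_def by (intro prod.cong refl arg_cong2[where f="(*)"] arg_cong[where f="flat_exp 0"]) (auto simp: algebra_simps)
  moreover have "(\<lambda>n. \<Prod>i\<in>UNIV. flat_exp 0 (real (Suc n) * (x $ i - a $ i)) * flat_exp 0 (real (Suc n) * (b $ i - x $ i)))
      \<longlonglongrightarrow> (\<Prod>i\<in>(UNIV::3 set). 1 * 1)"
    using True by (intro tendsto_prod tendsto_mult lim) (auto simp: mem_box_cart)
  ultimately show ?thesis using True by simp
next
  case False
  then show ?thesis using box_bump_eq_0_iff[of a b _ x] by simp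
qed

lemma box_bump_test_function:
  assumes "cbox a b \<subseteq> A"
  shows "test_function A (box_bump a b n)"
proof -
  have "closure {x. box_bump a b n x \<noteq> 0} \<subseteq> cbox a b"
    by (rule closure_minimal) (auto simp: box_bump_eq_0_iff intro: subsetD[OF box_subset_cbox])
  moreover from this have "compact (closure {x. box_bump a b n x \<noteq> 0})"
    using compact_cbox closed_closure compact_Int_closed by (metis inf.absorb_iff2)
  ultimately show ?thesis using assms by (auto simp: test_function_def box_bump_smooth)
qed

lemma integral_over_box_eq_0:
  fixes h :: "real^3 \<Rightarrow> real"
  assumes h: "integrable lebesgue h" and "cbox a b \<subseteq> A"
    and zero: "\<And>\<psi>. test_function A \<psi> \<Longrightarrow> (LINT x|lebesgue. h x * \<psi> x) = 0"
  shows "(LINT x|lebesgue. indicator (box a b) x * h x) = 0"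
proof -
  have "(\<lambda>n. LINT x|lebesgue. h x * box_bump a b n x) \<longlonglongrightarrow> (LINT x|lebesgue. h x * indicator (box a b) x)"
  proof (rule integral_dominated_convergence)
    show "integrable lebesgue (\<lambda>x. \<bar>h x\<bar>)" using h by simp
    show "(\<lambda>x. h x * indicator (box a b) x) \<in> borel_measurable lebesgue"
      using h by (intro borel_measurable_times borel_measurable_indicator) auto
    show "(\<lambda>x. h x * box_bump a b n x) \<in> borel_measurable lebesgue" for n
    proof -
      have "continuous_on UNIV (box_bump a b n)" using box_bump_smooth[of 0 a b n] by simp
      then have "box_bump a b n \<in> borel_measurable borel" by (rule borel_measurable_continuous_onI)
      then have "box_bump a b n \<in> borel_measurable lebesgue"
        by (intro measurable_completion) simp
      then show ?thesis using h by (intro borel_measurable_times) auto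
    qed
    show "AE x in lebesgue. norm (h x * box_bump a b n x) \<le> \<bar>h x\<bar>" for n
      by (intro AE_I2) (use box_bump_bounds[of a b n] in \<open>simp add: abs_mult mult_left_le\<close>)
    show "AE x in lebesgue. (\<lambda>n. h x * box_bump a b n x) \<longlonglongrightarrow> h x * indicator (box a b) x"
      by (intro AE_I2 tendsto_intros box_bump_tendsto)
  qed
  moreover have "(LINT x|lebesgue. h x * box_bump a b n x) = 0" for n
    by (intro zero box_bump_test_function assms)
  ultimately have "(\<lambda>n::nat. 0) \<longlonglongrightarrow> (LINT x|lebesgue. h x * indicator (box a b) x)" by simp
  then have "(LINT x|lebesgue. h x * indicator (box a b) x) = 0"
    using LIMSEQ_unique[OF tendsto_const] by metis
  then show ?thesis by (simp add: mult.commute)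
qed

text \<open>The open boxes are stable under intersection and generate the Borel sets, so the integral of \<open>h\<close>
vanishes over every Borel set. The vanishing total integral is what complements need.\<close>

lemma AE_eq_0_if_box_integrals_eq_0:
  fixes h :: "'a::euclidean_space \<Rightarrow> real"
  assumes h: "integrable lebesgue h"
    and box: "\<And>a b. (LINT x|lebesgue. indicator (box a b) x * h x) = 0"
    and total: "(LINT x|lebesgue. h x) = 0"
  shows "AE x in lebesgue. h x = 0"
proof -
  have ind: "integrable lebesgue (\<lambda>x. indicator A x * h x)" if "A \<in> sets borel" for A
    using integrable_mult_indicator[OF _ h, of A] that by simp
  have borel: "(LINT x|lebesgue. indicator A x * h x) = 0" if "A \<in> sets borel" for A
  proof -
    let ?E = "range (\<lambda>(a, b). box a b :: 'a set)"
    have E: "sets borel = sigma_sets UNIV ?E"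
      by (subst borel_eq_box) (simp add: sets_measure_of)
    have stable: "Int_stable ?E"
      by (auto simp: Int_stable_def box_Int_box)
    have "A \<in> sigma_sets UNIV ?E" using that E by blast
    have sub: "?E \<subseteq> Pow UNIV" by auto
    from stable sub \<open>A \<in> sigma_sets UNIV ?E\<close> show ?thesis
    proof (induction rule: sigma_sets_induct_disjoint)
      case (basic A)
      then show ?case using box by auto
    next
      case empty
      show ?case by simp
    next
      case (compl A)
      then have "A \<in> sets borel" using E by blast
      have "(LINT x|lebesgue. indicator (UNIV - A) x * h x) = (LINT x|lebesgue. h x - indicator A x * h x)"
        by (intro Bochner_Integration.integral_cong refl) (simp add: indicator_def)
      also have "\<dots> = 0" using h ind[OF \<open>A \<in> sets borel\<close>] total compl by simp
      finally show ?case .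
    next
      case (union A)
      have meas: "A i \<in> sets borel" for i using union(2) E by blast
      have "(LINT x:(\<Union>i. A i)|lebesgue. h x) = (\<Sum>i. (LINT x:(A i)|lebesgue. h x))"
      proof (rule lebesgue_integral_countable_add)
        show "A i \<inter> A j = {}" if "i \<noteq> j" for i j using union(1) that by (auto simp: disjoint_family_on_def)
        show "set_integrable lebesgue (\<Union>i. A i) h"
          unfolding set_integrable_def using meas by (intro integrable_mult_indicator h) auto
      qed (use meas in auto)
      then show ?case using union(3) by (simp add: set_lebesgue_integral_def)
    qed
  qed
  show ?thesis
  proof (rule density_unique_real[OF h, of "\<lambda>_. 0", simplified])
    fix A :: "'a set" assume "A \<in> sets lebesgue"
    then obtain S N N' where A: "A = S \<union> N" "N \<subseteq> N'" "N' \<in> null_sets lborel" "S \<in> sets lborel"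
      by (rule sets_completionE)
    have "AE x in lebesgue. x \<notin> N'" using A(3) by (intro AE_not_in null_sets_completionI)
    then have "AE x in lebesgue. indicator A x *\<^sub>R h x = indicator S x * h x"
      by eventually_elim (use A in \<open>auto simp: indicator_def\<close>)
    then have "(LINT x|lebesgue. indicator A x *\<^sub>R h x) = (LINT x|lebesgue. indicator S x * h x)"
      using \<open>A \<in> sets lebesgue\<close> h A(4)
      by (intro integral_cong_AE borel_measurable_times borel_measurable_scaleR borel_measurable_indicator) auto
    then show "set_lebesgue_integral lebesgue A h = 0"
      using borel[of S] A(4) by (simp add: set_lebesgue_integral_def)
  qed
qed

text \<open>The bumps turn the hypothesis into vanishing integrals over boxes inside \<open>A\<close>, which settles each
compact box in \<open>A\<close>; countably many of these cover \<open>A\<close>.\<close>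

lemma fundamental_lemma_calculus_of_variations:
  fixes g :: "real^3 \<Rightarrow> real"
  assumes "open A" "A \<subseteq> \<Omega>" "\<Omega> \<in> sets lebesgue" and g: "integrable (lebesgue_on \<Omega>) g"
    and zero: "\<And>\<psi>. test_function A \<psi> \<Longrightarrow> (LINT x|lebesgue_on \<Omega>. g x * \<psi> x) = 0"
  shows "AE x in lebesgue_on \<Omega>. x \<in> A \<longrightarrow> g x = 0"
proof -
  define h where "h = (\<lambda>x. indicator \<Omega> x * g x)"
  have \<Omega>: "\<Omega> \<inter> space lebesgue \<in> sets lebesgue" using assms by simp
  have h: "integrable lebesgue h"
    using g by (simp add: integrable_restrict_space[OF \<Omega>] h_def)
  have zero': "(LINT x|lebesgue. h x * \<psi> x) = 0" if "test_function A \<psi>" for \<psi>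
    using zero[OF that] by (simp add: integral_restrict_space[OF \<Omega>] h_def mult.assoc)
  have cell: "AE x in lebesgue. x \<in> cbox a b \<longrightarrow> h x = 0" if ab: "cbox a b \<subseteq> A" for a b
  proof -
    let ?h = "\<lambda>x. indicator (box a b) x * h x"
    have 1: "integrable lebesgue ?h"
      using integrable_mult_indicator[OF _ h, of "box a b"] by simp
    have "AE x in lebesgue. ?h x = 0"
    proof (rule AE_eq_0_if_box_integrals_eq_0[OF 1])
      show "(LINT x|lebesgue. indicator (box u v) x * ?h x) = 0" for u v
      proof -
        obtain p q where pq: "box u v \<inter> box a b = box p q" by (simp add: box_Int_box)
        have "(LINT x|lebesgue. indicator (box u v) x * ?h x) = (LINT x|lebesgue. indicator (box p q) x * h x)"
          unfolding pq[symmetric] by (intro Bochner_Integration.integral_cong refl) (simp add: indicator_def)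
        also have "\<dots> = 0"
        proof (cases "box p q = {}")
          case False
          have "box p q \<subseteq> cbox a b" using pq box_subset_cbox[of a b] by blast
          then have "cbox p q \<subseteq> cbox a b" using False by (metis closure_box closure_cbox closure_mono)
          then show ?thesis
            using ab by (intro integral_over_box_eq_0[OF h _ zero']) auto
        qed simp
        finally show ?thesis .
      qed
      show "(LINT x|lebesgue. ?h x) = 0"
        by (rule integral_over_box_eq_0[OF h ab zero'])
    qed
    moreover have "AE x in lebesgue. x \<notin> cbox a b - box a b"
      using negligible_frontier_interval[of a b] by (intro AE_not_in) (simp add: negligible_iff_null_sets)
    ultimately show ?thesis by eventually_elim (auto simp: indicator_def split: if_splits)
  qed
  obtain \<D> where \<D>: "countable \<D>" "\<D> \<subseteq> Pow A" "\<And>X. X \<in> \<D> \<Longrightarrow> \<exists>a b. X = cbox a b" "\<Union>\<D> = A"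
    using open_countable_Union_open_cbox[OF assms(1)] by metis
  have "AE x in lebesgue. \<forall>X\<in>\<D>. x \<in> X \<longrightarrow> h x = 0"
  proof (subst AE_ball_countable[OF \<D>(1)], intro ballI)
    fix X assume "X \<in> \<D>"
    then obtain a b where "X = cbox a b" "cbox a b \<subseteq> A" using \<D>(2,3) by blast
    then show "AE x in lebesgue. x \<in> X \<longrightarrow> h x = 0" using cell by simp
  qed
  then have "AE x in lebesgue. x \<in> A \<longrightarrow> h x = 0"
    by eventually_elim (use \<D>(4) in blast)
  then have "AE x in lebesgue. x \<in> \<Omega> \<longrightarrow> x \<in> A \<longrightarrow> g x = 0"
    by eventually_elim (auto simp: h_def)
  then show ?thesis using AE_restrict_space_iff[OF \<Omega>] by simp
qed

section \<open>Polynomials\<close>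

definition monom3 :: "(3 \<Rightarrow> nat) \<Rightarrow> real^3 \<Rightarrow> real" where
  "monom3 \<alpha> x = (\<Prod>i\<in>UNIV. (x $ i) ^ \<alpha> i)"

lemma finite_exponents: "finite {\<alpha> :: 3 \<Rightarrow> nat. (\<Sum>i\<in>UNIV. \<alpha> i) \<le> k}"
proof (rule finite_subset)
  show "{\<alpha> :: 3 \<Rightarrow> nat. (\<Sum>i\<in>UNIV. \<alpha> i) \<le> k} \<subseteq> PiE UNIV (\<lambda>_. {..k})"
  proof
    fix \<alpha> :: "3 \<Rightarrow> nat" assume "\<alpha> \<in> {\<alpha>. (\<Sum>i\<in>UNIV. \<alpha> i) \<le> k}"
    moreover have "\<alpha> i \<le> (\<Sum>i\<in>UNIV. \<alpha> i)" for i by (rule member_le_sum) auto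
    ultimately show "\<alpha> \<in> PiE UNIV (\<lambda>_. {..k})" by (auto intro: order_trans)
  qed
qed (auto intro: finite_PiE)

lemma Pk_iff: "p \<in> Pk k \<longleftrightarrow> (\<exists>a. p = (\<lambda>x. \<Sum>\<alpha> | (\<Sum>i\<in>UNIV. \<alpha> i) \<le> k. a \<alpha> * monom3 \<alpha> x))"
  unfolding Pk_def monom3_def by (auto simp: fun_eq_iff)

lemma Pk_add: "p \<in> Pk k \<Longrightarrow> q \<in> Pk k \<Longrightarrow> (\<lambda>x. p x + q x) \<in> Pk k"
  unfolding Pk_iff by (auto simp: sum.distrib[symmetric] distrib_right[symmetric])

lemma Pk_cmult:
  assumes "p \<in> Pk k"
  shows "(\<lambda>x. c * p x) \<in> Pk k"
proof -
  obtain a where "p = (\<lambda>x. \<Sum>\<alpha> | (\<Sum>i\<in>UNIV. \<alpha> i) \<le> k. a \<alpha> * monom3 \<alpha> x)" using assms Pk_iff by blast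
  then have "(\<lambda>x. c * p x) = (\<lambda>x. \<Sum>\<alpha> | (\<Sum>i\<in>UNIV. \<alpha> i) \<le> k. (c * a \<alpha>) * monom3 \<alpha> x)"
    by (simp add: sum_distrib_left mult.assoc)
  then show ?thesis unfolding Pk_iff by (rule exI[of _ "\<lambda>\<alpha>. c * a \<alpha>"])
qed

lemma Pk_diff: "p \<in> Pk k \<Longrightarrow> q \<in> Pk k \<Longrightarrow> (\<lambda>x. p x - q x) \<in> Pk k"
  using Pk_add[of p k "\<lambda>x. -1 * q x"] Pk_cmult[of q k "-1"] by simp

lemma Pk_zero: "(\<lambda>x. 0) \<in> Pk k"
  unfolding Pk_iff by (auto intro: exI[of _ "\<lambda>_. 0"])

lemma monom3_in_Pk:
  assumes "(\<Sum>i\<in>UNIV. \<alpha> i) \<le> k"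
  shows "monom3 \<alpha> \<in> Pk k"
proof -
  have "(\<Sum>\<beta> | (\<Sum>i\<in>UNIV. \<beta> i) \<le> k. (if \<beta> = \<alpha> then 1 else 0) * monom3 \<beta> x) = monom3 \<alpha> x" for x
  proof -
    have "(\<Sum>\<beta> | (\<Sum>i\<in>UNIV. \<beta> i) \<le> k. (if \<beta> = \<alpha> then 1 else 0) * monom3 \<beta> x)
        = (\<Sum>\<beta> | (\<Sum>i\<in>UNIV. \<beta> i) \<le> k. if \<beta> = \<alpha> then monom3 \<beta> x else 0)"
      by (intro sum.cong) auto
    also have "\<dots> = monom3 \<alpha> x" using assms finite_exponents[of k] by (subst sum.delta) auto
    finally show ?thesis .
  qed
  then show ?thesis unfolding Pk_iff by (intro exI[of _ "\<lambda>\<beta>. if \<beta> = \<alpha> then 1 else 0"]) auto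
qed

lemma Pk_induct [consumes 1, case_names monom zero add cmult]:
  assumes p: "p \<in> Pk k"
    and monom: "\<And>\<alpha>. (\<Sum>i\<in>UNIV. \<alpha> i) \<le> k \<Longrightarrow> P (monom3 \<alpha>)"
    and zero: "P (\<lambda>x. 0)"
    and add: "\<And>p q. P p \<Longrightarrow> P q \<Longrightarrow> P (\<lambda>x. p x + q x)"
    and cmult: "\<And>c p. P p \<Longrightarrow> P (\<lambda>x. c * p x)"
  shows "P p"
proof -
  obtain a where p: "p = (\<lambda>x. \<Sum>\<alpha> | (\<Sum>i\<in>UNIV. \<alpha> i) \<le> k. a \<alpha> * monom3 \<alpha> x)" using p Pk_iff by blast
  have "P (\<lambda>x. \<Sum>\<alpha>\<in>A. a \<alpha> * monom3 \<alpha> x)" if "finite A" "\<forall>\<alpha>\<in>A. (\<Sum>i\<in>UNIV. \<alpha> i) \<le> k" for A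
    using that by (induction A rule: finite_induct) (auto intro: zero add[OF cmult[OF monom]])
  from this[OF finite_exponents] show ?thesis unfolding p by blast
qed

lemma Pk_mono: "p \<in> Pk k \<Longrightarrow> k \<le> l \<Longrightarrow> p \<in> Pk l"
  by (induction rule: Pk_induct) (simp_all add: monom3_in_Pk Pk_zero Pk_add Pk_cmult)

lemma Pk_const: "(\<lambda>x. c) \<in> Pk k"
  using Pk_cmult[OF monom3_in_Pk[of "\<lambda>_. 0" k], of c] by (simp add: monom3_def)

lemma Pk_mult_coordinate: "p \<in> Pk k \<Longrightarrow> (\<lambda>x. x $ i * p x) \<in> Pk (Suc k)"
proof (induction rule: Pk_induct)
  case (monom \<alpha>)
  have "x $ i * monom3 \<alpha> x = monom3 (\<alpha>(i := Suc (\<alpha> i))) x" for x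
  proof -
    have "(\<Prod>j\<in>UNIV - {i}. (x $ j) ^ (\<alpha>(i := Suc (\<alpha> i))) j) = (\<Prod>j\<in>UNIV - {i}. (x $ j) ^ \<alpha> j)"
      by (intro prod.cong) auto
    then show ?thesis unfolding monom3_def by (simp add: prod.remove[of UNIV i] mult_ac)
  qed
  moreover have "(\<Sum>j\<in>UNIV. (\<alpha>(i := Suc (\<alpha> i))) j) = Suc (\<Sum>j\<in>UNIV. \<alpha> j)"
  proof -
    have "(\<Sum>j\<in>UNIV - {i}. (\<alpha>(i := Suc (\<alpha> i))) j) = (\<Sum>j\<in>UNIV - {i}. \<alpha> j)"
      by (intro sum.cong) auto
    then show ?thesis by (simp add: sum.remove[of UNIV i])
  qed
  ultimately show ?case using monom monom3_in_Pk[of "\<alpha>(i := Suc (\<alpha> i))" "Suc k"] by simp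
next
  case zero
  show ?case by (simp add: Pk_zero)
next
  case (add p q)
  then show ?case by (simp add: distrib_left Pk_add)
next
  case (cmult c p)
  then show ?case using Pk_cmult[of "\<lambda>x. x $ i * p x" "Suc k" c] by (simp add: mult_ac)
qed

lemma monom3_deriv:
  "(monom3 \<alpha> has_derivative (\<lambda>v. \<Sum>i\<in>UNIV. real (\<alpha> i) * v $ i * x $ i ^ (\<alpha> i - 1) * (\<Prod>j\<in>UNIV - {i}. (x $ j) ^ \<alpha> j))) (at x)"
proof -
  have "((\<lambda>x. x $ i) has_derivative (\<lambda>v. v $ i)) (at x)" for i
    by (rule bounded_linear.has_derivative[OF bounded_linear_vec_nth has_derivative_ident])
  then have "((\<lambda>x. (x $ i) ^ \<alpha> i) has_derivative (\<lambda>v. real (\<alpha> i) * v $ i * x $ i ^ (\<alpha> i - 1))) (at x)" for i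
    by (rule has_derivative_power)
  from has_derivative_prod[of UNIV "\<lambda>i x. (x $ i) ^ \<alpha> i", OF this]
  show ?thesis by (simp add: monom3_def[abs_def])
qed

text \<open>The degree drops by truncated subtraction; for \<open>k = 0\<close> the derivatives vanish and lie in every space.\<close>

lemma Pk_derivs:
  "p \<in> Pk k \<Longrightarrow> (\<forall>x. p differentiable (at x)) \<and> (\<forall>i. partial_deriv i p \<in> Pk (k - 1))"
proof (induction rule: Pk_induct)
  case (monom \<alpha>)
  have "partial_deriv i (monom3 \<alpha>) = (\<lambda>x. real (\<alpha> i) * monom3 (\<alpha>(i := \<alpha> i - 1)) x)" for i
  proof
    fix x
    have "partial_deriv i (monom3 \<alpha>) x
        = (\<Sum>j\<in>UNIV. real (\<alpha> j) * axis i 1 $ j * x $ j ^ (\<alpha> j - 1) * (\<Prod>l\<in>UNIV - {j}. (x $ l) ^ \<alpha> l))"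
      by (rule partial_deriv_eqI[OF monom3_deriv])
    also have "\<dots> = (\<Sum>j\<in>UNIV. if j = i then real (\<alpha> i) * x $ i ^ (\<alpha> i - 1) * (\<Prod>l\<in>UNIV - {i}. (x $ l) ^ \<alpha> l) else 0)"
      by (intro sum.cong) (auto simp: axis_def)
    also have "\<dots> = real (\<alpha> i) * x $ i ^ (\<alpha> i - 1) * (\<Prod>l\<in>UNIV - {i}. (x $ l) ^ \<alpha> l)"
      by simp
    also have "\<dots> = real (\<alpha> i) * monom3 (\<alpha>(i := \<alpha> i - 1)) x"
    proof -
      have "(\<Prod>j\<in>UNIV - {i}. (x $ j) ^ (\<alpha>(i := \<alpha> i - 1)) j) = (\<Prod>j\<in>UNIV - {i}. (x $ j) ^ \<alpha> j)"
        by (intro prod.cong) auto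
      then show ?thesis unfolding monom3_def by (simp add: prod.remove[of UNIV i])
    qed
    finally show "partial_deriv i (monom3 \<alpha>) x = real (\<alpha> i) * monom3 (\<alpha>(i := \<alpha> i - 1)) x" .
  qed
  moreover have "(\<lambda>x. real (\<alpha> i) * monom3 (\<alpha>(i := \<alpha> i - 1)) x) \<in> Pk (k - 1)" for i
  proof (cases "\<alpha> i")
    case 0
    then show ?thesis by (simp add: Pk_zero)
  next
    case (Suc n)
    have "(\<Sum>j\<in>UNIV - {i}. (\<alpha>(i := \<alpha> i - 1)) j) = (\<Sum>j\<in>UNIV - {i}. \<alpha> j)"
      by (intro sum.cong) auto
    then have "(\<Sum>j\<in>UNIV. (\<alpha>(i := \<alpha> i - 1)) j) \<le> k - 1"
      using Suc monom by (simp add: sum.remove[of UNIV i])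
    then show ?thesis by (intro Pk_cmult monom3_in_Pk)
  qed
  moreover have "monom3 \<alpha> differentiable (at x)" for x
    using monom3_deriv unfolding differentiable_def by blast
  ultimately show ?case by simp
next
  case zero
  have "partial_deriv j (\<lambda>x. 0) = (\<lambda>x. 0)" for j
    using partial_deriv_eqI[OF has_derivative_const] by blast
  then show ?case by (simp add: Pk_zero)
next
  case (add p q)
  then have "partial_deriv j (\<lambda>x. p x + q x) = (\<lambda>x. partial_deriv j p x + partial_deriv j q x)" for j
    by (intro ext partial_deriv_add) auto
  then show ?case using add by (simp add: Pk_add)
next
  case (cmult c p)
  then have "partial_deriv j (\<lambda>x. c * p x) = (\<lambda>x. c * partial_deriv j p x)" for j
    by (intro ext partial_deriv_cmult) auto
  then show ?case using cmult by (simp add: Pk_cmult)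
qed

lemma Pk_differentiable: "p \<in> Pk k \<Longrightarrow> p differentiable (at x)"
  and Pk_partial_deriv: "p \<in> Pk k \<Longrightarrow> partial_deriv i p \<in> Pk (k - 1)"
  using Pk_derivs by blast+

lemma Pk_continuous: "p \<in> Pk k \<Longrightarrow> continuous_on A p"
  by (meson Pk_differentiable continuous_at_imp_continuous_on differentiable_imp_continuous_within)

lemma Pk_C1: "p \<in> Pk k \<Longrightarrow> C1 p"
  unfolding C1_def using Pk_differentiable Pk_partial_deriv Pk_continuous by blast

section \<open>The mesh\<close>

locale mesh =
  fixes \<Omega> :: "(real^3) set" and T :: "(real^3) set set"
  assumes conforming: "conforming_polyhedral_mesh \<Omega> T"
begin

abbreviation L where "L \<equiv> lebesgue_on \<Omega>"

text \<open>The union of the open cells, on which the fields are meaningful. It has full measure in the domain.\<close>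

definition S :: "(real^3) set" where "S = (\<Union>K\<in>T. interior K)"

lemma domain: "open \<Omega>" "bounded \<Omega>" "\<Union>T = closure \<Omega>" "finite T"
  and polyhedral_cells: "\<forall>K\<in>T. polyhedral_cell K"
  and disjoint_interiors: "\<forall>K\<in>T. \<forall>K'\<in>T. K \<noteq> K' \<longrightarrow> interior K \<inter> interior K' = {} \<and>
        (\<exists>\<F> \<subseteq> (\<Union>j. cell_faces j K) \<inter> (\<Union>j. cell_faces j K'). K \<inter> K' = \<Union>\<F>)"
  and frontier_facets: "\<exists>\<F> \<subseteq> (\<Union>K\<in>T. cell_faces 2 K). frontier \<Omega> = \<Union>\<F>"
proof -
  note c = conforming[unfolded conforming_polyhedral_mesh_def]
  from c show "open \<Omega>" by (elim conjE)
  from c show "bounded \<Omega>" by (elim conjE)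
  from c show "\<Union>T = closure \<Omega>" by (elim conjE)
  from c show "finite T" by (elim conjE)
  from c show "\<forall>K\<in>T. polyhedral_cell K" by (elim conjE)
  from c show "\<forall>K\<in>T. \<forall>K'\<in>T. K \<noteq> K' \<longrightarrow> interior K \<inter> interior K' = {} \<and>
        (\<exists>\<F> \<subseteq> (\<Union>j. cell_faces j K) \<inter> (\<Union>j. cell_faces j K'). K \<inter> K' = \<Union>\<F>)" by (elim conjE)
  from c show "\<exists>\<F> \<subseteq> (\<Union>K\<in>T. cell_faces 2 K). frontier \<Omega> = \<Union>\<F>" by (elim conjE)
qed

lemma cell:
  assumes "K \<in> T"
  shows "closure (interior K) = K" "compact K" "negligible (frontier K)"
proof -
  have K: "polyhedral_cell K" using polyhedral_cells assms by blast
  then show "closure (interior K) = K" by (simp add: polyhedral_cell_def)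
  obtain P where P: "finite P" "\<And>Q. Q \<in> P \<Longrightarrow> polytope Q" "K = \<Union>P"
    using K by (auto simp: polyhedral_cell_def)
  then show "compact K" by (auto intro: polytope_imp_compact)
  have "frontier K \<subseteq> (\<Union>Q\<in>P. frontier Q)"
    using P(1,3) frontier_Union_subset[of P] by auto
  moreover have "negligible (\<Union>Q\<in>P. frontier Q)"
    using P by (intro negligible_Union) (auto intro!: negligible_convex_frontier polytope_imp_convex)
  ultimately show "negligible (frontier K)" using negligible_subset by blast
qed

lemma interior_cell_Int_cell:
  assumes "K \<in> T" "K' \<in> T" "K \<noteq> K'"
  shows "interior K \<inter> K' = {}"
proof -
  have "interior K \<inter> interior K' = {}"
    using disjoint_interiors assms by blast
  then have "interior K \<inter> closure (interior K') = {}"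
    by (simp add: open_Int_closure_eq_empty)
  then show ?thesis using cell(1)[OF assms(2)] by simp
qed

lemma interior_cell_unique:
  "K \<in> T \<Longrightarrow> K' \<in> T \<Longrightarrow> x \<in> interior K \<Longrightarrow> x \<in> K' \<Longrightarrow> K' = K"
  using interior_cell_Int_cell by blast

text \<open>The cells cover the closure of the domain, so it is to be excluded that an open cell meets the frontier.
The frontier consists of facets, and near the points that generate a facet its cell is translation
invariant in two dimensions only, whereas at an interior point it is so in all three.\<close>

lemma interior_cell_subset:
  assumes K: "K \<in> T"
  shows "interior K \<subseteq> \<Omega>"
proof -
  have miss: "F \<inter> interior K = {}" if "K' \<in> T" "F \<in> cell_faces 2 K'" for K' F
  proof -
    from that(2) obtain C where C: "F = closure C" "C \<in> components {x \<in> K'. dim (local_directions K' x) = 2}"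
      by (auto simp: cell_faces_def)
    have "C \<inter> interior K = {}"
    proof (cases "K' = K")
      case True
      have "dim (local_directions K x) \<noteq> 2" if x: "x \<in> interior K" for x
      proof -
        obtain r where "r > 0" "ball x r \<subseteq> K"
          using x by (meson mem_interior)
        then have "local_directions K x = UNIV" unfolding local_directions_def by blast
        then show ?thesis by simp
      qed
      then show ?thesis using in_components_subset[OF C(2)] True by blast
    next
      case False
      then show ?thesis
        using in_components_subset[OF C(2)] interior_cell_Int_cell[OF K \<open>K' \<in> T\<close>] by blast
    qed
    then show ?thesis
      using C(1) open_Int_closure_eq_empty[OF open_interior, of K C] by (simp add: Int_commute)
  qed
  obtain \<F> where "\<F> \<subseteq> (\<Union>K\<in>T. cell_faces 2 K)" "frontier \<Omega> = \<Union>\<F>"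
    using frontier_facets by blast
  then have "frontier \<Omega> \<inter> interior K = {}" using miss by blast
  moreover have "interior K \<subseteq> closure \<Omega>" using K domain(3) interior_subset by blast
  ultimately show ?thesis
    using domain(1) by (auto simp: frontier_def interior_open)
qed

lemma open_S: "open S" and S_subset: "S \<subseteq> \<Omega>"
  using interior_cell_subset by (auto simp: S_def)

lemma domain_sets: "\<Omega> \<in> sets lebesgue" "\<Omega> \<inter> space lebesgue \<in> sets lebesgue"
  using domain(1) by auto

lemma AE_S: "AE x in L. x \<in> S"
proof -
  have "negligible (\<Union>K\<in>T. frontier K)"
    using domain(4) cell(3) by (intro negligible_Union) auto
  then have "AE x in lebesgue. x \<notin> (\<Union>K\<in>T. frontier K)"
    by (intro AE_not_in) (simp add: negligible_iff_null_sets)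
  then have "AE x in lebesgue. x \<in> \<Omega> \<longrightarrow> x \<in> S"
  proof eventually_elim
    case (elim x)
    show ?case
    proof
      assume "x \<in> \<Omega>"
      then obtain K where "K \<in> T" "x \<in> K" using domain(3) closure_subset by blast
      then show "x \<in> S" using elim closure_subset by (auto simp: S_def frontier_def)
    qed
  qed
  then show ?thesis using AE_restrict_space_iff[OF domain_sets(2)] by simp
qed

lemma finite_measure_L: "finite_measure L"
proof (rule finite_measureI)
  have "\<Omega> \<in> lmeasurable" using domain by (simp add: lmeasurable_open)
  then show "emeasure L (space L) \<noteq> \<infinity>"
    using domain_sets by (simp add: emeasure_restrict_space space_restrict_space fmeasurableD2 del: emeasure_completion)
qed

lemma integrable_const_L: "integrable L (\<lambda>x. c)"
  using finite_measure_L by (rule finite_measure.integrable_const)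

lemma integrable_if_bounded:
  fixes f :: "real^3 \<Rightarrow> real"
  assumes "f \<in> borel_measurable L" "\<And>x. x \<in> S \<Longrightarrow> \<bar>f x\<bar> \<le> C"
  shows "integrable L f"
proof (rule Bochner_Integration.integrable_bound[OF integrable_const_L[of C] assms(1)])
  show "AE x in L. norm (f x) \<le> norm C"
    using AE_S by eventually_elim (use assms(2) in fastforce)
qed

lemma trace_eq:
  assumes K: "K \<in> T" "x \<in> K" and f: "\<And>y. y \<in> interior K \<Longrightarrow> f y = p y" and p: "continuous_on UNIV p"
  shows "cell_trace K f x = p x"
proof -
  have "x islimpt interior K"
  proof (cases "x \<in> interior K")
    case True
    then show ?thesis by (simp add: interior_limit_point open_interior interior_open)
  next
    case False
    then show ?thesis using cell(1)[OF K(1)] K(2) by (auto simp: closure_def)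
  qed
  then have nt: "\<not> trivial_limit (at x within interior K)" by (simp add: trivial_limit_within)
  have "(p \<longlongrightarrow> p x) (at x within interior K)"
    using p by (intro tendsto_within_subset[OF isContD subset_UNIV]) (simp add: continuous_on_eq_continuous_at)
  then have "(f \<longlongrightarrow> p x) (at x within interior K)"
    by (rule Lim_transform_eventually) (auto simp: eventually_at_filter f)
  then show ?thesis unfolding cell_trace_def by (rule tendsto_Lim[OF nt])
qed

lemma point_value_in_cell:
  assumes \<kappa>: "cell_selection T \<kappa>" and K: "K \<in> T" "x \<in> interior K"
    and f: "\<And>y. y \<in> interior K \<Longrightarrow> f y = p y" and p: "continuous_on UNIV p"
  shows "point_value \<kappa> f x = f x"
proof -
  have x: "x \<in> K" using K interior_subset by blast
  then have "\<kappa> x \<in> T" "x \<in> \<kappa> x" using \<kappa> K(1) by (auto simp: cell_selection_def)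
  then have "\<kappa> x = K" using interior_cell_unique K by blast
  then show ?thesis using trace_eq[OF K(1) x f p] f[OF K(2)] by (simp add: point_value_def)
qed

subsection \<open>Piecewise polynomial fields\<close>

definition pw_poly :: "nat \<Rightarrow> (real^3 \<Rightarrow> real) \<Rightarrow> bool" where
  "pw_poly n f \<longleftrightarrow> (\<forall>K\<in>T. \<exists>p\<in>Pk n. \<forall>x\<in>interior K. f x = p x)"

abbreviation pw_polyvec :: "nat \<Rightarrow> (real^3 \<Rightarrow> real^3) \<Rightarrow> bool" where
  "pw_polyvec n f \<equiv> \<forall>i. pw_poly n (\<lambda>x. f x $ i)"

lemma pw_poly_add:
  assumes "pw_poly n f" "pw_poly n g"
  shows "pw_poly n (\<lambda>x. f x + g x)"
  unfolding pw_poly_def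
proof
  fix K assume "K \<in> T"
  with assms obtain p q where "p \<in> Pk n" "\<forall>x\<in>interior K. f x = p x" "q \<in> Pk n" "\<forall>x\<in>interior K. g x = q x"
    unfolding pw_poly_def by blast
  then show "\<exists>p\<in>Pk n. \<forall>x\<in>interior K. f x + g x = p x"
    by (intro bexI[of _ "\<lambda>x. p x + q x"] Pk_add) auto
qed

lemma pw_poly_diff:
  assumes "pw_poly n f" "pw_poly n g"
  shows "pw_poly n (\<lambda>x. f x - g x)"
  unfolding pw_poly_def
proof
  fix K assume "K \<in> T"
  with assms obtain p q where "p \<in> Pk n" "\<forall>x\<in>interior K. f x = p x" "q \<in> Pk n" "\<forall>x\<in>interior K. g x = q x"
    unfolding pw_poly_def by blast
  then show "\<exists>p\<in>Pk n. \<forall>x\<in>interior K. f x - g x = p x"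
    by (intro bexI[of _ "\<lambda>x. p x - q x"] Pk_diff) auto
qed

lemma pw_poly_cmult:
  assumes "pw_poly n f"
  shows "pw_poly n (\<lambda>x. c * f x)"
  unfolding pw_poly_def
proof
  fix K assume "K \<in> T"
  with assms obtain p where "p \<in> Pk n" "\<forall>x\<in>interior K. f x = p x"
    unfolding pw_poly_def by blast
  then show "\<exists>p\<in>Pk n. \<forall>x\<in>interior K. c * f x = p x"
    by (intro bexI[of _ "\<lambda>x. c * p x"] Pk_cmult) auto
qed

lemma pw_poly_const: "pw_poly n (\<lambda>x. c)"
  unfolding pw_poly_def by (intro ballI bexI[of _ "\<lambda>x. c"] Pk_const) auto

lemma pw_poly_cong: "pw_poly n f \<Longrightarrow> (\<And>x. x \<in> S \<Longrightarrow> g x = f x) \<Longrightarrow> pw_poly n g"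
  unfolding pw_poly_def S_def by (metis (no_types, lifting) UN_I)

lemma pw_poly_partial_deriv:
  assumes "pw_poly n f"
  shows "pw_poly (n - 1) (partial_deriv i f)"
  unfolding pw_poly_def
proof
  fix K assume "K \<in> T"
  then obtain p where p: "p \<in> Pk n" "\<And>x. x \<in> interior K \<Longrightarrow> f x = p x"
    using assms unfolding pw_poly_def by blast
  then have "partial_deriv i f x = partial_deriv i p x" if "x \<in> interior K" for x
    using partial_deriv_cong_open[OF open_interior that] by blast
  then show "\<exists>p\<in>Pk (n - 1). \<forall>x\<in>interior K. partial_deriv i f x = p x"
    using Pk_partial_deriv[OF p(1)] by blast
qed

lemma pw_poly_differentiable:
  assumes "pw_poly n f" "x \<in> S"
  shows "f differentiable (at x)"
proof -
  obtain K where K: "K \<in> T" "x \<in> interior K" using assms(2) by (auto simp: S_def)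
  then obtain p where p: "p \<in> Pk n" "\<And>x. x \<in> interior K \<Longrightarrow> f x = p x"
    using assms unfolding pw_poly_def by blast
  from Pk_differentiable[OF p(1), of x] obtain D where "(p has_derivative D) (at x)"
    by (auto simp: differentiable_def)
  then have "(f has_derivative D) (at x)"
    by (rule has_derivative_transform_within_open[OF _ open_interior K(2)]) (simp add: p)
  then show ?thesis by (auto simp: differentiable_def)
qed

lemma pw_poly_bounded:
  assumes "pw_poly n f"
  obtains C where "C \<ge> 0" "\<And>x. x \<in> S \<Longrightarrow> \<bar>f x\<bar> \<le> C"
proof -
  have "\<forall>K\<in>T. \<exists>C. \<forall>x\<in>interior K. \<bar>f x\<bar> \<le> C"
  proof
    fix K assume K: "K \<in> T"
    then obtain p where p: "p \<in> Pk n" "\<And>x. x \<in> interior K \<Longrightarrow> f x = p x"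
      using assms unfolding pw_poly_def by blast
    have "compact (p ` K)" using cell(2)[OF K] Pk_continuous[OF p(1)] by (rule compact_continuous_image[rotated])
    from compact_imp_bounded[OF this] obtain C where "\<forall>y\<in>p ` K. norm y \<le> C" unfolding bounded_iff by blast
    then show "\<exists>C. \<forall>x\<in>interior K. \<bar>f x\<bar> \<le> C"
      using p(2) interior_subset[of K] by (intro exI[of _ C]) auto
  qed
  from bchoice[OF this] obtain C where C: "\<forall>K\<in>T. \<forall>x\<in>interior K. \<bar>f x\<bar> \<le> C K" by blast
  show thesis
  proof
    show "0 \<le> (\<Sum>K\<in>T. \<bar>C K\<bar>)" by (simp add: sum_nonneg)
    fix x assume "x \<in> S"
    then obtain K where K: "K \<in> T" "x \<in> interior K" by (auto simp: S_def)
    then have "\<bar>f x\<bar> \<le> \<bar>C K\<bar>" using C by force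
    also have "\<dots> \<le> (\<Sum>K\<in>T. \<bar>C K\<bar>)" using K(1) domain(4) by (intro member_le_sum) auto
    finally show "\<bar>f x\<bar> \<le> (\<Sum>K\<in>T. \<bar>C K\<bar>)" .
  qed
qed

lemma pw_polyvec_bounded:
  assumes "pw_polyvec n f"
  obtains C where "C \<ge> 0" "\<And>x. x \<in> S \<Longrightarrow> norm (f x) \<le> C"
proof -
  have "\<forall>i. \<exists>C\<ge>0. \<forall>x\<in>S. \<bar>f x $ i\<bar> \<le> C"
    using assms pw_poly_bounded by metis
  from choice[OF this] obtain C where C: "\<forall>i. C i \<ge> 0 \<and> (\<forall>x\<in>S. \<bar>f x $ i\<bar> \<le> C i)" by blast
  show thesis
  proof
    show "0 \<le> (\<Sum>i\<in>UNIV. C i)" using C by (simp add: sum_nonneg)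
    fix x assume "x \<in> S"
    have "norm (f x) \<le> (\<Sum>i\<in>UNIV. \<bar>f x $ i\<bar>)" by (rule norm_le_l1_cart)
    also have "\<dots> \<le> (\<Sum>i\<in>UNIV. C i)" using C \<open>x \<in> S\<close> by (intro sum_mono) auto
    finally show "norm (f x) \<le> (\<Sum>i\<in>UNIV. C i)" .
  qed
qed

text \<open>The gradient or curl of a field is defined pointwise by a choice of derivative, hence arbitrary on
the mesh skeleton. Setting it to zero there makes it measurable and does not affect its traces.\<close>

definition on_cells :: "(real^3 \<Rightarrow> 'a::zero) \<Rightarrow> real^3 \<Rightarrow> 'a" where
  "on_cells f x = (if x \<in> S then f x else 0)"

lemma on_cells_measurable:
  assumes "pw_poly n f"
  shows "on_cells f \<in> borel_measurable L"
proof -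
  have "\<forall>K\<in>T. \<exists>p. p \<in> Pk n \<and> (\<forall>x\<in>interior K. f x = p x)"
    using assms unfolding pw_poly_def by blast
  from bchoice[OF this] obtain p where p: "\<forall>K\<in>T. p K \<in> Pk n \<and> (\<forall>x\<in>interior K. f x = p K x)" by blast
  have "on_cells f x = (\<Sum>K\<in>T. indicator (interior K) x * p K x)" for x
  proof (cases "x \<in> S")
    case True
    then obtain K where K: "K \<in> T" "x \<in> interior K" by (auto simp: S_def)
    have "(\<Sum>K'\<in>T. indicator (interior K') x * p K' x) = (\<Sum>K'\<in>T. if K' = K then p K x else 0)"
    proof (intro sum.cong refl)
      fix K' assume "K' \<in> T"
      then show "indicator (interior K') x * p K' x = (if K' = K then p K x else 0)"
        using K interior_cell_unique[OF K(1) \<open>K' \<in> T\<close> K(2)] interior_subset[of K'] by (auto simp: indicator_def)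
    qed
    also have "\<dots> = p K x" using K domain(4) by simp
    finally show ?thesis using True K p by (simp add: on_cells_def)
  next
    case False
    then show ?thesis by (auto simp: on_cells_def S_def intro!: sum.neutral[symmetric])
  qed
  then have eq: "on_cells f = (\<lambda>x. \<Sum>K\<in>T. indicator (interior K) x * p K x)" by blast
  have "(\<lambda>x. \<Sum>K\<in>T. indicator (interior K) x * p K x) \<in> borel_measurable borel"
  proof (intro borel_measurable_sum borel_measurable_times borel_measurable_indicator)
    fix K assume "K \<in> T"
    then show "p K \<in> borel_measurable borel"
      using p Pk_continuous by (intro borel_measurable_continuous_onI) blast
  qed auto
  then have "on_cells f \<in> borel_measurable lebesgue"
    unfolding eq by (intro measurable_completion) simp
  then show ?thesis by (rule measurable_restrict_space1)
qed

lemma measurable_vec: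
  fixes f :: "'x \<Rightarrow> real^3"
  assumes "\<And>i. (\<lambda>x. f x $ i) \<in> borel_measurable M"
  shows "f \<in> borel_measurable M"
proof (rule borel_measurable_euclidean_space[THEN iffD2], intro ballI)
  fix b :: "real^3" assume "b \<in> Basis"
  then obtain i where "b = axis i 1" by (auto simp: Basis_vec_def)
  then show "(\<lambda>x. f x \<bullet> b) \<in> borel_measurable M" using assms[of i] by (simp add: inner_axis)
qed

lemma measurable_nth:
  fixes f :: "'x \<Rightarrow> real^3"
  assumes "f \<in> borel_measurable M"
  shows "(\<lambda>x. f x $ i) \<in> borel_measurable M"
  by (rule borel_measurable_continuous_on[OF _ assms]) (intro continuous_intros)

lemma on_cells_vec_measurable:
  assumes "pw_polyvec n f"
  shows "on_cells f \<in> borel_measurable L"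
proof (rule measurable_vec)
  fix i
  have "(\<lambda>x. on_cells f x $ i) = on_cells (\<lambda>x. f x $ i)" by (auto simp: on_cells_def)
  then show "(\<lambda>x. on_cells f x $ i) \<in> borel_measurable L" using on_cells_measurable assms by metis
qed

lemma L2_if_bounded:
  fixes f :: "real^3 \<Rightarrow> 'b::euclidean_space"
  assumes "f \<in> borel_measurable L" "\<And>x. x \<in> S \<Longrightarrow> norm (f x) \<le> C"
  shows "f \<in> L2 \<Omega>"
proof -
  have "integrable L (\<lambda>x. (norm (f x))\<^sup>2)"
    using assms(1) by (intro integrable_if_bounded[of _ "C\<^sup>2"]) (auto intro!: power_mono assms(2) borel_measurable_power borel_measurable_norm)
  then show ?thesis using assms(1) by (simp add: L2_def)
qed

lemma L2_measurable: "f \<in> L2 \<Omega> \<Longrightarrow> f \<in> borel_measurable L"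
  by (simp add: L2_def)

lemma L2_inner_integrable:
  fixes f g :: "real^3 \<Rightarrow> 'b::euclidean_space"
  assumes "f \<in> L2 \<Omega>" "g \<in> L2 \<Omega>"
  shows "integrable L (\<lambda>x. f x \<bullet> g x)"
proof (rule Bochner_Integration.integrable_bound)
  show "integrable L (\<lambda>x. (norm (f x))\<^sup>2 + (norm (g x))\<^sup>2)" using assms by (simp add: L2_def)
  show "(\<lambda>x. f x \<bullet> g x) \<in> borel_measurable L" using assms by (intro borel_measurable_inner) (auto simp: L2_def)
  show "AE x in L. norm (f x \<bullet> g x) \<le> norm ((norm (f x))\<^sup>2 + (norm (g x))\<^sup>2)"
  proof (rule AE_I2)
    fix x
    have "\<bar>f x \<bullet> g x\<bar> \<le> norm (f x) * norm (g x)" by (rule Cauchy_Schwarz_ineq2)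
    also have "\<dots> \<le> (norm (f x))\<^sup>2 + (norm (g x))\<^sup>2"
    proof -
      have "2 * (norm (f x) * norm (g x)) \<le> (norm (f x))\<^sup>2 + (norm (g x))\<^sup>2"
        using sum_squares_bound[of "norm (f x)" "norm (g x)"] by (simp only: mult.assoc)
      moreover have "0 \<le> norm (f x) * norm (g x)" by simp
      ultimately show ?thesis by linarith
    qed
    finally show "norm (f x \<bullet> g x) \<le> norm ((norm (f x))\<^sup>2 + (norm (g x))\<^sup>2)" by simp
  qed
qed

lemma L2_mult_integrable:
  fixes f g :: "real^3 \<Rightarrow> real"
  assumes "f \<in> L2 \<Omega>" "g \<in> L2 \<Omega>"
  shows "integrable L (\<lambda>x. f x * g x)"
  using L2_inner_integrable[OF assms] by simp

lemma L2_cmult: "f \<in> L2 \<Omega> \<Longrightarrow> (\<lambda>x. c *\<^sub>R f x) \<in> L2 \<Omega>"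
  by (auto simp: L2_def power_mult_distrib)

lemma L2_add:
  assumes "f \<in> L2 \<Omega>" "g \<in> L2 \<Omega>"
  shows "(\<lambda>x. f x + g x) \<in> L2 \<Omega>"
proof -
  have "integrable L (\<lambda>x. (norm (f x))\<^sup>2 + (norm (g x))\<^sup>2 + 2 * (f x \<bullet> g x))"
    using assms L2_inner_integrable[OF assms] by (auto simp: L2_def)
  moreover have "(\<lambda>x. (norm (f x))\<^sup>2 + (norm (g x))\<^sup>2 + 2 * (f x \<bullet> g x)) = (\<lambda>x. (norm (f x + g x))\<^sup>2)"
    by (auto simp: power2_norm_eq_inner inner_add inner_commute)
  ultimately show ?thesis using assms by (auto simp: L2_def)
qed

lemma L2_nth:
  fixes f :: "real^3 \<Rightarrow> real^3"
  assumes "f \<in> L2 \<Omega>"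
  shows "(\<lambda>x. f x $ i) \<in> L2 \<Omega>"
proof -
  have m: "(\<lambda>x. f x $ i) \<in> borel_measurable L" by (rule measurable_nth[OF L2_measurable[OF assms]])
  have "integrable L (\<lambda>x. (norm (f x $ i))\<^sup>2)"
  proof (rule Bochner_Integration.integrable_bound)
    show "integrable L (\<lambda>x. (norm (f x))\<^sup>2)" using assms by (simp add: L2_def)
    show "(\<lambda>x. (norm (f x $ i))\<^sup>2) \<in> borel_measurable L" using m by simp
    show "AE x in L. norm ((norm (f x $ i))\<^sup>2) \<le> norm ((norm (f x))\<^sup>2)"
    proof (intro AE_I2)
      fix x
      show "norm ((norm (f x $ i))\<^sup>2) \<le> norm ((norm (f x))\<^sup>2)"
        using power_mono[OF component_le_norm_cart[of "f x" i] abs_ge_zero, of 2] by simp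
    qed
  qed
  then show ?thesis using m by (simp add: L2_def)
qed

lemma L2_const: "(\<lambda>x. c) \<in> L2 \<Omega>"
  using L2_if_bounded[of "\<lambda>x. c" "norm c"] by simp

lemma L2_integrable: "f \<in> L2 \<Omega> \<Longrightarrow> integrable L (f :: real^3 \<Rightarrow> real)"
  using L2_mult_integrable[OF _ L2_const[of 1]] by simp

end

section \<open>Weak derivatives of piecewise polynomial fields\<close>

lemma test_function_C1: "test_function A \<psi> \<Longrightarrow> C1 \<psi>"
  unfolding test_function_def using times_cont_diff_imp_C1[of 0 \<psi>] by blast

lemma test_function_compact: "test_function A \<psi> \<Longrightarrow> compact (closure {x. \<psi> x \<noteq> 0})"
  unfolding test_function_def by blast

lemma test_function_continuous: "test_function A \<psi> \<Longrightarrow> continuous_on UNIV \<psi>"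
  by (rule C1_continuous_on[OF test_function_C1])

lemma test_function_mono: "test_function A \<psi> \<Longrightarrow> A \<subseteq> B \<Longrightarrow> test_function B \<psi>"
  unfolding test_function_def by blast

lemma test_function_outside: "test_function A \<psi> \<Longrightarrow> x \<notin> A \<Longrightarrow> \<psi> x = 0"
  unfolding test_function_def using closure_subset[of "{x. \<psi> x \<noteq> 0}"] by blast

lemma test_function_partial_deriv:
  assumes "test_function A \<psi>"
  shows "test_function A (partial_deriv i \<psi>)"
proof -
  have sub: "closure {x. partial_deriv i \<psi> x \<noteq> 0} \<subseteq> closure {x. \<psi> x \<noteq> 0}" by (rule partial_deriv_support)
  have "times_cont_diff n (partial_deriv i \<psi>)" for n
  proof -
    have "times_cont_diff (Suc n) \<psi>" using assms unfolding test_function_def by blast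
    then show ?thesis by simp
  qed
  moreover have "compact (closure {x. partial_deriv i \<psi> x \<noteq> 0})"
  proof -
    have "compact (closure {x. \<psi> x \<noteq> 0} \<inter> closure {x. partial_deriv i \<psi> x \<noteq> 0})"
      by (rule compact_Int_closed[OF test_function_compact[OF assms] closed_closure])
    then show ?thesis using sub by (simp add: inf.absorb2)
  qed
  moreover have "closure {x. partial_deriv i \<psi> x \<noteq> 0} \<subseteq> A"
    using sub assms unfolding test_function_def by blast
  ultimately show ?thesis unfolding test_function_def by blast
qed

lemma test_function_zero: "test_function A (\<lambda>x. 0)"
proof -
  have "smooth_alg (\<lambda>x. 0)" by (rule smooth_alg.const)
  then show ?thesis using smooth_alg_times_cont_diff by (simp add: test_function_def)
qed

lemma test_function_mixed:
  assumes "test_function A \<psi>"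
  shows "partial_deriv j (partial_deriv i \<psi>) = partial_deriv i (partial_deriv j \<psi>)"
proof -
  have "times_cont_diff 3 \<psi>" using assms unfolding test_function_def by blast
  then show ?thesis using mixed_partial_derivs_commute by blast
qed

lemma curl_nth:
  "curl f x $ 1 = partial_deriv 2 (\<lambda>y. f y $ 3) x - partial_deriv 3 (\<lambda>y. f y $ 2) x"
  "curl f x $ 2 = partial_deriv 3 (\<lambda>y. f y $ 1) x - partial_deriv 1 (\<lambda>y. f y $ 3) x"
  "curl f x $ 3 = partial_deriv 1 (\<lambda>y. f y $ 2) x - partial_deriv 2 (\<lambda>y. f y $ 1) x"
  by (simp_all add: curl_def)

lemma inner3: "(a::real^3) \<bullet> b = a $ 1 * b $ 1 + a $ 2 * b $ 2 + a $ 3 * b $ 3"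
  by (simp add: inner_vec_def sum_3)

context mesh
begin

lemma continuous_L2:
  fixes f :: "real^3 \<Rightarrow> real"
  assumes "continuous_on UNIV f"
  shows "f \<in> L2 \<Omega>"
proof -
  have cpt: "compact (f ` closure \<Omega>)"
    using domain(2) assms by (intro compact_continuous_image) (auto intro: continuous_on_subset)
  obtain C where "\<forall>y\<in>f ` closure \<Omega>. norm y \<le> C"
    using compact_imp_bounded[OF cpt] unfolding bounded_iff by blast
  then have C: "norm (f x) \<le> C" if "x \<in> S" for x
    using that S_subset closure_subset by blast
  have "f \<in> borel_measurable borel" using assms by (rule borel_measurable_continuous_onI)
  then have "f \<in> borel_measurable lebesgue" by (intro measurable_completion) simp
  then have "f \<in> borel_measurable L" by (rule measurable_restrict_space1)
  then show ?thesis using C by (rule L2_if_bounded)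
qed

lemma test_function_L2: "test_function A \<psi> \<Longrightarrow> \<psi> \<in> L2 \<Omega>"
  by (intro continuous_L2 test_function_continuous)

lemma L2_vec:
  fixes f :: "real^3 \<Rightarrow> real^3"
  assumes "\<And>i. (\<lambda>x. f x $ i) \<in> L2 \<Omega>"
  shows "f \<in> L2 \<Omega>"
proof -
  have "integrable L (\<lambda>x. (f x $ 1 * f x $ 1 + f x $ 2 * f x $ 2) + f x $ 3 * f x $ 3)"
    by (intro Bochner_Integration.integrable_add L2_mult_integrable assms)
  then have "integrable L (\<lambda>x. f x \<bullet> f x)" by (simp add: inner3)
  moreover have "f \<in> borel_measurable L"
    by (intro measurable_vec L2_measurable[OF assms])
  ultimately show ?thesis by (simp add: L2_def power2_norm_eq_inner)
qed

lemma grad_test_function_L2: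
  assumes "test_function A \<psi>"
  shows "grad \<psi> \<in> L2 \<Omega>"
proof (rule L2_vec)
  fix i
  show "(\<lambda>x. grad \<psi> x $ i) \<in> L2 \<Omega>"
    using test_function_L2[OF test_function_partial_deriv[OF assms, of i]] by (simp add: grad_def)
qed

lemma integral_L_eq_lborel:
  fixes f :: "real^3 \<Rightarrow> real"
  assumes "f \<in> borel_measurable borel" "\<And>x. x \<notin> \<Omega> \<Longrightarrow> f x = 0"
  shows "(LINT x|L. f x) = (LINT x|lborel. f x)"
proof -
  have "(LINT x|L. f x) = (LINT x|lebesgue. indicator \<Omega> x *\<^sub>R f x)"
    by (rule integral_restrict_space[OF domain_sets(2)])
  also have "\<dots> = (LINT x|lebesgue. f x)"
    by (intro Bochner_Integration.integral_cong refl) (use assms(2) in \<open>auto simp: indicator_def\<close>)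
  also have "\<dots> = (LINT x|lborel. f x)" using assms(1) by (intro integral_completion) simp
  finally show ?thesis .
qed

text \<open>The product with the test function is compactly supported, so its derivative has integral zero.\<close>

lemma integral_by_parts:
  assumes p: "C1 p" and \<psi>: "test_function \<Omega> \<psi>"
  shows "(LINT x|L. p x * partial_deriv i \<psi> x) = - (LINT x|L. partial_deriv i p x * \<psi> x)"
proof -
  note \<psi>1 = test_function_C1[OF \<psi>] and d\<psi> = test_function_partial_deriv[OF \<psi>, of i]
  have sub: "closure {x. p x * \<psi> x \<noteq> 0} \<subseteq> closure {x. \<psi> x \<noteq> 0}" by (rule closure_mono) auto
  have "compact (closure {x. \<psi> x \<noteq> 0} \<inter> closure {x. p x * \<psi> x \<noteq> 0})"
    by (rule compact_Int_closed[OF test_function_compact[OF \<psi>] closed_closure])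
  then have "compact (closure {x. p x * \<psi> x \<noteq> 0})" using sub by (simp add: inf.absorb2)
  with C1_mult[OF p \<psi>1] have zero: "(LINT x|lborel. partial_deriv i (\<lambda>x. p x * \<psi> x) x) = 0"
    by (rule integral_partial_deriv_lborel)
  have eq: "partial_deriv i (\<lambda>x. p x * \<psi> x) = (\<lambda>x. partial_deriv i p x * \<psi> x + p x * partial_deriv i \<psi> x)"
    using p \<psi>1 by (intro ext partial_deriv_mult) (auto simp: C1_def)
  have cont: "continuous_on UNIV (partial_deriv i p)" "continuous_on UNIV p"
    using p C1_continuous_on by (auto simp: C1_def)
  have "(LINT x|L. partial_deriv i p x * \<psi> x + p x * partial_deriv i \<psi> x) = 0"
  proof (subst integral_L_eq_lborel)
    show "(\<lambda>x. partial_deriv i p x * \<psi> x + p x * partial_deriv i \<psi> x) \<in> borel_measurable borel"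
      using cont test_function_continuous[OF \<psi>] test_function_continuous[OF d\<psi>]
      by (intro borel_measurable_continuous_onI continuous_intros)
  qed (use zero eq test_function_outside[OF \<psi>] test_function_outside[OF d\<psi>] in auto)
  moreover have "integrable L (\<lambda>x. partial_deriv i p x * \<psi> x)" "integrable L (\<lambda>x. p x * partial_deriv i \<psi> x)"
    using continuous_L2[OF cont(1)] continuous_L2[OF cont(2)] test_function_L2[OF \<psi>] test_function_L2[OF d\<psi>]
    by (auto intro: L2_mult_integrable)
  ultimately show ?thesis by simp
qed

lemma integral_by_parts_cell:
  assumes K: "K \<in> T" and p: "p \<in> Pk n" "\<And>x. x \<in> interior K \<Longrightarrow> f x = p x"
    and \<psi>: "test_function (interior K) \<psi>"
  shows "(LINT x|L. f x * partial_deriv i \<psi> x) = - (LINT x|L. partial_deriv i p x * \<psi> x)"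
proof -
  have "(LINT x|L. f x * partial_deriv i \<psi> x) = (LINT x|L. p x * partial_deriv i \<psi> x)"
    using p(2) test_function_outside[OF test_function_partial_deriv[OF \<psi>, of i]]
    by (intro Bochner_Integration.integral_cong refl) (metis mult_zero_right)
  also have "\<dots> = - (LINT x|L. partial_deriv i p x * \<psi> x)"
    using test_function_mono[OF \<psi> interior_cell_subset[OF K]] Pk_C1[OF p(1)] by (intro integral_by_parts)
  finally show ?thesis .
qed

lemma AE_cells:
  assumes "\<And>K. K \<in> T \<Longrightarrow> AE x in L. x \<in> interior K \<longrightarrow> P x"
  shows "AE x in L. P x"
proof -
  have "AE x in L. \<forall>K\<in>T. x \<in> interior K \<longrightarrow> P x"
    unfolding AE_ball_countable[OF countable_finite[OF domain(4)]] using assms by blast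
  with AE_S show ?thesis by eventually_elim (auto simp: S_def)
qed

text \<open>Inside a cell the field is a smooth polynomial, and integration by parts against test functions
supported there identifies the weak gradient; the skeleton is a null set.\<close>

lemma weak_grad_eq_grad:
  assumes f: "pw_poly n f" and g: "has_weak_grad \<Omega> f g"
  shows "AE x in L. g x = grad f x"
proof (rule AE_cells)
  fix K assume K: "K \<in> T"
  obtain p where p: "p \<in> Pk n" "\<And>x. x \<in> interior K \<Longrightarrow> f x = p x" using f K unfolding pw_poly_def by blast
  have gi: "(\<lambda>x. g x $ i) \<in> L2 \<Omega>" for i using g L2_nth by (simp add: has_weak_grad_def)
  have pi: "partial_deriv i p \<in> L2 \<Omega>" for i
    using Pk_continuous[OF Pk_partial_deriv[OF p(1)]] by (intro continuous_L2)
  have "AE x in L. x \<in> interior K \<longrightarrow> g x $ i - partial_deriv i p x = 0" for i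
  proof (rule fundamental_lemma_calculus_of_variations[OF open_interior interior_cell_subset[OF K] domain_sets(1)])
    show "integrable L (\<lambda>x. g x $ i - partial_deriv i p x)"
      using L2_integrable[OF gi] L2_integrable[OF pi] by simp
    fix \<psi> assume \<psi>: "test_function (interior K) \<psi>"
    have "(LINT x|L. g x $ i * \<psi> x) = (LINT x|L. partial_deriv i p x * \<psi> x)"
      using integral_by_parts_cell[OF K p \<psi>, of i] g test_function_mono[OF \<psi> interior_cell_subset[OF K]]
      by (simp add: has_weak_grad_def)
    moreover have "integrable L (\<lambda>x. g x $ i * \<psi> x)" "integrable L (\<lambda>x. partial_deriv i p x * \<psi> x)"
      using L2_mult_integrable[OF gi test_function_L2[OF \<psi>]] L2_mult_integrable[OF pi test_function_L2[OF \<psi>]] by auto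
    ultimately show "(LINT x|L. (g x $ i - partial_deriv i p x) * \<psi> x) = 0"
      by (simp add: left_diff_distrib)
  qed
  then have "AE x in L. \<forall>i. x \<in> interior K \<longrightarrow> g x $ i - partial_deriv i p x = 0"
    unfolding AE_all_countable by blast
  then show "AE x in L. x \<in> interior K \<longrightarrow> g x = grad f x"
  proof eventually_elim
    case (elim x)
    show ?case
    proof
      assume x: "x \<in> interior K"
      have "partial_deriv i f x = partial_deriv i p x" for i
        by (rule partial_deriv_cong_open[OF open_interior x]) (rule p(2))
      then show "g x = grad f x" using elim x by (simp add: grad_def vec_eq_iff)
    qed
  qed
qed

lemma partial_deriv_axis:
  "partial_deriv a (\<lambda>y. axis k (\<psi> y) $ b) x = (if b = k then partial_deriv a \<psi> x else 0)"
proof (cases "b = k")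
  case False
  then have "(\<lambda>y. axis k (\<psi> y) $ b) = (\<lambda>y. 0)" by (simp add: axis_def)
  then show ?thesis using False partial_deriv_eqI[OF has_derivative_const] by simp
qed (simp add: axis_def)

lemma weak_curl_eq_curl:
  assumes f: "pw_polyvec n f" and "f \<in> L2 \<Omega>" and g: "has_weak_curl \<Omega> f g"
  shows "AE x in L. g x = curl f x"
proof (rule AE_cells)
  fix K assume K: "K \<in> T"
  have "\<forall>i. \<exists>p. p \<in> Pk n \<and> (\<forall>x\<in>interior K. f x $ i = p x)" using f K unfolding pw_poly_def by blast
  from choice[OF this] obtain p where p: "\<And>i. p i \<in> Pk n" "\<And>i x. x \<in> interior K \<Longrightarrow> f x $ i = p i x" by blast
  have gi: "(\<lambda>x. g x $ i) \<in> L2 \<Omega>" for i using g L2_nth by (simp add: has_weak_curl_def)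
  have fi: "(\<lambda>x. f x $ i) \<in> L2 \<Omega>" for i using assms(2) L2_nth by blast
  have pi: "partial_deriv i (p j) \<in> L2 \<Omega>" for i j
    using Pk_continuous[OF Pk_partial_deriv[OF p(1)]] by (intro continuous_L2)
  \<comment> \<open>The component \<open>l\<close> is tested with \<open>\<psi>\<close> times the unit vector \<open>l\<close>; then \<open>a\<close> and \<open>b\<close> are the other two
    indices, in cyclic order.\<close>
  have comp: "AE x in L. x \<in> interior K \<longrightarrow> g x $ l - (partial_deriv a (p b) x - partial_deriv b (p a) x) = 0"
    if eq: "\<And>\<psi> x. f x \<bullet> curl (\<lambda>y. axis l (\<psi> y)) x = f x $ a * partial_deriv b \<psi> x - f x $ b * partial_deriv a \<psi> x"
    for l a b
  proof (rule fundamental_lemma_calculus_of_variations[OF open_interior interior_cell_subset[OF K] domain_sets(1)])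
    show "integrable L (\<lambda>x. g x $ l - (partial_deriv a (p b) x - partial_deriv b (p a) x))"
      using L2_integrable[OF gi] L2_integrable[OF pi] by simp
    fix \<psi> assume \<psi>: "test_function (interior K) \<psi>"
    have \<psi>\<Omega>: "test_function \<Omega> \<psi>" using test_function_mono[OF \<psi> interior_cell_subset[OF K]] .
    have "test_function \<Omega> (\<lambda>x. axis l (\<psi> x) $ i)" for i
      using \<psi>\<Omega> test_function_zero[of \<Omega>] by (cases "i = l") (simp_all add: axis_def)
    then have "(LINT x|L. g x \<bullet> axis l (\<psi> x)) = (LINT x|L. f x \<bullet> curl (\<lambda>y. axis l (\<psi> y)) x)"
      using g by (simp add: has_weak_curl_def)
    also have "\<dots> = (LINT x|L. f x $ a * partial_deriv b \<psi> x) - (LINT x|L. f x $ b * partial_deriv a \<psi> x)"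
      unfolding eq using L2_mult_integrable[OF fi test_function_L2[OF test_function_partial_deriv[OF \<psi>]]]
      by (intro Bochner_Integration.integral_diff)
    also have "\<dots> = (LINT x|L. partial_deriv a (p b) x * \<psi> x) - (LINT x|L. partial_deriv b (p a) x * \<psi> x)"
      using integral_by_parts_cell[OF K p(1) p(2) \<psi>, of a b] integral_by_parts_cell[OF K p(1) p(2) \<psi>, of b a] by simp
    finally have "(LINT x|L. g x $ l * \<psi> x) = \<dots>" by (simp add: inner_axis)
    moreover have "integrable L (\<lambda>x. g x $ l * \<psi> x)" "integrable L (\<lambda>x. partial_deriv i (p j) x * \<psi> x)" for i j
      using L2_mult_integrable[OF gi test_function_L2[OF \<psi>]] L2_mult_integrable[OF pi test_function_L2[OF \<psi>]] by auto
    ultimately show "(LINT x|L. (g x $ l - (partial_deriv a (p b) x - partial_deriv b (p a) x)) * \<psi> x) = 0"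
      by (simp add: left_diff_distrib)
  qed
  have "AE x in L. x \<in> interior K \<longrightarrow> g x $ 1 - (partial_deriv 2 (p 3) x - partial_deriv 3 (p 2) x) = 0"
    "AE x in L. x \<in> interior K \<longrightarrow> g x $ 2 - (partial_deriv 3 (p 1) x - partial_deriv 1 (p 3) x) = 0"
    "AE x in L. x \<in> interior K \<longrightarrow> g x $ 3 - (partial_deriv 1 (p 2) x - partial_deriv 2 (p 1) x) = 0"
    by (intro comp; simp add: inner3 curl_nth partial_deriv_axis)+
  then show "AE x in L. x \<in> interior K \<longrightarrow> g x = curl f x"
  proof eventually_elim
    case (elim x)
    show ?case
    proof
      assume x: "x \<in> interior K"
      have "partial_deriv i (\<lambda>x. f x $ j) x = partial_deriv i (p j) x" for i j
        by (rule partial_deriv_cong_open[OF open_interior x]) (rule p(2))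
      then show "g x = curl f x" using elim x by (simp add: vec_eq_iff forall_3 curl_nth)
    qed
  qed
qed

subsection \<open>The finite element spaces\<close>

lemma Qk_facts:
  assumes "f \<in> Qk \<Omega> T n"
  shows "f \<in> L2 \<Omega>" "pw_poly n f" "has_weak_grad \<Omega> f (wgrad \<Omega> f)" "AE x in L. wgrad \<Omega> f x = grad f x"
proof -
  show "f \<in> L2 \<Omega>" and pw: "pw_poly n f" using assms by (auto simp: Qk_def H1_def pw_poly_def)
  show w: "has_weak_grad \<Omega> f (wgrad \<Omega> f)"
    using assms unfolding wgrad_def Qk_def H1_def by (intro someI_ex[of "has_weak_grad \<Omega> f"]) auto
  show "AE x in L. wgrad \<Omega> f x = grad f x" by (rule weak_grad_eq_grad[OF pw w])
qed

lemma Qkvec_facts: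
  assumes "f \<in> Qkvec \<Omega> T n"
  shows "(\<lambda>x. f x $ i) \<in> Qk \<Omega> T n" "pw_polyvec n f" "f \<in> borel_measurable L"
proof -
  show i: "(\<lambda>x. f x $ i) \<in> Qk \<Omega> T n" for i using assms by (simp add: Qkvec_def)
  show "pw_polyvec n f" using Qk_facts(2)[OF i] by blast
  show "f \<in> borel_measurable L" using Qk_facts(1)[OF i] L2_measurable by (intro measurable_vec) blast
qed

lemma pw_polyvec_cross:
  assumes "\<forall>K\<in>T. \<exists>p\<in>Pkvec n. \<exists>q\<in>Pkvec n. \<forall>x\<in>interior K. f x = p x + cross3 x (q x)"
  shows "pw_polyvec (Suc n) f"
proof
  fix i
  show "pw_poly (Suc n) (\<lambda>x. f x $ i)"
    unfolding pw_poly_def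
  proof
    fix K assume "K \<in> T"
    then obtain p q where pq: "p \<in> Pkvec n" "q \<in> Pkvec n" "\<And>x. x \<in> interior K \<Longrightarrow> f x = p x + cross3 x (q x)"
      using assms by blast
    have p: "(\<lambda>x. p x $ j) \<in> Pk (Suc n)" for j
      using pq(1) Pk_mono[of _ n "Suc n"] by (simp add: Pkvec_def)
    have q: "(\<lambda>x. x $ j * q x $ l) \<in> Pk (Suc n)" for j l
      using pq(2) Pk_mult_coordinate by (simp add: Pkvec_def)
    have "(\<lambda>x. (p x + cross3 x (q x)) $ j) \<in> Pk (Suc n)" for j
      using exhaust_3[of j] by (elim disjE) (auto simp: cross3_def intro!: Pk_add[OF p Pk_diff[OF q q]])
    then show "\<exists>p\<in>Pk (Suc n). \<forall>x\<in>interior K. f x $ i = p x"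
      using pq(3) by (intro bexI[of _ "\<lambda>x. (p x + cross3 x (q x)) $ i"]) auto
  qed
qed

lemma pw_polyvec_radial:
  assumes "\<forall>K\<in>T. \<exists>p\<in>Pkvec n. \<exists>q\<in>Pk n. \<forall>x\<in>interior K. f x = p x + q x *\<^sub>R x"
  shows "pw_polyvec (Suc n) f"
proof
  fix i
  show "pw_poly (Suc n) (\<lambda>x. f x $ i)"
    unfolding pw_poly_def
  proof
    fix K assume "K \<in> T"
    then obtain p q where pq: "p \<in> Pkvec n" "q \<in> Pk n" "\<And>x. x \<in> interior K \<Longrightarrow> f x = p x + q x *\<^sub>R x"
      using assms by blast
    have p: "(\<lambda>x. p x $ i) \<in> Pk (Suc n)"
      using pq(1) Pk_mono[of _ n "Suc n"] by (simp add: Pkvec_def)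
    have q: "(\<lambda>x. x $ i * q x) \<in> Pk (Suc n)"
      using pq(2) Pk_mult_coordinate by simp
    from Pk_add[OF p q] show "\<exists>p\<in>Pk (Suc n). \<forall>x\<in>interior K. f x $ i = p x"
      using pq(3) by (intro bexI[of _ "\<lambda>x. p x $ i + x $ i * q x"]) (auto simp: mult.commute)
  qed
qed

lemma Nk_facts:
  assumes "f \<in> Nk \<Omega> T n"
  shows "f \<in> L2 \<Omega>" "pw_polyvec (Suc n) f" "has_weak_curl \<Omega> f (wcurl \<Omega> f)" "AE x in L. wcurl \<Omega> f x = curl f x"
proof -
  show l2: "f \<in> L2 \<Omega>" using assms by (auto simp: Nk_def Hcurl_def)
  show pw: "pw_polyvec (Suc n) f" using assms by (intro pw_polyvec_cross) (simp add: Nk_def)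
  show w: "has_weak_curl \<Omega> f (wcurl \<Omega> f)"
    using assms unfolding wcurl_def Nk_def Hcurl_def by (intro someI_ex[of "has_weak_curl \<Omega> f"]) auto
  show "AE x in L. wcurl \<Omega> f x = curl f x" by (rule weak_curl_eq_curl[OF pw l2 w])
qed

lemma RTk_facts:
  assumes "f \<in> RTk \<Omega> T n"
  shows "f \<in> L2 \<Omega>" "pw_polyvec (Suc n) f"
  using assms pw_polyvec_radial[of n f] by (auto simp: RTk_def Hdiv_def)

lemma const_in_Qk: "(\<lambda>x. c) \<in> Qk \<Omega> T n" and AE_wgrad_const: "AE x in L. wgrad \<Omega> (\<lambda>x. c) x = 0"
proof -
  have d0: "partial_deriv i (\<lambda>x. c) x = 0" for i x
    using partial_deriv_eqI[OF has_derivative_const] by simp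
  have C1: "C1 (\<lambda>x. c)" using Pk_C1[OF Pk_const[of c 0]] .
  have "has_weak_grad \<Omega> (\<lambda>x. c) (\<lambda>x. 0)"
    unfolding has_weak_grad_def using integral_by_parts[OF C1] L2_const by (simp add: d0)
  then show c: "(\<lambda>x. c) \<in> Qk \<Omega> T n"
    using L2_const[of c] pw_poly_const[of n c] unfolding Qk_def H1_def pw_poly_def by auto
  have "grad (\<lambda>x. c) x = 0" for x by (simp add: grad_def d0 vec_eq_iff)
  then show "AE x in L. wgrad \<Omega> (\<lambda>x. c) x = 0" using Qk_facts(4)[OF c] by simp
qed

text \<open>Closure under sums and multiples in one condition. It is satisfied by all discrete spaces, and
together with the piecewise polynomial form it is all that the time calculus uses.\<close>

definition lin_closed :: "(real^3 \<Rightarrow> 'a::real_vector) set \<Rightarrow> bool" where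
  "lin_closed V \<longleftrightarrow> (\<forall>f\<in>V. \<forall>g\<in>V. \<forall>c. (\<lambda>x. f x + c *\<^sub>R g x) \<in> V)"

lemma Qk_lin_closed: "lin_closed (Qk \<Omega> T n)"
  unfolding lin_closed_def
proof (intro ballI allI)
  fix f g :: "real^3 \<Rightarrow> real" and c :: real assume f: "f \<in> Qk \<Omega> T n" and g: "g \<in> Qk \<Omega> T n"
  let ?w = "\<lambda>x. wgrad \<Omega> f x + c *\<^sub>R wgrad \<Omega> g x"
  have L2: "wgrad \<Omega> f \<in> L2 \<Omega>" "wgrad \<Omega> g \<in> L2 \<Omega>"
    using Qk_facts(3)[OF f] Qk_facts(3)[OF g] by (auto simp: has_weak_grad_def)
  have "has_weak_grad \<Omega> (\<lambda>x. f x + c * g x) ?w"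
    unfolding has_weak_grad_def
  proof (intro conjI allI impI)
    show "?w \<in> L2 \<Omega>" by (intro L2_add L2_cmult L2)
    fix \<psi> i assume \<psi>: "test_function \<Omega> \<psi>"
    note t = test_function_L2[OF \<psi>] test_function_L2[OF test_function_partial_deriv[OF \<psi>, of i]]
    have "(LINT x|L. (f x + c * g x) * partial_deriv i \<psi> x)
        = (LINT x|L. f x * partial_deriv i \<psi> x) + c * (LINT x|L. g x * partial_deriv i \<psi> x)"
      using L2_mult_integrable[OF Qk_facts(1)[OF f] t(2)] L2_mult_integrable[OF Qk_facts(1)[OF g] t(2)]
      by (simp add: distrib_right mult.assoc)
    also have "\<dots> = - (LINT x|L. wgrad \<Omega> f x $ i * \<psi> x) + c * - (LINT x|L. wgrad \<Omega> g x $ i * \<psi> x)"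
      using Qk_facts(3)[OF f] Qk_facts(3)[OF g] \<psi> by (simp add: has_weak_grad_def)
    also have "\<dots> = - (LINT x|L. ?w x $ i * \<psi> x)"
      using L2_mult_integrable[OF L2_nth[OF L2(1)] t(1)] L2_mult_integrable[OF L2_nth[OF L2(2)] t(1)]
      by (simp add: distrib_right mult.assoc)
    finally show "(LINT x|L. (f x + c * g x) * partial_deriv i \<psi> x) = - (LINT x|L. ?w x $ i * \<psi> x)" .
  qed
  moreover have "(\<lambda>x. f x + c * g x) \<in> L2 \<Omega>"
    using L2_add[OF Qk_facts(1)[OF f] L2_cmult[OF Qk_facts(1)[OF g], of c]] by simp
  moreover have "pw_poly n (\<lambda>x. f x + c * g x)"
    using Qk_facts(2)[OF f] Qk_facts(2)[OF g] by (intro pw_poly_add pw_poly_cmult)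
  ultimately show "(\<lambda>x. f x + c *\<^sub>R g x) \<in> Qk \<Omega> T n"
    unfolding Qk_def H1_def pw_poly_def by auto
qed

lemma Qkvec_lin_closed: "lin_closed (Qkvec \<Omega> T n)"
  using Qk_lin_closed[of n] by (auto simp: lin_closed_def Qkvec_def)

lemma pw_poly_trace:
  assumes K: "K \<in> T" "x \<in> K" and f: "pw_poly n f"
  obtains p where "p \<in> Pk n" "\<And>y. y \<in> interior K \<Longrightarrow> f y = p y" "\<And>y. y \<in> K \<Longrightarrow> cell_trace K f y = p y"
proof -
  obtain p where p: "p \<in> Pk n" "\<And>x. x \<in> interior K \<Longrightarrow> f x = p x" using f K(1) unfolding pw_poly_def by blast
  then show thesis using trace_eq[OF K(1) _ p(2) Pk_continuous[OF p(1)]] that by blast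
qed

lemma pw_polyvec_trace:
  assumes K: "K \<in> T" and f: "pw_polyvec n f"
  obtains p where "\<And>i. (\<lambda>x. p x $ i) \<in> Pk n" "\<And>y. y \<in> interior K \<Longrightarrow> f y = p y" "\<And>y. y \<in> K \<Longrightarrow> cell_trace K f y = p y"
proof -
  have "\<forall>i. \<exists>p. p \<in> Pk n \<and> (\<forall>x\<in>interior K. f x $ i = p x)" using f K unfolding pw_poly_def by blast
  from choice[OF this] obtain p where p: "\<And>i. p i \<in> Pk n" "\<And>i x. x \<in> interior K \<Longrightarrow> f x $ i = p i x" by blast
  let ?p = "\<lambda>x. \<chi> i. p i x"
  have eq: "f y = ?p y" if "y \<in> interior K" for y using p(2)[OF that] by (simp add: vec_eq_iff)
  have "continuous_on UNIV ?p" using p(1) Pk_continuous by (intro continuous_on_vec_lambda) blast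
  from trace_eq[OF K _ eq this] show thesis using p(1) eq by (intro that[of ?p]) auto
qed

lemma Pk_vec_continuous:
  fixes p :: "real^3 \<Rightarrow> real^3"
  assumes "\<And>i. (\<lambda>x. p x $ i) \<in> Pk n"
  shows "continuous_on A p"
proof -
  have "continuous_on A (\<lambda>x. \<chi> i. p x $ i)"
    by (intro continuous_on_vec_lambda Pk_continuous[OF assms])
  then show ?thesis by simp
qed

lemma Qk0_lin_closed: "lin_closed (Qk0 \<Omega> T n)"
  unfolding lin_closed_def
proof (intro ballI allI)
  fix f g :: "real^3 \<Rightarrow> real" and c :: real assume f: "f \<in> Qk0 \<Omega> T n" and g: "g \<in> Qk0 \<Omega> T n"
  then have Q: "f \<in> Qk \<Omega> T n" "g \<in> Qk \<Omega> T n" by (auto simp: Qk0_def)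
  have "cell_trace K (\<lambda>x. f x + c *\<^sub>R g x) x = 0" if K: "K \<in> T" "x \<in> K \<inter> frontier \<Omega>" for K x
  proof -
    have x: "x \<in> K" using K by simp
    obtain p where p: "p \<in> Pk n" "\<And>y. y \<in> interior K \<Longrightarrow> f y = p y" "\<And>y. y \<in> K \<Longrightarrow> cell_trace K f y = p y"
      by (rule pw_poly_trace[OF K(1) x Qk_facts(2)[OF Q(1)]]) blast
    obtain q where q: "q \<in> Pk n" "\<And>y. y \<in> interior K \<Longrightarrow> g y = q y" "\<And>y. y \<in> K \<Longrightarrow> cell_trace K g y = q y"
      by (rule pw_poly_trace[OF K(1) x Qk_facts(2)[OF Q(2)]]) blast
    have "cell_trace K (\<lambda>x. f x + c *\<^sub>R g x) x = p x + c * q x"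
      using p q by (intro trace_eq[OF K(1) x] continuous_intros Pk_continuous) auto
    then show ?thesis using f g K p(3)[OF x] q(3)[OF x] by (simp add: Qk0_def)
  qed
  moreover have "(\<lambda>x. f x + c *\<^sub>R g x) \<in> Qk \<Omega> T n" using Qk_lin_closed Q unfolding lin_closed_def by blast
  ultimately show "(\<lambda>x. f x + c *\<^sub>R g x) \<in> Qk0 \<Omega> T n" by (simp add: Qk0_def)
qed

lemma boundary_normal_mem:
  assumes "boundary_normal \<Omega> K x n"
  shows "x \<in> K"
proof -
  obtain r where r: "r > 0" "K \<inter> ball x r = {y. n \<bullet> (y - x) \<le> 0} \<inter> ball x r"
    using assms unfolding boundary_normal_def by blast
  then have "x \<in> {y. n \<bullet> (y - x) \<le> 0} \<inter> ball x r" by simp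
  then show ?thesis using r(2) by blast
qed

lemma RTk0_lin_closed: "lin_closed (RTk0 \<Omega> T k)"
  unfolding lin_closed_def
proof (intro ballI allI)
  fix f g :: "real^3 \<Rightarrow> real^3" and c :: real assume f: "f \<in> RTk0 \<Omega> T k" and g: "g \<in> RTk0 \<Omega> T k"
  let ?h = "\<lambda>x. f x + c *\<^sub>R g x"
  have Q: "f \<in> RTk \<Omega> T k" "g \<in> RTk \<Omega> T k" using f g by (auto simp: RTk0_def)
  note L2 = RTk_facts(1)[OF Q(1)] RTk_facts(1)[OF Q(2)]
  have "n \<bullet> cell_trace K ?h x = 0" if K: "K \<in> T" "boundary_normal \<Omega> K x n" for K x n
  proof -
    have x: "x \<in> K" using boundary_normal_mem K by blast
    obtain p where p: "\<And>i. (\<lambda>x. p x $ i) \<in> Pk (Suc k)" "\<And>y. y \<in> interior K \<Longrightarrow> f y = p y" "\<And>y. y \<in> K \<Longrightarrow> cell_trace K f y = p y"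
      by (rule pw_polyvec_trace[OF K(1) RTk_facts(2)[OF Q(1)]]) blast
    obtain q where q: "\<And>i. (\<lambda>x. q x $ i) \<in> Pk (Suc k)" "\<And>y. y \<in> interior K \<Longrightarrow> g y = q y" "\<And>y. y \<in> K \<Longrightarrow> cell_trace K g y = q y"
      by (rule pw_polyvec_trace[OF K(1) RTk_facts(2)[OF Q(2)]]) blast
    have "continuous_on UNIV p" "continuous_on UNIV q"
      using Pk_vec_continuous p(1) q(1) by blast+
    then have "cell_trace K ?h x = p x + c *\<^sub>R q x"
      using p(2) q(2) by (intro trace_eq[OF K(1) x] continuous_intros) auto
    moreover have "n \<bullet> cell_trace K f x = 0" "n \<bullet> cell_trace K g x = 0"
      using f g K unfolding RTk0_def by blast+
    ultimately show ?thesis using p(3)[OF x] q(3)[OF x] by (simp add: inner_add_right)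
  qed
  moreover have "?h \<in> RTk \<Omega> T k"
  proof -
    obtain u v where u: "has_weak_div \<Omega> f u" and v: "has_weak_div \<Omega> g v"
      using Q by (auto simp: RTk_def Hdiv_def)
    have uv: "u \<in> L2 \<Omega>" "v \<in> L2 \<Omega>" using u v by (auto simp: has_weak_div_def)
    have "has_weak_div \<Omega> ?h (\<lambda>x. u x + c * v x)"
      unfolding has_weak_div_def
    proof (intro conjI allI impI)
      show "(\<lambda>x. u x + c * v x) \<in> L2 \<Omega>" using L2_add[OF uv(1) L2_cmult[OF uv(2), of c]] by simp
      fix \<psi> assume \<psi>: "test_function \<Omega> \<psi>"
      have gr: "grad \<psi> \<in> L2 \<Omega>" by (rule grad_test_function_L2[OF \<psi>])
      have "(LINT x|L. ?h x \<bullet> grad \<psi> x) = (LINT x|L. f x \<bullet> grad \<psi> x) + c * (LINT x|L. g x \<bullet> grad \<psi> x)"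
        using L2_inner_integrable[OF L2(1) gr] L2_inner_integrable[OF L2(2) gr] by (simp add: inner_add_left)
      also have "\<dots> = - (LINT x|L. u x * \<psi> x) + c * - (LINT x|L. v x * \<psi> x)"
        using u v \<psi> by (simp add: has_weak_div_def)
      also have "\<dots> = - (LINT x|L. (u x + c * v x) * \<psi> x)"
        using L2_mult_integrable[OF uv(1) test_function_L2[OF \<psi>]] L2_mult_integrable[OF uv(2) test_function_L2[OF \<psi>]]
        by (simp add: distrib_right mult.assoc)
      finally show "(LINT x|L. ?h x \<bullet> grad \<psi> x) = - (LINT x|L. (u x + c * v x) * \<psi> x)" .
    qed
    moreover have "?h \<in> L2 \<Omega>" by (intro L2_add L2_cmult L2)
    moreover have "\<exists>p\<in>Pkvec k. \<exists>q\<in>Pk k. \<forall>x\<in>interior K. ?h x = p x + q x *\<^sub>R x" if K: "K \<in> T" for K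
    proof -
      obtain p1 q1 where 1: "p1 \<in> Pkvec k" "q1 \<in> Pk k" "\<forall>x\<in>interior K. f x = p1 x + q1 x *\<^sub>R x"
        using Q(1) K by (auto simp: RTk_def)
      obtain p2 q2 where 2: "p2 \<in> Pkvec k" "q2 \<in> Pk k" "\<forall>x\<in>interior K. g x = p2 x + q2 x *\<^sub>R x"
        using Q(2) K by (auto simp: RTk_def)
      have "(\<lambda>x. p1 x + c *\<^sub>R p2 x) \<in> Pkvec k"
        using 1(1) 2(1) by (auto simp: Pkvec_def intro!: Pk_add Pk_cmult)
      moreover have "(\<lambda>x. q1 x + c * q2 x) \<in> Pk k" using 1(2) 2(2) by (intro Pk_add Pk_cmult)
      ultimately show ?thesis
        using 1(3) 2(3) by (intro bexI[of _ "\<lambda>x. p1 x + c *\<^sub>R p2 x"] bexI[of _ "\<lambda>x. q1 x + c * q2 x"])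
          (auto simp: algebra_simps)
    qed
    ultimately show ?thesis unfolding RTk_def Hdiv_def by blast
  qed
  ultimately show "?h \<in> RTk0 \<Omega> T k" by (simp add: RTk0_def)
qed

end

section \<open>Finite-dimensional function spaces\<close>

text \<open>The scalar counterpart of \<open>lin_closed\<close> on an arbitrary domain: it is applied to vector fields, viewed as
functions of a point and a direction, and to functionals on a space of fields.\<close>

definition real_lin_closed :: "('x \<Rightarrow> real) set \<Rightarrow> bool" where
  "real_lin_closed V \<longleftrightarrow> (\<forall>f\<in>V. \<forall>g\<in>V. \<forall>c. (\<lambda>x. f x + c * g x) \<in> V)"

lemma real_lin_closedD: "real_lin_closed V \<Longrightarrow> f \<in> V \<Longrightarrow> g \<in> V \<Longrightarrow> (\<lambda>x. f x + c * g x) \<in> V"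
  unfolding real_lin_closed_def by blast

lemma real_lin_closed_sum:
  assumes V: "real_lin_closed V" and "finite J" "f \<in> V" "\<And>j. j \<in> J \<Longrightarrow> g j \<in> V"
  shows "(\<lambda>x. f x + (\<Sum>j\<in>J. c j * g j x)) \<in> V"
  using assms(2,4)
proof (induction J rule: finite_induct)
  case empty
  show ?case using assms(3) by simp
next
  case (insert j J)
  then have "(\<lambda>x. (f x + (\<Sum>j\<in>J. c j * g j x)) + c j * g j x) \<in> V"
    by (intro real_lin_closedD[OF V]) auto
  then show ?case using insert by (simp add: add_ac)
qed

lemma real_lin_closed_cmult:
  assumes "real_lin_closed V" "f \<in> V"
  shows "(\<lambda>x. c * f x) \<in> V"
  using real_lin_closedD[OF assms(1,2,2), of "c - 1"] by (simp add: algebra_simps)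

text \<open>In a finite-dimensional space of functions there are points whose values determine a function linearly.
By induction on the dimension: if some \<open>v\<close> does not vanish at \<open>y\<close>, pass to the subspace of functions
vanishing at \<open>y\<close> and correct the basis found there by a multiple of \<open>v\<close>.\<close>

lemma lagrange_basis:
  fixes V :: "('x \<Rightarrow> real) set" and b :: "'j \<Rightarrow> 'x \<Rightarrow> real"
  assumes "finite J" and "real_lin_closed V"
    and "\<forall>f\<in>V. \<exists>a. \<forall>x\<in>A. f x = (\<Sum>j\<in>J. a j * b j x)"
  shows "\<exists>P \<beta>. finite P \<and> P \<subseteq> A \<and> (\<forall>y\<in>P. \<beta> y \<in> V) \<and> (\<forall>f\<in>V. \<forall>x\<in>A. f x = (\<Sum>y\<in>P. f y * \<beta> y x))"
  using assms
proof (induction "card J" arbitrary: J b V)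
  case 0
  then have "\<forall>f\<in>V. \<forall>x\<in>A. f x = 0" by simp
  then show ?case by (intro exI[of _ "{}"]) simp
next
  case (Suc n)
  note V = Suc.prems(2)
  show ?case
  proof (cases "\<forall>f\<in>V. \<forall>x\<in>A. f x = 0")
    case True
    then show ?thesis by (intro exI[of _ "{}"]) simp
  next
    case False
    then obtain v y where v: "v \<in> V" "y \<in> A" "v y \<noteq> 0" by blast
    obtain av where "v y = (\<Sum>j\<in>J. av j * b j y)" using Suc.prems(3) v by blast
    then obtain j where j: "j \<in> J" "b j y \<noteq> 0"
      using v(3) by (metis (no_types, lifting) mult_zero_right sum.neutral)
    define W where "W = {u \<in> V. u y = 0}"
    \<comment> \<open>The function \<open>b j\<close> is eliminated from the spanning set by means of its value at \<open>y\<close>.\<close>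
    define b' where "b' = (\<lambda>i x. b i x - b i y / b j y * b j x)"
    have "\<exists>P \<beta>. finite P \<and> P \<subseteq> A \<and> (\<forall>y\<in>P. \<beta> y \<in> W) \<and> (\<forall>f\<in>W. \<forall>x\<in>A. f x = (\<Sum>y\<in>P. f y * \<beta> y x))"
    proof (rule Suc.hyps(1))
      show "n = card (J - {j})" using Suc.hyps(2) j(1) Suc.prems(1) by simp
      show "real_lin_closed W" using V by (auto simp: real_lin_closed_def W_def)
      show "\<forall>f\<in>W. \<exists>a. \<forall>x\<in>A. f x = (\<Sum>i\<in>J - {j}. a i * b' i x)"
      proof
        fix u assume u: "u \<in> W"
        then obtain a where a: "\<forall>x\<in>A. u x = (\<Sum>i\<in>J. a i * b i x)" using Suc.prems(3) by (auto simp: W_def)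
        have split: "(\<Sum>i\<in>J. a i * b i x) = a j * b j x + (\<Sum>i\<in>J - {j}. a i * b i x)" for x
          using Suc.prems(1) j(1) by (rule sum.remove)
        have "0 = a j * b j y + (\<Sum>i\<in>J - {j}. a i * b i y)" using a u v(2) split by (simp add: W_def)
        then have aj: "a j = - (\<Sum>i\<in>J - {j}. a i * b i y) / b j y" using j(2) by (simp add: field_simps)
        have "u x = (\<Sum>i\<in>J - {j}. a i * b' i x)" if "x \<in> A" for x
        proof -
          have "u x = a j * b j x + (\<Sum>i\<in>J - {j}. a i * b i x)" using a that split by simp
          also have "a j * b j x = - (\<Sum>i\<in>J - {j}. a i * b i y / b j y * b j x)"
            unfolding aj by (simp add: sum_divide_distrib sum_distrib_right)
          finally show ?thesis by (simp add: b'_def right_diff_distrib sum_subtractf mult.assoc)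
        qed
        then show "\<exists>a. \<forall>x\<in>A. u x = (\<Sum>i\<in>J - {j}. a i * b' i x)" by blast
      qed
    qed (use Suc.prems(1) in simp)
    then obtain P \<beta> where P: "finite P" "P \<subseteq> A" "\<forall>y\<in>P. \<beta> y \<in> W"
      "\<And>u x. u \<in> W \<Longrightarrow> x \<in> A \<Longrightarrow> u x = (\<Sum>z\<in>P. u z * \<beta> z x)" by blast
    \<comment> \<open>The value at \<open>y\<close> carries no information on \<open>W\<close>, so \<open>y\<close> may be removed before it is added again.\<close>
    define P' where "P' = P - {y}"
    have P': "u x = (\<Sum>z\<in>P'. u z * \<beta> z x)" if "u \<in> W" "x \<in> A" for u x
    proof -
      have "(\<Sum>z\<in>P. u z * \<beta> z x) = (\<Sum>z\<in>P'. u z * \<beta> z x)"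
        using P(1) that(1) by (intro sum.mono_neutral_right) (auto simp: P'_def W_def)
      then show ?thesis using P(4)[OF that] by simp
    qed
    define \<gamma> where "\<gamma> = (\<lambda>z. if z = y then (\<lambda>x. (1 / v y) * (v x + (\<Sum>z\<in>P'. (- v z) * \<beta> z x))) else \<beta> z)"
    have \<gamma>z: "\<gamma> z = \<beta> z" if "z \<in> P'" for z using that by (auto simp: \<gamma>_def P'_def)
    have "\<gamma> z \<in> V" if "z \<in> insert y P'" for z
    proof (cases "z = y")
      case True
      have "(\<lambda>x. v x + (\<Sum>z\<in>P'. (- v z) * \<beta> z x)) \<in> V"
        using P(1,3) by (intro real_lin_closed_sum[OF V] v) (auto simp: P'_def W_def)
      from real_lin_closed_cmult[OF V this, of "1 / v y"] show ?thesis by (simp only: \<gamma>_def True refl if_True)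
    next
      case False
      then show ?thesis using P(3) that by (auto simp: \<gamma>_def P'_def W_def)
    qed
    moreover have "f x = (\<Sum>z\<in>insert y P'. f z * \<gamma> z x)" if f: "f \<in> V" "x \<in> A" for f x
    proof -
      define u where "u = (\<lambda>x. f x + (- f y / v y) * v x)"
      have "u \<in> V" unfolding u_def by (rule real_lin_closedD[OF V f(1) v(1)])
      moreover have "u y = 0" using v(3) by (simp add: u_def)
      ultimately have "u \<in> W" by (simp add: W_def)
      from P'[OF this f(2)] have "f x = f y / v y * v x + (\<Sum>z\<in>P'. u z * \<beta> z x)"
        by (simp add: u_def)
      also have "(\<Sum>z\<in>P'. u z * \<beta> z x) = (\<Sum>z\<in>P'. f z * \<beta> z x) + (\<Sum>z\<in>P'. f y / v y * ((- v z) * \<beta> z x))"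
        by (simp add: u_def algebra_simps sum.distrib sum_subtractf sum_negf)
      also have "(\<Sum>z\<in>P'. f y / v y * ((- v z) * \<beta> z x)) = f y / v y * (\<Sum>z\<in>P'. (- v z) * \<beta> z x)"
        by (simp only: sum_distrib_left)
      also have "f y / v y * v x + ((\<Sum>z\<in>P'. f z * \<beta> z x) + f y / v y * (\<Sum>z\<in>P'. (- v z) * \<beta> z x))
          = f y * \<gamma> y x + (\<Sum>z\<in>P'. f z * \<gamma> z x)"
      proof -
        have "(\<Sum>z\<in>P'. f z * \<gamma> z x) = (\<Sum>z\<in>P'. f z * \<beta> z x)" using \<gamma>z by simp
        moreover have "f y * \<gamma> y x = f y / v y * (v x + (\<Sum>z\<in>P'. (- v z) * \<beta> z x))" by (simp add: \<gamma>_def)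
        ultimately show ?thesis by (simp only: distrib_left add_ac)
      qed
      also have "\<dots> = (\<Sum>z\<in>insert y P'. f z * \<gamma> z x)"
        using P(1) by (subst sum.insert) (auto simp: P'_def)
      finally show ?thesis .
    qed
    moreover have "finite (insert y P')" "insert y P' \<subseteq> A" using P(1,2) v(2) by (auto simp: P'_def)
    ultimately show ?thesis by (intro exI[of _ "insert y P'"] exI[of _ \<gamma>]) blast
  qed
qed

text \<open>The form \<open>ip\<close> need only be semidefinite, with \<open>l\<close> vanishing on its null vectors: the fields that are zero
almost everywhere are null for the \<open>L2\<close> product, but need not be zero. A Lagrange basis of the functionals
\<open>ip D\<close> provides \<open>y\<close> and \<open>d y\<close> with \<open>ip D \<phi> = \<Sum>y. ip D y * ip (d y) \<phi>\<close>, and \<open>\<Sum>y. l y * d y\<close> represents \<open>l\<close>.\<close>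

lemma riesz_finite_dim:
  fixes V :: "('x \<Rightarrow> real) set" and ip :: "('x \<Rightarrow> real) \<Rightarrow> ('x \<Rightarrow> real) \<Rightarrow> real"
  assumes V: "real_lin_closed V" "v0 \<in> V" and "finite J"
    and span: "\<forall>D\<in>V. \<exists>a. \<forall>\<phi>\<in>V. ip D \<phi> = (\<Sum>j\<in>J. a j * b j \<phi>)"
    and ip: "\<And>f g h c. f \<in> V \<Longrightarrow> g \<in> V \<Longrightarrow> h \<in> V \<Longrightarrow> ip (\<lambda>x. f x + c * g x) h = ip f h + c * ip g h"
      "\<And>f g. f \<in> V \<Longrightarrow> g \<in> V \<Longrightarrow> ip f g = ip g f"
    and l: "\<And>f g c. f \<in> V \<Longrightarrow> g \<in> V \<Longrightarrow> l (\<lambda>x. f x + c * g x) = l f + c * l g"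
    and null: "\<And>z. z \<in> V \<Longrightarrow> ip z z = 0 \<Longrightarrow> l z = 0"
  shows "\<exists>D\<in>V. \<forall>\<phi>\<in>V. ip D \<phi> = l \<phi>"
proof -
  have add_sum: "m (\<lambda>x. f x + (\<Sum>j\<in>J. c j * g j x)) = m f + (\<Sum>j\<in>J. c j * m (g j))"
    if "finite J" "f \<in> V" "\<And>j. j \<in> J \<Longrightarrow> g j \<in> V"
      and m: "\<And>f g c. f \<in> V \<Longrightarrow> g \<in> V \<Longrightarrow> m (\<lambda>x. f x + c * g x) = m f + c * m g"
    for m :: "('x \<Rightarrow> real) \<Rightarrow> real" and J :: "('x \<Rightarrow> real) set" and f g c
    using that(1,3)
  proof (induction J rule: finite_induct)
    case empty
    then show ?case by simp
  next
    case (insert j J)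
    then have "m (\<lambda>x. (f x + (\<Sum>j\<in>J. c j * g j x)) + c j * g j x) = m (\<lambda>x. f x + (\<Sum>j\<in>J. c j * g j x)) + c j * m (g j)"
      by (intro m real_lin_closed_sum[OF V(1)]) (use that(2) in auto)
    then show ?case using insert by (simp add: add_ac)
  qed
  have ip2: "ip h (\<lambda>x. f x + c * g x) = ip h f + c * ip h g" if "f \<in> V" "g \<in> V" "h \<in> V" for f g h c
    using ip(1)[OF that] ip(2) real_lin_closedD[OF V(1) that(1,2)] that by simp
  define \<Phi> where "\<Phi> = (\<lambda>D \<phi>. if \<phi> \<in> V then ip D \<phi> else 0)"
  have "\<exists>P \<beta>. finite P \<and> P \<subseteq> V \<and> (\<forall>y\<in>P. \<beta> y \<in> \<Phi> ` V) \<and> (\<forall>f\<in>\<Phi> ` V. \<forall>x\<in>V. f x = (\<Sum>y\<in>P. f y * \<beta> y x))"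
  proof (rule lagrange_basis[OF \<open>finite J\<close>])
    show "real_lin_closed (\<Phi> ` V)"
      unfolding real_lin_closed_def
    proof (intro ballI allI)
      fix F G c assume "F \<in> \<Phi> ` V" "G \<in> \<Phi> ` V"
      then obtain f g where fg: "f \<in> V" "g \<in> V" "F = \<Phi> f" "G = \<Phi> g" by blast
      have "(\<lambda>x. F x + c * G x) = \<Phi> (\<lambda>x. f x + c * g x)"
        using fg ip(1) by (auto simp: \<Phi>_def)
      then show "(\<lambda>x. F x + c * G x) \<in> \<Phi> ` V" using real_lin_closedD[OF V(1) fg(1,2)] by blast
    qed
    show "\<forall>f\<in>\<Phi> ` V. \<exists>a. \<forall>x\<in>V. f x = (\<Sum>j\<in>J. a j * b j x)"
      using span by (simp add: \<Phi>_def)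
  qed
  then obtain P \<beta> where P: "finite P" "P \<subseteq> V" "\<forall>y\<in>P. \<beta> y \<in> \<Phi> ` V"
    "\<And>D \<phi>. D \<in> V \<Longrightarrow> \<phi> \<in> V \<Longrightarrow> \<Phi> D \<phi> = (\<Sum>y\<in>P. \<Phi> D y * \<beta> y \<phi>)" by blast
  have "\<forall>y\<in>P. \<exists>d. d \<in> V \<and> \<beta> y = \<Phi> d" using P(3) by blast
  from bchoice[OF this] obtain d where d: "\<And>y. y \<in> P \<Longrightarrow> d y \<in> V" "\<And>y. y \<in> P \<Longrightarrow> \<beta> y = \<Phi> (d y)" by blast
  have rep: "ip D \<phi> = (\<Sum>y\<in>P. ip D y * ip (d y) \<phi>)" if "D \<in> V" "\<phi> \<in> V" for D \<phi>
  proof -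
    have "\<Phi> D \<phi> = (\<Sum>y\<in>P. \<Phi> D y * \<beta> y \<phi>)" by (rule P(4)[OF that])
    also have "\<dots> = (\<Sum>y\<in>P. ip D y * ip (d y) \<phi>)"
      using P(2) that d(2) by (intro sum.cong refl) (auto simp: \<Phi>_def)
    finally show ?thesis using that by (simp add: \<Phi>_def)
  qed
  have zero: "(\<lambda>x. 0 * v0 x) \<in> V" by (rule real_lin_closed_cmult[OF V])
  then have zV: "(\<lambda>x. 0) \<in> V" by simp
  have l0: "l (\<lambda>x. 0) = 0" using l[OF zV zV, of 1] by simp
  have ip0: "ip (\<lambda>x. 0) h = 0" if "h \<in> V" for h using ip(1)[OF zV zV that, of 1] by simp
  define D where "D = (\<lambda>x. 0 + (\<Sum>y\<in>P. l y * d y x))"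
  have DV: "D \<in> V" unfolding D_def using P(1) zV d(1) by (intro real_lin_closed_sum[OF V(1)])
  have "ip D \<phi> = l \<phi>" if \<phi>: "\<phi> \<in> V" for \<phi>
  proof -
    \<comment> \<open>The remainder of \<open>\<phi>\<close> in the expansion along the points \<open>y\<close> is orthogonal to the whole space.\<close>
    define z where "z = (\<lambda>x. \<phi> x + (\<Sum>y\<in>P. (- ip (d y) \<phi>) * y x))"
    have z: "z \<in> V" unfolding z_def using P(1,2) \<phi> by (intro real_lin_closed_sum[OF V(1)]) auto
    have "ip D' z = 0" if D': "D' \<in> V" for D'
    proof -
      have "ip D' z = ip D' \<phi> + (\<Sum>y\<in>P. (- ip (d y) \<phi>) * ip D' y)"
        unfolding z_def using P(1,2) \<phi> D' by (intro add_sum ip2) auto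
      then show ?thesis using rep[OF D' \<phi>] by (simp add: sum_negf mult.commute)
    qed
    then have "l z = 0" using null[OF z] z by blast
    moreover have "l z = l \<phi> + (\<Sum>y\<in>P. (- ip (d y) \<phi>) * l y)"
      unfolding z_def using P(1,2) \<phi> by (intro add_sum l) auto
    moreover have "ip D \<phi> = ip (\<lambda>x. 0) \<phi> + (\<Sum>y\<in>P. l y * ip (d y) \<phi>)"
      unfolding D_def using P(1) zV d(1) \<phi> by (intro add_sum[of _ _ _ "\<lambda>f. ip f \<phi>"] ip(1))
    ultimately show ?thesis using ip0[OF \<phi>] by (simp add: sum_negf mult.commute)
  qed
  then show ?thesis using DV by blast
qed

section \<open>Finite element fields depending on time\<close>

text \<open>The bound that dominates difference quotients at the time \<open>t\<close>.\<close>

definition locally_linear :: "real \<Rightarrow> (real \<Rightarrow> real \<Rightarrow> real) \<Rightarrow> bool" where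
  "locally_linear t d \<longleftrightarrow> (\<exists>C r. r > 0 \<and> C \<ge> 0 \<and> (\<forall>s\<in>ball t r. d s t \<le> C * \<bar>s - t\<bar>))"

lemma locally_linear_add:
  assumes "locally_linear t d" "locally_linear t e"
  shows "locally_linear t (\<lambda>s t. d s t + e s t)"
proof -
  obtain C r C' r' where "r > 0" "C \<ge> 0" "\<forall>s\<in>ball t r. d s t \<le> C * \<bar>s - t\<bar>" "r' > 0" "C' \<ge> 0" "\<forall>s\<in>ball t r'. e s t \<le> C' * \<bar>s - t\<bar>"
    using assms unfolding locally_linear_def by blast
  then show ?thesis unfolding locally_linear_def
    by (intro exI[of _ "C + C'"] exI[of _ "min r r'"]) (auto simp: distrib_right intro!: add_mono)
qed

lemma locally_linear_zero: "locally_linear t (\<lambda>s t. 0)"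
  unfolding locally_linear_def by (intro exI[of _ 0] exI[of _ 1]) simp

lemma locally_linear_sum:
  "finite J \<Longrightarrow> (\<And>j. j \<in> J \<Longrightarrow> locally_linear t (d j)) \<Longrightarrow> locally_linear t (\<lambda>s t. \<Sum>j\<in>J. d j s t)"
  by (induction J rule: finite_induct) (simp_all add: locally_linear_zero locally_linear_add)

lemma locally_linear_cmult:
  assumes "locally_linear t d" "c \<ge> 0"
  shows "locally_linear t (\<lambda>s t. c * d s t)"
proof -
  obtain C r where "r > 0" "C \<ge> 0" "\<forall>s\<in>ball t r. d s t \<le> C * \<bar>s - t\<bar>"
    using assms unfolding locally_linear_def by blast
  then show ?thesis unfolding locally_linear_def using assms(2)
    by (intro exI[of _ "c * C"] exI[of _ r]) (auto simp: mult.assoc intro!: mult_left_mono)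
qed

lemma locally_linear_if_differentiable:
  assumes "(g has_vector_derivative g') (at t)"
  shows "locally_linear t (\<lambda>s t. dist (g s) (g t))"
proof -
  have "(g has_derivative (\<lambda>h. h *\<^sub>R g')) (at t)" using assms by (simp add: has_vector_derivative_def)
  then obtain r where r: "r > 0" "\<And>s. norm (s - t) < r \<Longrightarrow> norm (g s - g t - (s - t) *\<^sub>R g') \<le> 1 * norm (s - t)"
    unfolding has_derivative_at_alt by (metis zero_less_one)
  have "dist (g s) (g t) \<le> (1 + norm g') * \<bar>s - t\<bar>" if "s \<in> ball t r" for s
  proof -
    have "norm (s - t) < r" using that by (simp add: dist_norm norm_minus_commute)
    from r(2)[OF this] have "norm (g s - g t - (s - t) *\<^sub>R g') \<le> \<bar>s - t\<bar>" by simp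
    moreover have "norm (g s - g t) \<le> norm (g s - g t - (s - t) *\<^sub>R g') + norm ((s - t) *\<^sub>R g')"
      using norm_triangle_ineq[of "g s - g t - (s - t) *\<^sub>R g'" "(s - t) *\<^sub>R g'"] by simp
    moreover have "norm ((s - t) *\<^sub>R g') = \<bar>s - t\<bar> * norm g'" by (rule norm_scaleR)
    ultimately have "norm (g s - g t) \<le> \<bar>s - t\<bar> + \<bar>s - t\<bar> * norm g'" by linarith
    moreover have "(1 + norm g') * \<bar>s - t\<bar> = \<bar>s - t\<bar> + \<bar>s - t\<bar> * norm g'" by (simp add: algebra_simps)
    ultimately show ?thesis by (simp only: dist_norm)
  qed
  then show ?thesis unfolding locally_linear_def using r(1)
    by (intro exI[of _ "1 + norm g'"] exI[of _ r]) auto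
qed

context mesh
begin

lemma lin_closed_sum:
  fixes V :: "(real^3 \<Rightarrow> 'a::real_vector) set"
  assumes V: "lin_closed V" and "finite J" "f \<in> V" "\<And>j. j \<in> J \<Longrightarrow> g j \<in> V"
  shows "(\<lambda>x. f x + (\<Sum>j\<in>J. c j *\<^sub>R g j x)) \<in> V"
  using assms(2,4)
proof (induction J rule: finite_induct)
  case empty
  show ?case using assms(3) by simp
next
  case (insert j J)
  then have "(\<lambda>x. (f x + (\<Sum>j\<in>J. c j *\<^sub>R g j x)) + c j *\<^sub>R g j x) \<in> V"
    using V unfolding lin_closed_def by simp
  then show ?case using insert by (simp add: add_ac)
qed

lemma pw_poly_span:
  assumes "pw_poly n f"
  shows "\<exists>a. \<forall>x\<in>S. f x = (\<Sum>(K, \<alpha>)\<in>T \<times> {\<alpha>. (\<Sum>i\<in>UNIV. \<alpha> i) \<le> n}. a (K, \<alpha>) * (indicator (interior K) x * monom3 \<alpha> x))"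
proof -
  have "\<forall>K\<in>T. \<exists>a. \<forall>x\<in>interior K. f x = (\<Sum>\<alpha> | (\<Sum>i\<in>UNIV. \<alpha> i) \<le> n. a \<alpha> * monom3 \<alpha> x)"
  proof
    fix K assume "K \<in> T"
    then obtain p where p: "p \<in> Pk n" "\<forall>x\<in>interior K. f x = p x" using assms unfolding pw_poly_def by blast
    from p(1) obtain a where "p = (\<lambda>x. \<Sum>\<alpha> | (\<Sum>i\<in>UNIV. \<alpha> i) \<le> n. a \<alpha> * monom3 \<alpha> x)" unfolding Pk_iff by blast
    with p(2) show "\<exists>a. \<forall>x\<in>interior K. f x = (\<Sum>\<alpha> | (\<Sum>i\<in>UNIV. \<alpha> i) \<le> n. a \<alpha> * monom3 \<alpha> x)"
      by (intro exI[of _ a]) simp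
  qed
  from bchoice[OF this] obtain a where
    a: "\<And>K x. K \<in> T \<Longrightarrow> x \<in> interior K \<Longrightarrow> f x = (\<Sum>\<alpha> | (\<Sum>i\<in>UNIV. \<alpha> i) \<le> n. a K \<alpha> * monom3 \<alpha> x)" by blast
  have "f x = (\<Sum>(K, \<alpha>)\<in>T \<times> {\<alpha>. (\<Sum>i\<in>UNIV. \<alpha> i) \<le> n}. a K \<alpha> * (indicator (interior K) x * monom3 \<alpha> x))"
    if x: "x \<in> S" for x
  proof -
    obtain K where K: "K \<in> T" "x \<in> interior K" using x by (auto simp: S_def)
    have "(\<Sum>(K, \<alpha>)\<in>T \<times> {\<alpha>. (\<Sum>i\<in>UNIV. \<alpha> i) \<le> n}. a K \<alpha> * (indicator (interior K) x * monom3 \<alpha> x))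
       = (\<Sum>K'\<in>T. \<Sum>\<alpha> | (\<Sum>i\<in>UNIV. \<alpha> i) \<le> n. a K' \<alpha> * (indicator (interior K') x * monom3 \<alpha> x))"
      by (simp add: sum.cartesian_product)
    also have "\<dots> = (\<Sum>K'\<in>T. if K' = K then f x else 0)"
    proof (intro sum.cong refl)
      fix K' assume K': "K' \<in> T"
      show "(\<Sum>\<alpha> | (\<Sum>i\<in>UNIV. \<alpha> i) \<le> n. a K' \<alpha> * (indicator (interior K') x * monom3 \<alpha> x)) = (if K' = K then f x else 0)"
      proof (cases "K' = K")
        case True
        then show ?thesis using a[OF K] K by simp
      next
        case False
        then have "x \<notin> interior K'" using interior_cell_unique[OF K(1) K' K(2)] interior_subset by blast
        then show ?thesis using False by simp
      qed
    qed
    also have "\<dots> = f x" using K(1) domain(4) by simp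
    finally show ?thesis by simp
  qed
  then show ?thesis by (intro exI[of _ "\<lambda>(K, \<alpha>). a K \<alpha>"]) simp
qed

lemma finite_span_index: "finite (T \<times> {\<alpha>::3 \<Rightarrow> nat. (\<Sum>i\<in>UNIV. \<alpha> i) \<le> n})"
  using domain(4) finite_exponents by blast

text \<open>A vector field becomes a scalar function of a point and a coordinate direction, so that the Lagrange
basis consists of components at points of the open cells.\<close>

lemma field_basis:
  fixes V :: "(real^3 \<Rightarrow> 'a::euclidean_space) set"
  assumes V: "lin_closed V" and pw: "\<And>f b. f \<in> V \<Longrightarrow> b \<in> Basis \<Longrightarrow> pw_poly n (\<lambda>x. f x \<bullet> b)"
  shows "\<exists>P \<beta>. finite P \<and> P \<subseteq> S \<times> Basis \<and> (\<forall>z\<in>P. \<beta> z \<in> V) \<and>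
     (\<forall>f\<in>V. \<forall>x\<in>S. f x = (\<Sum>z\<in>P. (f (fst z) \<bullet> snd z) *\<^sub>R \<beta> z x))"
proof -
  define \<Phi> where "\<Phi> = (\<lambda>(f :: real^3 \<Rightarrow> 'a) z. f (fst z) \<bullet> snd z)"
  let ?J = "(T \<times> {\<alpha>::3 \<Rightarrow> nat. (\<Sum>i\<in>UNIV. \<alpha> i) \<le> n}) \<times> (Basis :: 'a set)"
  let ?b = "\<lambda>((K, \<alpha>), b) z. indicator (interior K) (fst z) * monom3 \<alpha> (fst z) * (if snd z = b then 1 else (0::real))"
  have "\<exists>P \<beta>. finite P \<and> P \<subseteq> S \<times> Basis \<and> (\<forall>y\<in>P. \<beta> y \<in> \<Phi> ` V) \<and>
      (\<forall>f\<in>\<Phi> ` V. \<forall>x\<in>S \<times> Basis. f x = (\<Sum>y\<in>P. f y * \<beta> y x))"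
  proof (rule lagrange_basis)
    show "finite ?J" using finite_span_index by simp
    show "real_lin_closed (\<Phi> ` V)"
      unfolding real_lin_closed_def
    proof (intro ballI allI)
      fix F G c assume "F \<in> \<Phi> ` V" "G \<in> \<Phi> ` V"
      then obtain f g where fg: "f \<in> V" "g \<in> V" "F = \<Phi> f" "G = \<Phi> g" by blast
      have "(\<lambda>x. F x + c * G x) = \<Phi> (\<lambda>x. f x + c *\<^sub>R g x)"
        using fg by (auto simp: \<Phi>_def inner_add_left)
      then show "(\<lambda>x. F x + c * G x) \<in> \<Phi> ` V" using V fg(1,2) unfolding lin_closed_def by blast
    qed
    show "\<forall>F\<in>\<Phi> ` V. \<exists>a. \<forall>z\<in>S \<times> Basis. F z = (\<Sum>j\<in>?J. a j * ?b j z)"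
    proof
      fix F assume "F \<in> \<Phi> ` V"
      then obtain f where f: "f \<in> V" "F = \<Phi> f" by blast
      have "\<forall>b\<in>Basis. \<exists>a. \<forall>x\<in>S. f x \<bullet> b = (\<Sum>(K, \<alpha>)\<in>T \<times> {\<alpha>. (\<Sum>i\<in>UNIV. \<alpha> i) \<le> n}. a (K, \<alpha>) * (indicator (interior K) x * monom3 \<alpha> x))"
        using pw_poly_span pw f(1) by blast
      from bchoice[OF this] obtain a where a: "\<And>b x. b \<in> Basis \<Longrightarrow> x \<in> S \<Longrightarrow> f x \<bullet> b = (\<Sum>(K, \<alpha>)\<in>T \<times> {\<alpha>. (\<Sum>i\<in>UNIV. \<alpha> i) \<le> n}. a b (K, \<alpha>) * (indicator (interior K) x * monom3 \<alpha> x))"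
        by blast
      have "F z = (\<Sum>j\<in>?J. a (snd j) (fst j) * ?b j z)" if z: "z \<in> S \<times> Basis" for z
      proof -
        obtain x b where xb: "z = (x, b)" "x \<in> S" "b \<in> Basis" using z by blast
        have "(\<Sum>j\<in>?J. a (snd j) (fst j) * ?b j z)
           = (\<Sum>(i, b')\<in>?J. if b' = b then a b' i * (indicator (interior (fst i)) x * monom3 (snd i) x) else 0)"
          by (intro sum.cong refl) (auto simp: xb(1))
        also have "\<dots> = (\<Sum>i\<in>T \<times> {\<alpha>. (\<Sum>i\<in>UNIV. \<alpha> i) \<le> n}. \<Sum>b'\<in>Basis. if b' = b then a b' i * (indicator (interior (fst i)) x * monom3 (snd i) x) else 0)"
          by (rule sum.cartesian_product[symmetric])
        also have "\<dots> = (\<Sum>i\<in>T \<times> {\<alpha>. (\<Sum>i\<in>UNIV. \<alpha> i) \<le> n}. a b i * (indicator (interior (fst i)) x * monom3 (snd i) x))"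
          using xb(3) by (intro sum.cong refl) simp
        also have "\<dots> = f x \<bullet> b" using a[OF xb(3,2)] by (simp add: split_def)
        finally show ?thesis using f(2) xb(1) by (simp add: \<Phi>_def)
      qed
      then show "\<exists>a. \<forall>z\<in>S \<times> Basis. F z = (\<Sum>j\<in>?J. a j * ?b j z)"
        by (intro exI[of _ "\<lambda>j. a (snd j) (fst j)"]) blast
    qed
  qed
  then obtain P \<beta> where P: "finite P" "P \<subseteq> S \<times> Basis" "\<forall>y\<in>P. \<beta> y \<in> \<Phi> ` V"
    "\<And>f z. f \<in> V \<Longrightarrow> z \<in> S \<times> Basis \<Longrightarrow> \<Phi> f z = (\<Sum>y\<in>P. \<Phi> f y * \<beta> y z)" by blast
  have "\<forall>y\<in>P. \<exists>g. g \<in> V \<and> \<beta> y = \<Phi> g" using P(3) by blast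
  from bchoice[OF this] obtain g where g: "\<And>y. y \<in> P \<Longrightarrow> g y \<in> V" "\<And>y. y \<in> P \<Longrightarrow> \<beta> y = \<Phi> (g y)" by blast
  have "f x = (\<Sum>z\<in>P. (f (fst z) \<bullet> snd z) *\<^sub>R g z x)" if f: "f \<in> V" "x \<in> S" for f x
  proof (rule euclidean_eqI)
    fix b :: 'a assume b: "b \<in> Basis"
    have "f x \<bullet> b = \<Phi> f (x, b)" by (simp add: \<Phi>_def)
    also have "\<dots> = (\<Sum>y\<in>P. \<Phi> f y * \<beta> y (x, b))" using f b by (intro P(4)) auto
    also have "\<dots> = (\<Sum>z\<in>P. (f (fst z) \<bullet> snd z) * (g z x \<bullet> b))"
      using g(2) by (intro sum.cong refl) (simp add: \<Phi>_def)
    finally show "f x \<bullet> b = (\<Sum>z\<in>P. (f (fst z) \<bullet> snd z) *\<^sub>R g z x) \<bullet> b" by (simp add: inner_sum_left)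
  qed
  then show ?thesis using P(1,2) g(1) by (intro exI[of _ P] exI[of _ g]) blast
qed

lemma pw_bounded:
  fixes f :: "real^3 \<Rightarrow> 'a::euclidean_space"
  assumes "\<And>b. b \<in> Basis \<Longrightarrow> pw_poly n (\<lambda>x. f x \<bullet> b)"
  shows "\<exists>C\<ge>0. \<forall>x\<in>S. norm (f x) \<le> C"
proof -
  have "\<forall>b\<in>Basis. \<exists>C\<ge>0. \<forall>x\<in>S. \<bar>f x \<bullet> b\<bar> \<le> C"
  proof
    fix b :: 'a assume b: "b \<in> Basis"
    obtain C where "C \<ge> 0" "\<And>x. x \<in> S \<Longrightarrow> \<bar>f x \<bullet> b\<bar> \<le> C"
      by (rule pw_poly_bounded[OF assms[OF b]]) blast
    then show "\<exists>C\<ge>0. \<forall>x\<in>S. \<bar>f x \<bullet> b\<bar> \<le> C" by blast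
  qed
  from bchoice[OF this] obtain C where C: "\<forall>b\<in>Basis. C b \<ge> 0 \<and> (\<forall>x\<in>S. \<bar>f x \<bullet> b\<bar> \<le> C b)" by blast
  have "norm (f x) \<le> (\<Sum>b\<in>Basis. C b)" if "x \<in> S" for x
  proof -
    have "norm (f x) \<le> (\<Sum>b\<in>Basis. \<bar>f x \<bullet> b\<bar>)" by (rule norm_le_l1)
    also have "\<dots> \<le> (\<Sum>b\<in>Basis. C b)" using C that by (intro sum_mono) blast
    finally show ?thesis .
  qed
  moreover have "0 \<le> (\<Sum>b\<in>Basis. C b)" using C by (intro sum_nonneg) blast
  ultimately show ?thesis by blast
qed

text \<open>All coefficients in a Lagrange basis are values of the field at fixed points, hence absolutely
continuous, and differentiable when the field is differentiable at all points. As the basis fields are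
bounded, the sum of the increments of the coefficients controls all points at once; and the time
derivative, being a combination of basis fields, is again in the space.\<close>

lemma field_control:
  fixes V :: "(real^3 \<Rightarrow> 'a::euclidean_space) set"
  assumes V: "lin_closed V" and pw: "\<And>f b. f \<in> V \<Longrightarrow> b \<in> Basis \<Longrightarrow> pw_poly n (\<lambda>x. f x \<bullet> b)"
    and f: "\<And>t. t \<in> {a..b} \<Longrightarrow> f t \<in> V" and ac: "field_abs_cont T I f" and I: "{a..b} \<subseteq> I"
  obtains d R where "ac_control a b d"
    "\<And>s t x. s \<in> {a..b} \<Longrightarrow> t \<in> {a..b} \<Longrightarrow> x \<in> S \<Longrightarrow> dist (f s x) (f t x) \<le> d s t"
    "\<And>t x. t \<in> {a..b} \<Longrightarrow> x \<in> S \<Longrightarrow> norm (f t x) \<le> R"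
    "\<And>t. t \<in> {a<..<b} \<Longrightarrow> field_differentiable_at T f t \<Longrightarrow> locally_linear t d"
    "\<And>t. t \<in> {a<..<b} \<Longrightarrow> field_differentiable_at T f t \<Longrightarrow>
        \<exists>v\<in>V. \<forall>x\<in>S. ((\<lambda>s. f s x) has_vector_derivative v x) (at t)"
proof -
  obtain P \<beta> where P: "finite P" "P \<subseteq> S \<times> Basis" "\<And>z. z \<in> P \<Longrightarrow> \<beta> z \<in> V"
    and rep: "\<And>f x. f \<in> V \<Longrightarrow> x \<in> S \<Longrightarrow> f x = (\<Sum>z\<in>P. (f (fst z) \<bullet> snd z) *\<^sub>R \<beta> z x)"
    using field_basis[OF V pw] by blast
  have "\<forall>z\<in>P. \<exists>C\<ge>0. \<forall>x\<in>S. norm (\<beta> z x) \<le> C" using pw_bounded pw P(3) by blast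
  from bchoice[OF this] obtain C where C: "\<And>z. z \<in> P \<Longrightarrow> C z \<ge> 0" "\<And>z x. z \<in> P \<Longrightarrow> x \<in> S \<Longrightarrow> norm (\<beta> z x) \<le> C z" by blast
  define g where "g = (\<lambda>z s. f s (fst z) \<bullet> snd z)"
  have g: "f s x = (\<Sum>z\<in>P. g z s *\<^sub>R \<beta> z x)" if "s \<in> {a..b}" "x \<in> S" for s x
    using rep[OF f[OF that(1)] that(2)] by (simp add: g_def)
  have gac: "abs_cont {a..b} (g z)" if z: "z \<in> P" for z
  proof -
    have zz: "fst z \<in> S" "snd z \<in> Basis" using P(2) z by auto
    then obtain K where "K \<in> T" "fst z \<in> interior K" by (auto simp: S_def)
    then have fac: "abs_cont I (\<lambda>s. f s (fst z))" using ac by (auto simp: field_abs_cont_def)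
    show ?thesis
    proof (rule abs_cont_bound_by[OF fac I, of _ 1])
      fix s t
      have "\<bar>(f s (fst z) - f t (fst z)) \<bullet> snd z\<bar> \<le> norm (f s (fst z) - f t (fst z))"
        using zz(2) by (rule Basis_le_norm)
      then show "dist (g z s) (g z t) \<le> 1 * dist (f s (fst z)) (f t (fst z))"
        by (simp add: g_def dist_norm inner_diff_left)
    qed simp
  qed
  define d where "d = (\<lambda>s t. \<Sum>z\<in>P. C z * dist (g z s) (g z t))"
  have "\<forall>z\<in>P. \<exists>B. \<forall>s\<in>{a..b}. \<bar>g z s\<bar> \<le> B"
  proof
    fix z assume "z \<in> P"
    have cpt: "compact (g z ` {a..b})"
      by (rule compact_continuous_image[OF abs_cont_imp_continuous_on[OF gac[OF \<open>z \<in> P\<close>]] compact_Icc])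
    obtain B where "\<forall>y\<in>g z ` {a..b}. norm y \<le> B" using compact_imp_bounded[OF cpt] unfolding bounded_iff by blast
    then show "\<exists>B. \<forall>s\<in>{a..b}. \<bar>g z s\<bar> \<le> B" by (intro exI[of _ B]) auto
  qed
  from bchoice[OF this] obtain B where B: "\<And>z s. z \<in> P \<Longrightarrow> s \<in> {a..b} \<Longrightarrow> \<bar>g z s\<bar> \<le> B z" by blast
  show thesis
  proof (rule that[of d "\<Sum>z\<in>P. B z * C z"])
    show "ac_control a b d"
      unfolding d_def
    proof (rule ac_control_sum[OF P(1)])
      fix z assume z: "z \<in> P"
      show "ac_control a b (\<lambda>s t. C z * dist (g z s) (g z t))"
        by (rule ac_control_mono[OF abs_cont_imp_ac_control[OF gac[OF z] order_refl] C(1)[OF z]]) simp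
    qed
    show "dist (f s x) (f t x) \<le> d s t" if "s \<in> {a..b}" "t \<in> {a..b}" "x \<in> S" for s t x
    proof -
      have "dist (f s x) (f t x) = norm (\<Sum>z\<in>P. (g z s - g z t) *\<^sub>R \<beta> z x)"
        using g that by (simp add: dist_norm scaleR_left_diff_distrib sum_subtractf)
      also have "\<dots> \<le> (\<Sum>z\<in>P. C z * dist (g z s) (g z t))"
        using C that(3) by (intro sum_norm_le) (auto simp: dist_real_def mult.commute intro!: mult_right_mono)
      finally show ?thesis by (simp add: d_def)
    qed
    show "norm (f t x) \<le> (\<Sum>z\<in>P. B z * C z)" if "t \<in> {a..b}" "x \<in> S" for t x
    proof -
      have "norm (f t x) = norm (\<Sum>z\<in>P. g z t *\<^sub>R \<beta> z x)" using g that by simp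
      also have "\<dots> \<le> (\<Sum>z\<in>P. B z * C z)"
      proof (rule sum_norm_le)
        fix z assume z: "z \<in> P"
        have "\<bar>g z t\<bar> * norm (\<beta> z x) \<le> B z * C z"
          using B[OF z that(1)] C(2)[OF z that(2)] by (intro mult_mono) auto
        then show "norm (g z t *\<^sub>R \<beta> z x) \<le> B z * C z" by simp
      qed
      finally show ?thesis .
    qed
    fix t assume t: "t \<in> {a<..<b}" "field_differentiable_at T f t"
    have gd: "(g z has_vector_derivative vector_derivative (g z) (at t)) (at t)" if z: "z \<in> P" for z
    proof -
      have "fst z \<in> S" using P(2) z by auto
      then obtain K where "K \<in> T" "fst z \<in> interior K" by (auto simp: S_def)
      then have "(\<lambda>s. f s (fst z)) differentiable (at t)" using t(2) by (auto simp: field_differentiable_at_def)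
      then have "g z differentiable (at t)" unfolding g_def by (intro differentiable_inner) auto
      then show ?thesis by (simp add: vector_derivative_works)
    qed
    show "locally_linear t d"
      unfolding d_def using C(1) gd by (intro locally_linear_sum[OF P(1)] locally_linear_cmult locally_linear_if_differentiable)
    \<comment> \<open>The first summand is the zero field, written such that it visibly belongs to \<open>V\<close>.\<close>
    define v where "v = (\<lambda>x. (f t x + (-1) *\<^sub>R f t x) + (\<Sum>z\<in>P. vector_derivative (g z) (at t) *\<^sub>R \<beta> z x))"
    have ft: "f t \<in> V" using f t by simp
    have z: "(\<lambda>x. f t x + (-1) *\<^sub>R f t x) \<in> V" using V ft unfolding lin_closed_def by blast
    have "v \<in> V" unfolding v_def by (rule lin_closed_sum[OF V P(1) z P(3)])
    moreover have "((\<lambda>s. f s x) has_vector_derivative v x) (at t)" if x: "x \<in> S" for x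
    proof -
      have "((\<lambda>s. \<Sum>z\<in>P. g z s *\<^sub>R \<beta> z x) has_vector_derivative (\<Sum>z\<in>P. vector_derivative (g z) (at t) *\<^sub>R \<beta> z x)) (at t)"
      proof (rule has_vector_derivative_sum)
        fix z assume "z \<in> P"
        from has_vector_derivative_scaleR[OF gd[OF this, unfolded has_real_derivative_iff_has_vector_derivative[symmetric]] has_vector_derivative_const[of "\<beta> z x"]]
        show "((\<lambda>s. g z s *\<^sub>R \<beta> z x) has_vector_derivative vector_derivative (g z) (at t) *\<^sub>R \<beta> z x) (at t)" by simp
      qed
      then have "((\<lambda>s. f s x) has_vector_derivative (\<Sum>z\<in>P. vector_derivative (g z) (at t) *\<^sub>R \<beta> z x)) (at t)"
        by (rule has_vector_derivative_transform_within_open[OF _ open_greaterThanLessThan t(1)]) (simp add: g x)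
      then show ?thesis by (simp add: v_def)
    qed
    ultimately show "\<exists>v\<in>V. \<forall>x\<in>S. ((\<lambda>s. f s x) has_vector_derivative v x) (at t)" by blast
  qed
qed

subsection \<open>The discrete weak divergence\<close>

lemma Qk_inner_lin:
  assumes "f \<in> Qk \<Omega> T n" "g \<in> Qk \<Omega> T n" "h \<in> Qk \<Omega> T n"
  shows "(LINT x|L. (f x + c * g x) * h x) = (LINT x|L. f x * h x) + c * (LINT x|L. g x * h x)"
  using L2_mult_integrable[OF Qk_facts(1)[OF assms(1)] Qk_facts(1)[OF assms(3)]]
    L2_mult_integrable[OF Qk_facts(1)[OF assms(2)] Qk_facts(1)[OF assms(3)]]
  by (simp add: distrib_right mult.assoc)

lemma wgrad_lin:
  assumes f: "f \<in> Qk \<Omega> T n" and g: "g \<in> Qk \<Omega> T n"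
  shows "AE x in L. wgrad \<Omega> (\<lambda>x. f x + c * g x) x = wgrad \<Omega> f x + c *\<^sub>R wgrad \<Omega> g x"
proof -
  have h: "(\<lambda>x. f x + c * g x) \<in> Qk \<Omega> T n" using Qk_lin_closed[of n] f g unfolding lin_closed_def by simp
  show ?thesis using Qk_facts(4)[OF h] Qk_facts(4)[OF f] Qk_facts(4)[OF g] AE_S
  proof eventually_elim
    case (elim x)
    have d: "f differentiable (at x)" "g differentiable (at x)"
      using pw_poly_differentiable Qk_facts(2) f g elim(4) by blast+
    then have "partial_deriv i (\<lambda>x. f x + c * g x) x = partial_deriv i f x + c * partial_deriv i g x" for i
      by (subst partial_deriv_add) (auto simp: partial_deriv_cmult intro: differentiable_mult)
    then show ?case using elim by (simp add: grad_def vec_eq_iff)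
  qed
qed

text \<open>Needed because fields that agree almost everywhere may differ on the skeleton.\<close>

lemma wgrad_eq_0:
  assumes z: "z \<in> Qk \<Omega> T n" and ae: "AE x in L. z x = 0"
  shows "AE x in L. wgrad \<Omega> z x = 0"
proof -
  have "has_weak_grad \<Omega> (\<lambda>x. 0) (wgrad \<Omega> z)"
    unfolding has_weak_grad_def
  proof (intro conjI allI impI)
    show "wgrad \<Omega> z \<in> L2 \<Omega>" using Qk_facts(3)[OF z] by (simp add: has_weak_grad_def)
    fix \<psi> i assume \<psi>: "test_function \<Omega> \<psi>"
    have m: "(\<lambda>x. z x * partial_deriv i \<psi> x) \<in> borel_measurable L"
      by (intro borel_measurable_times L2_measurable Qk_facts(1)[OF z] test_function_L2[OF test_function_partial_deriv[OF \<psi>]])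
    have "AE x in L. 0 * partial_deriv i \<psi> x = z x * partial_deriv i \<psi> x" using ae by eventually_elim simp
    then have "(LINT x|L. 0 * partial_deriv i \<psi> x) = (LINT x|L. z x * partial_deriv i \<psi> x)"
      using m by (intro integral_cong_AE) auto
    also have "\<dots> = - (LINT x|L. wgrad \<Omega> z x $ i * \<psi> x)"
      using Qk_facts(3)[OF z] \<psi> by (simp add: has_weak_grad_def)
    finally show "(LINT x|L. 0 * partial_deriv i \<psi> x) = - (LINT x|L. wgrad \<Omega> z x $ i * \<psi> x)" .
  qed
  from weak_grad_eq_grad[OF pw_poly_const this] show ?thesis
  proof eventually_elim
    case (elim x)
    have "grad (\<lambda>x. 0) x = 0"
      using partial_deriv_eqI[OF has_derivative_const] by (simp add: grad_def vec_eq_iff)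
    then show ?case using elim by simp
  qed
qed

lemma Qk_wgrad_L2: "f \<in> Qk \<Omega> T n \<Longrightarrow> wgrad \<Omega> f \<in> L2 \<Omega>"
  using Qk_facts(3) by (simp add: has_weak_grad_def)

text \<open>The functional \<open>\<phi> \<mapsto> - \<integral> E \<bullet> \<nabla>\<phi>\<close> vanishes on fields that are zero almost everywhere, so it is represented by
a member of the space.\<close>

lemma weak_divergence_works:
  assumes E: "E \<in> L2 \<Omega>"
  shows "weak_divergence \<Omega> T k E \<in> Qk0 \<Omega> T (k + 1) \<and>
     (\<forall>\<phi>\<in>Qk0 \<Omega> T (k + 1). (LINT x|L. weak_divergence \<Omega> T k E x * \<phi> x) = - (LINT x|L. E x \<bullet> wgrad \<Omega> \<phi> x))"
proof -
  let ?V = "Qk0 \<Omega> T (k + 1)" and ?ip = "\<lambda>f g. LINT x|L. f x * g x" and ?l = "\<lambda>\<phi>. - (LINT x|L. E x \<bullet> wgrad \<Omega> \<phi> x)"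
  let ?J = "T \<times> {\<alpha>::3 \<Rightarrow> nat. (\<Sum>i\<in>UNIV. \<alpha> i) \<le> k + 1}"
  let ?b = "\<lambda>(K, \<alpha>) \<phi>. LINT x|L. (on_cells (\<lambda>x. indicator (interior K) x * monom3 \<alpha> x)) x * \<phi> x"
  have Q: "f \<in> Qk \<Omega> T (k + 1)" if "f \<in> ?V" for f using that by (simp add: Qk0_def)
  have lin: "real_lin_closed ?V" using Qk0_lin_closed[of "k + 1"] by (simp add: real_lin_closed_def lin_closed_def)
  have "\<exists>D\<in>?V. \<forall>\<phi>\<in>?V. ?ip D \<phi> = ?l \<phi>"
  proof (rule riesz_finite_dim[OF lin _ finite_span_index[of "k + 1"], where b = ?b and ip = ?ip and l = ?l])
    have "cell_trace K (\<lambda>x. 0) x = (0::real)" if "K \<in> T" "x \<in> K" for K x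
      using trace_eq[OF that, of "\<lambda>x. 0" "\<lambda>x. 0::real"] by simp
    then show "(\<lambda>x. 0) \<in> ?V" using const_in_Qk[of 0] by (simp add: Qk0_def)
    have bm: "on_cells (\<lambda>x. indicator (interior K) x * monom3 \<alpha> x) \<in> L2 \<Omega>"
      if "K \<in> T" "(\<Sum>i\<in>UNIV. \<alpha> i) \<le> k + 1" for K \<alpha>
    proof -
      have pw: "pw_poly (k + 1) (\<lambda>x. indicator (interior K) x * monom3 \<alpha> x)"
        unfolding pw_poly_def
      proof
        fix K' assume K': "K' \<in> T"
        show "\<exists>p\<in>Pk (k + 1). \<forall>x\<in>interior K'. indicator (interior K) x * monom3 \<alpha> x = p x"
        proof (cases "K' = K")
          case True
          then show ?thesis using monom3_in_Pk[OF that(2)] by (intro bexI[of _ "monom3 \<alpha>"]) auto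
        next
          case False
          then have "x \<notin> interior K" if "x \<in> interior K'" for x
            using that interior_cell_unique[OF \<open>K \<in> T\<close> K'] interior_subset by blast
          then show ?thesis using Pk_zero by (intro bexI[of _ "\<lambda>x. 0"]) auto
        qed
      qed
      obtain C where C: "C \<ge> 0" "\<And>x. x \<in> S \<Longrightarrow> \<bar>indicator (interior K) x * monom3 \<alpha> x\<bar> \<le> C"
        by (rule pw_poly_bounded[OF pw]) blast
      show ?thesis using C by (intro L2_if_bounded[OF on_cells_measurable[OF pw], of C]) (auto simp: on_cells_def)
    qed
    show "\<forall>D\<in>?V. \<exists>a. \<forall>\<phi>\<in>?V. ?ip D \<phi> = (\<Sum>j\<in>?J. a j * ?b j \<phi>)"
    proof
      fix D assume D: "D \<in> ?V"
      obtain a where a: "\<And>x. x \<in> S \<Longrightarrow> D x = (\<Sum>(K, \<alpha>)\<in>?J. a (K, \<alpha>) * (indicator (interior K) x * monom3 \<alpha> x))"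
        using pw_poly_span[OF Qk_facts(2)[OF Q[OF D]]] by blast
      have "?ip D \<phi> = (\<Sum>j\<in>?J. a j * ?b j \<phi>)" if \<phi>: "\<phi> \<in> ?V" for \<phi>
      proof -
        have int: "integrable L (\<lambda>x. on_cells (\<lambda>x. indicator (interior (fst j)) x * monom3 (snd j) x) x * \<phi> x)" if "j \<in> ?J" for j
          using bm[of "fst j" "snd j"] that by (intro L2_mult_integrable Qk_facts(1)[OF Q[OF \<phi>]]) auto
        have "?ip D \<phi> = (LINT x|L. (\<Sum>j\<in>?J. a j * (on_cells (\<lambda>x. indicator (interior (fst j)) x * monom3 (snd j) x) x * \<phi> x)))"
        proof (rule integral_cong_AE)
          show "AE x in L. D x * \<phi> x = (\<Sum>j\<in>?J. a j * (on_cells (\<lambda>x. indicator (interior (fst j)) x * monom3 (snd j) x) x * \<phi> x))"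
            using AE_S
          proof eventually_elim
            case (elim x)
            then show ?case using a[OF elim] by (simp add: on_cells_def sum_distrib_right split_def mult.assoc)
          qed
          show "(\<lambda>x. D x * \<phi> x) \<in> borel_measurable L"
            using L2_mult_integrable[OF Qk_facts(1)[OF Q[OF D]] Qk_facts(1)[OF Q[OF \<phi>]]] by blast
          show "(\<lambda>x. \<Sum>j\<in>?J. a j * (on_cells (\<lambda>x. indicator (interior (fst j)) x * monom3 (snd j) x) x * \<phi> x)) \<in> borel_measurable L"
            using int by (intro borel_measurable_sum borel_measurable_times[of "\<lambda>x. a _"] borel_measurable_integrable) auto
        qed
        also have "\<dots> = (\<Sum>j\<in>?J. a j * ?b j \<phi>)"
          using int by (subst Bochner_Integration.integral_sum) (auto simp: split_def)
        finally show ?thesis .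
      qed
      then show "\<exists>a. \<forall>\<phi>\<in>?V. ?ip D \<phi> = (\<Sum>j\<in>?J. a j * ?b j \<phi>)" by blast
    qed
    show "?ip (\<lambda>x. f x + c * g x) h = ?ip f h + c * ?ip g h" if "f \<in> ?V" "g \<in> ?V" "h \<in> ?V" for f g h c
      by (rule Qk_inner_lin[OF Q[OF that(1)] Q[OF that(2)] Q[OF that(3)]])
    show "?ip f g = ?ip g f" if "f \<in> ?V" "g \<in> ?V" for f g by (simp add: mult.commute)
    show "?l (\<lambda>x. f x + c * g x) = ?l f + c * ?l g" if fg: "f \<in> ?V" "g \<in> ?V" for f g c
    proof -
      have h: "(\<lambda>x. f x + c * g x) \<in> ?V" using real_lin_closedD[OF lin fg] .
      note i = L2_inner_integrable[OF E Qk_wgrad_L2[OF Q[OF fg(1)]]] L2_inner_integrable[OF E Qk_wgrad_L2[OF Q[OF fg(2)]]]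
      have "(LINT x|L. E x \<bullet> wgrad \<Omega> (\<lambda>x. f x + c * g x) x) = (LINT x|L. E x \<bullet> wgrad \<Omega> f x + c * (E x \<bullet> wgrad \<Omega> g x))"
      proof (rule integral_cong_AE)
        show "AE x in L. E x \<bullet> wgrad \<Omega> (\<lambda>x. f x + c * g x) x = E x \<bullet> wgrad \<Omega> f x + c * (E x \<bullet> wgrad \<Omega> g x)"
          using wgrad_lin[OF Q[OF fg(1)] Q[OF fg(2)], of c] by eventually_elim (simp add: inner_add_right)
        show "(\<lambda>x. E x \<bullet> wgrad \<Omega> (\<lambda>x. f x + c * g x) x) \<in> borel_measurable L"
          using L2_inner_integrable[OF E Qk_wgrad_L2[OF Q[OF h]]] by blast
        show "(\<lambda>x. E x \<bullet> wgrad \<Omega> f x + c * (E x \<bullet> wgrad \<Omega> g x)) \<in> borel_measurable L"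
          using i by (intro borel_measurable_integrable Bochner_Integration.integrable_add integrable_mult_right)
      qed
      also have "\<dots> = (LINT x|L. E x \<bullet> wgrad \<Omega> f x) + c * (LINT x|L. E x \<bullet> wgrad \<Omega> g x)" using i by simp
      finally show ?thesis by simp
    qed
    fix z assume z: "z \<in> ?V" "?ip z z = 0"
    show "?l z = 0"
    proof -
      have "AE x in L. z x * z x = 0"
        using z(2) integral_nonneg_eq_0_iff_AE[OF L2_mult_integrable[OF Qk_facts(1)[OF Q[OF z(1)]] Qk_facts(1)[OF Q[OF z(1)]]]] by simp
      then have "AE x in L. z x = 0" by eventually_elim simp
      then have "AE x in L. wgrad \<Omega> z x = 0" by (rule wgrad_eq_0[OF Q[OF z(1)]])
      then have "AE x in L. E x \<bullet> wgrad \<Omega> z x = 0" by eventually_elim simp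
      then show ?thesis using integral_eq_zero_AE by auto
    qed
  qed
  then have "\<exists>D. D \<in> ?V \<and> (\<forall>\<phi>\<in>?V. ?ip D \<phi> = ?l \<phi>)" by blast
  from someI_ex[OF this] show ?thesis unfolding weak_divergence_def .
qed

end

section \<open>Continuity of conforming piecewise polynomials\<close>

lemma integral_lborel_translate:
  fixes f :: "'a::euclidean_space \<Rightarrow> real"
  assumes "f \<in> borel_measurable borel"
  shows "(LINT x|lborel. f (x - a)) = (LINT x|lborel. f x)"
proof -
  have "(LINT x|lborel. f x) = (LINT x|distr lborel borel ((+) (- a)). f x)" by (simp add: lborel_distr_plus)
  also have "\<dots> = (LINT x|lborel. f (- a + x))" using assms by (subst integral_distr) auto
  finally show ?thesis by simp
qed

lemma partial_deriv_translate:
  assumes "f differentiable (at (x - a))"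
  shows "partial_deriv i (\<lambda>x. f (x - a)) x = partial_deriv i f (x - a)"
proof -
  have "((\<lambda>x. x - a) has_derivative (\<lambda>v. v)) (at x)" by (auto intro!: derivative_eq_intros)
  from has_derivative_compose[OF this has_derivative_partial_deriv[OF assms]]
  have "((\<lambda>x. f (x - a)) has_derivative (\<lambda>v. \<Sum>i\<in>UNIV. v $ i * partial_deriv i f (x - a))) (at x)" by simp
  from partial_deriv_eqI[OF this] show ?thesis by (simp add: axis_def if_distrib[of "\<lambda>a. a * _"] cong: if_cong)
qed

lemma box_bump_translate: "box_bump a b n (x - w) = box_bump (a + w) (b + w) n x"
  unfolding box_bump_def by (intro prod.cong refl) (simp add: algebra_simps)

lemma mem_box_around:
  "u \<in> cbox (y - (\<chi> i. \<delta>)) (y + (\<chi> i. \<delta>)) \<longleftrightarrow> (\<forall>i. \<bar>u $ i - y $ i\<bar> \<le> \<delta>)" for u y :: "real^3"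
  by (auto simp: mem_box_cart abs_le_iff algebra_simps)

context mesh
begin

text \<open>Move the bump along \<open>v\<close>. The derivative of the weighted integral is the integral of the weak gradient in
the direction \<open>v\<close>, which is bounded, against the moving bump. The bump may
cross cell boundaries as long as it stays inside the domain.\<close>

lemma Qk_difference_bound:
  assumes \<phi>: "\<phi> \<in> Qk \<Omega> T n" and C: "C \<ge> 0" "\<And>i x. x \<in> S \<Longrightarrow> \<bar>partial_deriv i \<phi> x\<bar> \<le> C"
    and in\<Omega>: "\<And>s. s \<in> {0..1} \<Longrightarrow> cbox (a + s *\<^sub>R v) (b + s *\<^sub>R v) \<subseteq> \<Omega>"
  defines "\<psi> \<equiv> box_bump a b 0"
  shows "\<bar>(LINT x|L. \<phi> x * \<psi> (x - v)) - (LINT x|L. \<phi> x * \<psi> x)\<bar> \<le> 3 * C * norm v * (LINT x|lborel. \<psi> x)"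
proof -
  have ts: "test_function (cbox a b) \<psi>" unfolding \<psi>_def by (rule box_bump_test_function) simp
  note C1 = test_function_C1[OF ts]
  have diff: "\<psi> differentiable (at x)" for x using C1 by (simp add: C1_def)
  obtain \<Lambda> where \<Lambda>: "\<Lambda> \<ge> 0" "\<And>x y. \<bar>\<psi> x - \<psi> y\<bar> \<le> \<Lambda> * norm (x - y)"
    by (rule C1_compact_support_lipschitz[OF C1 test_function_compact[OF ts]]) blast
  define \<psi>s where "\<psi>s = (\<lambda>s x. \<psi> (x - s *\<^sub>R v))"
  have ts': "test_function (cbox (a + s *\<^sub>R v) (b + s *\<^sub>R v)) (\<psi>s s)" for s
    unfolding \<psi>s_def \<psi>_def box_bump_translate by (rule box_bump_test_function) simp
  have nonneg: "0 \<le> \<psi>s s x" for s x by (simp add: \<psi>s_def \<psi>_def box_bump_bounds)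
  have \<psi>L2: "\<psi>s s \<in> L2 \<Omega>" for s by (rule test_function_L2[OF ts'])
  define H where "H = (\<lambda>s. LINT x|L. \<phi> x * \<psi>s s x)"
  define H' where "H' = (\<lambda>s. LINT x|L. \<phi> x * (\<Sum>i\<in>UNIV. - v $ i * partial_deriv i (\<psi>s s) x))"
  have deriv: "(H has_real_derivative H' s) (at s)" for s
    unfolding H_def H'_def
  proof (rule param_integral_has_derivative[of 1 _ _ _ "\<lambda>x. \<bar>\<phi> x\<bar> * (\<Lambda> * norm v)"])
    show "integrable L (\<lambda>x. \<phi> x * \<psi>s t x)" for t
      by (rule L2_mult_integrable[OF Qk_facts(1)[OF \<phi>] \<psi>L2])
    show "integrable L (\<lambda>x. \<bar>\<phi> x\<bar> * (\<Lambda> * norm v))"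
      using L2_integrable[OF Qk_facts(1)[OF \<phi>]] by simp
    show "AE x in L. \<bar>\<phi> x * \<psi>s t x - \<phi> x * \<psi>s s x\<bar> \<le> \<bar>\<phi> x\<bar> * (\<Lambda> * norm v) * \<bar>t - s\<bar>" for t
    proof (intro AE_I2)
      fix x
      have "norm ((x - t *\<^sub>R v) - (x - s *\<^sub>R v)) = \<bar>t - s\<bar> * norm v"
        by (simp add: scaleR_left_diff_distrib[symmetric] norm_minus_commute abs_minus_commute)
      then have "\<bar>\<psi>s t x - \<psi>s s x\<bar> \<le> \<Lambda> * norm v * \<bar>t - s\<bar>"
        using \<Lambda>(2)[of "x - t *\<^sub>R v" "x - s *\<^sub>R v"] by (simp add: \<psi>s_def mult_ac)
      then have "\<bar>\<phi> x\<bar> * \<bar>\<psi>s t x - \<psi>s s x\<bar> \<le> \<bar>\<phi> x\<bar> * (\<Lambda> * norm v * \<bar>t - s\<bar>)" by (intro mult_left_mono) auto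
      then show "\<bar>\<phi> x * \<psi>s t x - \<phi> x * \<psi>s s x\<bar> \<le> \<bar>\<phi> x\<bar> * (\<Lambda> * norm v) * \<bar>t - s\<bar>"
        by (simp add: right_diff_distrib[symmetric] abs_mult mult_ac)
    qed
    show "AE x in L. ((\<lambda>s. \<phi> x * \<psi>s s x) has_real_derivative \<phi> x * (\<Sum>i\<in>UNIV. - v $ i * partial_deriv i (\<psi>s s) x)) (at s)"
    proof (intro AE_I2)
      fix x
      have "((\<lambda>s. \<psi> (x + s *\<^sub>R (- v))) has_real_derivative (\<Sum>i\<in>UNIV. (- v) $ i * partial_deriv i \<psi> (x + s *\<^sub>R (- v)))) (at s)"
        by (rule partial_deriv_along_line[OF diff])
      then have "((\<lambda>s. \<psi>s s x) has_real_derivative (\<Sum>i\<in>UNIV. - v $ i * partial_deriv i (\<psi>s s) x)) (at s)"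
        by (simp add: \<psi>s_def partial_deriv_translate[OF diff])
      then show "((\<lambda>s. \<phi> x * \<psi>s s x) has_real_derivative \<phi> x * (\<Sum>i\<in>UNIV. - v $ i * partial_deriv i (\<psi>s s) x)) (at s)"
        by (rule DERIV_cmult)
    qed
    show "(\<lambda>x. \<phi> x * (\<Sum>i\<in>UNIV. - v $ i * partial_deriv i (\<psi>s s) x)) \<in> borel_measurable L"
      by (intro borel_measurable_times borel_measurable_sum borel_measurable_const L2_measurable[OF Qk_facts(1)[OF \<phi>]]
          L2_measurable[OF test_function_L2[OF test_function_partial_deriv[OF ts']]])
  qed simp
  have J: "(LINT x|L. \<psi>s s x) = (LINT x|lborel. \<psi> x)" if s: "s \<in> {0..1}" for s
  proof -
    have "(LINT x|L. \<psi>s s x) = (LINT x|lborel. \<psi>s s x)"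
      using test_function_mono[OF ts' in\<Omega>[OF s]] test_function_outside
      by (intro integral_L_eq_lborel borel_measurable_continuous_onI[OF test_function_continuous[OF ts']]) blast
    also have "\<dots> = (LINT x|lborel. \<psi> x)"
      unfolding \<psi>s_def by (rule integral_lborel_translate[OF borel_measurable_continuous_onI[OF test_function_continuous[OF ts]]])
    finally show ?thesis .
  qed
  let ?J = "LINT x|lborel. \<psi> x"
  have bound: "\<bar>H' s\<bar> \<le> 3 * C * norm v * ?J" if s: "s \<in> {0..1}" for s
  proof -
    have ts\<Omega>: "test_function \<Omega> (\<psi>s s)" by (rule test_function_mono[OF ts' in\<Omega>[OF s]])
    let ?w = "wgrad \<Omega> \<phi>"
    have intw: "integrable L (\<lambda>x. ?w x $ i * \<psi>s s x)" for i
      by (rule L2_mult_integrable[OF L2_nth[OF Qk_wgrad_L2[OF \<phi>]] \<psi>L2])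
    have ints: "integrable L (\<lambda>x. \<phi> x * partial_deriv i (\<psi>s s) x)" for i
      by (rule L2_mult_integrable[OF Qk_facts(1)[OF \<phi>] test_function_L2[OF test_function_partial_deriv[OF ts\<Omega>]]])
    have "H' s = (LINT x|L. (\<Sum>i\<in>UNIV. - v $ i * (\<phi> x * partial_deriv i (\<psi>s s) x)))"
      unfolding H'_def by (intro Bochner_Integration.integral_cong refl) (simp add: sum_distrib_left mult_ac)
    also have "\<dots> = (\<Sum>i\<in>UNIV. - v $ i * (LINT x|L. \<phi> x * partial_deriv i (\<psi>s s) x))"
      using ints by (subst Bochner_Integration.integral_sum) auto
    also have "\<dots> = (\<Sum>i\<in>UNIV. v $ i * (LINT x|L. ?w x $ i * \<psi>s s x))"
      using Qk_facts(3)[OF \<phi>] ts\<Omega> by (simp add: has_weak_grad_def)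
    finally have eq: "H' s = (\<Sum>i\<in>UNIV. v $ i * (LINT x|L. ?w x $ i * \<psi>s s x))" .
    have each: "\<bar>LINT x|L. ?w x $ i * \<psi>s s x\<bar> \<le> C * ?J" for i
    proof -
      have "\<bar>LINT x|L. ?w x $ i * \<psi>s s x\<bar> \<le> (LINT x|L. \<bar>?w x $ i * \<psi>s s x\<bar>)" by (rule integral_abs_bound)
      also have "\<dots> \<le> (LINT x|L. C * \<psi>s s x)"
      proof (rule integral_mono_AE)
        show "AE x in L. \<bar>?w x $ i * \<psi>s s x\<bar> \<le> C * \<psi>s s x"
          using Qk_facts(4)[OF \<phi>] AE_S
        proof eventually_elim
          case (elim x)
          then have "\<bar>?w x $ i\<bar> \<le> C" using C(2) by (simp add: grad_def)
          then show ?case using nonneg[of s x] by (simp add: abs_mult mult_right_mono)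
        qed
      qed (use intw L2_integrable[OF \<psi>L2] in auto)
      also have "\<dots> = C * ?J" using J[OF s] by simp
      finally show ?thesis .
    qed
    have "\<bar>H' s\<bar> \<le> (\<Sum>i\<in>UNIV. \<bar>v $ i * (LINT x|L. ?w x $ i * \<psi>s s x)\<bar>)" unfolding eq by (rule sum_abs)
    also have "\<dots> \<le> (\<Sum>i\<in>(UNIV :: 3 set). norm v * (C * ?J))"
      unfolding abs_mult by (intro sum_mono mult_mono each component_le_norm_cart) auto
    also have "\<dots> = 3 * C * norm v * ?J" by simp
    finally show ?thesis .
  qed
  obtain s where s: "0 < s" "s < 1" "H 1 - H 0 = (1 - 0) * H' s"
    using MVT2[of 0 1 H H'] deriv by auto
  then have "\<bar>H 1 - H 0\<bar> \<le> 3 * C * norm v * ?J" using bound[of s] by simp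
  then show ?thesis by (simp add: H_def \<psi>s_def)
qed

lemma weighted_average_close:
  assumes K: "K \<in> T" and \<phi>: "\<phi> \<in> L2 \<Omega>" "\<And>y. y \<in> interior K \<Longrightarrow> \<phi> y = p y" and box: "cbox a b \<subseteq> interior K"
    and close: "\<And>y. y \<in> cbox a b \<Longrightarrow> \<bar>p y - c\<bar> \<le> \<epsilon>"
  shows "\<bar>(LINT x|L. \<phi> x * box_bump a b 0 x) - c * (LINT x|lborel. box_bump a b 0 x)\<bar> \<le> \<epsilon> * (LINT x|lborel. box_bump a b 0 x)"
proof -
  let ?\<psi> = "box_bump a b 0"
  have ts: "test_function (cbox a b) ?\<psi>" by (rule box_bump_test_function) simp
  have ts\<Omega>: "test_function \<Omega> ?\<psi>"
    using test_function_mono[OF ts] box interior_cell_subset[OF K] by blast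
  have int: "integrable L ?\<psi>" "integrable L (\<lambda>x. \<phi> x * ?\<psi> x)"
    using L2_integrable[OF test_function_L2[OF ts]] L2_mult_integrable[OF \<phi>(1) test_function_L2[OF ts]] by auto
  have J: "(LINT x|L. ?\<psi> x) = (LINT x|lborel. ?\<psi> x)"
    using test_function_outside[OF ts\<Omega>]
    by (intro integral_L_eq_lborel borel_measurable_continuous_onI[OF test_function_continuous[OF ts]]) blast
  have "\<bar>(LINT x|L. \<phi> x * ?\<psi> x) - c * (LINT x|L. ?\<psi> x)\<bar> = \<bar>LINT x|L. \<phi> x * ?\<psi> x - c * ?\<psi> x\<bar>"
    using int by simp
  also have "\<dots> \<le> (LINT x|L. \<bar>\<phi> x * ?\<psi> x - c * ?\<psi> x\<bar>)" by (rule integral_abs_bound)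
  also have "\<dots> \<le> (LINT x|L. \<epsilon> * ?\<psi> x)"
  proof (rule integral_mono)
    fix x
    show "\<bar>\<phi> x * ?\<psi> x - c * ?\<psi> x\<bar> \<le> \<epsilon> * ?\<psi> x"
    proof (cases "x \<in> cbox a b")
      case True
      then have "\<phi> x = p x" using \<phi>(2) box by blast
      then have "\<bar>\<phi> x * ?\<psi> x - c * ?\<psi> x\<bar> = \<bar>p x - c\<bar> * ?\<psi> x"
        using box_bump_bounds(1)[of a b 0 x] by (simp add: left_diff_distrib[symmetric] abs_mult)
      then show ?thesis using close[OF True] box_bump_bounds(1)[of a b 0 x] by (simp add: mult_right_mono)
    next
      case False
      then show ?thesis using test_function_outside[OF ts] by simp
    qed
  qed (use int in auto)
  finally show ?thesis using J int by simp
qed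

text \<open>The weak gradient is bounded, so weighted averages of \<open>\<phi>\<close> over two small cubes differ by at most a
  constant times the distance of the cubes; taking the cubes in the two cells gives equal traces.\<close>

lemma Qk_traces_agree:
  assumes \<phi>: "\<phi> \<in> Qk \<Omega> T n" and K: "K \<in> T" "K' \<in> T" and x: "x \<in> K" "x \<in> K'" "x \<in> \<Omega>"
    and p: "continuous_on UNIV p" "\<And>y. y \<in> interior K \<Longrightarrow> \<phi> y = p y"
    and q: "continuous_on UNIV q" "\<And>y. y \<in> interior K' \<Longrightarrow> \<phi> y = q y"
  shows "p x = q x"
proof -
  have "\<forall>i. \<exists>C\<ge>0. \<forall>x\<in>S. \<bar>partial_deriv i \<phi> x\<bar> \<le> C"
  proof
    fix i
    obtain C where "C \<ge> 0" "\<And>x. x \<in> S \<Longrightarrow> \<bar>partial_deriv i \<phi> x\<bar> \<le> C"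
      by (rule pw_poly_bounded[OF pw_poly_partial_deriv[OF Qk_facts(2)[OF \<phi>], of i]]) blast
    then show "\<exists>C\<ge>0. \<forall>x\<in>S. \<bar>partial_deriv i \<phi> x\<bar> \<le> C" by blast
  qed
  from choice[OF this] obtain Ci where Ci: "\<And>i. Ci i \<ge> 0" "\<And>i x. x \<in> S \<Longrightarrow> \<bar>partial_deriv i \<phi> x\<bar> \<le> Ci i" by blast
  define C where "C = (\<Sum>i\<in>UNIV. Ci i)"
  have C: "C \<ge> 0" "\<And>i x. x \<in> S \<Longrightarrow> \<bar>partial_deriv i \<phi> x\<bar> \<le> C"
  proof -
    show "C \<ge> 0" unfolding C_def using Ci(1) by (simp add: sum_nonneg)
    fix i x assume "x \<in> S"
    then have "\<bar>partial_deriv i \<phi> x\<bar> \<le> Ci i" by (rule Ci(2))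
    also have "\<dots> \<le> C" unfolding C_def using Ci(1) by (intro member_le_sum) auto
    finally show "\<bar>partial_deriv i \<phi> x\<bar> \<le> C" .
  qed
  have "\<bar>p x - q x\<bar> \<le> (2 + 6 * C) * \<epsilon>" if \<epsilon>: "\<epsilon> > 0" for \<epsilon>
  proof -
    obtain r where r: "r > 0" "ball x r \<subseteq> \<Omega>" using domain(1) x(3) by (meson open_contains_ball)
    have "isCont p x" "isCont q x" using p(1) q(1) by (auto simp: continuous_on_eq_continuous_at)
    then obtain d1 d2 where d: "d1 > 0" "\<And>y. dist y x < d1 \<Longrightarrow> dist (p y) (p x) < \<epsilon>"
      "d2 > 0" "\<And>y. dist y x < d2 \<Longrightarrow> dist (q y) (q x) < \<epsilon>"
      using \<epsilon> unfolding continuous_at_eps_delta dist_commute[of _ x] by (metis dist_commute)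
    define \<eta> where "\<eta> = min (min r \<epsilon>) (min d1 d2)"
    have \<eta>: "\<eta> > 0" "\<eta> \<le> r" "\<eta> \<le> \<epsilon>" "\<eta> \<le> d1" "\<eta> \<le> d2" using r d \<epsilon> by (auto simp: \<eta>_def)
    obtain y where y: "y \<in> interior K" "dist y x < \<eta> / 2"
      using x(1) cell(1)[OF K(1)] \<eta>(1) closure_approachable[of x "interior K"] by (metis half_gt_zero)
    obtain z where z: "z \<in> interior K'" "dist z x < \<eta> / 2"
      using x(2) cell(1)[OF K(2)] \<eta>(1) closure_approachable[of x "interior K'"] by (metis half_gt_zero)
    obtain ry where ry: "ry > 0" "ball y ry \<subseteq> interior K" using y(1) open_interior by (meson open_contains_ball)
    obtain rz where rz: "rz > 0" "ball z rz \<subseteq> interior K'" using z(1) open_interior by (meson open_contains_ball)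
    define \<delta> where "\<delta> = min (min ry rz) (\<eta> / 2) / 4"
    have \<delta>: "\<delta> > 0" "4 * \<delta> \<le> ry" "4 * \<delta> \<le> rz" "4 * \<delta> \<le> \<eta> / 2" using ry rz \<eta>(1) by (auto simp: \<delta>_def)
    let ?e = "(\<chi> i. \<delta>) :: real^3"
    have near: "dist u w < 4 * \<delta>" if u: "u \<in> cbox (w - ?e) (w + ?e)" for u w
    proof -
      have "dist u w \<le> (\<Sum>i\<in>UNIV. \<bar>(u - w) $ i\<bar>)" unfolding dist_norm by (rule norm_le_l1_cart)
      also have "\<dots> \<le> (\<Sum>i\<in>(UNIV :: 3 set). \<delta>)" using u unfolding mem_box_around by (intro sum_mono) simp
      finally show ?thesis using \<delta>(1) by simp
    qed
    define v where "v = z - y"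
    have xs: "u \<in> ball x \<eta>" if u: "u \<in> cbox (y - ?e + s *\<^sub>R v) (y + ?e + s *\<^sub>R v)" and s: "s \<in> {0..1}" for u s
    proof -
      have "u \<in> cbox ((y + s *\<^sub>R v) - ?e) ((y + s *\<^sub>R v) + ?e)" using u by (simp add: algebra_simps)
      then have 1: "dist u (y + s *\<^sub>R v) < 4 * \<delta>" by (rule near)
      have "y + s *\<^sub>R v = (1 - s) *\<^sub>R y + s *\<^sub>R z" by (simp add: v_def algebra_simps)
      moreover have "(1 - s) *\<^sub>R y + s *\<^sub>R z \<in> ball x (\<eta> / 2)"
        using convex_ball[of x "\<eta> / 2"] y(2) z(2) s unfolding convex_alt by (simp add: dist_commute)
      ultimately have "dist x (y + s *\<^sub>R v) < \<eta> / 2" by simp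
      with 1 \<delta>(4) show ?thesis using dist_triangle[of x u "y + s *\<^sub>R v"] by (simp add: dist_commute)
    qed
    let ?\<psi> = "box_bump (y - ?e) (y + ?e) 0" and ?\<psi>' = "box_bump (z - ?e) (z + ?e) 0"
    have shift: "?\<psi> (u - v) = ?\<psi>' u" for u unfolding box_bump_translate v_def by (simp add: algebra_simps)
    let ?J = "LINT x|lborel. ?\<psi> x"
    have ts: "test_function (cbox (y - ?e) (y + ?e)) ?\<psi>" by (rule box_bump_test_function) simp
    have J': "(LINT x|lborel. ?\<psi>' x) = ?J"
      unfolding shift[symmetric] by (rule integral_lborel_translate[OF borel_measurable_continuous_onI[OF test_function_continuous[OF ts]]])
    have 1: "\<bar>(LINT x|L. \<phi> x * ?\<psi> (x - v)) - (LINT x|L. \<phi> x * ?\<psi> x)\<bar> \<le> 3 * C * norm v * ?J"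
    proof (rule Qk_difference_bound[OF \<phi> C])
      fix s :: real assume "s \<in> {0..1}"
      then show "cbox (y - ?e + s *\<^sub>R v) (y + ?e + s *\<^sub>R v) \<subseteq> \<Omega>"
        using xs[of _ s] r(2) \<eta>(2) by fastforce
    qed
    have 2: "\<bar>(LINT x|L. \<phi> x * ?\<psi> x) - p x * ?J\<bar> \<le> \<epsilon> * ?J"
    proof (rule weighted_average_close[OF K(1) Qk_facts(1)[OF \<phi>] p(2)])
      show "cbox (y - ?e) (y + ?e) \<subseteq> interior K"
        using near ry(2) \<delta>(2) by (fastforce simp: dist_commute)
      show "\<bar>p u - p x\<bar> \<le> \<epsilon>" if "u \<in> cbox (y - ?e) (y + ?e)" for u
        using xs[of u 0] that d(2)[of u] \<eta>(4) by (simp add: dist_real_def dist_commute)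
    qed
    have 3: "\<bar>(LINT x|L. \<phi> x * ?\<psi>' x) - q x * ?J\<bar> \<le> \<epsilon> * ?J"
      unfolding J'[symmetric]
    proof (rule weighted_average_close[OF K(2) Qk_facts(1)[OF \<phi>] q(2)])
      show "cbox (z - ?e) (z + ?e) \<subseteq> interior K'"
        using near rz(2) \<delta>(3) by (fastforce simp: dist_commute)
      show "\<bar>q u - q x\<bar> \<le> \<epsilon>" if u: "u \<in> cbox (z - ?e) (z + ?e)" for u
      proof -
        have "u \<in> cbox (y - ?e + 1 *\<^sub>R v) (y + ?e + 1 *\<^sub>R v)" using u by (simp add: v_def algebra_simps)
        from xs[OF this] show ?thesis using d(4)[of u] \<eta>(5) by (simp add: dist_real_def dist_commute)
      qed
    qed
    have J0: "?J > 0"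
    proof -
      have int: "integrable lborel ?\<psi>"
      proof (rule Bochner_Integration.integrable_bound)
        show "integrable lborel (indicator (cbox (y - ?e) (y + ?e)) :: _ \<Rightarrow> real)"
          by (intro integrable_real_indicator) (simp, rule emeasure_lborel_cbox_finite)
        show "?\<psi> \<in> borel_measurable lborel"
          using borel_measurable_continuous_onI[OF test_function_continuous[OF ts]] by simp
        show "AE x in lborel. norm (?\<psi> x) \<le> norm (indicator (cbox (y - ?e) (y + ?e)) x :: real)"
        proof (intro AE_I2)
          fix u
          show "norm (?\<psi> u) \<le> norm (indicator (cbox (y - ?e) (y + ?e)) u :: real)"
            using test_function_outside[OF ts, of u] box_bump_bounds[of "y - ?e" "y + ?e" 0 u]
            by (cases "u \<in> cbox (y - ?e) (y + ?e)") auto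
        qed
      qed
      have "?J \<noteq> 0"
      proof
        assume "?J = 0"
        then have "AE x in lborel. ?\<psi> x = 0"
          using integral_nonneg_eq_0_iff_AE[OF int] box_bump_bounds(1) by simp
        then have "AE x in lborel. x \<notin> box (y - ?e) (y + ?e)" by (simp add: box_bump_eq_0_iff)
        then have "box (y - ?e) (y + ?e) \<in> null_sets lborel"
          by (subst (asm) AE_iff_null_sets[symmetric]) auto
        then have "negligible (box (y - ?e) (y + ?e))"
          using null_sets_completionI negligible_iff_null_sets by blast
        moreover have "y \<in> box (y - ?e) (y + ?e)" using \<delta>(1) by (simp add: mem_box_cart)
        ultimately show False using open_not_negligible[OF open_box] by blast
      qed
      moreover have "?J \<ge> 0" by (intro Bochner_Integration.integral_nonneg) (simp add: box_bump_bounds)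
      ultimately show ?thesis by linarith
    qed
    have v: "norm v \<le> 2 * \<epsilon>"
    proof -
      have "norm v \<le> dist z x + dist y x" unfolding v_def by (metis dist_commute dist_norm dist_triangle)
      then show ?thesis using y(2) z(2) \<eta>(1,3) \<epsilon> by linarith
    qed
    have "\<bar>p x * ?J - q x * ?J\<bar> \<le> 2 * (\<epsilon> * ?J) + 3 * C * norm v * ?J"
      using 1 2 3 unfolding shift by linarith
    moreover have "\<bar>p x * ?J - q x * ?J\<bar> = \<bar>p x - q x\<bar> * ?J"
      using J0 by (simp add: left_diff_distrib[symmetric] abs_mult)
    moreover have "(2 * \<epsilon> + 3 * C * norm v) * ?J = 2 * (\<epsilon> * ?J) + 3 * C * norm v * ?J"
      by (simp add: algebra_simps)
    ultimately have "\<bar>p x - q x\<bar> * ?J \<le> (2 * \<epsilon> + 3 * C * norm v) * ?J" by linarith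
    then have "\<bar>p x - q x\<bar> \<le> 2 * \<epsilon> + 3 * C * norm v" using J0 by simp
    also have "\<dots> \<le> 2 * \<epsilon> + 3 * C * (2 * \<epsilon>)" using v C(1) by (intro add_left_mono mult_left_mono) auto
    finally show ?thesis by (simp add: algebra_simps)
  qed
  then have le: "\<bar>p x - q x\<bar> \<le> (2 + 6 * C) * \<epsilon>" if "\<epsilon> > 0" for \<epsilon> using that by blast
  have "\<bar>p x - q x\<bar> \<le> 0 + \<epsilon>" if "\<epsilon> > 0" for \<epsilon>
  proof -
    have pos: "2 + 6 * C > 0" using C(1) by simp
    then have "\<bar>p x - q x\<bar> \<le> (2 + 6 * C) * (\<epsilon> / (2 + 6 * C))" using that by (intro le) simp
    then show ?thesis using pos by simp
  qed
  then have "\<bar>p x - q x\<bar> \<le> 0" by (rule field_le_epsilon)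
  then show ?thesis by simp
qed

end

section \<open>Fields along particle paths\<close>

text \<open>Every such point has a basic neighbourhood that contains no other point of \<open>A\<close>.\<close>

lemma countable_isolated_points:
  fixes A :: "'a::second_countable_topology set"
  shows "countable {x \<in> A. \<not> x islimpt A}"
proof -
  obtain B :: "'a set set" where B: "countable B" "topological_basis B"
    using ex_countable_basis by blast
  have "\<forall>x\<in>{x \<in> A. \<not> x islimpt A}. \<exists>b. b \<in> B \<and> b \<inter> A = {x}"
  proof
    fix x assume "x \<in> {x \<in> A. \<not> x islimpt A}"
    then obtain U where U: "x \<in> A" "open U" "x \<in> U" "\<forall>y\<in>A. y \<in> U \<longrightarrow> y = x"
      unfolding islimpt_def by blast
    obtain b where b: "b \<in> B" "x \<in> b" "b \<subseteq> U" using topological_basisE[OF B(2) U(2,3)] by blast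
    have "b \<inter> A \<subseteq> {x}" using U(4) b(3) by blast
    then have "b \<inter> A = {x}" using U(1) b(2) by blast
    then show "\<exists>b. b \<in> B \<and> b \<inter> A = {x}" using b(1) by blast
  qed
  from bchoice[OF this] obtain f where f: "\<forall>x\<in>{x \<in> A. \<not> x islimpt A}. f x \<in> B \<and> f x \<inter> A = {x}" by blast
  have inj: "inj_on f {x \<in> A. \<not> x islimpt A}"
  proof (rule inj_onI)
    fix x y assume "x \<in> {x \<in> A. \<not> x islimpt A}" "y \<in> {x \<in> A. \<not> x islimpt A}" "f x = f y"
    then have "{x} = {y}" using f by metis
    then show "x = y" by simp
  qed
  have "f ` {x \<in> A. \<not> x islimpt A} \<subseteq> B" using f by blast
  then have "countable (f ` {x \<in> A. \<not> x islimpt A})" by (rule countable_subset[OF _ B(1)])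
  then show ?thesis by (rule countable_image_inj_on[OF _ inj])
qed

text \<open>Go from \<open>a\<close> to the last point of a set containing \<open>a\<close>. The remaining interval is covered by the other
sets, including its left endpoint because their union is closed; so induction on their number applies.\<close>

lemma closed_cover_lipschitz:
  fixes h :: "real \<Rightarrow> real"
  assumes "finite F" and cl: "\<And>i. i \<in> F \<Longrightarrow> closed (A i)"
    and cover: "{a..b} \<subseteq> (\<Union>i\<in>F. A i)" and "a \<le> b"
    and lip: "\<And>i s t. i \<in> F \<Longrightarrow> s \<in> A i \<inter> {a..b} \<Longrightarrow> t \<in> A i \<inter> {a..b} \<Longrightarrow> \<bar>h s - h t\<bar> \<le> \<Lambda> * \<bar>s - t\<bar>"
  shows "\<bar>h b - h a\<bar> \<le> \<Lambda> * (b - a)"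
  using assms
proof (induction "card F" arbitrary: F a)
  case 0
  then show ?case by auto
next
  case (Suc n)
  then obtain i where i: "i \<in> F" "a \<in> A i" by auto
  define s where "s = Sup (A i \<inter> {a..b})"
  have ne: "a \<in> A i \<inter> {a..b}" using i Suc.prems(4) by simp
  have "closed (A i \<inter> {a..b})" using Suc.prems(2)[OF i(1)] by auto
  then have s: "s \<in> A i \<inter> {a..b}"
    unfolding s_def by (rule closed_contains_Sup[rotated 2]) (use ne in \<open>auto intro: bdd_aboveI2\<close>)
  have above: "t \<notin> A i" if "s < t" "t \<le> b" for t
  proof
    assume "t \<in> A i"
    then have "t \<in> A i \<inter> {a..b}" using that s by auto
    then have "t \<le> s" unfolding s_def by (rule cSup_upper) (auto intro: bdd_aboveI2)
    then show False using that by simp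
  qed
  have 1: "\<bar>h s - h a\<bar> \<le> \<Lambda> * (s - a)" using Suc.prems(5)[OF i(1) s ne] s by simp
  show ?case
  proof (cases "s = b")
    case True
    then show ?thesis using 1 by simp
  next
    case False
    then have sb: "s < b" using s by simp
    let ?F = "F - {i}"
    have "{s<..b} \<subseteq> (\<Union>i\<in>?F. A i)"
    proof
      fix t assume t: "t \<in> {s<..b}"
      then have "t \<in> {a..b}" using s by auto
      then have "t \<in> (\<Union>i\<in>F. A i)" using Suc.prems(3) by blast
      then show "t \<in> (\<Union>i\<in>?F. A i)" using above t by auto
    qed
    moreover have "closed (\<Union>i\<in>?F. A i)" using Suc.prems(1,2) by auto
    ultimately have "closure {s<..b} \<subseteq> (\<Union>i\<in>?F. A i)" by (rule closure_minimal)
    then have cov: "{s..b} \<subseteq> (\<Union>i\<in>?F. A i)" using sb by simp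
    have "\<bar>h b - h s\<bar> \<le> \<Lambda> * (b - s)"
    proof (rule Suc.hyps(1)[of ?F s])
      show "n = card ?F" using Suc.hyps(2) i(1) Suc.prems(1) by simp
      show "\<bar>h u - h t\<bar> \<le> \<Lambda> * \<bar>u - t\<bar>" if "j \<in> ?F" "u \<in> A j \<inter> {s..b}" "t \<in> A j \<inter> {s..b}" for j u t
        using Suc.prems(5)[of j u t] that s by auto
    qed (use Suc.prems(1,2) cov sb in auto)
    then show ?thesis using 1 by (simp add: algebra_simps)
  qed
qed

lemma C1_lipschitz_on_cball:
  assumes "C1 p"
  obtains \<Lambda> where "\<Lambda> \<ge> 0" "\<And>x y. x \<in> cball 0 R \<Longrightarrow> y \<in> cball 0 R \<Longrightarrow> \<bar>p x - p y\<bar> \<le> \<Lambda> * norm (x - y)"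
proof -
  have "\<forall>i. \<exists>B\<ge>0. \<forall>x\<in>cball 0 R. \<bar>partial_deriv i p x\<bar> \<le> B"
  proof
    fix i
    have cpt: "compact (partial_deriv i p ` cball 0 R)"
      using assms by (intro compact_continuous_image) (auto simp: C1_def intro: continuous_on_subset)
    obtain B where B: "B > 0" "\<forall>y\<in>partial_deriv i p ` cball 0 R. norm y \<le> B"
      using compact_imp_bounded[OF cpt] unfolding bounded_pos by blast
    then show "\<exists>B\<ge>0. \<forall>x\<in>cball 0 R. \<bar>partial_deriv i p x\<bar> \<le> B" by (intro exI[of _ B]) auto
  qed
  from choice[OF this] obtain B where B: "\<And>i. B i \<ge> 0" "\<And>i x. x \<in> cball 0 R \<Longrightarrow> \<bar>partial_deriv i p x\<bar> \<le> B i" by blast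
  let ?L = "\<Sum>i\<in>UNIV. B i"
  have L0: "?L \<ge> 0" by (rule sum_nonneg) (rule B(1))
  have lip: "\<bar>p x - p y\<bar> \<le> ?L * norm (x - y)" if "x \<in> cball 0 R" "y \<in> cball 0 R" for x y
    proof -
      have "norm (p x - p y) \<le> ?L * norm (x - y)"
      proof (rule differentiable_bound[OF convex_cball[of 0 R]])
        fix z :: "real^3" assume z: "z \<in> cball 0 R"
        show "(p has_derivative (\<lambda>v. \<Sum>i\<in>UNIV. v $ i * partial_deriv i p z)) (at z within cball 0 R)"
          using assms by (intro has_derivative_at_withinI[OF has_derivative_partial_deriv]) (auto simp: C1_def)
        show "onorm (\<lambda>v. \<Sum>i\<in>UNIV. v $ i * partial_deriv i p z) \<le> ?L"
        proof (rule onorm_bound[OF L0])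
          fix v :: "real^3"
          have "norm (\<Sum>i\<in>UNIV. v $ i * partial_deriv i p z) \<le> (\<Sum>i\<in>UNIV. B i * norm v)"
          proof (rule sum_norm_le)
            fix i :: 3
            have "\<bar>partial_deriv i p z\<bar> * \<bar>v $ i\<bar> \<le> B i * norm v"
              by (intro mult_mono B component_le_norm_cart z) auto
            then show "norm (v $ i * partial_deriv i p z) \<le> B i * norm v" by (simp add: abs_mult mult.commute)
          qed
          then show "norm (\<Sum>i\<in>UNIV. v $ i * partial_deriv i p z) \<le> ?L * norm v"
            by (simp add: sum_distrib_right)
        qed
      qed (use that in auto)
      then show ?thesis by simp
    qed
  show thesis by (rule that[OF L0 lip])
qed

lemma has_derivative_along_path:
  assumes p: "p differentiable (at (X t))" and X: "(X has_vector_derivative X') (at t)"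
  shows "((\<lambda>s. p (X s)) has_real_derivative grad p (X t) \<bullet> X') (at t)"
proof -
  have "(X has_derivative (\<lambda>h. h *\<^sub>R X')) (at t)" using X by (simp add: has_vector_derivative_def)
  from has_derivative_compose[OF this has_derivative_partial_deriv[OF p]]
  show ?thesis unfolding has_field_derivative_def
    by (rule has_derivative_eq_rhs) (auto simp: grad_def inner_vec_def sum_distrib_right sum_distrib_left mult_ac)
qed

lemma derivative_eq_0_if_zero_on_limit_set:
  fixes h :: "real \<Rightarrow> real"
  assumes h: "(h has_real_derivative D) (at t)" and A: "t islimpt A" "t \<in> A" "\<And>s. s \<in> A \<Longrightarrow> h s = 0"
  shows "D = 0"
proof -
  have "(h has_real_derivative D) (at t within A)" using h by (rule has_field_derivative_at_within)
  then have "((\<lambda>s. (h s - h t) / (s - t)) \<longlongrightarrow> D) (at t within A)" unfolding has_field_derivative_iff .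
  moreover have "eventually (\<lambda>s. (h s - h t) / (s - t) = 0) (at t within A)"
    using A(2,3) by (auto simp: eventually_at_filter)
  ultimately have "((\<lambda>s. 0) \<longlongrightarrow> D) (at t within A)" by (rule Lim_transform_eventually)
  moreover have "\<not> trivial_limit (at t within A)" using A(1) by (simp add: trivial_limit_within)
  ultimately show ?thesis using tendsto_unique[OF _ _ tendsto_const] by blast
qed

context mesh
begin

lemma closed_cell: "K \<in> T \<Longrightarrow> closed K"
  using cell(2) compact_imp_closed by blast

text \<open>The polynomials of two cells agree at common points: inside the domain by continuity of conforming
fields, and on its boundary because they vanish.\<close>

lemma Qk0_representative:
  assumes \<phi>: "\<phi> \<in> Qk0 \<Omega> T n" and \<kappa>: "cell_selection T \<kappa>"
  obtains p where "\<And>K. K \<in> T \<Longrightarrow> p K \<in> Pk n" "\<And>K x. K \<in> T \<Longrightarrow> x \<in> interior K \<Longrightarrow> \<phi> x = p K x"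
    "\<And>K x. K \<in> T \<Longrightarrow> x \<in> K \<Longrightarrow> point_value \<kappa> \<phi> x = p K x"
    "\<And>K x. K \<in> T \<Longrightarrow> x \<in> K \<Longrightarrow> x \<notin> \<Omega> \<Longrightarrow> p K x = 0"
proof -
  have Q: "\<phi> \<in> Qk \<Omega> T n" using \<phi> by (simp add: Qk0_def)
  have "\<forall>K\<in>T. \<exists>p. p \<in> Pk n \<and> (\<forall>x\<in>interior K. \<phi> x = p x)"
    using Qk_facts(2)[OF Q] unfolding pw_poly_def by blast
  from bchoice[OF this] obtain p where p: "\<And>K. K \<in> T \<Longrightarrow> p K \<in> Pk n" "\<And>K x. K \<in> T \<Longrightarrow> x \<in> interior K \<Longrightarrow> \<phi> x = p K x" by blast
  have tr: "cell_trace K \<phi> x = p K x" if "K \<in> T" "x \<in> K" for K x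
    using that by (intro trace_eq p Pk_continuous[OF p(1)])
  have zero: "p K x = 0" if "K \<in> T" "x \<in> K" "x \<notin> \<Omega>" for K x
  proof -
    have "x \<in> frontier \<Omega>" using that domain(1,3) by (auto simp: frontier_def interior_open)
    then show ?thesis using \<phi> that tr[OF that(1,2)] by (simp add: Qk0_def)
  qed
  have agree: "p K x = p K' x" if "K \<in> T" "K' \<in> T" "x \<in> K" "x \<in> K'" for K K' x
  proof (cases "x \<in> \<Omega>")
    case True
    show ?thesis
      by (rule Qk_traces_agree[OF Q that True Pk_continuous[OF p(1)[OF that(1)]] p(2)[OF that(1)]
            Pk_continuous[OF p(1)[OF that(2)]] p(2)[OF that(2)]])
  next
    case False
    then show ?thesis using zero that by simp
  qed
  have "point_value \<kappa> \<phi> x = p K x" if "K \<in> T" "x \<in> K" for K x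
  proof -
    have k: "\<kappa> x \<in> T" "x \<in> \<kappa> x" using \<kappa> that by (auto simp: cell_selection_def)
    then show ?thesis using agree[OF k(1) that(1) k(2) that(2)] tr[OF k] by (simp add: point_value_def)
  qed
  with p zero show thesis by (intro that[of p]) auto
qed

text \<open>The segment between two points may leave the domain, where the field is extended by zero. The segment is
covered by the closed preimages of the cells and of the complement of the domain, and on each of these
the extended field is a polynomial or zero.\<close>

lemma Qk0_lipschitz:
  assumes \<phi>: "\<phi> \<in> Qk0 \<Omega> T n" and \<kappa>: "cell_selection T \<kappa>"
  obtains \<Lambda> where "\<Lambda> \<ge> 0"
    "\<And>x y. x \<in> \<Union>T \<Longrightarrow> y \<in> \<Union>T \<Longrightarrow> \<bar>point_value \<kappa> \<phi> x - point_value \<kappa> \<phi> y\<bar> \<le> \<Lambda> * norm (x - y)"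
proof -
  obtain p where p: "\<And>K. K \<in> T \<Longrightarrow> p K \<in> Pk n"
    "\<And>K x. K \<in> T \<Longrightarrow> x \<in> K \<Longrightarrow> point_value \<kappa> \<phi> x = p K x"
    "\<And>K x. K \<in> T \<Longrightarrow> x \<in> K \<Longrightarrow> x \<notin> \<Omega> \<Longrightarrow> p K x = 0"
    by (rule Qk0_representative[OF \<phi> \<kappa>]) blast
  obtain R where R: "\<And>x. x \<in> \<Union>T \<Longrightarrow> x \<in> cball 0 R"
    using domain(2,3) bounded_closure[of \<Omega>] unfolding bounded_iff by auto
  have "\<forall>K\<in>T. \<exists>\<Lambda>\<ge>0. \<forall>x\<in>cball 0 R. \<forall>y\<in>cball 0 R. \<bar>p K x - p K y\<bar> \<le> \<Lambda> * norm (x - y)"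
  proof
    fix K assume "K \<in> T"
    obtain \<Lambda> where "\<Lambda> \<ge> 0" "\<And>x y. x \<in> cball 0 R \<Longrightarrow> y \<in> cball 0 R \<Longrightarrow> \<bar>p K x - p K y\<bar> \<le> \<Lambda> * norm (x - y)"
      by (rule C1_lipschitz_on_cball[OF Pk_C1[OF p(1)[OF \<open>K \<in> T\<close>]], of R]) blast
    then show "\<exists>\<Lambda>\<ge>0. \<forall>x\<in>cball 0 R. \<forall>y\<in>cball 0 R. \<bar>p K x - p K y\<bar> \<le> \<Lambda> * norm (x - y)" by blast
  qed
  from bchoice[OF this] obtain M where M: "\<And>K. K \<in> T \<Longrightarrow> M K \<ge> 0"
    "\<And>K x y. K \<in> T \<Longrightarrow> x \<in> cball 0 R \<Longrightarrow> y \<in> cball 0 R \<Longrightarrow> \<bar>p K x - p K y\<bar> \<le> M K * norm (x - y)" by blast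
  define \<Lambda> where "\<Lambda> = (\<Sum>K\<in>T. M K)"
  have \<Lambda>0: "\<Lambda> \<ge> 0" unfolding \<Lambda>_def using M(1) by (simp add: sum_nonneg)
  have M\<Lambda>: "M K \<le> \<Lambda>" if "K \<in> T" for K unfolding \<Lambda>_def using M(1) domain(4) that by (intro member_le_sum) auto
  show thesis
  proof (rule that[OF \<Lambda>0])
    fix x y assume x: "x \<in> \<Union>T" and y: "y \<in> \<Union>T"
    define \<Phi> where "\<Phi> = (\<lambda>x. if x \<in> \<Union>T then point_value \<kappa> \<phi> x else 0)"
    define seg where "seg = (\<lambda>r. x + r *\<^sub>R (y - x))"
    have segcont: "continuous_on UNIV seg" unfolding seg_def by (intro continuous_intros)
    have segR: "seg r \<in> cball 0 R" if "r \<in> {0..1}" for r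
    proof -
      have "seg r = (1 - r) *\<^sub>R x + r *\<^sub>R y" by (simp add: seg_def algebra_simps)
      moreover have "0 \<le> r \<and> r \<le> 1" using that by simp
      then have "(1 - r) *\<^sub>R x + r *\<^sub>R y \<in> cball 0 R"
        using convex_cball[of 0 R] R[OF x] R[OF y] unfolding convex_alt by blast
      ultimately show ?thesis by (simp only:)
    qed
    have segd: "norm (seg r - seg s) = \<bar>r - s\<bar> * norm (x - y)" for r s
      by (simp add: seg_def scaleR_left_diff_distrib[symmetric] norm_minus_commute)
    let ?A = "\<lambda>Z. case Z of None \<Rightarrow> seg -` (- \<Omega>) | Some K \<Rightarrow> seg -` K"
    have "\<bar>(\<Phi> \<circ> seg) 1 - (\<Phi> \<circ> seg) 0\<bar> \<le> (\<Lambda> * norm (x - y)) * (1 - 0)"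
    proof (rule closed_cover_lipschitz[of "insert None (Some ` T)" ?A])
      show "closed (?A Z)" if "Z \<in> insert None (Some ` T)" for Z
        using that closed_cell domain(1) by (auto intro!: closed_vimage[OF _ segcont])
      show "{0..1} \<subseteq> (\<Union>Z\<in>insert None (Some ` T). ?A Z)"
      proof
        fix r
        show "r \<in> (\<Union>Z\<in>insert None (Some ` T). ?A Z)"
        proof (cases "seg r \<in> \<Omega>")
          case True
          then obtain K where "K \<in> T" "seg r \<in> K" using domain(3) closure_subset by blast
          then show ?thesis by auto
        qed auto
      qed
      fix Z s t assume Z: "Z \<in> insert None (Some ` T)" and s: "s \<in> ?A Z \<inter> {0..1}" and t: "t \<in> ?A Z \<inter> {0..1}"
      show "\<bar>(\<Phi> \<circ> seg) s - (\<Phi> \<circ> seg) t\<bar> \<le> \<Lambda> * norm (x - y) * \<bar>s - t\<bar>"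
      proof (cases Z)
        case None
        have "\<Phi> z = 0" if z: "z \<notin> \<Omega>" for z
        proof (cases "z \<in> \<Union>T")
          case True
          then obtain K where "K \<in> T" "z \<in> K" by blast
          then show ?thesis using p(2,3) z by (simp add: \<Phi>_def)
        qed (simp add: \<Phi>_def)
        then have "(\<Phi> \<circ> seg) s = 0" "(\<Phi> \<circ> seg) t = 0" using None s t by auto
        then show ?thesis using \<Lambda>0 by simp
      next
        case (Some K)
        then have K: "K \<in> T" "seg s \<in> K" "seg t \<in> K" using Z s t by auto
        have "\<Phi> z = p K z" if "z \<in> K" for z using K(1) that p(2)[OF K(1) that] by (auto simp: \<Phi>_def)
        then have "\<bar>(\<Phi> \<circ> seg) s - (\<Phi> \<circ> seg) t\<bar> = \<bar>p K (seg s) - p K (seg t)\<bar>" using K by simp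
        also have "\<dots> \<le> M K * norm (seg s - seg t)" using s t by (intro M(2)[OF K(1)] segR) auto
        also have "\<dots> \<le> \<Lambda> * norm (seg s - seg t)" using M\<Lambda>[OF K(1)] by (intro mult_right_mono) auto
        finally show ?thesis unfolding segd by (simp add: mult_ac)
      qed
    qed (use domain(4) in auto)
    moreover have "seg 0 = x" "seg 1 = y" by (simp_all add: seg_def)
    ultimately show "\<bar>point_value \<kappa> \<phi> x - point_value \<kappa> \<phi> y\<bar> \<le> \<Lambda> * norm (x - y)"
      using x y by (simp add: \<Phi>_def abs_minus_commute)
  qed
qed

lemma on_cells_grad_trace:
  assumes K: "K \<in> T" "x \<in> K" and p: "p \<in> Pk n" "\<And>y. y \<in> interior K \<Longrightarrow> \<phi> y = p y"
  shows "cell_trace K (on_cells (grad \<phi>)) x = grad p x"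
proof (rule trace_eq[OF K])
  fix y assume y: "y \<in> interior K"
  have "partial_deriv i \<phi> y = partial_deriv i p y" for i
    by (rule partial_deriv_cong_open[OF open_interior y]) (rule p(2))
  then show "on_cells (grad \<phi>) y = grad p y" using y K(1) by (auto simp: on_cells_def S_def grad_def)
next
  show "continuous_on UNIV (grad p)"
    using Pk_continuous[OF Pk_partial_deriv[OF p(1)]] unfolding grad_def[abs_def] by (intro continuous_on_vec_lambda)
qed

text \<open>For all but countably many times at which the path meets two cells, the path meets both at times
  accumulating there, so the derivatives of the two polynomials along the path agree.\<close>

lemma Qk0_path_derivative:
  assumes \<phi>: "\<phi> \<in> Qk0 \<Omega> T n" and \<kappa>: "cell_selection T \<kappa>"
    and X: "\<And>t. t \<in> {a..b} \<Longrightarrow> X t \<in> \<Union>T"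
  shows "\<exists>N. countable N \<and> (\<forall>t\<in>{a<..<b} - N. \<forall>X'. (X has_vector_derivative X') (at t) \<longrightarrow>
     ((\<lambda>s. point_value \<kappa> \<phi> (X s)) has_real_derivative point_value \<kappa> (on_cells (grad \<phi>)) (X t) \<bullet> X') (at t))"
proof -
  obtain p where p: "\<And>K. K \<in> T \<Longrightarrow> p K \<in> Pk n" "\<And>K x. K \<in> T \<Longrightarrow> x \<in> interior K \<Longrightarrow> \<phi> x = p K x"
    "\<And>K x. K \<in> T \<Longrightarrow> x \<in> K \<Longrightarrow> point_value \<kappa> \<phi> x = p K x"
    by (rule Qk0_representative[OF \<phi> \<kappa>]) blast
  define A where "A = (\<lambda>K K'. {t \<in> {a<..<b}. X t \<in> K \<and> X t \<in> K'})"
  \<comment> \<open>The times that are isolated among the times spent in two given cells.\<close>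
  define N where "N = (\<Union>K\<in>T. \<Union>K'\<in>T. {t \<in> A K K'. \<not> t islimpt A K K'})"
  have "countable N"
    unfolding N_def using domain(4) by (intro countable_UN countable_isolated_points countable_finite) auto
  moreover have "((\<lambda>s. point_value \<kappa> \<phi> (X s)) has_real_derivative point_value \<kappa> (on_cells (grad \<phi>)) (X t) \<bullet> X') (at t)"
    if t: "t \<in> {a<..<b} - N" and X': "(X has_vector_derivative X') (at t)" for t X'
  proof -
    define K0 where "K0 = \<kappa> (X t)"
    have K0: "K0 \<in> T" "X t \<in> K0" using \<kappa> X[of t] t by (auto simp: cell_selection_def K0_def)
    define c where "c = grad (p K0) (X t) \<bullet> X'"
    have pv: "point_value \<kappa> (on_cells (grad \<phi>)) (X t) \<bullet> X' = c"
      unfolding point_value_def c_def using on_cells_grad_trace[OF K0 p(1)[OF K0(1)] p(2)[OF K0(1)]] by (simp add: K0_def)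
    have pd: "((\<lambda>s. p K (X s)) has_real_derivative grad (p K) (X t) \<bullet> X') (at t)" if "K \<in> T" for K
      by (rule has_derivative_along_path[OF Pk_differentiable[OF p(1)[OF that]] X'])
    have same: "grad (p K) (X t) \<bullet> X' = c" if K: "K \<in> T" "X t \<in> K" for K
    proof -
      have tA: "t \<in> A K K0" using t K K0 by (auto simp: A_def)
      then have "t islimpt A K K0" using t K(1) K0(1) by (auto simp: N_def)
      moreover have "p K (X s) - p K0 (X s) = 0" if "s \<in> A K K0" for s
        using that p(3)[OF K(1), of "X s"] p(3)[OF K0(1), of "X s"] by (simp add: A_def)
      ultimately have "grad (p K) (X t) \<bullet> X' - grad (p K0) (X t) \<bullet> X' = 0"
        using tA by (intro derivative_eq_0_if_zero_on_limit_set[OF DERIV_diff[OF pd[OF K(1)] pd[OF K0(1)]]]) auto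
      then show ?thesis by (simp add: c_def)
    qed
    have Xcont: "isCont X t" using X' by (rule has_vector_derivative_continuous)
    have "((\<lambda>s. point_value \<kappa> \<phi> (X s)) has_derivative (\<lambda>h. c * h)) (at t)"
      unfolding has_derivative_at_within
    proof (intro conjI)
      show "bounded_linear (\<lambda>h. c * h)" by (rule bounded_linear_mult_right)
      let ?q = "\<lambda>g s. (g s - g t - c * (s - t)) /\<^sub>R norm (s - t)"
      let ?g = "\<lambda>s. point_value \<kappa> \<phi> (X s)"
      show "(?q ?g \<longlongrightarrow> 0) (at t)"
      proof (rule tendstoI)
        fix \<epsilon> :: real assume \<epsilon>: "\<epsilon> > 0"
        have cells: "eventually (\<lambda>s. X s \<in> K \<longrightarrow> dist (?q ?g s) 0 < \<epsilon>) (at t)" if K: "K \<in> T" for K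
        proof (cases "X t \<in> K")
          case True
          have "((\<lambda>s. p K (X s)) has_derivative (\<lambda>h. c * h)) (at t)"
            using pd[OF K] same[OF K True] by (simp add: has_field_derivative_def)
          then have "(?q (\<lambda>s. p K (X s)) \<longlongrightarrow> 0) (at t)" unfolding has_derivative_at_within by blast
          from tendstoD[OF this \<epsilon>] show ?thesis
          proof eventually_elim
            case (elim s)
            show ?case
            proof
              assume s: "X s \<in> K"
              show "dist (?q ?g s) 0 < \<epsilon>" using elim p(3)[OF K s] p(3)[OF K True] by simp
            qed
          qed
        next
          case False
          have "open (- K)" using closed_cell[OF K] by auto
          then have "eventually (\<lambda>s. X s \<in> - K) (at t)"
            using Xcont False unfolding isCont_def by (intro topological_tendstoD) auto
          then show ?thesis by eventually_elim simp
        qed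
        have "eventually (\<lambda>s. \<forall>K\<in>T. X s \<in> K \<longrightarrow> dist (?q ?g s) 0 < \<epsilon>) (at t)"
          by (rule eventually_ball_finite[OF domain(4)]) (use cells in blast)
        moreover have "eventually (\<lambda>s. s \<in> {a<..<b}) (at t)"
          using t by (intro eventually_at_in_open') auto
        ultimately show "eventually (\<lambda>s. dist (?q ?g s) 0 < \<epsilon>) (at t)"
        proof eventually_elim
          case (elim s)
          then obtain K where "K \<in> T" "X s \<in> K" using X[of s] by auto
          then show ?case using elim(1) by blast
        qed
      qed
    qed
    then show ?thesis unfolding pv has_field_derivative_def .
  qed
  ultimately show ?thesis by blast
qed

subsection \<open>Gradients and curls as test functions\<close>

text \<open>The boundary facet is flat near \<open>x\<close>, so the tangential part \<open>v\<close> of the gradient points into it and the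
derivative of \<open>p\<close> in the direction \<open>v\<close> is zero.\<close>

lemma grad_parallel_normal:
  assumes bn: "boundary_normal \<Omega> K x n" and p: "p differentiable (at x)"
    and zero: "\<And>r y. boundary_normal \<Omega> K y n \<Longrightarrow> p y = 0"
  shows "grad p x = (n \<bullet> grad p x) *\<^sub>R n"
proof -
  obtain r where r: "r > 0" "norm n = 1" "K \<inter> ball x r = {y. n \<bullet> (y - x) \<le> 0} \<inter> ball x r"
    "{y. n \<bullet> (y - x) = 0} \<inter> ball x r \<subseteq> frontier \<Omega>"
    using bn unfolding boundary_normal_def by blast
  have near: "boundary_normal \<Omega> K y n" if y: "n \<bullet> (y - x) = 0" "y \<in> ball x r" for y
  proof -
    have eq: "n \<bullet> (z - y) = n \<bullet> (z - x)" for z using y(1) by (simp add: inner_diff_right)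
    have sub: "ball y (r - dist x y) \<subseteq> ball x r"
    proof
      fix z assume "z \<in> ball y (r - dist x y)"
      then show "z \<in> ball x r" using dist_triangle[of x z y] by simp
    qed
    have "K \<inter> ball y (r - dist x y) = {z. n \<bullet> (z - y) \<le> 0} \<inter> ball y (r - dist x y)"
      unfolding eq using r(3) sub by blast
    moreover have "{z. n \<bullet> (z - y) = 0} \<inter> ball y (r - dist x y) \<subseteq> frontier \<Omega>"
      unfolding eq using r(4) sub by blast
    moreover have "r - dist x y > 0" using y(2) by simp
    ultimately show ?thesis unfolding boundary_normal_def using r(2) by blast
  qed
  define g where "g = grad p x"
  define v where "v = g - (n \<bullet> g) *\<^sub>R n"
  have nn: "n \<bullet> n = 1" using r(2) by (simp add: power2_norm_eq_inner[symmetric])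
  have nv: "n \<bullet> v = 0" by (simp add: v_def inner_diff_right nn)
  have X: "((\<lambda>s. x + s *\<^sub>R v) has_vector_derivative v) (at 0)"
    by (auto intro!: derivative_eq_intros)
  have d: "((\<lambda>s. p (x + s *\<^sub>R v)) has_real_derivative grad p (x + 0 *\<^sub>R v) \<bullet> v) (at 0)"
    by (rule has_derivative_along_path[OF _ X]) (use p in simp)
  have "grad p (x + 0 *\<^sub>R v) \<bullet> v = 0"
  proof (rule derivative_eq_0_if_zero_on_limit_set[OF d])
    let ?A = "{s. x + s *\<^sub>R v \<in> ball x r}"
    have "continuous_on UNIV (\<lambda>s. x + s *\<^sub>R v)" by (intro continuous_intros)
    then have "open ((\<lambda>s. x + s *\<^sub>R v) -` ball x r)" by (rule open_vimage[OF open_ball])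
    then have "open ?A" by (simp only: vimage_def)
    moreover show 0: "0 \<in> ?A" using r(1) by simp
    ultimately show "0 islimpt ?A" by (simp add: interior_limit_point interior_open)
    show "p (x + s *\<^sub>R v) = 0" if "s \<in> ?A" for s
      using that nv by (intro zero near) auto
  qed
  then have "g \<bullet> v = 0" by (simp add: g_def)
  moreover have "v \<bullet> v = g \<bullet> v - (n \<bullet> g) * (n \<bullet> v)" by (simp add: v_def inner_diff_left)
  ultimately have "v = 0" using nv by simp
  then show ?thesis by (simp add: v_def g_def)
qed

lemma boundary_normal_frontier: "boundary_normal \<Omega> K x n \<Longrightarrow> x \<in> frontier \<Omega>"
proof -
  assume "boundary_normal \<Omega> K x n"
  then obtain r where "r > 0" "{y. n \<bullet> (y - x) = 0} \<inter> ball x r \<subseteq> frontier \<Omega>"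
    unfolding boundary_normal_def by blast
  moreover from this have "x \<in> {y. n \<bullet> (y - x) = 0} \<inter> ball x r" by simp
  ultimately show ?thesis by blast
qed

lemma pw_polyvec_on_cells:
  assumes "pw_polyvec n f"
  shows "pw_polyvec n (on_cells f)"
proof
  fix i
  have "pw_poly n (\<lambda>x. f x $ i)" using assms by blast
  then show "pw_poly n (\<lambda>x. on_cells f x $ i)" by (rule pw_poly_cong) (simp add: on_cells_def)
qed

lemma pw_polyvec_on_cells_L2:
  assumes "pw_polyvec n f"
  shows "on_cells f \<in> L2 \<Omega>"
proof -
  obtain C where "C \<ge> 0" "\<And>x. x \<in> S \<Longrightarrow> norm (f x) \<le> C" by (rule pw_polyvec_bounded[OF assms]) blast
  then show ?thesis by (intro L2_if_bounded[OF on_cells_vec_measurable[OF assms], of C]) (auto simp: on_cells_def)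
qed

text \<open>The first arrow of the discrete de Rham complex. The weak curl of a weak gradient is zero since the mixed
derivatives of test functions commute; the tangential trace vanishes since a function that is zero on
a flat face has a gradient normal to it.\<close>

lemma grad_in_Nk0:
  assumes \<phi>: "\<phi> \<in> Qk0 \<Omega> T (k + 1)"
  shows "on_cells (grad \<phi>) \<in> Nk0 \<Omega> T k" and "has_weak_curl \<Omega> (on_cells (grad \<phi>)) (\<lambda>x. 0)"
    and "AE x in L. wcurl \<Omega> (on_cells (grad \<phi>)) x = 0" and "AE x in L. wgrad \<Omega> \<phi> x = on_cells (grad \<phi>) x"
proof -
  have Q: "\<phi> \<in> Qk \<Omega> T (k + 1)" using \<phi> by (simp add: Qk0_def)
  let ?\<nu> = "on_cells (grad \<phi>)" and ?w = "wgrad \<Omega> \<phi>"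
  have pw: "pw_polyvec k (grad \<phi>)"
    using pw_poly_partial_deriv[OF Qk_facts(2)[OF Q]] by (simp add: grad_def)
  have pw': "pw_polyvec k ?\<nu>"
    by (rule pw_polyvec_on_cells[OF pw])
  have L2: "?\<nu> \<in> L2 \<Omega>" by (rule pw_polyvec_on_cells_L2[OF pw])
  show ae: "AE x in L. ?w x = ?\<nu> x"
    using Qk_facts(4)[OF Q] AE_S by eventually_elim (simp add: on_cells_def)
  show curl0: "has_weak_curl \<Omega> ?\<nu> (\<lambda>x. 0)"
    unfolding has_weak_curl_def
  proof (intro conjI allI impI)
    show "(\<lambda>x. 0) \<in> L2 \<Omega>" by (rule L2_const)
    fix \<Psi> :: "real^3 \<Rightarrow> real^3" assume "\<forall>i. test_function \<Omega> (\<lambda>x. \<Psi> x $ i)"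
    then have t: "test_function \<Omega> (\<lambda>x. \<Psi> x $ i)" for i by blast
    define D where "D = (\<lambda>j l. partial_deriv j (\<lambda>x. \<Psi> x $ l))"
    have tD: "test_function \<Omega> (D j l)" for j l unfolding D_def by (rule test_function_partial_deriv[OF t])
    have int: "integrable L (\<lambda>x. ?w x $ i * D j l x)" for i j l
      by (rule L2_mult_integrable[OF L2_nth[OF Qk_wgrad_L2[OF Q]] test_function_L2[OF tD]])
    define Z where "Z = (\<lambda>i j l. LINT x|L. ?w x $ i * D j l x)"
    have sym: "Z i j l = Z j i l" for i j l
    proof -
      have "Z i j l = - (LINT x|L. \<phi> x * partial_deriv i (D j l) x)" for i j
        using Qk_facts(3)[OF Q] tD by (simp add: Z_def has_weak_grad_def)
      moreover have "partial_deriv i (D j l) = partial_deriv j (D i l)"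
        unfolding D_def by (rule test_function_mixed[OF t])
      ultimately show ?thesis by simp
    qed
    have curlL2: "curl \<Psi> \<in> L2 \<Omega>"
    proof (rule L2_vec)
      fix i
      have "(\<lambda>x. D a b x - D a' b' x) \<in> L2 \<Omega>" for a b a' b'
        using L2_add[OF test_function_L2[OF tD[of a b]] L2_cmult[OF test_function_L2[OF tD[of a' b']], of "-1"]] by simp
      then show "(\<lambda>x. curl \<Psi> x $ i) \<in> L2 \<Omega>"
        using exhaust_3[of i] by (auto simp: curl_nth D_def)
    qed
    have "(LINT x|L. ?\<nu> x \<bullet> curl \<Psi> x) = (LINT x|L. ?w x \<bullet> curl \<Psi> x)"
    proof (rule integral_cong_AE)
      show "AE x in L. ?\<nu> x \<bullet> curl \<Psi> x = ?w x \<bullet> curl \<Psi> x" using ae by eventually_elim simp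
    qed (use L2_inner_integrable[OF L2 curlL2] L2_inner_integrable[OF Qk_wgrad_L2[OF Q] curlL2] in auto)
    also have "\<dots> = (LINT x|L. (?w x $ 1 * D 2 3 x - ?w x $ 1 * D 3 2 x) + (?w x $ 2 * D 3 1 x - ?w x $ 2 * D 1 3 x)
        + (?w x $ 3 * D 1 2 x - ?w x $ 3 * D 2 1 x))"
      by (simp add: inner3 curl_nth D_def right_diff_distrib)
    also have "\<dots> = (Z 1 2 3 - Z 1 3 2) + (Z 2 3 1 - Z 2 1 3) + (Z 3 1 2 - Z 3 2 1)"
      unfolding Z_def using int by simp
    also have "\<dots> = 0" using sym[of 1 2 3] sym[of 1 3 2] sym[of 2 3 1] by simp
    finally show "(LINT x|L. ?\<nu> x \<bullet> curl \<Psi> x) = (LINT x|L. 0 \<bullet> \<Psi> x)" by simp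
  qed
  have cellrep: "\<exists>p\<in>Pkvec k. \<exists>q\<in>Pkvec k. \<forall>x\<in>interior K. ?\<nu> x = p x + cross3 x (q x)" if K: "K \<in> T" for K
  proof -
    obtain p where p: "\<And>i. (\<lambda>x. p x $ i) \<in> Pk k" "\<And>y. y \<in> interior K \<Longrightarrow> ?\<nu> y = p y"
      by (rule pw_polyvec_trace[OF K pw']) blast
    have "p \<in> Pkvec k" "(\<lambda>x. 0) \<in> Pkvec k" using p(1) Pk_zero by (auto simp: Pkvec_def)
    then show ?thesis using p(2) by (intro bexI[of _ p] bexI[of _ "\<lambda>x. 0"]) auto
  qed
  have N: "?\<nu> \<in> Nk \<Omega> T k" using L2 curl0 cellrep unfolding Nk_def Hcurl_def by blast
  have bc: "cross3 n (cell_trace K ?\<nu> x) = 0" if K: "K \<in> T" "boundary_normal \<Omega> K x n" for K x n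
  proof -
    obtain p where p: "p \<in> Pk (k + 1)" "\<And>y. y \<in> interior K \<Longrightarrow> \<phi> y = p y" "\<And>y. y \<in> K \<Longrightarrow> cell_trace K \<phi> y = p y"
      by (rule pw_poly_trace[OF K(1) boundary_normal_mem[OF K(2)] Qk_facts(2)[OF Q]]) blast
    have "grad p x = (n \<bullet> grad p x) *\<^sub>R n"
    proof (rule grad_parallel_normal[OF K(2) Pk_differentiable[OF p(1)]])
      fix y assume y: "boundary_normal \<Omega> K y n"
      have "y \<in> K \<inter> frontier \<Omega>" using boundary_normal_mem[OF y] boundary_normal_frontier[OF y] by blast
      then have "cell_trace K \<phi> y = 0" using \<phi> K(1) unfolding Qk0_def by blast
      then show "p y = 0" using p(3)[OF boundary_normal_mem[OF y]] by simp
    qed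
    then have "cross3 n (grad p x) = 0" by (metis cross_mult_right cross_refl scaleR_zero_right)
    then show ?thesis using on_cells_grad_trace[OF K(1) boundary_normal_mem[OF K(2)] p(1,2)] by simp
  qed
  show N0: "?\<nu> \<in> Nk0 \<Omega> T k" using N bc by (simp add: Nk0_def)
  have "has_weak_curl \<Omega> ?\<nu> (wcurl \<Omega> ?\<nu>)" by (rule Nk_facts(3)[OF N])
  from weak_curl_eq_curl[OF pw' L2 this] weak_curl_eq_curl[OF pw' L2 curl0]
  show "AE x in L. wcurl \<Omega> ?\<nu> x = 0" by eventually_elim simp
qed

lemma partial_deriv_lin:
  assumes "f differentiable (at x)" "g differentiable (at x)"
  shows "partial_deriv i (\<lambda>x. a * f x - b * g x) x = a * partial_deriv i f x - b * partial_deriv i g x"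
proof -
  have "(f has_derivative frechet_derivative f (at x)) (at x)" "(g has_derivative frechet_derivative g (at x)) (at x)"
    using assms frechet_derivative_works by blast+
  from partial_deriv_eqI[OF has_derivative_diff[OF has_derivative_mult_right[OF this(1)] has_derivative_mult_right[OF this(2)]]]
  show ?thesis by (simp add: partial_deriv_def)
qed

lemma cross3_nth:
  "cross3 a b $ 1 = a $ 2 * b $ 3 - a $ 3 * b $ 2"
  "cross3 a b $ 2 = a $ 3 * b $ 1 - a $ 1 * b $ 3"
  "cross3 a b $ 3 = a $ 1 * b $ 2 - a $ 2 * b $ 1"
  by (simp_all add: cross3_def)

text \<open>If \<open>n \<times> p = 0\<close> on the face, each component of \<open>n \<times> p\<close> has a gradient parallel to \<open>n\<close> there, so the
  divergence of \<open>n \<times> p\<close>, which is \<open>- n \<bullet> curl p\<close>, is the normal derivative of \<open>n \<bullet> (n \<times> p) = 0\<close>.\<close>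

lemma normal_curl_eq_0:
  assumes bn: "boundary_normal \<Omega> K x n" and p: "\<And>i. (\<lambda>x. p x $ i) \<in> Pk l"
    and zero: "\<And>y. boundary_normal \<Omega> K y n \<Longrightarrow> cross3 n (p y) = 0"
  shows "n \<bullet> curl p x = 0"
proof -
  define D where "D = (\<lambda>i j. partial_deriv i (\<lambda>y. p y $ j) x)"
  have d: "(\<lambda>y. p y $ i) differentiable (at x)" for i by (rule Pk_differentiable[OF p])
  have par: "grad (\<lambda>y. cross3 n (p y) $ j) x $ i = (n \<bullet> grad (\<lambda>y. cross3 n (p y) $ j) x) * n $ i" for i j
  proof -
    have "(\<lambda>y. cross3 n (p y) $ j) differentiable (at x)"
      using exhaust_3[of j] d by (auto simp: cross3_nth intro!: differentiable_diff differentiable_mult)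
    then have "grad (\<lambda>y. cross3 n (p y) $ j) x = (n \<bullet> grad (\<lambda>y. cross3 n (p y) $ j) x) *\<^sub>R n"
      using zero by (intro grad_parallel_normal[OF bn]) auto
    from arg_cong[OF this, of "\<lambda>v. v $ i"] show ?thesis by (simp only: vector_scaleR_component real_scaleR_def)
  qed
  have g: "grad (\<lambda>y. cross3 n (p y) $ 1) x $ i = n $ 2 * D i 3 - n $ 3 * D i 2"
    "grad (\<lambda>y. cross3 n (p y) $ 2) x $ i = n $ 3 * D i 1 - n $ 1 * D i 3"
    "grad (\<lambda>y. cross3 n (p y) $ 3) x $ i = n $ 1 * D i 2 - n $ 2 * D i 1" for i
    by (simp_all add: grad_def cross3_nth D_def partial_deriv_lin[OF d d])
  have "n \<bullet> curl p x = - ((n $ 2 * D 1 3 - n $ 3 * D 1 2) + (n $ 3 * D 2 1 - n $ 1 * D 2 3) + (n $ 1 * D 3 2 - n $ 2 * D 3 1))"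
    by (simp add: inner3 curl_nth D_def algebra_simps)
  also have "\<dots> = - ((n \<bullet> grad (\<lambda>y. cross3 n (p y) $ 1) x) * n $ 1 + (n \<bullet> grad (\<lambda>y. cross3 n (p y) $ 2) x) * n $ 2
      + (n \<bullet> grad (\<lambda>y. cross3 n (p y) $ 3) x) * n $ 3)"
    unfolding par[symmetric] g ..
  also have "\<dots> = 0" unfolding inner3 g by (simp add: algebra_simps)
  finally show ?thesis .
qed

text \<open>The second arrow of the discrete de Rham complex, by the same arguments for the curl.\<close>

lemma curl_in_RTk0:
  assumes E: "E \<in> Nk0 \<Omega> T k"
  shows "on_cells (curl E) \<in> RTk0 \<Omega> T k" and "AE x in L. wcurl \<Omega> E x = on_cells (curl E) x"
    and "\<And>\<psi>. test_function \<Omega> \<psi> \<Longrightarrow> (LINT x|L. on_cells (curl E) x \<bullet> grad \<psi> x) = 0"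
proof -
  have N: "E \<in> Nk \<Omega> T k" using E by (simp add: Nk0_def)
  let ?r = "on_cells (curl E)"
  have pwE: "pw_polyvec (Suc k) E" by (rule Nk_facts(2)[OF N])
  have pd: "pw_poly k (partial_deriv i (\<lambda>x. E x $ j))" for i j
    using pw_poly_partial_deriv[OF spec[OF pwE, of j], of i] by simp
  have pw: "pw_polyvec k (curl E)"
  proof
    fix i
    show "pw_poly k (\<lambda>x. curl E x $ i)"
      using exhaust_3[of i] pw_poly_diff[OF pd pd] by (elim disjE) (simp_all add: curl_nth)
  qed
  have pw': "pw_polyvec k ?r"
    by (rule pw_polyvec_on_cells[OF pw])
  have L2: "?r \<in> L2 \<Omega>" by (rule pw_polyvec_on_cells_L2[OF pw])
  show ae: "AE x in L. wcurl \<Omega> E x = ?r x"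
    using Nk_facts(4)[OF N] AE_S by eventually_elim (simp add: on_cells_def)
  show div: "(LINT x|L. ?r x \<bullet> grad \<psi> x) = 0" if \<psi>: "test_function \<Omega> \<psi>" for \<psi>
  proof -
    have w: "wcurl \<Omega> E \<in> L2 \<Omega>" using Nk_facts(3)[OF N] by (simp add: has_weak_curl_def)
    have "(LINT x|L. ?r x \<bullet> grad \<psi> x) = (LINT x|L. wcurl \<Omega> E x \<bullet> grad \<psi> x)"
    proof (rule integral_cong_AE)
      show "AE x in L. ?r x \<bullet> grad \<psi> x = wcurl \<Omega> E x \<bullet> grad \<psi> x" using ae by eventually_elim simp
    qed (use L2_inner_integrable[OF L2 grad_test_function_L2[OF \<psi>]] L2_inner_integrable[OF w grad_test_function_L2[OF \<psi>]] in auto)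
    also have "\<dots> = (LINT x|L. E x \<bullet> curl (grad \<psi>) x)"
      using Nk_facts(3)[OF N] test_function_partial_deriv[OF \<psi>] by (simp add: has_weak_curl_def grad_def)
    also have "\<dots> = 0"
    proof -
      have "curl (grad \<psi>) x = 0" for x
        using test_function_mixed[OF \<psi>] by (simp add: vec_eq_iff forall_3 curl_nth grad_def)
      then show ?thesis by simp
    qed
    finally show ?thesis .
  qed
  have "has_weak_div \<Omega> ?r (\<lambda>x. 0)"
    unfolding has_weak_div_def using L2_const div by simp
  moreover have "\<exists>p\<in>Pkvec k. \<exists>q\<in>Pk k. \<forall>x\<in>interior K. ?r x = p x + q x *\<^sub>R x" if K: "K \<in> T" for K
  proof -
    obtain p where p: "\<And>i. (\<lambda>x. p x $ i) \<in> Pk k" "\<And>y. y \<in> interior K \<Longrightarrow> ?r y = p y"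
      by (rule pw_polyvec_trace[OF K pw']) blast
    have "p \<in> Pkvec k" using p(1) by (auto simp: Pkvec_def)
    then show ?thesis using p(2) Pk_zero by (intro bexI[of _ p] bexI[of _ "\<lambda>x. 0"]) auto
  qed
  ultimately have R: "?r \<in> RTk \<Omega> T k" using L2 unfolding RTk_def Hdiv_def by blast
  have "n \<bullet> cell_trace K ?r x = 0" if K: "K \<in> T" "boundary_normal \<Omega> K x n" for K x n
  proof -
    obtain p where p: "\<And>i. (\<lambda>x. p x $ i) \<in> Pk (Suc k)" "\<And>y. y \<in> interior K \<Longrightarrow> E y = p y" "\<And>y. y \<in> K \<Longrightarrow> cell_trace K E y = p y"
      by (rule pw_polyvec_trace[OF K(1) pwE]) blast
    have "cell_trace K ?r x = curl p x"
    proof (rule trace_eq[OF K(1) boundary_normal_mem[OF K(2)]])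
      fix y assume y: "y \<in> interior K"
      have "partial_deriv i (\<lambda>x. E x $ j) y = partial_deriv i (\<lambda>x. p x $ j) y" for i j
        by (rule partial_deriv_cong_open[OF open_interior y]) (simp add: p(2))
      then show "?r y = curl p y" using y K(1) by (auto simp: on_cells_def S_def vec_eq_iff forall_3 curl_nth)
    next
      have c: "continuous_on UNIV (partial_deriv i (\<lambda>x. p x $ j))" for i j
        by (rule Pk_continuous[OF Pk_partial_deriv[OF p(1)]])
      have "(\<lambda>x. curl p x $ i) \<in> Pk k" for i
        using exhaust_3[of i] Pk_diff[OF Pk_partial_deriv[OF p(1)] Pk_partial_deriv[OF p(1)]]
        by (elim disjE) (simp_all add: curl_nth)
      then show "continuous_on UNIV (curl p)" by (rule Pk_vec_continuous)
    qed
    moreover have "n \<bullet> curl p x = 0"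
    proof (rule normal_curl_eq_0[OF K(2) p(1)])
      fix y assume y: "boundary_normal \<Omega> K y n"
      have "cross3 n (cell_trace K E y) = 0" using E K(1) y unfolding Nk0_def by blast
      then show "cross3 n (p y) = 0" using p(3)[OF boundary_normal_mem[OF y]] by simp
    qed
    ultimately show ?thesis by simp
  qed
  then show "?r \<in> RTk0 \<Omega> T k" using R by (simp add: RTk0_def)
qed

end

section \<open>Conservation laws\<close>

lemma sgn_const_if_nonzero:
  fixes f :: "real \<Rightarrow> real"
  assumes "continuous_on {a..b} f" "\<And>t. t \<in> {a..b} \<Longrightarrow> f t \<noteq> 0" "s \<in> {a..b}" "t \<in> {a..b}"
  shows "sgn (f s) = sgn (f t)"
proof (rule ccontr)
  assume ne: "sgn (f s) \<noteq> sgn (f t)"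
  have conn: "connected (f ` {a..b})" using assms(1) by (intro connected_continuous_image) auto
  have "0 \<in> f ` {a..b}"
  proof (cases "f s < 0")
    case True
    then have "f t \<ge> 0" using ne by (auto simp: sgn_if split: if_splits)
    then show ?thesis using connectedD_interval[OF conn, of "f s" "f t" 0] True assms(3,4) by auto
  next
    case False
    then have "f t \<le> 0" using ne assms(2)[OF assms(3)] by (auto simp: sgn_if split: if_splits)
    then show ?thesis using connectedD_interval[OF conn, of "f t" "f s" 0] False assms(3,4) by auto
  qed
  then show False using assms(2) by auto
qed

lemma constant_onI_if_equal_at_endpoints:
  fixes f :: "real \<Rightarrow> 'a"
  assumes "is_interval I" and eq: "\<And>a b. a \<le> b \<Longrightarrow> {a..b} \<subseteq> I \<Longrightarrow> f a = f b"
  shows "\<forall>s\<in>I. \<forall>t\<in>I. f s = f t"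
proof -
  have le: "f s = f t" if "s \<in> I" "t \<in> I" "s \<le> t" for s t
  proof (rule eq[OF that(3)])
    show "{s..t} \<subseteq> I" using mem_is_interval_1_I[OF assms(1) that(1,2)] by (simp add: subset_iff)
  qed
  have "f s = f t" if "s \<in> I" "t \<in> I" for s t
  proof (cases "s \<le> t")
    case False
    then have "f t = f s" using le[OF that(2,1)] by simp
    then show ?thesis by simp
  qed (rule le[OF that])
  then show ?thesis by blast
qed

lemma lorentz_eq_norm:
  assumes "m > 0" "c > 0"
  shows "lorentz m c u = norm (1 :: real, (1 / (m * c)) *\<^sub>R u)"
proof -
  have "(norm ((1 / (m * c)) *\<^sub>R u))\<^sup>2 = u \<bullet> u / (m\<^sup>2 * c\<^sup>2)"
    by (simp add: power2_norm_eq_inner[symmetric] power_divide power_mult_distrib)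
  then show ?thesis unfolding lorentz_def norm_Pair by simp
qed

lemma lorentz_pos: "lorentz m c u > 0"
  unfolding lorentz_def by (simp add: add_pos_nonneg)

lemma lorentz_lipschitz:
  assumes "m > 0" "c > 0"
  shows "\<bar>lorentz m c u - lorentz m c v\<bar> \<le> 1 / (m * c) * norm (u - v)"
proof -
  have "\<bar>lorentz m c u - lorentz m c v\<bar> \<le> norm ((1 :: real, (1 / (m * c)) *\<^sub>R u) - (1, (1 / (m * c)) *\<^sub>R v))"
    unfolding lorentz_eq_norm[OF assms] by (rule norm_triangle_ineq3)
  also have "\<dots> = 1 / (m * c) * norm (u - v)"
    using assms by (simp add: norm_Pair scaleR_right_diff_distrib[symmetric])
  finally show ?thesis .
qed

lemma lorentz_has_derivative:
  assumes U: "(U has_vector_derivative U') (at t)"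
  shows "((\<lambda>t. lorentz m c (U t)) has_real_derivative (U t \<bullet> U') / (lorentz m c (U t) * m\<^sup>2 * c\<^sup>2)) (at t)"
proof -
  have "((\<lambda>t. U t \<bullet> U t) has_derivative (\<lambda>h. U t \<bullet> (h *\<^sub>R U') + (h *\<^sub>R U') \<bullet> U t)) (at t)"
    using U unfolding has_vector_derivative_def by (intro has_derivative_inner)
  then have d: "((\<lambda>t. U t \<bullet> U t) has_real_derivative 2 * (U t \<bullet> U')) (at t)"
    unfolding has_field_derivative_def by (rule has_derivative_eq_rhs) (auto simp: inner_commute)
  have pos: "1 + (U t \<bullet> U t) / (m\<^sup>2 * c\<^sup>2) > 0" by (simp add: add_pos_nonneg)
  have "((\<lambda>t. sqrt (1 + (U t \<bullet> U t) / (m\<^sup>2 * c\<^sup>2))) has_real_derivative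
      (0 + 2 * (U t \<bullet> U') / (m\<^sup>2 * c\<^sup>2)) * (inverse (sqrt (1 + (U t \<bullet> U t) / (m\<^sup>2 * c\<^sup>2))) / 2)) (at t)"
    using DERIV_chain2[OF DERIV_real_sqrt[OF pos] DERIV_add[OF DERIV_const DERIV_cdivide[OF d]]]
    by (simp add: mult.commute)
  then show ?thesis unfolding lorentz_def by (simp add: field_simps)
qed

context mesh
begin

lemma negligible_domain_minus_S: "\<Omega> - S \<in> null_sets lebesgue"
proof -
  have "AE x in lebesgue. x \<in> \<Omega> \<longrightarrow> x \<in> S" using AE_S AE_restrict_space_iff[OF domain_sets(2)] by simp
  then have "AE x in lebesgue. x \<notin> \<Omega> - S" by eventually_elim simp
  moreover have "\<Omega> - S \<in> sets lebesgue" using domain(1) open_S by simp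
  ultimately show ?thesis using AE_iff_null_sets by blast
qed

lemma measurable_cong_S:
  fixes f :: "real^3 \<Rightarrow> 'b::topological_space"
  assumes g: "g \<in> borel_measurable L" and eq: "\<And>x. x \<in> S \<Longrightarrow> f x = g x"
  shows "f \<in> borel_measurable L"
proof (rule measurableI)
  have sp: "space L = \<Omega>" by (simp add: space_restrict_space)
  have sL: "A \<in> sets L \<longleftrightarrow> A \<subseteq> \<Omega> \<and> A \<in> sets lebesgue" for A
    using sets_restrict_space_iff[OF domain_sets(2), of A] by simp
  fix A :: "'b set" assume A: "A \<in> sets borel"
  have "f -` A \<inter> (\<Omega> - S) \<in> null_sets lebesgue"
    by (rule null_sets_completion_subset[OF _ negligible_domain_minus_S]) blast
  then have 1: "f -` A \<inter> (\<Omega> - S) \<in> sets lebesgue" by blast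
  have "g -` A \<inter> space L \<in> sets L" using g A by (rule measurable_sets)
  then have "g -` A \<inter> \<Omega> \<in> sets lebesgue" using sp sL by simp
  moreover have "S \<in> sets lebesgue" using open_S by simp
  ultimately have 2: "(g -` A \<inter> \<Omega>) \<inter> S \<in> sets lebesgue" by (rule sets.Int)
  have "f -` A \<inter> space L = (f -` A \<inter> (\<Omega> - S)) \<union> ((g -` A \<inter> \<Omega>) \<inter> S)"
    using eq S_subset unfolding sp by auto
  then show "f -` A \<inter> space L \<in> sets L"
    unfolding sL using sets.Un[OF 1 2] sp by auto
qed simp

lemma integral_cong_S:
  fixes f g :: "real^3 \<Rightarrow> real"
  assumes g: "g \<in> borel_measurable L" and eq: "\<And>x. x \<in> S \<Longrightarrow> f x = g x"
  shows "(LINT x|L. f x) = (LINT x|L. g x)"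
proof (rule integral_cong_AE)
  show "AE x in L. f x = g x" using AE_S by eventually_elim (rule eq)
qed (use measurable_cong_S[OF g eq] g in auto)

text \<open>Both the regularity and the derivative in time of a functional follow from a common bound for the
increments of its integrand on the open cells.\<close>

lemma functional_control:
  fixes F :: "real \<Rightarrow> real^3 \<Rightarrow> real"
  assumes d: "ac_control a b d" and G: "integrable L G" "\<And>x. 0 \<le> G x"
    and F: "\<And>t. t \<in> {a..b} \<Longrightarrow> integrable L (F t)"
    and le: "\<And>s t x. s \<in> {a..b} \<Longrightarrow> t \<in> {a..b} \<Longrightarrow> x \<in> S \<Longrightarrow> \<bar>F s x - F t x\<bar> \<le> G x * d s t"
  shows "abs_cont {a..b} (\<lambda>t. LINT x|L. F t x)"
    and "\<And>t F'. t \<in> {a<..<b} \<Longrightarrow> locally_linear t d \<Longrightarrow> F' \<in> borel_measurable L \<Longrightarrow>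
      (\<And>x. x \<in> S \<Longrightarrow> ((\<lambda>s. F s x) has_real_derivative F' x) (at t)) \<Longrightarrow>
      ((\<lambda>s. LINT x|L. F s x) has_real_derivative (LINT x|L. F' x)) (at t)"
proof -
  have leAE: "AE x in L. \<bar>F s x - F t x\<bar> \<le> G x * d s t" if "s \<in> {a..b}" "t \<in> {a..b}" for s t
    using AE_S by eventually_elim (rule le[OF that])
  show "abs_cont {a..b} (\<lambda>t. LINT x|L. F t x)"
    by (rule param_integral_abs_cont[OF d F G leAE])
  fix t F' assume t: "t \<in> {a<..<b}" and ll: "locally_linear t d" and m: "F' \<in> borel_measurable L"
    and D: "\<And>x. x \<in> S \<Longrightarrow> ((\<lambda>s. F s x) has_real_derivative F' x) (at t)"
  obtain C r where C: "r > 0" "C \<ge> 0" "\<And>s. s \<in> ball t r \<Longrightarrow> d s t \<le> C * \<bar>s - t\<bar>"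
    using ll unfolding locally_linear_def by blast
  define r' where "r' = min r (min (t - a) (b - t))"
  have r': "r' > 0" "ball t r' \<subseteq> ball t r" "ball t r' \<subseteq> {a..b}"
    using C(1) t by (auto simp: r'_def dist_real_def)
  show "((\<lambda>s. LINT x|L. F s x) has_real_derivative (LINT x|L. F' x)) (at t)"
  proof (rule param_integral_has_derivative[OF r'(1), where G = "\<lambda>x. G x * C"])
    show "integrable L (F s)" if "s \<in> ball t r'" for s using F r'(3) that by blast
    show "integrable L (\<lambda>x. G x * C)" using G(1) by simp
    show "AE x in L. \<bar>F s x - F t x\<bar> \<le> G x * C * \<bar>s - t\<bar>" if s: "s \<in> ball t r'" for s
    proof -
      have st: "s \<in> {a..b}" "t \<in> {a..b}" using r'(3) s t by auto
      have ds: "d s t \<le> C * \<bar>s - t\<bar>" using C(3) r'(2) s by blast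
      show ?thesis using leAE[OF st]
      proof eventually_elim
        case (elim x)
        also have "G x * d s t \<le> G x * (C * \<bar>s - t\<bar>)" using ds G(2) by (rule mult_left_mono)
        finally show ?case by (simp add: mult.assoc)
      qed
    qed
    show "AE x in L. ((\<lambda>s. F s x) has_real_derivative F' x) (at t)"
      using AE_S by eventually_elim (rule D)
  qed (rule m)
qed

lemma linear_functional:
  fixes f :: "real \<Rightarrow> real^3 \<Rightarrow> 'b::euclidean_space"
  assumes d: "ac_control a b d" and g: "g \<in> L2 \<Omega>"
    and f: "\<And>t. t \<in> {a..b} \<Longrightarrow> f t \<in> L2 \<Omega>"
    and le: "\<And>s t x. s \<in> {a..b} \<Longrightarrow> t \<in> {a..b} \<Longrightarrow> x \<in> S \<Longrightarrow> dist (f s x) (f t x) \<le> d s t"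
  shows "abs_cont {a..b} (\<lambda>t. LINT x|L. f t x \<bullet> g x)"
    and "\<And>t v. t \<in> {a<..<b} \<Longrightarrow> locally_linear t d \<Longrightarrow> v \<in> borel_measurable L \<Longrightarrow>
      (\<And>x. x \<in> S \<Longrightarrow> ((\<lambda>s. f s x) has_vector_derivative v x) (at t)) \<Longrightarrow>
      ((\<lambda>s. LINT x|L. f s x \<bullet> g x) has_real_derivative (LINT x|L. v x \<bullet> g x)) (at t)"
proof -
  have G: "integrable L (\<lambda>x. norm (g x))"
  proof (rule L2_integrable)
    show "(\<lambda>x. norm (g x)) \<in> L2 \<Omega>" using g by (auto simp: L2_def intro: borel_measurable_norm)
  qed
  have le': "\<bar>f s x \<bullet> g x - f t x \<bullet> g x\<bar> \<le> norm (g x) * d s t"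
    if "s \<in> {a..b}" "t \<in> {a..b}" "x \<in> S" for s t x
  proof -
    have "\<bar>f s x \<bullet> g x - f t x \<bullet> g x\<bar> = \<bar>(f s x - f t x) \<bullet> g x\<bar>" by (simp add: inner_diff_left)
    also have "\<dots> \<le> norm (f s x - f t x) * norm (g x)" by (rule Cauchy_Schwarz_ineq2)
    also have "\<dots> \<le> d s t * norm (g x)" using le[OF that] by (intro mult_right_mono) (auto simp: dist_norm)
    finally show ?thesis by (simp add: mult.commute)
  qed
  show "abs_cont {a..b} (\<lambda>t. LINT x|L. f t x \<bullet> g x)"
    by (rule functional_control(1)[OF d G norm_ge_zero L2_inner_integrable[OF f g] le'])
  fix t v assume t: "t \<in> {a<..<b}" "locally_linear t d" "v \<in> borel_measurable L"
    and v: "\<And>x. x \<in> S \<Longrightarrow> ((\<lambda>s. f s x) has_vector_derivative v x) (at t)"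
  show "((\<lambda>s. LINT x|L. f s x \<bullet> g x) has_real_derivative (LINT x|L. v x \<bullet> g x)) (at t)"
  proof (rule functional_control(2)[OF d G norm_ge_zero _ _ t(1,2)])
    show "integrable L (\<lambda>x. f t x \<bullet> g x)" if "t \<in> {a..b}" for t by (rule L2_inner_integrable[OF f[OF that] g])
    show "\<bar>f s x \<bullet> g x - f t x \<bullet> g x\<bar> \<le> norm (g x) * d s t"
      if "s \<in> {a..b}" "t \<in> {a..b}" "x \<in> S" for s t x by (rule le'[OF that])
    show "(\<lambda>x. v x \<bullet> g x) \<in> borel_measurable L"
      using t(3) L2_measurable[OF g] by (rule borel_measurable_inner)
    fix x assume "x \<in> S"
    from v[OF this] show "((\<lambda>s. f s x \<bullet> g x) has_real_derivative v x \<bullet> g x) (at t)"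
      unfolding has_vector_derivative_def has_field_derivative_def
      by (rule has_derivative_eq_rhs[OF has_derivative_inner_left]) auto
  qed
qed

end

text \<open>A solution on one compact interval of times, with fixed projections \<open>w\<close> and \<open>G\<close>, whose equations hold
outside a null set \<open>Z\<close>. Constancy on the whole interval \<open>I\<close> follows by varying \<open>a\<close> and \<open>b\<close>.\<close>

locale scheme = mesh \<Omega> T for \<Omega> T +
  fixes \<kappa> :: "real^3 \<Rightarrow> (real^3) set" and k N :: nat and c m e :: real and wt :: "nat \<Rightarrow> real" and I :: "real set"
    and \<rho> :: "real \<Rightarrow> real^3 \<Rightarrow> real" and M E B :: "real \<Rightarrow> real^3 \<Rightarrow> real^3"
    and X U :: "nat \<Rightarrow> real \<Rightarrow> real^3" and w :: "real \<Rightarrow> real^3 \<Rightarrow> real^3" and G :: "real \<Rightarrow> real^3 \<Rightarrow> real"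
    and a b :: real and Z :: "real set"
  assumes \<kappa>: "cell_selection T \<kappa>" and c: "c > 0" and m: "m > 0"
    and \<rho>: "t \<in> I \<Longrightarrow> \<rho> t \<in> Qk \<Omega> T (k + 1)" and M: "t \<in> I \<Longrightarrow> M t \<in> Qkvec \<Omega> T (k + 1)"
    and E: "t \<in> I \<Longrightarrow> E t \<in> Nk0 \<Omega> T k" and B: "t \<in> I \<Longrightarrow> B t \<in> RTk0 \<Omega> T k"
    and nonzero: "t \<in> I \<Longrightarrow> x \<in> \<Omega> \<Longrightarrow> point_value \<kappa> (\<rho> t) x \<noteq> 0"
    and Xin: "t \<in> I \<Longrightarrow> p \<in> {1..N} \<Longrightarrow> X p t \<in> \<Union>T"
    and ac: "field_abs_cont T I \<rho>" "field_abs_cont T I M" "field_abs_cont T I E" "field_abs_cont T I B"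
    and acp: "p \<in> {1..N} \<Longrightarrow> abs_cont I (X p)" "p \<in> {1..N} \<Longrightarrow> abs_cont I (U p)"
    and proj: "t \<in> I \<Longrightarrow> velocity_projection \<Omega> T k c m (\<rho> t) (M t) (w t)"
      "t \<in> I \<Longrightarrow> G_projection \<Omega> T k c m (\<rho> t) (M t) (G t)"
    and ab: "a \<le> b" "{a..b} \<subseteq> I" and Z: "negligible Z"
    and eqs: "t \<in> {a..b} - Z \<Longrightarrow> scheme_equations \<Omega> T \<kappa> k c m e N wt \<rho> M E B X U w G t"
begin

abbreviation regular :: "real \<Rightarrow> bool" where "regular t \<equiv> t \<in> {a<..<b} \<and> t \<notin> Z"

lemma in_I: "t \<in> {a..b} \<Longrightarrow> t \<in> I" "t \<in> {a<..<b} \<Longrightarrow> t \<in> I"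
  using ab(2) by auto

lemma equations:
  assumes "regular t"
  shows "field_differentiable_at T \<rho> t" "field_differentiable_at T M t"
    "field_differentiable_at T E t" "field_differentiable_at T B t"
    "\<And>\<phi>. \<phi> \<in> Qk \<Omega> T (k + 1) \<Longrightarrow> (LINT x|L. time_deriv \<rho> t x * \<phi> x) = (LINT x|L. \<rho> t x * (w t x \<bullet> wgrad \<Omega> \<phi> x))"
    "\<And>\<mu>. \<mu> \<in> Qkvec \<Omega> T (k + 1) \<Longrightarrow> (LINT x|L. time_deriv M t x \<bullet> \<mu> x)
        = (LINT x|L. adv \<Omega> (w t) \<mu> (M t) x - adv \<Omega> \<mu> (w t) (M t) x)
          - (LINT x|L. \<rho> t x * (\<mu> x \<bullet> wgrad \<Omega> (G t) x) * c\<^sup>2)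
          + e / m * (LINT x|L. \<rho> t x * ((E t x + cross3 (w t x) ((1 / c) *\<^sub>R B t x)) \<bullet> \<mu> x))"
    "\<And>\<nu>. \<nu> \<in> Nk0 \<Omega> T k \<Longrightarrow> (LINT x|L. time_deriv E t x \<bullet> \<nu> x)
        = c * (LINT x|L. B t x \<bullet> wcurl \<Omega> \<nu> x) - 4 * pi * e / m * (LINT x|L. \<rho> t x * (w t x \<bullet> \<nu> x))
          - 4 * pi * e / m * (\<Sum>p\<in>{1..N}. ((wt p / lorentz m c (U p t)) *\<^sub>R U p t) \<bullet> point_value \<kappa> \<nu> (X p t))"
    "\<And>\<tau>. \<tau> \<in> RTk0 \<Omega> T k \<Longrightarrow> (LINT x|L. time_deriv B t x \<bullet> \<tau> x) = - c * (LINT x|L. \<tau> x \<bullet> wcurl \<Omega> (E t) x)"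
    "\<And>p. p \<in> {1..N} \<Longrightarrow> (X p has_vector_derivative (1 / (m * lorentz m c (U p t))) *\<^sub>R U p t) (at t)"
    "\<And>p. p \<in> {1..N} \<Longrightarrow> (U p has_vector_derivative
           e *\<^sub>R (point_value \<kappa> (E t) (X p t)
             + (1 / (c * m * lorentz m c (U p t))) *\<^sub>R cross3 (U p t) (point_value \<kappa> (B t) (X p t)))) (at t)"
proof -
  have "t \<in> {a..b} - Z" using assms by auto
  note q = eqs[OF this, unfolded scheme_equations_def]
  note q1 = conjunct1[OF q] conjunct2[OF q]
  note q2 = conjunct1[OF q1(2)] conjunct2[OF q1(2)]
  note q3 = conjunct1[OF q2(2)] conjunct2[OF q2(2)]
  note q4 = conjunct1[OF q3(2)] conjunct2[OF q3(2)]
  note q5 = conjunct1[OF q4(2)] conjunct2[OF q4(2)]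
  note q6 = conjunct1[OF q5(2)] conjunct2[OF q5(2)]
  note q7 = conjunct1[OF q6(2)] conjunct2[OF q6(2)]
  note q8 = conjunct1[OF q7(2)] conjunct2[OF q7(2)]
  show "field_differentiable_at T \<rho> t" by (rule q1)
  show "field_differentiable_at T M t" by (rule q2)
  show "field_differentiable_at T E t" by (rule q3)
  show "field_differentiable_at T B t" by (rule q4)
  show "(LINT x|L. time_deriv \<rho> t x * \<phi> x) = (LINT x|L. \<rho> t x * (w t x \<bullet> wgrad \<Omega> \<phi> x))"
    if "\<phi> \<in> Qk \<Omega> T (k + 1)" for \<phi> by (rule bspec[OF q5(1) that])
  show "(LINT x|L. time_deriv M t x \<bullet> \<mu> x)
        = (LINT x|L. adv \<Omega> (w t) \<mu> (M t) x - adv \<Omega> \<mu> (w t) (M t) x)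
          - (LINT x|L. \<rho> t x * (\<mu> x \<bullet> wgrad \<Omega> (G t) x) * c\<^sup>2)
          + e / m * (LINT x|L. \<rho> t x * ((E t x + cross3 (w t x) ((1 / c) *\<^sub>R B t x)) \<bullet> \<mu> x))"
    if "\<mu> \<in> Qkvec \<Omega> T (k + 1)" for \<mu> by (rule bspec[OF q6(1) that])
  show "(LINT x|L. time_deriv E t x \<bullet> \<nu> x)
        = c * (LINT x|L. B t x \<bullet> wcurl \<Omega> \<nu> x) - 4 * pi * e / m * (LINT x|L. \<rho> t x * (w t x \<bullet> \<nu> x))
          - 4 * pi * e / m * (\<Sum>p\<in>{1..N}. ((wt p / lorentz m c (U p t)) *\<^sub>R U p t) \<bullet> point_value \<kappa> \<nu> (X p t))"
    if "\<nu> \<in> Nk0 \<Omega> T k" for \<nu> by (rule bspec[OF q7(1) that])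
  show "(LINT x|L. time_deriv B t x \<bullet> \<tau> x) = - c * (LINT x|L. \<tau> x \<bullet> wcurl \<Omega> (E t) x)"
    if "\<tau> \<in> RTk0 \<Omega> T k" for \<tau> by (rule bspec[OF q8(1) that])
  show "(X p has_vector_derivative (1 / (m * lorentz m c (U p t))) *\<^sub>R U p t) (at t)"
    if "p \<in> {1..N}" for p by (rule conjunct1[OF bspec[OF q8(2) that]])
  show "(U p has_vector_derivative
           e *\<^sub>R (point_value \<kappa> (E t) (X p t)
             + (1 / (c * m * lorentz m c (U p t))) *\<^sub>R cross3 (U p t) (point_value \<kappa> (B t) (X p t)))) (at t)"
    if "p \<in> {1..N}" for p by (rule conjunct2[OF bspec[OF q8(2) that]])
qed

lemma membership:
  assumes "t \<in> I"
  shows "\<rho> t \<in> L2 \<Omega>" "M t \<in> L2 \<Omega>" "E t \<in> L2 \<Omega>" "B t \<in> L2 \<Omega>" "E t \<in> Nk \<Omega> T k" "B t \<in> RTk \<Omega> T k"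
    "pw_polyvec (Suc k) (E t)"
proof -
  show "\<rho> t \<in> L2 \<Omega>" by (rule Qk_facts(1)[OF \<rho>[OF assms]])
  show "M t \<in> L2 \<Omega>" by (rule L2_vec[OF Qk_facts(1)[OF Qkvec_facts(1)[OF M[OF assms]]]])
  show N: "E t \<in> Nk \<Omega> T k" using E[OF assms] by (simp add: Nk0_def)
  show R: "B t \<in> RTk \<Omega> T k" using B[OF assms] by (simp add: RTk0_def)
  show "E t \<in> L2 \<Omega>" "B t \<in> L2 \<Omega>" "pw_polyvec (Suc k) (E t)" using Nk_facts(1,2)[OF N] RTk_facts(1)[OF R] by blast+
qed

lemma rho_nonzero:
  assumes "t \<in> I" "x \<in> S"
  shows "\<rho> t x \<noteq> 0"
proof -
  obtain K where K: "K \<in> T" "x \<in> interior K" using assms(2) by (auto simp: S_def)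
  obtain p where p: "p \<in> Pk (k + 1)" "\<And>y. y \<in> interior K \<Longrightarrow> \<rho> t y = p y"
    using Qk_facts(2)[OF \<rho>[OF assms(1)]] K(1) unfolding pw_poly_def by blast
  have "point_value \<kappa> (\<rho> t) x = \<rho> t x"
    by (rule point_value_in_cell[OF \<kappa> K p(2) Pk_continuous[OF p(1)]])
  then show ?thesis using nonzero[OF assms(1), of x] S_subset assms(2) by auto
qed

lemma Basis3: "(i :: real^3) \<in> Basis \<longleftrightarrow> (\<exists>j. i = axis j 1)"
  by (auto simp: Basis_vec_def)

lemma rho_control:
  obtains d R where "ac_control a b d"
    "\<And>s t x. s \<in> {a..b} \<Longrightarrow> t \<in> {a..b} \<Longrightarrow> x \<in> S \<Longrightarrow> dist (\<rho> s x) (\<rho> t x) \<le> d s t"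
    "\<And>t. regular t \<Longrightarrow> locally_linear t d"
    "\<And>t x. t \<in> {a..b} \<Longrightarrow> x \<in> S \<Longrightarrow> norm (\<rho> t x) \<le> R"
    "\<And>t. regular t \<Longrightarrow> \<exists>v\<in>Qk \<Omega> T (k + 1). \<forall>x\<in>S. ((\<lambda>s. \<rho> s x) has_vector_derivative v x) (at t)"
proof -
  have pw: "pw_poly (k + 1) (\<lambda>x. f x \<bullet> i)" if "f \<in> Qk \<Omega> T (k + 1)" "i \<in> Basis" for f and i :: real
    using Qk_facts(2)[OF that(1)] that(2) by simp
  show thesis
  proof (rule field_control[OF Qk_lin_closed pw \<rho>[OF in_I(1)] ac(1) ab(2)])
    fix d R
    assume d: "ac_control a b d"
      "\<And>s t x. s \<in> {a..b} \<Longrightarrow> t \<in> {a..b} \<Longrightarrow> x \<in> S \<Longrightarrow> dist (\<rho> s x) (\<rho> t x) \<le> d s t"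
      "\<And>t x. t \<in> {a..b} \<Longrightarrow> x \<in> S \<Longrightarrow> norm (\<rho> t x) \<le> R"
      "\<And>t. t \<in> {a<..<b} \<Longrightarrow> field_differentiable_at T \<rho> t \<Longrightarrow> locally_linear t d"
      "\<And>t. t \<in> {a<..<b} \<Longrightarrow> field_differentiable_at T \<rho> t \<Longrightarrow>
        \<exists>v\<in>Qk \<Omega> T (k + 1). \<forall>x\<in>S. ((\<lambda>s. \<rho> s x) has_vector_derivative v x) (at t)"
    show thesis
    proof (rule that[of d R])
      fix t assume t: "regular t"
      show "locally_linear t d" by (rule d(4)[OF conjunct1[OF t] equations(1)[OF t]])
      show "\<exists>v\<in>Qk \<Omega> T (k + 1). \<forall>x\<in>S. ((\<lambda>s. \<rho> s x) has_vector_derivative v x) (at t)"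
        using d(5)[OF conjunct1[OF t] equations(1)[OF t]] by blast
    qed (fact d(1) d(2) d(3))+
  qed assumption+
qed

lemma M_control:
  obtains d R where "ac_control a b d"
    "\<And>s t x. s \<in> {a..b} \<Longrightarrow> t \<in> {a..b} \<Longrightarrow> x \<in> S \<Longrightarrow> dist (M s x) (M t x) \<le> d s t"
    "\<And>t. regular t \<Longrightarrow> locally_linear t d"
    "\<And>t x. t \<in> {a..b} \<Longrightarrow> x \<in> S \<Longrightarrow> norm (M t x) \<le> R"
    "\<And>t. regular t \<Longrightarrow> \<exists>v\<in>Qkvec \<Omega> T (k + 1). \<forall>x\<in>S. ((\<lambda>s. M s x) has_vector_derivative v x) (at t)"
proof -
  have pw: "pw_poly (k + 1) (\<lambda>x. f x \<bullet> i)" if "f \<in> Qkvec \<Omega> T (k + 1)" "i \<in> Basis" for f and i :: "real^3"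
    using Qkvec_facts(2)[OF that(1)] that(2) by (auto simp: Basis3 inner_axis)
  show thesis
  proof (rule field_control[OF Qkvec_lin_closed pw M[OF in_I(1)] ac(2) ab(2)])
    fix d R
    assume d: "ac_control a b d"
      "\<And>s t x. s \<in> {a..b} \<Longrightarrow> t \<in> {a..b} \<Longrightarrow> x \<in> S \<Longrightarrow> dist (M s x) (M t x) \<le> d s t"
      "\<And>t x. t \<in> {a..b} \<Longrightarrow> x \<in> S \<Longrightarrow> norm (M t x) \<le> R"
      "\<And>t. t \<in> {a<..<b} \<Longrightarrow> field_differentiable_at T M t \<Longrightarrow> locally_linear t d"
      "\<And>t. t \<in> {a<..<b} \<Longrightarrow> field_differentiable_at T M t \<Longrightarrow>
        \<exists>v\<in>Qkvec \<Omega> T (k + 1). \<forall>x\<in>S. ((\<lambda>s. M s x) has_vector_derivative v x) (at t)"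
    show thesis
    proof (rule that[of d R])
      fix t assume t: "regular t"
      show "locally_linear t d" by (rule d(4)[OF conjunct1[OF t] equations(2)[OF t]])
      show "\<exists>v\<in>Qkvec \<Omega> T (k + 1). \<forall>x\<in>S. ((\<lambda>s. M s x) has_vector_derivative v x) (at t)"
        using d(5)[OF conjunct1[OF t] equations(2)[OF t]] by blast
    qed (fact d(1) d(2) d(3))+
  qed assumption+
qed

lemma E_control:
  obtains d R where "ac_control a b d"
    "\<And>s t x. s \<in> {a..b} \<Longrightarrow> t \<in> {a..b} \<Longrightarrow> x \<in> S \<Longrightarrow> dist (E s x) (E t x) \<le> d s t"
    "\<And>t. regular t \<Longrightarrow> locally_linear t d"
    "\<And>t x. t \<in> {a..b} \<Longrightarrow> x \<in> S \<Longrightarrow> norm (E t x) \<le> R"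
    "\<And>t. regular t \<Longrightarrow> \<exists>v\<in>L2 \<Omega>. \<forall>x\<in>S. ((\<lambda>s. E s x) has_vector_derivative v x) (at t)"
proof -
  let ?V = "{f \<in> borel_measurable L. pw_polyvec (Suc k) f}"
  have lin: "lin_closed ?V"
    unfolding lin_closed_def
  proof (intro ballI allI)
    fix f g :: "real^3 \<Rightarrow> real^3" and r :: real assume "f \<in> ?V" "g \<in> ?V"
    then show "(\<lambda>x. f x + r *\<^sub>R g x) \<in> ?V" by (auto intro!: pw_poly_add pw_poly_cmult)
  qed
  have pw: "pw_poly (Suc k) (\<lambda>x. f x \<bullet> i)" if "f \<in> ?V" "i \<in> Basis" for f and i :: "real^3"
    using that by (auto simp: Basis3 inner_axis)
  have mem: "E t \<in> ?V" if "t \<in> {a..b}" for t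
    using membership(3,7)[OF in_I(1)[OF that]] L2_measurable by simp
  have VL2: "v \<in> L2 \<Omega>" if v: "v \<in> ?V" for v
  proof -
    obtain C where "C \<ge> 0" "\<And>x. x \<in> S \<Longrightarrow> norm (v x) \<le> C" using pw_polyvec_bounded[of "Suc k" v] v by blast
    then show ?thesis using v by (intro L2_if_bounded[of v C]) auto
  qed
  show thesis
  proof (rule field_control[OF lin pw mem ac(3) ab(2)])
    fix d R
    assume d: "ac_control a b d"
      "\<And>s t x. s \<in> {a..b} \<Longrightarrow> t \<in> {a..b} \<Longrightarrow> x \<in> S \<Longrightarrow> dist (E s x) (E t x) \<le> d s t"
      "\<And>t x. t \<in> {a..b} \<Longrightarrow> x \<in> S \<Longrightarrow> norm (E t x) \<le> R"
      "\<And>t. t \<in> {a<..<b} \<Longrightarrow> field_differentiable_at T E t \<Longrightarrow> locally_linear t d"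
      "\<And>t. t \<in> {a<..<b} \<Longrightarrow> field_differentiable_at T E t \<Longrightarrow>
        \<exists>v\<in>?V. \<forall>x\<in>S. ((\<lambda>s. E s x) has_vector_derivative v x) (at t)"
    show thesis
    proof (rule that[of d R])
      fix t assume t: "regular t"
      show "locally_linear t d" by (rule d(4)[OF conjunct1[OF t] equations(3)[OF t]])
      show "\<exists>v\<in>L2 \<Omega>. \<forall>x\<in>S. ((\<lambda>s. E s x) has_vector_derivative v x) (at t)"
        using d(5)[OF conjunct1[OF t] equations(3)[OF t]] VL2 by blast
    qed (fact d(1) d(2) d(3))+
  qed assumption+
qed

lemma B_control:
  obtains d R where "ac_control a b d"
    "\<And>s t x. s \<in> {a..b} \<Longrightarrow> t \<in> {a..b} \<Longrightarrow> x \<in> S \<Longrightarrow> dist (B s x) (B t x) \<le> d s t"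
    "\<And>t. regular t \<Longrightarrow> locally_linear t d"
    "\<And>t x. t \<in> {a..b} \<Longrightarrow> x \<in> S \<Longrightarrow> norm (B t x) \<le> R"
    "\<And>t. regular t \<Longrightarrow> \<exists>v\<in>RTk0 \<Omega> T k. \<forall>x\<in>S. ((\<lambda>s. B s x) has_vector_derivative v x) (at t)"
proof -
  have pw: "pw_poly (Suc k) (\<lambda>x. f x \<bullet> i)" if "f \<in> RTk0 \<Omega> T k" "i \<in> Basis" for f and i :: "real^3"
    using RTk_facts(2)[of f k] that by (auto simp: Basis3 inner_axis RTk0_def)
  show thesis
  proof (rule field_control[OF RTk0_lin_closed pw B[OF in_I(1)] ac(4) ab(2)])
    fix d R
    assume d: "ac_control a b d"
      "\<And>s t x. s \<in> {a..b} \<Longrightarrow> t \<in> {a..b} \<Longrightarrow> x \<in> S \<Longrightarrow> dist (B s x) (B t x) \<le> d s t"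
      "\<And>t x. t \<in> {a..b} \<Longrightarrow> x \<in> S \<Longrightarrow> norm (B t x) \<le> R"
      "\<And>t. t \<in> {a<..<b} \<Longrightarrow> field_differentiable_at T B t \<Longrightarrow> locally_linear t d"
      "\<And>t. t \<in> {a<..<b} \<Longrightarrow> field_differentiable_at T B t \<Longrightarrow>
        \<exists>v\<in>RTk0 \<Omega> T k. \<forall>x\<in>S. ((\<lambda>s. B s x) has_vector_derivative v x) (at t)"
    show thesis
    proof (rule that[of d R])
      fix t assume t: "regular t"
      show "locally_linear t d" by (rule d(4)[OF conjunct1[OF t] equations(4)[OF t]])
      show "\<exists>v\<in>RTk0 \<Omega> T k. \<forall>x\<in>S. ((\<lambda>s. B s x) has_vector_derivative v x) (at t)"
        using d(5)[OF conjunct1[OF t] equations(4)[OF t]] by blast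
    qed (fact d(1) d(2) d(3))+
  qed assumption+
qed

lemma conserved:
  fixes f :: "real \<Rightarrow> real"
  assumes "abs_cont {a..b} f" "\<And>t. regular t \<Longrightarrow> t \<notin> Y \<Longrightarrow> (f has_real_derivative 0) (at t)" "countable Y"
  shows "f a = f b"
proof (rule abs_cont_zero_derivative_imp_const[OF assms(1) ab(1)])
  have "negligible Y"
    unfolding negligible_iff_null_sets by (rule null_sets_completionI[OF countable_imp_null_set_lborel[OF assms(3)]])
  then show "negligible (Z \<union> Y)" using Z by (intro negligible_Un)
qed (use assms(2) in auto)

subsection \<open>Mass\<close>

lemma rho_functional:
  assumes \<phi>: "\<phi> \<in> Qk \<Omega> T (k + 1)"
  shows "abs_cont {a..b} (\<lambda>t. LINT x|L. \<rho> t x * \<phi> x)"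
    and "\<And>t. regular t \<Longrightarrow> ((\<lambda>t. LINT x|L. \<rho> t x * \<phi> x) has_real_derivative (LINT x|L. \<rho> t x * (w t x \<bullet> wgrad \<Omega> \<phi> x))) (at t)"
proof -
  obtain d R where d: "ac_control a b d"
    "\<And>s t x. s \<in> {a..b} \<Longrightarrow> t \<in> {a..b} \<Longrightarrow> x \<in> S \<Longrightarrow> dist (\<rho> s x) (\<rho> t x) \<le> d s t"
    "\<And>t. regular t \<Longrightarrow> locally_linear t d"
    "\<And>t. regular t \<Longrightarrow> \<exists>v\<in>Qk \<Omega> T (k + 1). \<forall>x\<in>S. ((\<lambda>s. \<rho> s x) has_vector_derivative v x) (at t)"
    by (rule rho_control) blast
  note lf = linear_functional[OF d(1) Qk_facts(1)[OF \<phi>] membership(1)[OF in_I(1)] d(2), unfolded inner_real_def]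
  show "abs_cont {a..b} (\<lambda>t. LINT x|L. \<rho> t x * \<phi> x)" by (rule lf(1))
  fix t assume t: "regular t"
  obtain v where v: "v \<in> Qk \<Omega> T (k + 1)" "\<And>x. x \<in> S \<Longrightarrow> ((\<lambda>s. \<rho> s x) has_vector_derivative v x) (at t)"
    using d(4)[OF t] by blast
  have td: "time_deriv \<rho> t x = v x" if "x \<in> S" for x unfolding time_deriv_def by (rule vector_derivative_at[OF v(2)[OF that]])
  have "((\<lambda>t. LINT x|L. \<rho> t x * \<phi> x) has_real_derivative (LINT x|L. v x * \<phi> x)) (at t)"
    using t by (intro lf(2) d(3) L2_measurable[OF Qk_facts(1)[OF v(1)]] v(2)) auto
  moreover have "(LINT x|L. time_deriv \<rho> t x * \<phi> x) = (LINT x|L. v x * \<phi> x)"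
    using L2_mult_integrable[OF Qk_facts(1)[OF v(1)] Qk_facts(1)[OF \<phi>]] td
    by (intro integral_cong_S) auto
  ultimately show "((\<lambda>t. LINT x|L. \<rho> t x * \<phi> x) has_real_derivative (LINT x|L. \<rho> t x * (w t x \<bullet> wgrad \<Omega> \<phi> x))) (at t)"
    using equations(5)[OF t \<phi>] by simp
qed

lemma w_in: "t \<in> I \<Longrightarrow> w t \<in> Qkvec \<Omega> T (k + 1)" and G_in: "t \<in> I \<Longrightarrow> G t \<in> Qk \<Omega> T (k + 1)"
  using proj unfolding velocity_projection_def G_projection_def L2_projection_def by blast+

lemma w_L2: "t \<in> I \<Longrightarrow> w t \<in> L2 \<Omega>"
  by (rule L2_vec[OF Qk_facts(1)[OF Qkvec_facts(1)[OF w_in]]])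

lemma mass_conserved: "(LINT x|L. \<rho> a x) = (LINT x|L. \<rho> b x)"
proof -
  note rf = rho_functional[OF const_in_Qk[of 1]]
  have "(LINT x|L. \<rho> t x * (w t x \<bullet> wgrad \<Omega> (\<lambda>x. 1) x)) = 0" for t
  proof (rule integral_eq_zero_AE)
    show "AE x in L. \<rho> t x * (w t x \<bullet> wgrad \<Omega> (\<lambda>x. 1) x) = 0"
      using AE_wgrad_const[of 1] by eventually_elim simp
  qed
  then have "((\<lambda>t. LINT x|L. \<rho> t x * 1) has_real_derivative 0) (at t)" if "regular t" for t
    using rf(2)[OF that] by simp
  then have "(LINT x|L. \<rho> a x * 1) = (LINT x|L. \<rho> b x * 1)"
    by (intro conserved[OF rf(1), of "{}"]) auto
  then show ?thesis by simp
qed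

subsection \<open>The weak Gauss law\<close>

lemma E_functional:
  assumes g: "g \<in> L2 \<Omega>"
  shows "abs_cont {a..b} (\<lambda>t. LINT x|L. E t x \<bullet> g x)"
    and "\<And>t. regular t \<Longrightarrow> ((\<lambda>t. LINT x|L. E t x \<bullet> g x) has_real_derivative (LINT x|L. time_deriv E t x \<bullet> g x)) (at t)"
proof -
  obtain d R where d: "ac_control a b d"
    "\<And>s t x. s \<in> {a..b} \<Longrightarrow> t \<in> {a..b} \<Longrightarrow> x \<in> S \<Longrightarrow> dist (E s x) (E t x) \<le> d s t"
    "\<And>t. regular t \<Longrightarrow> locally_linear t d"
    "\<And>t. regular t \<Longrightarrow> \<exists>v\<in>L2 \<Omega>. \<forall>x\<in>S. ((\<lambda>s. E s x) has_vector_derivative v x) (at t)"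
    by (rule E_control) blast
  note lf = linear_functional[OF d(1) g membership(3)[OF in_I(1)] d(2)]
  show "abs_cont {a..b} (\<lambda>t. LINT x|L. E t x \<bullet> g x)" by (rule lf(1))
  fix t assume t: "regular t"
  obtain v where v: "v \<in> L2 \<Omega>" "\<And>x. x \<in> S \<Longrightarrow> ((\<lambda>s. E s x) has_vector_derivative v x) (at t)"
    using d(4)[OF t] by blast
  have td: "time_deriv E t x = v x" if "x \<in> S" for x unfolding time_deriv_def by (rule vector_derivative_at[OF v(2)[OF that]])
  have "((\<lambda>t. LINT x|L. E t x \<bullet> g x) has_real_derivative (LINT x|L. v x \<bullet> g x)) (at t)"
    using t by (intro lf(2) d(3) v L2_measurable[OF v(1)]) auto
  moreover have "(LINT x|L. time_deriv E t x \<bullet> g x) = (LINT x|L. v x \<bullet> g x)"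
    using borel_measurable_inner[OF L2_measurable[OF v(1)] L2_measurable[OF g]] td
    by (intro integral_cong_S) auto
  ultimately show "((\<lambda>t. LINT x|L. E t x \<bullet> g x) has_real_derivative (LINT x|L. time_deriv E t x \<bullet> g x)) (at t)"
    by simp
qed

lemma particle_functional:
  assumes \<phi>: "\<phi> \<in> Qk0 \<Omega> T (k + 1)" and p: "p \<in> {1..N}"
  obtains Y where "abs_cont {a..b} (\<lambda>t. point_value \<kappa> \<phi> (X p t))" "countable Y"
    "\<And>t. regular t \<Longrightarrow> t \<notin> Y \<Longrightarrow> ((\<lambda>t. point_value \<kappa> \<phi> (X p t)) has_real_derivative
        (1 / (m * lorentz m c (U p t))) * (U p t \<bullet> point_value \<kappa> (on_cells (grad \<phi>)) (X p t))) (at t)"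
proof -
  have Xin': "X p t \<in> \<Union>T" if "t \<in> {a..b}" for t using Xin[OF in_I(1)[OF that] p] .
  obtain \<Lambda> where \<Lambda>: "\<Lambda> \<ge> 0"
    "\<And>x y. x \<in> \<Union>T \<Longrightarrow> y \<in> \<Union>T \<Longrightarrow> \<bar>point_value \<kappa> \<phi> x - point_value \<kappa> \<phi> y\<bar> \<le> \<Lambda> * norm (x - y)"
    by (rule Qk0_lipschitz[OF \<phi> \<kappa>]) blast
  have ac1: "abs_cont {a..b} (\<lambda>t. point_value \<kappa> \<phi> (X p t))"
    using \<Lambda> Xin' by (intro abs_cont_bound_by[OF acp(1)[OF p] ab(2), of _ \<Lambda>]) (auto simp: dist_norm)
  have "\<exists>Y. countable Y \<and> (\<forall>t\<in>{a<..<b} - Y. \<forall>X'. (X p has_vector_derivative X') (at t) \<longrightarrow>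
     ((\<lambda>s. point_value \<kappa> \<phi> (X p s)) has_real_derivative point_value \<kappa> (on_cells (grad \<phi>)) (X p t) \<bullet> X') (at t))"
    by (rule Qk0_path_derivative[OF \<phi> \<kappa> Xin'])
  then obtain Y where Y: "countable Y"
    "\<forall>t\<in>{a<..<b} - Y. \<forall>X'. (X p has_vector_derivative X') (at t) \<longrightarrow>
     ((\<lambda>s. point_value \<kappa> \<phi> (X p s)) has_real_derivative point_value \<kappa> (on_cells (grad \<phi>)) (X p t) \<bullet> X') (at t)"
    by (elim exE conjE)
  show thesis
  proof (rule that[OF ac1 Y(1)])
    fix t assume t: "regular t" "t \<notin> Y"
    then have "((\<lambda>s. point_value \<kappa> \<phi> (X p s)) has_real_derivative
        point_value \<kappa> (on_cells (grad \<phi>)) (X p t) \<bullet> ((1 / (m * lorentz m c (U p t))) *\<^sub>R U p t)) (at t)"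
      by (intro Y(2)[rule_format] equations(9)[OF t(1) p]) auto
    then show "((\<lambda>t. point_value \<kappa> \<phi> (X p t)) has_real_derivative
        (1 / (m * lorentz m c (U p t))) * (U p t \<bullet> point_value \<kappa> (on_cells (grad \<phi>)) (X p t))) (at t)"
      by (simp add: inner_commute)
  qed
qed

text \<open>The residual is \<open>- \<integral> E \<bullet> \<nabla>\<phi> - (4 \<pi> e / m) \<integral> \<rho> \<phi>\<close> minus \<open>4 \<pi> e\<close> times the weighted sum of the values \<open>\<phi>(X)\<close>. The
terms of its derivative cancel by the equation for \<open>E\<close> tested with the gradient of \<open>\<phi>\<close>, the equation for \<open>\<rho>\<close>
tested with \<open>\<phi>\<close>, and the chain rule along the particle paths.\<close>

lemma gauss_conserved:
  assumes \<phi>: "\<phi> \<in> Qk0 \<Omega> T (k + 1)"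
  defines "\<Gamma> \<equiv> \<lambda>t. (LINT x|L. (weak_divergence \<Omega> T k (E t) x - 4 * pi * e * (\<rho> t x / m)) * \<phi> x)
             - 4 * pi * e * (\<Sum>p\<in>{1..N}. wt p * point_value \<kappa> \<phi> (X p t))"
  shows "\<Gamma> a = \<Gamma> b"
proof -
  have Q: "\<phi> \<in> Qk \<Omega> T (k + 1)" using \<phi> by (simp add: Qk0_def)
  note \<nu> = grad_in_Nk0[OF \<phi>]
  let ?\<nu> = "on_cells (grad \<phi>)" and ?q = "4 * pi * e"
  have "?\<nu> \<in> Nk \<Omega> T k" using \<nu>(1) unfolding Nk0_def by blast
  then have \<nu>m: "?\<nu> \<in> borel_measurable L" by (intro L2_measurable Nk_facts(1))
  define \<Delta> where "\<Delta> = (\<lambda>t. - (LINT x|L. E t x \<bullet> wgrad \<Omega> \<phi> x) + (- ?q / m) * (LINT x|L. \<rho> t x * \<phi> x)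
      + (- ?q) * (\<Sum>p\<in>{1..N}. wt p * point_value \<kappa> \<phi> (X p t)))"
  have eq: "\<Gamma> t = \<Delta> t" if t: "t \<in> I" for t
  proof -
    note wd = weak_divergence_works[OF membership(3)[OF t], of k]
    have D: "weak_divergence \<Omega> T k (E t) \<in> L2 \<Omega>" 
    proof -
      have "weak_divergence \<Omega> T k (E t) \<in> Qk \<Omega> T (k + 1)" using conjunct1[OF wd] unfolding Qk0_def by blast
      then show ?thesis by (rule Qk_facts(1))
    qed
    have "(LINT x|L. (weak_divergence \<Omega> T k (E t) x - ?q * (\<rho> t x / m)) * \<phi> x)
        = (LINT x|L. weak_divergence \<Omega> T k (E t) x * \<phi> x - ?q / m * (\<rho> t x * \<phi> x))"
      by (intro Bochner_Integration.integral_cong refl) (simp add: algebra_simps)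
    also have "\<dots> = (LINT x|L. weak_divergence \<Omega> T k (E t) x * \<phi> x) - ?q / m * (LINT x|L. \<rho> t x * \<phi> x)"
      using L2_mult_integrable[OF D Qk_facts(1)[OF Q]] L2_mult_integrable[OF membership(1)[OF t] Qk_facts(1)[OF Q]]
      by (subst Bochner_Integration.integral_diff) auto
    also have "(LINT x|L. weak_divergence \<Omega> T k (E t) x * \<phi> x) = - (LINT x|L. E t x \<bullet> wgrad \<Omega> \<phi> x)"
      using conjunct2[OF wd] \<phi> by blast
    finally show ?thesis by (simp add: \<Gamma>_def \<Delta>_def)
  qed
  have "\<forall>p\<in>{1..N}. \<exists>Y. abs_cont {a..b} (\<lambda>t. point_value \<kappa> \<phi> (X p t)) \<and> countable Y \<and>
    (\<forall>t. regular t \<and> t \<notin> Y \<longrightarrow> ((\<lambda>t. point_value \<kappa> \<phi> (X p t)) has_real_derivative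
        (1 / (m * lorentz m c (U p t))) * (U p t \<bullet> point_value \<kappa> ?\<nu> (X p t))) (at t))"
  proof
    fix p assume "p \<in> {1..N}"
    show "\<exists>Y. abs_cont {a..b} (\<lambda>t. point_value \<kappa> \<phi> (X p t)) \<and> countable Y \<and>
    (\<forall>t. regular t \<and> t \<notin> Y \<longrightarrow> ((\<lambda>t. point_value \<kappa> \<phi> (X p t)) has_real_derivative
        (1 / (m * lorentz m c (U p t))) * (U p t \<bullet> point_value \<kappa> ?\<nu> (X p t))) (at t))"
      by (rule particle_functional[OF \<phi> \<open>p \<in> {1..N}\<close>]) blast
  qed
  from bchoice[OF this] obtain Y where Y0: "\<forall>p\<in>{1..N}. abs_cont {a..b} (\<lambda>t. point_value \<kappa> \<phi> (X p t)) \<and> countable (Y p) \<and>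
    (\<forall>t. regular t \<and> t \<notin> Y p \<longrightarrow> ((\<lambda>t. point_value \<kappa> \<phi> (X p t)) has_real_derivative
        (1 / (m * lorentz m c (U p t))) * (U p t \<bullet> point_value \<kappa> ?\<nu> (X p t))) (at t))"
    by (elim exE)
  have Y: "abs_cont {a..b} (\<lambda>t. point_value \<kappa> \<phi> (X p t))" "countable (Y p)" if "p \<in> {1..N}" for p
    by (rule conjunct1[OF bspec[OF Y0 that]]) (rule conjunct1[OF conjunct2[OF bspec[OF Y0 that]]])
  have Y3: "((\<lambda>t. point_value \<kappa> \<phi> (X p t)) has_real_derivative
        (1 / (m * lorentz m c (U p t))) * (U p t \<bullet> point_value \<kappa> ?\<nu> (X p t))) (at t)"
    if "p \<in> {1..N}" "regular t" "t \<notin> Y p" for p t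
    by (rule conjunct2[OF conjunct2[OF bspec[OF Y0 that(1)]], rule_format, OF conjI[OF that(2,3)]])
  note Ef = E_functional[OF Qk_wgrad_L2[OF Q]] and \<rho>f = rho_functional[OF Q]
  have "\<Delta> a = \<Delta> b"
  proof (rule conserved[of _ "\<Union>p\<in>{1..N}. Y p"])
    have "abs_cont {a..b} (\<lambda>t. (-1) * (LINT x|L. E t x \<bullet> wgrad \<Omega> \<phi> x) + (- ?q / m) * (LINT x|L. \<rho> t x * \<phi> x)
      + (- ?q) * (\<Sum>p\<in>{1..N}. wt p * point_value \<kappa> \<phi> (X p t)))"
      by (intro abs_cont_add abs_cont_scaled abs_cont_sum Ef(1) \<rho>f(1) Y(1)) auto
    then show "abs_cont {a..b} \<Delta>" by (simp add: \<Delta>_def)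
    show "countable (\<Union>p\<in>{1..N}. Y p)" using Y(2) by (intro countable_UN) auto
    fix t assume t: "regular t" and tY: "t \<notin> (\<Union>p\<in>{1..N}. Y p)"
    have tI: "t \<in> I" using t in_I(2) by blast
    let ?P = "\<Sum>p\<in>{1..N}. wt p * ((1 / (m * lorentz m c (U p t))) * (U p t \<bullet> point_value \<kappa> ?\<nu> (X p t)))"
    have "(\<Delta> has_real_derivative - (LINT x|L. time_deriv E t x \<bullet> wgrad \<Omega> \<phi> x)
        + (- ?q / m) * (LINT x|L. \<rho> t x * (w t x \<bullet> wgrad \<Omega> \<phi> x)) + (- ?q) * ?P) (at t)"
      unfolding \<Delta>_def using tY
      by (intro DERIV_add DERIV_minus DERIV_cmult DERIV_sum Ef(2)[OF t] \<rho>f(2)[OF t] Y3[OF _ t]) auto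
    moreover have "- (LINT x|L. time_deriv E t x \<bullet> wgrad \<Omega> \<phi> x)
        + (- ?q / m) * (LINT x|L. \<rho> t x * (w t x \<bullet> wgrad \<Omega> \<phi> x)) + (- ?q) * ?P = 0"
    proof -
      have "(LINT x|L. time_deriv E t x \<bullet> wgrad \<Omega> \<phi> x) = (LINT x|L. time_deriv E t x \<bullet> ?\<nu> x)"
      proof -
        obtain v where v: "v \<in> L2 \<Omega>" "\<And>x. x \<in> S \<Longrightarrow> ((\<lambda>s. E s x) has_vector_derivative v x) (at t)"
          by (rule E_control) (use t in blast)
        have td: "time_deriv E t x = v x" if "x \<in> S" for x unfolding time_deriv_def by (rule vector_derivative_at[OF v(2)[OF that]])
        have m: "time_deriv E t \<in> borel_measurable L"
          by (rule measurable_cong_S[OF L2_measurable[OF v(1)]]) (rule td)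
        have "AE x in L. time_deriv E t x \<bullet> wgrad \<Omega> \<phi> x = time_deriv E t x \<bullet> ?\<nu> x"
          using \<nu>(4) by eventually_elim simp
        then show ?thesis
          using borel_measurable_inner[OF m L2_measurable[OF Qk_wgrad_L2[OF Q]]]
            borel_measurable_inner[OF m \<nu>m]
          by (intro integral_cong_AE) auto
      qed
      also have "\<dots> = c * (LINT x|L. B t x \<bullet> wcurl \<Omega> ?\<nu> x) - ?q / m * (LINT x|L. \<rho> t x * (w t x \<bullet> ?\<nu> x))
          - ?q / m * (\<Sum>p\<in>{1..N}. ((wt p / lorentz m c (U p t)) *\<^sub>R U p t) \<bullet> point_value \<kappa> ?\<nu> (X p t))"
        by (rule equations(7)[OF t \<nu>(1)])
      also have "(LINT x|L. B t x \<bullet> wcurl \<Omega> ?\<nu> x) = 0"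
      proof (rule integral_eq_zero_AE)
        show "AE x in L. B t x \<bullet> wcurl \<Omega> ?\<nu> x = 0" using \<nu>(3) by eventually_elim simp
      qed
      also have "(LINT x|L. \<rho> t x * (w t x \<bullet> ?\<nu> x)) = (LINT x|L. \<rho> t x * (w t x \<bullet> wgrad \<Omega> \<phi> x))"
      proof (rule integral_cong_AE)
        show "AE x in L. \<rho> t x * (w t x \<bullet> ?\<nu> x) = \<rho> t x * (w t x \<bullet> wgrad \<Omega> \<phi> x)"
          using \<nu>(4) by eventually_elim simp
        show "(\<lambda>x. \<rho> t x * (w t x \<bullet> ?\<nu> x)) \<in> borel_measurable L"
          by (intro borel_measurable_times borel_measurable_inner L2_measurable[OF membership(1)[OF tI]] L2_measurable[OF w_L2[OF tI]] \<nu>m)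
        show "(\<lambda>x. \<rho> t x * (w t x \<bullet> wgrad \<Omega> \<phi> x)) \<in> borel_measurable L"
          by (intro borel_measurable_times borel_measurable_inner L2_measurable[OF membership(1)[OF tI]]
              L2_measurable[OF w_L2[OF tI]] L2_measurable[OF Qk_wgrad_L2[OF Q]])
      qed
      also have "(\<Sum>p\<in>{1..N}. ((wt p / lorentz m c (U p t)) *\<^sub>R U p t) \<bullet> point_value \<kappa> ?\<nu> (X p t)) = m * ?P"
        unfolding sum_distrib_left using m lorentz_pos[of m c] by (intro sum.cong refl) (simp add: field_simps)
      finally show ?thesis using m by (simp add: algebra_simps)
    qed
    ultimately show "(\<Delta> has_real_derivative 0) (at t)" by simp
  qed
  moreover have "a \<in> I" "b \<in> I" using in_I(1)[of a] in_I(1)[of b] ab(1) by auto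
  ultimately show ?thesis using eq[of a] eq[of b] by simp
qed

subsection \<open>The divergence of the magnetic field\<close>

lemma B_functional:
  assumes g: "g \<in> L2 \<Omega>"
  shows "abs_cont {a..b} (\<lambda>t. LINT x|L. B t x \<bullet> g x)"
    and "\<And>t. regular t \<Longrightarrow> \<exists>v\<in>RTk0 \<Omega> T k. (\<forall>x\<in>S. time_deriv B t x = v x) \<and>
      ((\<lambda>t. LINT x|L. B t x \<bullet> g x) has_real_derivative (LINT x|L. v x \<bullet> g x)) (at t)"
proof -
  obtain d R where d: "ac_control a b d"
    "\<And>s t x. s \<in> {a..b} \<Longrightarrow> t \<in> {a..b} \<Longrightarrow> x \<in> S \<Longrightarrow> dist (B s x) (B t x) \<le> d s t"
    "\<And>t. regular t \<Longrightarrow> locally_linear t d"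
    "\<And>t. regular t \<Longrightarrow> \<exists>v\<in>RTk0 \<Omega> T k. \<forall>x\<in>S. ((\<lambda>s. B s x) has_vector_derivative v x) (at t)"
    by (rule B_control) blast
  note lf = linear_functional[OF d(1) g membership(4)[OF in_I(1)] d(2)]
  show "abs_cont {a..b} (\<lambda>t. LINT x|L. B t x \<bullet> g x)" by (rule lf(1))
  fix t assume t: "regular t"
  obtain v where v: "v \<in> RTk0 \<Omega> T k" "\<And>x. x \<in> S \<Longrightarrow> ((\<lambda>s. B s x) has_vector_derivative v x) (at t)"
    using d(4)[OF t] by blast
  have td: "time_deriv B t x = v x" if "x \<in> S" for x unfolding time_deriv_def by (rule vector_derivative_at[OF v(2)[OF that]])
  have vm: "v \<in> borel_measurable L" using v(1) RTk_facts(1)[of v k] L2_measurable by (simp add: RTk0_def)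
  have "((\<lambda>t. LINT x|L. B t x \<bullet> g x) has_real_derivative (LINT x|L. v x \<bullet> g x)) (at t)"
    using t by (intro lf(2) d(3) v vm) auto
  then show "\<exists>v\<in>RTk0 \<Omega> T k. (\<forall>x\<in>S. time_deriv B t x = v x) \<and>
      ((\<lambda>t. LINT x|L. B t x \<bullet> g x) has_real_derivative (LINT x|L. v x \<bullet> g x)) (at t)"
    using v(1) td by (intro bexI[of _ v]) blast+
qed

text \<open>The difference of both sides is itself an admissible test function; testing with it gives that its
\<open>L2\<close> norm is zero.\<close>

lemma B_derivative:
  assumes t: "regular t" and v: "v \<in> RTk0 \<Omega> T k" "\<And>x. x \<in> S \<Longrightarrow> time_deriv B t x = v x"
  shows "AE x in L. v x = - c *\<^sub>R on_cells (curl (E t)) x"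
proof -
  have tI: "t \<in> I" using t in_I(2) by blast
  note r = curl_in_RTk0[OF E[OF tI]]
  let ?r = "on_cells (curl (E t))"
  define \<tau> where "\<tau> = (\<lambda>x. v x + c *\<^sub>R ?r x)"
  have \<tau>: "\<tau> \<in> RTk0 \<Omega> T k" using RTk0_lin_closed[of k] v(1) r(1) unfolding lin_closed_def \<tau>_def by blast
  have L2: "v \<in> L2 \<Omega>" "?r \<in> L2 \<Omega>" "\<tau> \<in> L2 \<Omega>"
    using RTk_facts(1) v(1) r(1) \<tau> by (auto simp: RTk0_def)
  have w: "wcurl \<Omega> (E t) \<in> L2 \<Omega>" using Nk_facts(3)[OF membership(5)[OF tI]] by (simp add: has_weak_curl_def)
  have "(LINT x|L. time_deriv B t x \<bullet> \<tau> x) = (LINT x|L. v x \<bullet> \<tau> x)"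
    using L2_inner_integrable[OF L2(1,3)] v(2) by (intro integral_cong_S) auto
  moreover have "(LINT x|L. \<tau> x \<bullet> wcurl \<Omega> (E t) x) = (LINT x|L. ?r x \<bullet> \<tau> x)"
  proof (rule integral_cong_AE)
    show "AE x in L. \<tau> x \<bullet> wcurl \<Omega> (E t) x = ?r x \<bullet> \<tau> x"
      using r(2) by eventually_elim (simp add: inner_commute)
  qed (use L2_inner_integrable[OF L2(3) w] L2_inner_integrable[OF L2(2,3)] in auto)
  ultimately have "(LINT x|L. v x \<bullet> \<tau> x) + c * (LINT x|L. ?r x \<bullet> \<tau> x) = 0"
    using equations(8)[OF t \<tau>] by simp
  then have "(LINT x|L. \<tau> x \<bullet> \<tau> x) = 0"
    using L2_inner_integrable[OF L2(1,3)] L2_inner_integrable[OF L2(2,3)]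
    by (simp add: \<tau>_def inner_add_left)
  then have "AE x in L. \<tau> x \<bullet> \<tau> x = 0"
    using integral_nonneg_eq_0_iff_AE[OF L2_inner_integrable[OF L2(3,3)]] by simp
  then show ?thesis by eventually_elim (simp add: \<tau>_def add_eq_0_iff2)
qed

lemma div_B_conserved:
  assumes \<psi>: "test_function \<Omega> \<psi>"
  shows "(LINT x|L. B a x \<bullet> grad \<psi> x) = (LINT x|L. B b x \<bullet> grad \<psi> x)"
proof (rule conserved[of "\<lambda>t. LINT x|L. B t x \<bullet> grad \<psi> x" "{}"])
  note g = grad_test_function_L2[OF \<psi>]
  show "abs_cont {a..b} (\<lambda>t. LINT x|L. B t x \<bullet> grad \<psi> x)" by (rule B_functional(1)[OF g])
  fix t assume t: "regular t"
  then obtain v where v: "v \<in> RTk0 \<Omega> T k" "\<And>x. x \<in> S \<Longrightarrow> time_deriv B t x = v x"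
    "((\<lambda>t. LINT x|L. B t x \<bullet> grad \<psi> x) has_real_derivative (LINT x|L. v x \<bullet> grad \<psi> x)) (at t)"
    using B_functional(2)[OF g] by blast
  have tI: "t \<in> I" using t in_I(2) by blast
  note r = curl_in_RTk0[OF E[OF tI]]
  have L2: "v \<in> L2 \<Omega>" "on_cells (curl (E t)) \<in> L2 \<Omega>" using RTk_facts(1) v(1) r(1) by (auto simp: RTk0_def)
  have "(LINT x|L. v x \<bullet> grad \<psi> x) = (LINT x|L. - c * (on_cells (curl (E t)) x \<bullet> grad \<psi> x))"
  proof (rule integral_cong_AE)
    show "AE x in L. v x \<bullet> grad \<psi> x = - c * (on_cells (curl (E t)) x \<bullet> grad \<psi> x)"
    proof -
      have "AE x in L. v x = - c *\<^sub>R on_cells (curl (E t)) x" by (rule B_derivative[OF t v(1) v(2)])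
      then show ?thesis by eventually_elim simp
    qed
    show "(\<lambda>x. v x \<bullet> grad \<psi> x) \<in> borel_measurable L" using L2_inner_integrable[OF L2(1) g] by blast
    show "(\<lambda>x. - c * (on_cells (curl (E t)) x \<bullet> grad \<psi> x)) \<in> borel_measurable L"
      using L2_inner_integrable[OF L2(2) g] by (intro borel_measurable_times) auto
  qed
  also have "\<dots> = 0" using r(3)[OF \<psi>] by simp
  finally show "((\<lambda>t. LINT x|L. B t x \<bullet> grad \<psi> x) has_real_derivative 0) (at t)" using v(3) by simp
qed simp


subsection \<open>Energy\<close>

definition fluid_energy_density :: "real \<Rightarrow> real^3 \<Rightarrow> real" where
  "fluid_energy_density t x = \<rho> t x * (lorentz m c ((m / \<rho> t x) *\<^sub>R M t x) - 1) * c\<^sup>2"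

lemma lorentz_momentum:
  assumes "r \<noteq> (0 :: real)"
  shows "lorentz m c ((m / r) *\<^sub>R u) = norm (r, (1 / c) *\<^sub>R u) / \<bar>r\<bar>"
proof -
  have "lorentz m c ((m / r) *\<^sub>R u) = sqrt (1 + (u \<bullet> u) / (r\<^sup>2 * c\<^sup>2))"
    unfolding lorentz_def using m by (simp add: power2_eq_square)
  also have "1 + (u \<bullet> u) / (r\<^sup>2 * c\<^sup>2) = (r\<^sup>2 + (norm ((1 / c) *\<^sub>R u))\<^sup>2) / r\<^sup>2"
    using assms c by (simp add: power_mult_distrib power_divide power2_norm_eq_inner field_simps)
  also have "sqrt \<dots> = norm (r, (1 / c) *\<^sub>R u) / \<bar>r\<bar>"
    by (simp add: norm_Pair real_sqrt_divide)
  finally show ?thesis .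
qed

text \<open>In this form the density is visibly Lipschitz continuous in \<open>\<rho>\<close> and \<open>M\<close> as long as the sign of \<open>\<rho>\<close> does
not change, with constants independent of how small \<open>\<rho>\<close> is.\<close>

lemma fluid_energy_density_eq:
  assumes "t \<in> I" "x \<in> S"
  shows "fluid_energy_density t x = c\<^sup>2 * (sgn (\<rho> t x) * norm (\<rho> t x, (1 / c) *\<^sub>R M t x) - \<rho> t x)"
  unfolding fluid_energy_density_def lorentz_momentum[OF rho_nonzero[OF assms]]
  using rho_nonzero[OF assms] by (simp add: sgn_if algebra_simps abs_if)

lemma sgn_rho:
  assumes "s \<in> {a..b}" "t \<in> {a..b}" "x \<in> S"
  shows "sgn (\<rho> s x) = sgn (\<rho> t x)"
proof -
  obtain K where "K \<in> T" "x \<in> interior K" using assms(3) by (auto simp: S_def)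
  then have "abs_cont I (\<lambda>t. \<rho> t x)" using ac(1) by (simp add: field_abs_cont_def)
  then have "continuous_on {a..b} (\<lambda>t. \<rho> t x)"
    by (intro abs_cont_imp_continuous_on abs_cont_subset[OF _ ab(2)])
  then show ?thesis
    by (rule sgn_const_if_nonzero[OF _ rho_nonzero[OF in_I(1) assms(3)] assms(1,2)])
qed

definition velocity_source :: "real \<Rightarrow> real^3 \<Rightarrow> real^3" where
  "velocity_source t x = (1 / (\<rho> t x * lorentz m c ((m / \<rho> t x) *\<^sub>R M t x))) *\<^sub>R M t x"

definition G_source :: "real \<Rightarrow> real^3 \<Rightarrow> real" where
  "G_source t x = lorentz m c ((m / \<rho> t x) *\<^sub>R M t x) - 1
     - (M t x \<bullet> M t x) / ((\<rho> t x)\<^sup>2 * c\<^sup>2 * lorentz m c ((m / \<rho> t x) *\<^sub>R M t x))"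

lemma G_source_eq:
  assumes "t \<in> I" "x \<in> S"
  shows "G_source t x = 1 / lorentz m c ((m / \<rho> t x) *\<^sub>R M t x) - 1"
proof -
  let ?g = "lorentz m c ((m / \<rho> t x) *\<^sub>R M t x)"
  have r: "\<rho> t x \<noteq> 0" by (rule rho_nonzero[OF assms])
  have g: "?g > 0" by (rule lorentz_pos)
  have "?g\<^sup>2 = 1 + (M t x \<bullet> M t x) / ((\<rho> t x)\<^sup>2 * c\<^sup>2)"
  proof -
    have "0 \<le> (M t x \<bullet> M t x) / ((\<rho> t x)\<^sup>2 * c\<^sup>2)" by simp
    moreover have "(((m / \<rho> t x) *\<^sub>R M t x) \<bullet> ((m / \<rho> t x) *\<^sub>R M t x)) / (m\<^sup>2 * c\<^sup>2) = (M t x \<bullet> M t x) / ((\<rho> t x)\<^sup>2 * c\<^sup>2)"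
      using m by (simp add: power2_eq_square)
    ultimately show ?thesis unfolding lorentz_def by simp
  qed
  then have e: "(M t x \<bullet> M t x) / ((\<rho> t x)\<^sup>2 * c\<^sup>2) = ?g\<^sup>2 - 1" by simp
  have "(M t x \<bullet> M t x) / ((\<rho> t x)\<^sup>2 * c\<^sup>2 * ?g) = ((M t x \<bullet> M t x) / ((\<rho> t x)\<^sup>2 * c\<^sup>2)) / ?g" by simp
  also have "\<dots> = ?g - 1 / ?g" unfolding e using g by (simp add: field_simps power2_eq_square)
  finally show ?thesis by (simp add: G_source_def)
qed

text \<open>The sources of the two projections are the variational derivatives of the fluid energy. This is what
  makes the choice of \<open>w\<close> and \<open>G\<close> in the scheme conservative.\<close>

lemma fluid_energy_density_deriv:
  assumes t: "t \<in> {a<..<b}" and x: "x \<in> S"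
    and r': "((\<lambda>s. \<rho> s x) has_vector_derivative r') (at t)" and M': "((\<lambda>s. M s x) has_vector_derivative M') (at t)"
  shows "((\<lambda>s. fluid_energy_density s x) has_real_derivative c\<^sup>2 * (G_source t x * r') + velocity_source t x \<bullet> M') (at t)"
proof -
  let ?r = "\<rho> t x" and ?u = "M t x" and ?g = "lorentz m c ((m / \<rho> t x) *\<^sub>R M t x)"
  let ?\<sigma> = "sgn (\<rho> t x)" and ?n = "norm (\<rho> t x, (1 / c) *\<^sub>R M t x)"
  have tI: "t \<in> I" using t in_I(2) by blast
  have r0: "?r \<noteq> 0" by (rule rho_nonzero[OF tI x])
  have n0: "?n > 0" using r0 by (simp add: zero_prod_def)
  have rd: "((\<lambda>s. \<rho> s x) has_real_derivative r') (at t)" using r' by (simp add: has_real_derivative_iff_has_vector_derivative)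
  have "((\<lambda>s. M s x \<bullet> M s x) has_derivative (\<lambda>h. M t x \<bullet> (h *\<^sub>R M') + (h *\<^sub>R M') \<bullet> M t x)) (at t)"
    using M' unfolding has_vector_derivative_def by (intro has_derivative_inner)
  then have ud: "((\<lambda>s. M s x \<bullet> M s x) has_real_derivative 2 * (?u \<bullet> M')) (at t)"
    unfolding has_field_derivative_def by (rule has_derivative_eq_rhs) (auto simp: inner_commute)
  have nsq: "norm (\<rho> s x, (1 / c) *\<^sub>R M s x) = sqrt ((\<rho> s x)\<^sup>2 + (M s x \<bullet> M s x) / c\<^sup>2)" for s
    by (simp add: norm_Pair power_mult_distrib power_divide power2_norm_eq_inner)
  have pos: "?r\<^sup>2 + (?u \<bullet> ?u) / c\<^sup>2 > 0" using r0 by (simp add: add_pos_nonneg)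
  have sqd: "((\<lambda>s. (\<rho> s x)\<^sup>2 + (M s x \<bullet> M s x) / c\<^sup>2) has_real_derivative (2 * ?r * r' + 2 * (?u \<bullet> M') / c\<^sup>2)) (at t)"
    using DERIV_add[OF DERIV_power[OF rd, of 2] DERIV_cdivide[OF ud, of "c\<^sup>2"]] by (simp add: mult_ac)
  have nd: "((\<lambda>s. norm (\<rho> s x, (1 / c) *\<^sub>R M s x)) has_real_derivative (2 * ?r * r' + 2 * (?u \<bullet> M') / c\<^sup>2) * (inverse ?n / 2)) (at t)"
    using DERIV_chain2[OF DERIV_real_sqrt[OF pos] sqd] unfolding nsq by (simp add: mult.commute)
  have "((\<lambda>s. c\<^sup>2 * (?\<sigma> * norm (\<rho> s x, (1 / c) *\<^sub>R M s x) - \<rho> s x)) has_real_derivative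
      c\<^sup>2 * (?\<sigma> * ((2 * ?r * r' + 2 * (?u \<bullet> M') / c\<^sup>2) * (inverse ?n / 2)) - r')) (at t)"
    by (intro DERIV_cmult DERIV_diff nd rd)
  then have "((\<lambda>s. fluid_energy_density s x) has_real_derivative
      c\<^sup>2 * (?\<sigma> * ((2 * ?r * r' + 2 * (?u \<bullet> M') / c\<^sup>2) * (inverse ?n / 2)) - r')) (at t)"
  proof (rule has_field_derivative_transform_within_open[OF _ open_greaterThanLessThan t])
    fix s assume "s \<in> {a<..<b}"
    then have s: "s \<in> {a..b}" by simp
    show "c\<^sup>2 * (?\<sigma> * norm (\<rho> s x, (1 / c) *\<^sub>R M s x) - \<rho> s x) = fluid_energy_density s x"
      using fluid_energy_density_eq[OF in_I(1)[OF s] x] sgn_rho[OF s _ x, of t] t by simp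
  qed
  moreover have "c\<^sup>2 * (?\<sigma> * ((2 * ?r * r' + 2 * (?u \<bullet> M') / c\<^sup>2) * (inverse ?n / 2)) - r')
      = c\<^sup>2 * (G_source t x * r') + velocity_source t x \<bullet> M'"
  proof -
    have g: "?g = ?n / \<bar>?r\<bar>" by (rule lorentz_momentum[OF r0])
    have sr: "?\<sigma> * ?r = \<bar>?r\<bar>" "\<bar>?r\<bar> / ?r = ?\<sigma>" using r0 by (auto simp: sgn_if abs_if)
    have v: "velocity_source t x = (?\<sigma> / ?n) *\<^sub>R ?u"
    proof -
      have "1 / (?r * (?n / \<bar>?r\<bar>)) = (\<bar>?r\<bar> / ?r) / ?n" by simp
      then show ?thesis unfolding velocity_source_def g sr(2) by simp
    qed
    have G: "G_source t x = ?\<sigma> * ?r / ?n - 1"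
      unfolding G_source_eq[OF tI x] g sr(1) using r0 by simp
    have "c\<^sup>2 * (?\<sigma> * ((2 * ?r * r' + 2 * (?u \<bullet> M') / c\<^sup>2) * (inverse ?n / 2)) - r')
      = c\<^sup>2 * (?\<sigma> * ?r / ?n - 1) * r' + ?\<sigma> / ?n * (?u \<bullet> M')"
      using n0 c by (simp add: field_simps)
    then show ?thesis unfolding v G by (simp add: mult.assoc)
  qed
  ultimately show ?thesis by simp
qed

lemma source_measurable:
  assumes t: "t \<in> I"
  shows "velocity_source t \<in> L2 \<Omega>" "G_source t \<in> L2 \<Omega>" "fluid_energy_density t \<in> borel_measurable L"
proof -
  note r = L2_measurable[OF membership(1)[OF t]] and u = L2_measurable[OF membership(2)[OF t]]
  have g: "(\<lambda>x. lorentz m c ((m / \<rho> t x) *\<^sub>R M t x)) \<in> borel_measurable L"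
    unfolding lorentz_def using r u by measurable
  have vm: "velocity_source t \<in> borel_measurable L" unfolding velocity_source_def[abs_def] using g r u by measurable
  have Gm: "G_source t \<in> borel_measurable L" unfolding G_source_def[abs_def] using g r u by measurable
  show "fluid_energy_density t \<in> borel_measurable L" unfolding fluid_energy_density_def[abs_def] using g r by measurable
  have bounds: "norm (velocity_source t x) \<le> c \<and> norm (G_source t x) \<le> 1" if x: "x \<in> S" for x
  proof -
    let ?n = "norm (\<rho> t x, (1 / c) *\<^sub>R M t x)"
    have r0: "\<rho> t x \<noteq> 0" by (rule rho_nonzero[OF t x])
    have g: "lorentz m c ((m / \<rho> t x) *\<^sub>R M t x) = ?n / \<bar>\<rho> t x\<bar>" by (rule lorentz_momentum[OF r0])
    have n0: "?n > 0" using r0 by (simp add: zero_prod_def)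
    have "norm ((1 / c) *\<^sub>R M t x) \<le> ?n" using norm_snd_le[of "(1 / c) *\<^sub>R M t x" "\<rho> t x"] by simp
    then have "norm (M t x) \<le> c * ?n" using c by (simp add: field_simps)
    moreover have "norm (velocity_source t x) = norm (M t x) / ?n"
      unfolding velocity_source_def g using r0 by (simp add: abs_mult)
    ultimately have "norm (velocity_source t x) \<le> c" using n0 by (simp add: pos_divide_le_eq)
    moreover have "\<bar>\<rho> t x\<bar> \<le> ?n" using norm_fst_le[of "\<rho> t x" "(1 / c) *\<^sub>R M t x"] by simp
    then have "1 / lorentz m c ((m / \<rho> t x) *\<^sub>R M t x) \<le> 1" unfolding g using n0 r0 by simp
    then have "norm (G_source t x) \<le> 1"
      unfolding G_source_eq[OF t x] using lorentz_pos[of m c "(m / \<rho> t x) *\<^sub>R M t x"] by (simp add: abs_if)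
    ultimately show ?thesis by blast
  qed
  show "velocity_source t \<in> L2 \<Omega>" using bounds by (intro L2_if_bounded[OF vm, of c]) blast
  show "G_source t \<in> L2 \<Omega>" using bounds by (intro L2_if_bounded[OF Gm, of 1]) blast
qed

lemma projections:
  assumes "t \<in> I"
  shows "\<And>v. v \<in> Qkvec \<Omega> T (k + 1) \<Longrightarrow> (LINT x|L. w t x \<bullet> v x) = (LINT x|L. velocity_source t x \<bullet> v x)"
    "\<And>v. v \<in> Qk \<Omega> T (k + 1) \<Longrightarrow> (LINT x|L. G t x * v x) = (LINT x|L. G_source t x * v x)"
  using proj[OF assms]
  unfolding velocity_projection_def G_projection_def L2_projection_def velocity_source_def G_source_def inner_real_def
  by blast+

text \<open>The derivative is \<open>\<integral> c\<^sup>2 G \<partial>\<rho> + w \<bullet> \<partial>M\<close> by the projections. In the equation for \<open>M\<close> tested with \<open>w\<close> the two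
transport terms coincide, and the term with the gradient of \<open>G\<close> cancels against the equation for \<open>\<rho>\<close>
tested with \<open>G\<close>.\<close>

lemma fluid_energy:
  shows "abs_cont {a..b} (\<lambda>t. LINT x|L. fluid_energy_density t x)"
    and "\<And>t. regular t \<Longrightarrow> ((\<lambda>t. LINT x|L. fluid_energy_density t x) has_real_derivative
       e / m * (LINT x|L. \<rho> t x * (w t x \<bullet> E t x))) (at t)"
proof -
  obtain d1 R1 where d1: "ac_control a b d1"
    "\<And>s t x. s \<in> {a..b} \<Longrightarrow> t \<in> {a..b} \<Longrightarrow> x \<in> S \<Longrightarrow> dist (\<rho> s x) (\<rho> t x) \<le> d1 s t"
    "\<And>t. regular t \<Longrightarrow> locally_linear t d1"
    "\<And>t x. t \<in> {a..b} \<Longrightarrow> x \<in> S \<Longrightarrow> norm (\<rho> t x) \<le> R1"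
    "\<And>t. regular t \<Longrightarrow> \<exists>v\<in>Qk \<Omega> T (k + 1). \<forall>x\<in>S. ((\<lambda>s. \<rho> s x) has_vector_derivative v x) (at t)"
    by (rule rho_control) blast
  obtain d2 R2 where d2: "ac_control a b d2"
    "\<And>s t x. s \<in> {a..b} \<Longrightarrow> t \<in> {a..b} \<Longrightarrow> x \<in> S \<Longrightarrow> dist (M s x) (M t x) \<le> d2 s t"
    "\<And>t. regular t \<Longrightarrow> locally_linear t d2"
    "\<And>t x. t \<in> {a..b} \<Longrightarrow> x \<in> S \<Longrightarrow> norm (M t x) \<le> R2"
    "\<And>t. regular t \<Longrightarrow> \<exists>v\<in>Qkvec \<Omega> T (k + 1). \<forall>x\<in>S. ((\<lambda>s. M s x) has_vector_derivative v x) (at t)"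
    by (rule M_control) blast
  define d where "d = (\<lambda>s t. d1 s t + d2 s t)"
  define C where "C = c\<^sup>2 * (2 + 1 / c)"
  have C0: "C \<ge> 0" using c by (simp add: C_def)
  have dc: "ac_control a b d" unfolding d_def by (rule ac_control_add[OF d1(1) d2(1)])
  have ll: "locally_linear t d" if "regular t" for t
    unfolding d_def by (rule locally_linear_add[OF d1(3)[OF that] d2(3)[OF that]])
  have le: "\<bar>fluid_energy_density s x - fluid_energy_density t x\<bar> \<le> C * d s t"
    if s: "s \<in> {a..b}" and t: "t \<in> {a..b}" and x: "x \<in> S" for s t x
  proof -
    let ?n = "\<lambda>t. norm (\<rho> t x, (1 / c) *\<^sub>R M t x)"
    have "\<bar>?n s - ?n t\<bar> \<le> norm ((\<rho> s x, (1 / c) *\<^sub>R M s x) - (\<rho> t x, (1 / c) *\<^sub>R M t x))" by (rule norm_triangle_ineq3)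
    also have "\<dots> = norm (\<rho> s x - \<rho> t x, (1 / c) *\<^sub>R (M s x - M t x))" by (simp add: scaleR_right_diff_distrib)
    also have "\<dots> \<le> norm (\<rho> s x - \<rho> t x) + norm ((1 / c) *\<^sub>R (M s x - M t x))" by (rule norm_Pair_le)
    also have "\<dots> \<le> d1 s t + 1 / c * d2 s t"
      using d1(2)[OF s t x] d2(2)[OF s t x] c by (intro add_mono) (auto simp: dist_norm divide_right_mono)
    finally have n: "\<bar>?n s - ?n t\<bar> \<le> d1 s t + 1 / c * d2 s t" .
    have r: "\<bar>\<rho> s x - \<rho> t x\<bar> \<le> d1 s t" using d1(2)[OF s t x] by (simp add: dist_real_def)
    have d0: "d1 s t \<ge> 0" "d2 s t \<ge> 0"
      using order_trans[OF zero_le_dist d1(2)[OF s t x]] order_trans[OF zero_le_dist d2(2)[OF s t x]] by auto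
    have "fluid_energy_density s x - fluid_energy_density t x = c\<^sup>2 * (sgn (\<rho> t x) * (?n s - ?n t) - (\<rho> s x - \<rho> t x))"
      unfolding fluid_energy_density_eq[OF in_I(1)[OF s] x] fluid_energy_density_eq[OF in_I(1)[OF t] x] sgn_rho[OF s t x]
      by (simp add: algebra_simps)
    then have "\<bar>fluid_energy_density s x - fluid_energy_density t x\<bar> = c\<^sup>2 * \<bar>sgn (\<rho> t x) * (?n s - ?n t) - (\<rho> s x - \<rho> t x)\<bar>"
      by (simp add: abs_mult)
    also have "\<bar>sgn (\<rho> t x) * (?n s - ?n t) - (\<rho> s x - \<rho> t x)\<bar> \<le> \<bar>?n s - ?n t\<bar> + \<bar>\<rho> s x - \<rho> t x\<bar>"
      by (rule order_trans[OF abs_triangle_ineq4]) (auto simp: abs_mult sgn_if)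
    also have "\<dots> \<le> (d1 s t + 1 / c * d2 s t) + d1 s t" using n r by linarith
    also have "\<dots> \<le> (2 + 1 / c) * d s t"
      using d0 c by (simp add: d_def algebra_simps)
    finally show ?thesis unfolding C_def by (simp add: mult.assoc mult_left_mono)
  qed
  have int: "integrable L (fluid_energy_density t)" if t: "t \<in> {a..b}" for t
  proof (rule integrable_if_bounded[OF source_measurable(3)[OF in_I(1)[OF t]]])
    fix x assume x: "x \<in> S"
    let ?n = "norm (\<rho> t x, (1 / c) *\<^sub>R M t x)"
    have "\<bar>sgn (\<rho> t x) * ?n - \<rho> t x\<bar> \<le> ?n + \<bar>\<rho> t x\<bar>"
      by (rule order_trans[OF abs_triangle_ineq4]) (auto simp: abs_mult sgn_if)
    also have "?n \<le> norm (\<rho> t x) + norm ((1 / c) *\<^sub>R M t x)" by (rule norm_Pair_le)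
    also have "norm ((1 / c) *\<^sub>R M t x) \<le> 1 / c * R2" using d2(4)[OF t x] c by (simp add: divide_right_mono)
    also have "norm (\<rho> t x) \<le> R1" by (rule d1(4)[OF t x])
    also have "\<bar>\<rho> t x\<bar> \<le> R1" using d1(4)[OF t x] by simp
    finally have "\<bar>sgn (\<rho> t x) * ?n - \<rho> t x\<bar> \<le> R1 + 1 / c * R2 + R1" by simp
    then show "\<bar>fluid_energy_density t x\<bar> \<le> c\<^sup>2 * (R1 + 1 / c * R2 + R1)"
      unfolding fluid_energy_density_eq[OF in_I(1)[OF t] x] by (simp add: abs_mult mult_left_mono)
  qed
  show "abs_cont {a..b} (\<lambda>t. LINT x|L. fluid_energy_density t x)"
    by (rule functional_control(1)[OF dc integrable_const_L[of C] C0 int le])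
  fix t assume t: "regular t"
  have t': "t \<in> {a<..<b}" "t \<in> {a..b}" "t \<in> I" using t in_I(2)[of t] by auto
  obtain r' where r': "r' \<in> Qk \<Omega> T (k + 1)" "\<And>x. x \<in> S \<Longrightarrow> ((\<lambda>s. \<rho> s x) has_vector_derivative r' x) (at t)"
    using d1(5)[OF t] by blast
  obtain M' where M': "M' \<in> Qkvec \<Omega> T (k + 1)" "\<And>x. x \<in> S \<Longrightarrow> ((\<lambda>s. M s x) has_vector_derivative M' x) (at t)"
    using d2(5)[OF t] by blast
  have tdr: "time_deriv \<rho> t x = r' x" if "x \<in> S" for x
    unfolding time_deriv_def by (rule vector_derivative_at[OF r'(2)[OF that]])
  have tdM: "time_deriv M t x = M' x" if "x \<in> S" for x
    unfolding time_deriv_def by (rule vector_derivative_at[OF M'(2)[OF that]])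
  have r'L2: "r' \<in> L2 \<Omega>" by (rule Qk_facts(1)[OF r'(1)])
  have M'L2: "M' \<in> L2 \<Omega>" by (rule L2_vec[OF Qk_facts(1)[OF Qkvec_facts(1)[OF M'(1)]]])
  have i1: "integrable L (\<lambda>x. G_source t x * r' x)" by (rule L2_mult_integrable[OF source_measurable(2)[OF t'(3)] r'L2])
  have i2: "integrable L (\<lambda>x. velocity_source t x \<bullet> M' x)" by (rule L2_inner_integrable[OF source_measurable(1)[OF t'(3)] M'L2])
  have "((\<lambda>t. LINT x|L. fluid_energy_density t x) has_real_derivative
      (LINT x|L. c\<^sup>2 * (G_source t x * r' x) + velocity_source t x \<bullet> M' x)) (at t)"
  proof (rule functional_control(2)[OF dc integrable_const_L[of C] C0 int le t'(1) ll[OF t]])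
    show "(\<lambda>x. c\<^sup>2 * (G_source t x * r' x) + velocity_source t x \<bullet> M' x) \<in> borel_measurable L"
      using i1 i2 by (intro borel_measurable_add borel_measurable_times[of "\<lambda>x. c\<^sup>2"] borel_measurable_integrable) auto
    show "((\<lambda>s. fluid_energy_density s x) has_real_derivative c\<^sup>2 * (G_source t x * r' x) + velocity_source t x \<bullet> M' x) (at t)"
      if "x \<in> S" for x by (rule fluid_energy_density_deriv[OF t'(1) that r'(2)[OF that] M'(2)[OF that]])
  qed
  also have "(LINT x|L. c\<^sup>2 * (G_source t x * r' x) + velocity_source t x \<bullet> M' x)
      = c\<^sup>2 * (LINT x|L. G_source t x * r' x) + (LINT x|L. velocity_source t x \<bullet> M' x)"
    using i1 i2 by simp
  also have "(LINT x|L. G_source t x * r' x) = (LINT x|L. time_deriv \<rho> t x * G t x)"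
  proof -
    have "(LINT x|L. time_deriv \<rho> t x * G t x) = (LINT x|L. G t x * r' x)"
      using L2_mult_integrable[OF Qk_facts(1)[OF G_in[OF t'(3)]] r'L2] tdr
      by (intro integral_cong_S) auto
    then show ?thesis using projections(2)[OF t'(3) r'(1)] by simp
  qed
  also have "\<dots> = (LINT x|L. \<rho> t x * (w t x \<bullet> wgrad \<Omega> (G t) x))" by (rule equations(5)[OF t G_in[OF t'(3)]])
  also have "(LINT x|L. velocity_source t x \<bullet> M' x) = (LINT x|L. time_deriv M t x \<bullet> w t x)"
  proof -
    have "(LINT x|L. time_deriv M t x \<bullet> w t x) = (LINT x|L. w t x \<bullet> M' x)"
      using L2_inner_integrable[OF w_L2[OF t'(3)] M'L2] tdM
      by (intro integral_cong_S) (auto simp: inner_commute)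
    then show ?thesis using projections(1)[OF t'(3) M'(1)] by simp
  qed
  also have "\<dots> = (LINT x|L. adv \<Omega> (w t) (w t) (M t) x - adv \<Omega> (w t) (w t) (M t) x)
          - (LINT x|L. \<rho> t x * (w t x \<bullet> wgrad \<Omega> (G t) x) * c\<^sup>2)
          + e / m * (LINT x|L. \<rho> t x * ((E t x + cross3 (w t x) ((1 / c) *\<^sub>R B t x)) \<bullet> w t x))"
    by (rule equations(6)[OF t w_in[OF t'(3)]])
  also have "(LINT x|L. \<rho> t x * ((E t x + cross3 (w t x) ((1 / c) *\<^sub>R B t x)) \<bullet> w t x)) = (LINT x|L. \<rho> t x * (w t x \<bullet> E t x))"
  proof -
    have "(E t x + cross3 (w t x) ((1 / c) *\<^sub>R B t x)) \<bullet> w t x = w t x \<bullet> E t x" for x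
      by (simp add: inner_add_left dot_cross_self inner_commute[of "w t x"])
    then show ?thesis by simp
  qed
  finally show "((\<lambda>t. LINT x|L. fluid_energy_density t x) has_real_derivative
       e / m * (LINT x|L. \<rho> t x * (w t x \<bullet> E t x))) (at t)" by simp
qed

lemma field_energy:
  shows "abs_cont {a..b} (\<lambda>t. LINT x|L. (norm (E t x))\<^sup>2 + (norm (B t x))\<^sup>2)"
    and "\<And>t. regular t \<Longrightarrow> ((\<lambda>t. LINT x|L. (norm (E t x))\<^sup>2 + (norm (B t x))\<^sup>2) has_real_derivative
       2 * ((LINT x|L. time_deriv E t x \<bullet> E t x) + (LINT x|L. time_deriv B t x \<bullet> B t x))) (at t)"
proof -
  obtain d1 R1 where d1: "ac_control a b d1"
    "\<And>s t x. s \<in> {a..b} \<Longrightarrow> t \<in> {a..b} \<Longrightarrow> x \<in> S \<Longrightarrow> dist (E s x) (E t x) \<le> d1 s t"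
    "\<And>t. regular t \<Longrightarrow> locally_linear t d1"
    "\<And>t x. t \<in> {a..b} \<Longrightarrow> x \<in> S \<Longrightarrow> norm (E t x) \<le> R1"
    "\<And>t. regular t \<Longrightarrow> \<exists>v\<in>L2 \<Omega>. \<forall>x\<in>S. ((\<lambda>s. E s x) has_vector_derivative v x) (at t)"
    by (rule E_control) blast
  obtain d2 R2 where d2: "ac_control a b d2"
    "\<And>s t x. s \<in> {a..b} \<Longrightarrow> t \<in> {a..b} \<Longrightarrow> x \<in> S \<Longrightarrow> dist (B s x) (B t x) \<le> d2 s t"
    "\<And>t. regular t \<Longrightarrow> locally_linear t d2"
    "\<And>t x. t \<in> {a..b} \<Longrightarrow> x \<in> S \<Longrightarrow> norm (B t x) \<le> R2"
    "\<And>t. regular t \<Longrightarrow> \<exists>v\<in>RTk0 \<Omega> T k. \<forall>x\<in>S. ((\<lambda>s. B s x) has_vector_derivative v x) (at t)"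
    by (rule B_control) blast
  define d where "d = (\<lambda>s t. d1 s t + d2 s t)"
  define C where "C = 2 * (\<bar>R1\<bar> + \<bar>R2\<bar>)"
  have C0: "C \<ge> 0" by (simp add: C_def)
  have dc: "ac_control a b d" unfolding d_def by (rule ac_control_add[OF d1(1) d2(1)])
  have ll: "locally_linear t d" if "regular t" for t
    unfolding d_def by (rule locally_linear_add[OF d1(3)[OF that] d2(3)[OF that]])
  have sq: "\<bar>(norm u)\<^sup>2 - (norm v)\<^sup>2\<bar> \<le> C * dist u v"
    if "norm u \<le> R" "norm v \<le> R" "2 * R \<le> C" for u v :: "real^3" and R
  proof -
    have "\<bar>(norm u)\<^sup>2 - (norm v)\<^sup>2\<bar> = (norm u + norm v) * \<bar>norm u - norm v\<bar>"
      by (simp add: power2_eq_square square_diff_square_factored abs_mult)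
    also have "\<dots> \<le> C * dist u v"
      using that C0 norm_triangle_ineq3[of u v] by (intro mult_mono) (auto simp: dist_norm)
    finally show ?thesis .
  qed
  let ?F = "\<lambda>t x. (norm (E t x))\<^sup>2 + (norm (B t x))\<^sup>2"
  have le: "\<bar>?F s x - ?F t x\<bar> \<le> C * d s t" if s: "s \<in> {a..b}" and t: "t \<in> {a..b}" and x: "x \<in> S" for s t x
  proof -
    have "\<bar>(norm (E s x))\<^sup>2 - (norm (E t x))\<^sup>2\<bar> \<le> C * dist (E s x) (E t x)"
      using d1(4)[OF s x] d1(4)[OF t x] by (intro sq[of _ R1]) (auto simp: C_def)
    moreover have "\<bar>(norm (B s x))\<^sup>2 - (norm (B t x))\<^sup>2\<bar> \<le> C * dist (B s x) (B t x)"
      using d2(4)[OF s x] d2(4)[OF t x] by (intro sq[of _ R2]) (auto simp: C_def)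
    moreover have "C * dist (E s x) (E t x) \<le> C * d1 s t" "C * dist (B s x) (B t x) \<le> C * d2 s t"
      using d1(2)[OF s t x] d2(2)[OF s t x] C0 by (auto intro: mult_left_mono)
    ultimately show ?thesis unfolding d_def distrib_left by linarith
  qed
  have int: "integrable L (?F t)" if t: "t \<in> {a..b}" for t
    using membership(3,4)[OF in_I(1)[OF t]] by (intro Bochner_Integration.integrable_add) (simp_all add: L2_def)
  show "abs_cont {a..b} (\<lambda>t. LINT x|L. ?F t x)"
    by (rule functional_control(1)[OF dc integrable_const_L[of C] C0 int le])
  fix t assume t: "regular t"
  have t': "t \<in> {a<..<b}" "t \<in> I" using t in_I(2)[of t] by auto
  obtain u where u: "u \<in> L2 \<Omega>" "\<And>x. x \<in> S \<Longrightarrow> ((\<lambda>s. E s x) has_vector_derivative u x) (at t)"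
    using d1(5)[OF t] by blast
  obtain v where v: "v \<in> RTk0 \<Omega> T k" "\<And>x. x \<in> S \<Longrightarrow> ((\<lambda>s. B s x) has_vector_derivative v x) (at t)"
    using d2(5)[OF t] by blast
  have tdu: "time_deriv E t x = u x" if "x \<in> S" for x
    unfolding time_deriv_def by (rule vector_derivative_at[OF u(2)[OF that]])
  have tdv: "time_deriv B t x = v x" if "x \<in> S" for x
    unfolding time_deriv_def by (rule vector_derivative_at[OF v(2)[OF that]])
  note m = membership(3,4)[OF t'(2)]
  have vL2: "v \<in> L2 \<Omega>" using v(1) RTk_facts(1)[of v k] by (simp add: RTk0_def)
  have i2: "integrable L (\<lambda>x. v x \<bullet> B t x)" by (rule L2_inner_integrable[OF vL2 m(2)])
  have i1: "integrable L (\<lambda>x. u x \<bullet> E t x)" by (rule L2_inner_integrable[OF u(1) m(1)])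
  have sqd: "((\<lambda>s. (norm (f s))\<^sup>2) has_real_derivative 2 * (f' \<bullet> f t)) (at t)"
    if "(f has_vector_derivative f') (at t)" for f :: "real \<Rightarrow> real^3" and f'
  proof -
    have "((\<lambda>s. f s \<bullet> f s) has_derivative (\<lambda>h. f t \<bullet> (h *\<^sub>R f') + (h *\<^sub>R f') \<bullet> f t)) (at t)"
      using that unfolding has_vector_derivative_def by (intro has_derivative_inner)
    then show ?thesis unfolding has_field_derivative_def power2_norm_eq_inner
      by (rule has_derivative_eq_rhs) (auto simp: inner_commute)
  qed
  have "((\<lambda>t. LINT x|L. ?F t x) has_real_derivative (LINT x|L. 2 * (u x \<bullet> E t x) + 2 * (v x \<bullet> B t x))) (at t)"
  proof (rule functional_control(2)[OF dc integrable_const_L[of C] C0 int le t'(1) ll[OF t]])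
    show "(\<lambda>x. 2 * (u x \<bullet> E t x) + 2 * (v x \<bullet> B t x)) \<in> borel_measurable L"
      using i1 i2 by (intro borel_measurable_integrable Bochner_Integration.integrable_add integrable_mult_right)
    show "((\<lambda>s. ?F s x) has_real_derivative 2 * (u x \<bullet> E t x) + 2 * (v x \<bullet> B t x)) (at t)"
      if "x \<in> S" for x by (rule DERIV_add[OF sqd[OF u(2)[OF that]] sqd[OF v(2)[OF that]]])
  qed
  moreover have "(LINT x|L. time_deriv E t x \<bullet> E t x) = (LINT x|L. u x \<bullet> E t x)"
    using i1 tdu by (intro integral_cong_S) auto
  moreover have "(LINT x|L. time_deriv B t x \<bullet> B t x) = (LINT x|L. v x \<bullet> B t x)"
    using i2 tdv by (intro integral_cong_S) auto
  ultimately show "((\<lambda>t. LINT x|L. ?F t x) has_real_derivative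
       2 * ((LINT x|L. time_deriv E t x \<bullet> E t x) + (LINT x|L. time_deriv B t x \<bullet> B t x))) (at t)"
    using i1 i2 by simp
qed

text \<open>The magnetic force is orthogonal to \<open>U\<close> and does no work.\<close>

lemma particle_energy:
  assumes p: "p \<in> {1..N}"
  shows "abs_cont {a..b} (\<lambda>t. lorentz m c (U p t))"
    and "\<And>t. regular t \<Longrightarrow> ((\<lambda>t. lorentz m c (U p t)) has_real_derivative
       e * (U p t \<bullet> point_value \<kappa> (E t) (X p t)) / (lorentz m c (U p t) * m\<^sup>2 * c\<^sup>2)) (at t)"
proof -
  show "abs_cont {a..b} (\<lambda>t. lorentz m c (U p t))"
    using lorentz_lipschitz[OF m c] m c
    by (intro abs_cont_bound_by[OF acp(2)[OF p] ab(2), of _ "1 / (m * c)"]) (auto simp: dist_norm)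
  fix t assume t: "regular t"
  show "((\<lambda>t. lorentz m c (U p t)) has_real_derivative
       e * (U p t \<bullet> point_value \<kappa> (E t) (X p t)) / (lorentz m c (U p t) * m\<^sup>2 * c\<^sup>2)) (at t)"
    using lorentz_has_derivative[OF equations(10)[OF t p], of m c]
    by (simp add: inner_add_right dot_cross_self)
qed

text \<open>The terms with the curl of \<open>E\<close> cancel between the equations for \<open>E\<close> and \<open>B\<close>, and the work of the electric
field on the fluid and on the particles is what the field loses.\<close>

lemma energy_conserved:
  defines "H \<equiv> \<lambda>t. (LINT x|L. \<rho> t x * (lorentz m c ((m / \<rho> t x) *\<^sub>R M t x) - 1) * c\<^sup>2)
          + (\<Sum>p\<in>{1..N}. wt p * (lorentz m c (U p t) - 1) * m * c\<^sup>2)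
          + 1 / (8 * pi) * (LINT x|L. (norm (E t x))\<^sup>2 + (norm (B t x))\<^sup>2)"
  shows "H a = H b"
proof (rule conserved[of H "{}"])
  let ?P = "\<lambda>p. wt p * m * c\<^sup>2"
  have H: "H = (\<lambda>t. (LINT x|L. fluid_energy_density t x) + (\<Sum>p\<in>{1..N}. ?P p * lorentz m c (U p t) + - ?P p)
      + 1 / (8 * pi) * (LINT x|L. (norm (E t x))\<^sup>2 + (norm (B t x))\<^sup>2))"
    unfolding H_def fluid_energy_density_def by (simp add: algebra_simps)
  have ac_const: "abs_cont {a..b} (\<lambda>t. r)" for r :: real
    by (simp add: abs_cont_iff_ac_control ac_control_zero)
  show "abs_cont {a..b} H"
    unfolding H by (intro abs_cont_add abs_cont_scaled abs_cont_sum fluid_energy(1) field_energy(1) particle_energy(1) ac_const) auto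
  fix t assume t: "regular t"
  have tI: "t \<in> I" using t in_I(2) by blast
  let ?W = "LINT x|L. \<rho> t x * (w t x \<bullet> E t x)" and ?J = "LINT x|L. B t x \<bullet> wcurl \<Omega> (E t) x"
  let ?e = "\<lambda>p. U p t \<bullet> point_value \<kappa> (E t) (X p t)" and ?g = "\<lambda>p. lorentz m c (U p t)"
  have "(H has_real_derivative e / m * ?W + (\<Sum>p\<in>{1..N}. ?P p * (e * ?e p / (?g p * m\<^sup>2 * c\<^sup>2)) + 0)
      + 1 / (8 * pi) * (2 * ((LINT x|L. time_deriv E t x \<bullet> E t x) + (LINT x|L. time_deriv B t x \<bullet> B t x)))) (at t)"
    unfolding H by (intro DERIV_add DERIV_cmult DERIV_sum DERIV_const fluid_energy(2)[OF t] field_energy(2)[OF t] particle_energy(2)[OF _ t])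
  moreover have "(\<Sum>p\<in>{1..N}. ?P p * (e * ?e p / (?g p * m\<^sup>2 * c\<^sup>2)) + 0) = e / m * (\<Sum>p\<in>{1..N}. wt p / ?g p * ?e p)"
    unfolding sum_distrib_left
  proof (intro sum.cong refl)
    fix p
    have "?g p \<noteq> 0" using lorentz_pos[of m c "U p t"] by simp
    then show "?P p * (e * ?e p / (?g p * m\<^sup>2 * c\<^sup>2)) + 0 = e / m * (wt p / ?g p * ?e p)"
      using m c by (simp add: field_simps power2_eq_square)
  qed
  moreover have "(LINT x|L. time_deriv E t x \<bullet> E t x)
      = c * ?J - 4 * pi * e / m * ?W - 4 * pi * e / m * (\<Sum>p\<in>{1..N}. wt p / ?g p * ?e p)"
    using equations(7)[OF t E[OF tI]] by simp
  moreover have "(LINT x|L. time_deriv B t x \<bullet> B t x) = - c * ?J"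
    by (rule equations(8)[OF t B[OF tI]])
  ultimately have D: "(H has_real_derivative e / m * ?W + e / m * (\<Sum>p\<in>{1..N}. wt p / ?g p * ?e p)
      + 1 / (8 * pi) * (2 * ((c * ?J - 4 * pi * e / m * ?W - 4 * pi * e / m * (\<Sum>p\<in>{1..N}. wt p / ?g p * ?e p)) + - c * ?J))) (at t)"
    by (simp only:)
  have "e / m * W + e / m * P + 1 / (8 * pi) * (2 * ((c * J - 4 * pi * e / m * W - 4 * pi * e / m * P) + - c * J)) = 0"
    for W P J :: real
    using m by (simp add: field_simps)
  with D show "(H has_real_derivative 0) (at t)" by (simp only:)
qed simp

end

theorem proposition3p1:
  fixes \<Omega> :: "(real^3) set" and T :: "(real^3) set set" and \<kappa> :: "real^3 \<Rightarrow> (real^3) set"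
    and k N :: nat and c m e :: real and wt :: "nat \<Rightarrow> real" and I :: "real set"
    and \<rho> :: "real \<Rightarrow> real^3 \<Rightarrow> real" and M E B :: "real \<Rightarrow> real^3 \<Rightarrow> real^3"
    and X U :: "nat \<Rightarrow> real \<Rightarrow> real^3"
  assumes "conforming_polyhedral_mesh \<Omega> T"
    and "cell_selection T \<kappa>"
    and "c > 0" and "m > 0" and "e \<noteq> 0"
    and "is_interval I"
    and "scheme_solution \<Omega> T \<kappa> k c m e N wt I \<rho> M E B X U"
  shows "(\<lambda>t. LINT x|lebesgue_on \<Omega>. \<rho> t x) constant_on I
    \<and> (\<lambda>t. \<Sum>p\<in>{1..N}. wt p) constant_on I
    \<and> (\<lambda>t. (LINT x|lebesgue_on \<Omega>. \<rho> t x * (lorentz m c ((m / \<rho> t x) *\<^sub>R M t x) - 1) * c\<^sup>2)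
          + (\<Sum>p\<in>{1..N}. wt p * (lorentz m c (U p t) - 1) * m * c\<^sup>2)
          + 1 / (8 * pi) * (LINT x|lebesgue_on \<Omega>. (norm (E t x))\<^sup>2 + (norm (B t x))\<^sup>2)) constant_on I
    \<and> (\<forall>\<phi>\<in>Qk0 \<Omega> T (k + 1).
        (\<lambda>t. (LINT x|lebesgue_on \<Omega>. (weak_divergence \<Omega> T k (E t) x - 4 * pi * e * (\<rho> t x / m)) * \<phi> x)
             - 4 * pi * e * (\<Sum>p\<in>{1..N}. wt p * point_value \<kappa> \<phi> (X p t))) constant_on I)
    \<and> (\<forall>s\<in>I. \<forall>t\<in>I. AE x in lebesgue_on \<Omega>. wdiv \<Omega> (B s) x = wdiv \<Omega> (B t) x)"
proof -
  interpret mesh \<Omega> T by unfold_locales (rule assms(1))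
  note sol = assms(7)[unfolded scheme_solution_def]
  note s1 = conjunct1[OF sol] and s2 = conjunct2[OF sol]
  obtain w G where wG: "\<forall>t\<in>I. velocity_projection \<Omega> T k c m (\<rho> t) (M t) (w t) \<and>
                    G_projection \<Omega> T k c m (\<rho> t) (M t) (G t)"
    "AE t in lebesgue_on I. scheme_equations \<Omega> T \<kappa> k c m e N wt \<rho> M E B X U w G t"
    using s2 by (elim conjE exE)
  have "I \<in> sets borel" using assms(6) by (rule real_interval_borel_measurable)
  then have Is: "I \<inter> space lebesgue \<in> sets lebesgue" by simp
  have "AE t in lebesgue. t \<in> I \<longrightarrow> scheme_equations \<Omega> T \<kappa> k c m e N wt \<rho> M E B X U w G t"
    using wG(2) AE_restrict_space_iff[OF Is] by simp
  then obtain Z where Z: "Z \<in> null_sets lebesgue"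
    "{t \<in> space lebesgue. \<not> (t \<in> I \<longrightarrow> scheme_equations \<Omega> T \<kappa> k c m e N wt \<rho> M E B X U w G t)} \<subseteq> Z"
    unfolding eventually_ae_filter by blast
  have sch: "scheme \<Omega> T \<kappa> k N c m e wt I \<rho> M E B X U w G a b Z" if ab: "a \<le> b" "{a..b} \<subseteq> I" for a b
  proof -
    have eqs: "scheme_equations \<Omega> T \<kappa> k c m e N wt \<rho> M E B X U w G t" if "t \<in> {a..b} - Z" for t
      using that ab Z(2) by auto
    show ?thesis
      by (intro scheme.intro scheme_axioms.intro mesh_axioms)
        (use s1 s2 wG(1) ab Z(1) assms(2,3,4) eqs in \<open>simp_all add: negligible_iff_null_sets\<close>)
  qed
  have const: "f constant_on I" if "\<And>a b. a \<le> b \<Longrightarrow> {a..b} \<subseteq> I \<Longrightarrow> f a = f b" for f :: "real \<Rightarrow> real"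
    using constant_onI_if_equal_at_endpoints[OF assms(6), of f] that unfolding constant_on_def by blast
  \<comment> \<open>The chosen weak divergences coincide because the conditions they are chosen by are the same.\<close>
  have divB: "has_weak_div \<Omega> (B s) = has_weak_div \<Omega> (B t)" if "s \<in> I" "t \<in> I" for s t
  proof -
    have "(LINT x|L. B s x \<bullet> grad \<psi> x) = (LINT x|L. B t x \<bullet> grad \<psi> x)" if \<psi>: "test_function \<Omega> \<psi>" for \<psi>
    proof -
      have "\<forall>s\<in>I. \<forall>t\<in>I. (LINT x|L. B s x \<bullet> grad \<psi> x) = (LINT x|L. B t x \<bullet> grad \<psi> x)"
        by (rule constant_onI_if_equal_at_endpoints[OF assms(6)]) (rule scheme.div_B_conserved[OF sch \<psi>])
      then show ?thesis using \<open>s \<in> I\<close> \<open>t \<in> I\<close> by blast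
    qed
    then show ?thesis unfolding has_weak_div_def by (intro ext) auto
  qed
  show ?thesis
  proof (intro conjI ballI)
    show "(\<lambda>t. LINT x|L. \<rho> t x) constant_on I"
      by (rule const) (rule scheme.mass_conserved[OF sch])
    show "(\<lambda>t. \<Sum>p\<in>{1..N}. wt p) constant_on I" by (auto simp: constant_on_def)
    show "(\<lambda>t. (LINT x|L. \<rho> t x * (lorentz m c ((m / \<rho> t x) *\<^sub>R M t x) - 1) * c\<^sup>2)
          + (\<Sum>p\<in>{1..N}. wt p * (lorentz m c (U p t) - 1) * m * c\<^sup>2)
          + 1 / (8 * pi) * (LINT x|L. (norm (E t x))\<^sup>2 + (norm (B t x))\<^sup>2)) constant_on I"
      by (rule const) (rule scheme.energy_conserved[OF sch])
    fix \<phi> assume \<phi>: "\<phi> \<in> Qk0 \<Omega> T (k + 1)"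
    show "(\<lambda>t. (LINT x|L. (weak_divergence \<Omega> T k (E t) x - 4 * pi * e * (\<rho> t x / m)) * \<phi> x)
             - 4 * pi * e * (\<Sum>p\<in>{1..N}. wt p * point_value \<kappa> \<phi> (X p t))) constant_on I"
      by (rule const) (rule scheme.gauss_conserved[OF sch \<phi>])
  next
    fix s t assume "s \<in> I" "t \<in> I"
    from divB[OF this] show "AE x in L. wdiv \<Omega> (B s) x = wdiv \<Omega> (B t) x" by (simp add: wdiv_def)
  qed
qed

end
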